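(* Let $H$ be a cocommutative Hopf algebra over a field $\mathbf{k}$. The category $\mathbf{Lie2}H$ of Lie-$2$ $H$-pseudoalgebras and the category $\mathbf{2shLie}H$ of $2$-term $L_\infty$ $H$-pseudoalgebras are equivalent.
   Context: Polylinear maps. $H^{\otimes n}$ is a right $H$-module via $(h_1\otimes\cdots\otimes h_n)h=h_1h_{(1)}\otimes\cdots\otimes h_nh_{(n)}$. For left $H$-modules, $\mathrm{Hom}_{H^{\otimes n}}(L_1\boxtimes\cdots\boxtimes L_n,H^{\otimes n}\otimes_HM)$ is the space of $H^{\otimes n}$-linear maps $L_1\otimes\cdots\otimes L_n\to H^{\otimes n}\otimes_HM$ ($H^{\otimes n}$ acts factorwise on the source, by left multiplication on the target); its elements are called polylinear. Composition: if $\psi(y_1,\dots,y_l)=\sum_i(h_i^1\otimes\cdots\otimes h_i^l)\otimes_He_i$ and $\varphi(x_1,\dots,x_{m-1},e_i,x_{m+1},\dots,x_k)=\sum_j(f^1_{ij}\otimes\cdots\otimes f^k_{ij})\otimes_He_{ij}$, then $\varphi(x_1,\dots,x_{m-1},\psi(y_1,\dots,y_l),x_{m+1},\dots,x_k)=\sum_{i,j}(f^1_{ij}\otimes\cdots\otimes f^{m-1}_{ij}\otimes h_i^1f^m_{ij(1)}\otimes\cdots\otimes h^l_if^m_{ij(l)}\otimes f^{m+1}_{ij}\otimes\cdots\otimes f^k_{ij})\otimes_He_{ij}$. $H$-linear maps are applied to $H^{\otimes n}\otimes_HM$ through the second factor. Slot convention: each factor of $H^{\otimes N}$ is attached to one argument;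 in identities (and for sources/targets of arrows) whose terms involve the same elements in different orders, the $H$-factors are permuted so that they appear in one fixed order of the elements (well defined by cocommutativity). Skew-symmetric means: under this convention, exchanging two arguments changes the sign. A $2$-term $L_\infty$ $H$-pseudoalgebra $(\mathcal{L}_1\xrightarrow{\beta_1}\mathcal{L}_0,\beta_2,\beta_3)$: left $H$-modules $\mathcal{L}_0,\mathcal{L}_1$, an $H$-linear map $\beta_1$, a skew-symmetric polylinear $\beta_2$ with components $\mathcal{L}_i\boxtimes\mathcal{L}_j\to H^{\otimes2}\otimes_H\mathcal{L}_{i+j}$ (zero on $\mathcal{L}_1\boxtimes\mathcal{L}_1$; $\beta_2(u,x)=-\beta_2(x,u)$ under the slot convention), and a skew-symmetric polylinear $\beta_3:\mathcal{L}_0^{\boxtimes3}\to H^{\otimes3}\otimes_H\mathcal{L}_1$, such that for $x,y,z,w\in\mathcal{L}_0$, $u,v\in\mathcal{L}_1$: (i) $\beta_1(\beta_2(x,u))=\beta_2(x,\beta_1(u))$; (ii) $\beta_2(\beta_1(u),v)=\beta_2(u,\beta_1(v))$; (iii) $\beta_2(\beta_2(x,y),z)-\beta_2(x,\beta_2(y,z))+\beta_2(y,\beta_2(x,z))=-\beta_1(\beta_3(x,y,z))$; (iv) $\beta_2(\beta_2(x,y),v)-\beta_2(x,\beta_2(y,v))+\beta_2(y,\beta_2(x,v))=-\beta_3(x,y,\beta_1(v))$; (v) $\beta_2(x,\beta_3(y,z,w))-\beta_2(y,\beta_3(x,z,w))+\beta_2(z,\beta_3(x,y,w))-\beta_2(w,\beta_3(x,y,z))-\beta_3(\beta_2(x,y),z,w)+\beta_3(\beta_2(x,z),y,w)-\beta_3(\beta_2(x,w),y,z)-\beta_3(\beta_2(y,z),x,w)+\beta_3(\beta_2(y,w),x,z)-\beta_3(\beta_2(z,w),x,y)=0$.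 A morphism $(f_0,f_1,f_2):\mathcal{L}\rightsquigarrow\mathcal{L}'$: $H$-linear $f_0:\mathcal{L}_0\to\mathcal{L}_0'$, $f_1:\mathcal{L}_1\to\mathcal{L}_1'$ and a polylinear map $f_2:\mathcal{L}_0\boxtimes\mathcal{L}_0\to H^{\otimes2}\otimes_H\mathcal{L}'_1$ such that for $x,y,z\in\mathcal{L}_0$, $u\in\mathcal{L}_1$: $\beta_1'\circ f_1=f_0\circ\beta_1$; $f_0(\beta_2(x,y))-\beta_2'(f_0(x),f_0(y))=\beta_1'(f_2(x,y))$; $f_1(\beta_2(x,u))-\beta_2'(f_0(x),f_1(u))=f_2(x,\beta_1(u))$; and $\beta_2'(f_2(x,y),f_0(z))-\beta_2'(f_0(x),f_2(y,z))+\beta_2'(f_0(y),f_2(x,z))+f_2(\beta_2(x,y),z)-f_2(x,\beta_2(y,z))+f_2(y,\beta_2(x,z))=\beta_3'(f_0(x),f_0(y),f_0(z))-f_1(\beta_3(x,y,z))$. Composition: $g\circ f=(g_0f_0,\ g_1f_1,\ g_2\circ(f_0\otimes f_0)+(\mathrm{id}_{H^{\otimes2}}\otimes_Hg_1)\circ f_2)$. These are the objects, morphisms and composition of $\mathbf{2shLie}H$. A left-$2$ module over $H$ is a category $C=(C_1\rightrightarrows C_0)$ internal to left $H$-modules (objects $C_0$ and arrows $C_1$ are left $H$-modules; source $s$, target $t$, identity map $x\mapsto1_x$ and composition are $H$-linear). Morphisms are internal functors $F=(F_0,F_1)$. $H^{\otimes n}\otimes_HC$ denotes the internal category with objects $H^{\otimes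 n}\otimes_HC_0$ and arrows $H^{\otimes n}\otimes_HC_1$. A Lie-$2$ $H$-pseudoalgebra $(C,[\cdot*\cdot],\mathcal{J})$: a left-$2$ module $C$ over $H$; an $H^{\otimes2}$-linear skew-symmetric functor $[\cdot*\cdot]:C\otimes C\to H^{\otimes2}\otimes_HC$; and an $H^{\otimes3}$-linear skew-symmetric natural isomorphism $\mathcal{J}_{x,y,z}:[[x*y]*z]\to[x*[y*z]]-[y*[x*z]]$ in $H^{\otimes3}\otimes_HC$ (skew-symmetry refers to its arrow part $\mathcal{J}_{x,y,z}-1_{[[x*y]*z]}$), such that for all $x,y,z,w\in C_0$ the following two composites $[[[x*y]*z]*w]\to[x*[y*[z*w]]]-[y*[x*[z*w]]]-[z*[x*[y*w]]]+[z*[y*[x*w]]]$ are equal (an object inside a bracket with an arrow means its identity arrow, and $1$ means the identity arrow of the corresponding summand): first $[\mathcal{J}_{x,y,z}*w]$, then $\mathcal{J}_{x,[y*z],w}-\mathcal{J}_{y,[x*z],w}$, then $[x*\mathcal{J}_{y,z,w}]-\mathcal{J}_{y,z,[x*w]}-[y*\mathcal{J}_{x,z,w}]+\mathcal{J}_{x,z,[y*w]}$; and first $\mathcal{J}_{[x*y],z,w}$, then $1-[z*\mathcal{J}_{x,y,w}]$, then $\mathcal{J}_{x,y,[z*w]}-1+1$. A morphism $(F_0,F_1,F_2):(C,[\cdot*\cdot],\mathcal{J})\to(C',[\cdot*\cdot]',\mathcal{J}')$: a morphism $(F_0,F_1)$ of left-$2$ modules and a natural isomorphism $(F_2)^{x,y}:[F_0(x)*F_0(y)]'\to(\mathrm{id}_{H^{\otimes2}}\otimes_HF_0)[x*y]$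 such that for all $x,y,z\in C_0$ $$\big((F_2)^{x,[y*z]}-(F_2)^{y,[x*z]}\big)\circ\big([F_0(x)*(F_2)^{y,z}]'-[F_0(y)*(F_2)^{x,z}]'\big)\circ\mathcal{J}'_{F_0(x),F_0(y),F_0(z)}$$ $$=(\mathrm{id}_{H^{\otimes3}}\otimes_HF_1)(\mathcal{J}_{x,y,z})\circ(F_2)^{[x*y],z}\circ[(F_2)^{x,y}*F_0(z)]',$$ where expressions such as $(F_2)^{[x*y],z}$ are formed by the composition rule above. The composite of $(F_0,F_1,F_2)$ followed by $(G_0,G_1,G_2)$ is $(G_0F_0,\ G_1F_1,\ (\mathrm{id}_{H^{\otimes2}}\otimes_HG_1)((F_2)^{x,y})\circ(G_2)^{F_0(x),F_0(y)})$; the identity morphism has identity components. These data form $\mathbf{Lie2}H$.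
   Formalization: Morphisms of 2-term L∞ H-pseudoalgebras must also satisfy f_1(β_2(u,x)) − β_2'(f_1(u),f_0(x)) = f_2(β_1(u),x); without it, as f_2 need not be skew-symmetric, they are not closed under composition. F_2 is taken to be polylinear. *)

theory Defs
  imports "HOL.Vector_Spaces" "HOL-Algebra.Module" "HOL-Library.Poly_Mapping" "HOL-Library.Set_Algebras"
begin

section \<open>Categories and equivalences\<close>

text \<open>Hom-sets are indexed by pairs of objects and need not be disjoint; composition, identities
  and the arrow part of a functor therefore take the objects involved as arguments.\<close>

record ('o, 'a) category =
  Obj :: "'o set"
  Hom :: "'o \<Rightarrow> 'o \<Rightarrow> 'a set"
  Idt :: "'o \<Rightarrow> 'a"
  Cmp :: "'o \<Rightarrow> 'o \<Rightarrow> 'o \<Rightarrow> 'a \<Rightarrow> 'a \<Rightarrow> 'a"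
    \<comment> \<open>\<open>Cmp C X Y Z g f\<close> is \<open>g \<circ> f\<close> for \<open>f : X \<rightarrow> Y\<close> and \<open>g : Y \<rightarrow> Z\<close>\<close>

definition is_category :: "('o, 'a) category \<Rightarrow> bool" where
  "is_category C \<longleftrightarrow>
     (\<forall>X\<in>Obj C. Idt C X \<in> Hom C X X) \<and>
     (\<forall>X\<in>Obj C. \<forall>Y\<in>Obj C. \<forall>Z\<in>Obj C. \<forall>f\<in>Hom C X Y. \<forall>g\<in>Hom C Y Z.
        Cmp C X Y Z g f \<in> Hom C X Z) \<and>
     (\<forall>X\<in>Obj C. \<forall>Y\<in>Obj C. \<forall>f\<in>Hom C X Y.
        Cmp C X X Y f (Idt C X) = f \<and> Cmp C X Y Y (Idt C Y) f = f) \<and>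
     (\<forall>W\<in>Obj C. \<forall>X\<in>Obj C. \<forall>Y\<in>Obj C. \<forall>Z\<in>Obj C.
        \<forall>f\<in>Hom C W X. \<forall>g\<in>Hom C X Y. \<forall>h\<in>Hom C Y Z.
          Cmp C W Y Z h (Cmp C W X Y g f) = Cmp C W X Z (Cmp C X Y Z h g) f)"

definition is_functor ::
    "('o, 'a) category \<Rightarrow> ('p, 'b) category \<Rightarrow> ('o \<Rightarrow> 'p) \<Rightarrow> ('o \<Rightarrow> 'o \<Rightarrow> 'a \<Rightarrow> 'b) \<Rightarrow> bool" where
  "is_functor C D F FA \<longleftrightarrow>
     (\<forall>X\<in>Obj C. F X \<in> Obj D) \<and>
     (\<forall>X\<in>Obj C. \<forall>Y\<in>Obj C. \<forall>f\<in>Hom C X Y. FA X Y f \<in> Hom D (F X) (F Y)) \<and>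
     (\<forall>X\<in>Obj C. FA X X (Idt C X) = Idt D (F X)) \<and>
     (\<forall>X\<in>Obj C. \<forall>Y\<in>Obj C. \<forall>Z\<in>Obj C. \<forall>f\<in>Hom C X Y. \<forall>g\<in>Hom C Y Z.
        FA X Z (Cmp C X Y Z g f) = Cmp D (F X) (F Y) (F Z) (FA Y Z g) (FA X Y f))"

definition is_isomorphism :: "('o, 'a) category \<Rightarrow> 'o \<Rightarrow> 'o \<Rightarrow> 'a \<Rightarrow> bool" where
  "is_isomorphism C X Y f \<longleftrightarrow>
     f \<in> Hom C X Y \<and>
     (\<exists>g\<in>Hom C Y X. Cmp C X Y X g f = Idt C X \<and> Cmp C Y X Y f g = Idt C Y)"

definition is_natural_iso ::
    "('o, 'a) category \<Rightarrow> ('p, 'b) category \<Rightarrow> ('o \<Rightarrow> 'p) \<Rightarrow> ('o \<Rightarrow> 'o \<Rightarrow> 'a \<Rightarrow> 'b) \<Rightarrow>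
     ('o \<Rightarrow> 'p) \<Rightarrow> ('o \<Rightarrow> 'o \<Rightarrow> 'a \<Rightarrow> 'b) \<Rightarrow> ('o \<Rightarrow> 'b) \<Rightarrow> bool" where
  "is_natural_iso C D F FA G GA \<eta> \<longleftrightarrow>
     (\<forall>X\<in>Obj C. is_isomorphism D (F X) (G X) (\<eta> X)) \<and>
     (\<forall>X\<in>Obj C. \<forall>Y\<in>Obj C. \<forall>f\<in>Hom C X Y.
        Cmp D (F X) (F Y) (G Y) (\<eta> Y) (FA X Y f) = Cmp D (F X) (G X) (G Y) (GA X Y f) (\<eta> X))"

definition equivalent_categories :: "('o, 'a) category \<Rightarrow> ('p, 'b) category \<Rightarrow> bool" where
  "equivalent_categories C D \<longleftrightarrow>
     is_category C \<and> is_category D \<and>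
     (\<exists>F FA G GA \<eta> \<theta>.
        is_functor C D F FA \<and> is_functor D C G GA \<and>
        is_natural_iso C C (\<lambda>X. X) (\<lambda>X Y f. f) (\<lambda>X. G (F X)) (\<lambda>X Y f. GA (F X) (F Y) (FA X Y f)) \<eta> \<and>
        is_natural_iso D D (\<lambda>Y. F (G Y)) (\<lambda>X Y g. FA (G X) (G Y) (GA X Y g)) (\<lambda>Y. Y) (\<lambda>X Y g. g) \<theta>)"


section \<open>Left modules and left-2 modules\<close>

text \<open>Modules are records of HOL-Algebra, but over a possibly noncommutative ring of scalars; as
  there, the fields \<open>mult\<close> and \<open>one\<close> of the record play no role.\<close>

locale left_module = abelian_group M for M :: "('r::ring_1, 'm) module" (structure) +
  assumes smult_closed: "x \<in> carrier M \<Longrightarrow> r \<odot> x \<in> carrier M"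
    and smult_add_scalar: "x \<in> carrier M \<Longrightarrow> (r + s) \<odot> x = r \<odot> x \<oplus> s \<odot> x"
    and smult_add: "\<lbrakk>x \<in> carrier M; y \<in> carrier M\<rbrakk> \<Longrightarrow> r \<odot> (x \<oplus> y) = r \<odot> x \<oplus> r \<odot> y"
    and smult_mult: "x \<in> carrier M \<Longrightarrow> (r * s) \<odot> x = r \<odot> (s \<odot> x)"
    and smult_1: "x \<in> carrier M \<Longrightarrow> 1 \<odot> x = x"

definition lhom :: "('r, 'm) module \<Rightarrow> ('r, 'n) module \<Rightarrow> ('m \<Rightarrow> 'n) set" where
  "lhom M N = {f \<in> hom (add_monoid M) (add_monoid N).
                 \<forall>r. \<forall>x\<in>carrier M. f (r \<odot>\<^bsub>M\<^esub> x) = r \<odot>\<^bsub>N\<^esub> f x}"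

record ('r, 'm) internal_cat =
  Ob :: "('r, 'm) module"
  Ar :: "('r, 'm) module"
  src :: "'m \<Rightarrow> 'm"
  tgt :: "'m \<Rightarrow> 'm"
  idn :: "'m \<Rightarrow> 'm"
  cmp :: "'m \<times> 'm \<Rightarrow> 'm"  \<comment> \<open>\<open>cmp C (g, f)\<close> is \<open>g \<circ> f\<close>\<close>

definition composable :: "('r, 'm) internal_cat \<Rightarrow> ('r, 'm \<times> 'm) module" where
  "composable C =
     \<lparr>carrier = {(g, f). g \<in> carrier (Ar C) \<and> f \<in> carrier (Ar C) \<and> src C g = tgt C f},
      mult = undefined, one = undefined,
      zero = (\<zero>\<^bsub>Ar C\<^esub>, \<zero>\<^bsub>Ar C\<^esub>),
      add = (\<lambda>(g, f) (g', f'). (g \<oplus>\<^bsub>Ar C\<^esub> g', f \<oplus>\<^bsub>Ar C\<^esub> f')),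
      smult = (\<lambda>r (g, f). (r \<odot>\<^bsub>Ar C\<^esub> g, r \<odot>\<^bsub>Ar C\<^esub> f))\<rparr>"

definition left_2_module :: "('r::ring_1, 'm) internal_cat \<Rightarrow> bool" where
  "left_2_module C \<longleftrightarrow>
     left_module (Ob C) \<and> left_module (Ar C) \<and>
     src C \<in> lhom (Ar C) (Ob C) \<and> tgt C \<in> lhom (Ar C) (Ob C) \<and> idn C \<in> lhom (Ob C) (Ar C) \<and>
     cmp C \<in> lhom (composable C) (Ar C) \<and>
     (\<forall>x\<in>carrier (Ob C). src C (idn C x) = x \<and> tgt C (idn C x) = x) \<and>
     (\<forall>(g, f)\<in>carrier (composable C). src C (cmp C (g, f)) = src C f \<and> tgt C (cmp C (g, f)) = tgt C g) \<and>
     (\<forall>f\<in>carrier (Ar C). cmp C (f, idn C (src C f)) = f \<and> cmp C (idn C (tgt C f), f) = f) \<and>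
     (\<forall>h g f. (h, g) \<in> carrier (composable C) \<longrightarrow> (g, f) \<in> carrier (composable C) \<longrightarrow>
        cmp C (h, cmp C (g, f)) = cmp C (cmp C (h, g), f))"

definition left_2_module_hom ::
    "('r, 'm) internal_cat \<Rightarrow> ('r, 'm) internal_cat \<Rightarrow> ('m \<Rightarrow> 'm) \<Rightarrow> ('m \<Rightarrow> 'm) \<Rightarrow> bool" where
  "left_2_module_hom C C' F0 F1 \<longleftrightarrow>
     F0 \<in> lhom (Ob C) (Ob C') \<and> F1 \<in> lhom (Ar C) (Ar C') \<and>
     (\<forall>f\<in>carrier (Ar C). src C' (F1 f) = F0 (src C f) \<and> tgt C' (F1 f) = F0 (tgt C f)) \<and>
     (\<forall>x\<in>carrier (Ob C). F1 (idn C x) = idn C' (F0 x)) \<and>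
     (\<forall>(g, f)\<in>carrier (composable C). F1 (cmp C (g, f)) = cmp C' (F1 g, F1 f))"

definition arrow_in :: "('r, 'm) internal_cat \<Rightarrow> 'm \<Rightarrow> 'm \<Rightarrow> 'm \<Rightarrow> bool" where
  "arrow_in C f x y \<longleftrightarrow> f \<in> carrier (Ar C) \<and> src C f = x \<and> tgt C f = y"

definition iso_arrow_in :: "('r, 'm) internal_cat \<Rightarrow> 'm \<Rightarrow> 'm \<Rightarrow> 'm \<Rightarrow> bool" where
  "iso_arrow_in C f x y \<longleftrightarrow>
     arrow_in C f x y \<and> (\<exists>g. arrow_in C g y x \<and> cmp C (g, f) = idn C x \<and> cmp C (f, g) = idn C y)"


section \<open>Tensor powers of \<open>H\<close> and the modules \<open>H\<^sup>\<otimes>\<^sup>n \<otimes>\<^sub>H M\<close>\<close>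

text \<open>An element of \<open>H\<^sup>\<otimes>\<^sup>n\<close> is a coset of formal sums of words \<open>[h\<^sub>1, \<dots>, h\<^sub>n]\<close>, an element of
  \<open>H\<^sup>\<otimes>\<^sup>n \<otimes>\<^sub>H M\<close> is a coset of formal sums of generators \<open>([h\<^sub>1, \<dots>, h\<^sub>n], m)\<close>, modulo the subgroups
  \<open>pow_rel n\<close> and \<open>tens_rel n M\<close> of relations below (\<open>n \<ge> 1\<close> throughout). Sums of cosets are
  elementwise sums of sets.\<close>

type_synonym 'h pow = "('h list \<Rightarrow>\<^sub>0 int) set"
type_synonym ('h, 'm) tens = "('h list \<times> 'm \<Rightarrow>\<^sub>0 int) set"

text \<open>The additive map into the quotient by \<open>R\<close> that sends the class of a generator \<open>g\<close> to the
  coset \<open>f g\<close>. It does not depend on the chosen representatives when \<open>f\<close> respects the relations of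
  the source, which is the case in all uses below.\<close>

definition lin_extend :: "('b \<Rightarrow>\<^sub>0 int) set \<Rightarrow> ('a \<Rightarrow> ('b \<Rightarrow>\<^sub>0 int) set) \<Rightarrow> ('a \<Rightarrow>\<^sub>0 int) set \<Rightarrow> ('b \<Rightarrow>\<^sub>0 int) set" where
  "lin_extend R f X = frag_extend (\<lambda>g. SOME y. y \<in> f g) (SOME x. x \<in> X) +o R"

text \<open>All modules in the two categories are carried by subsets of a type \<open>'u\<close>, which plays the role of the
  universe. It is taken to be infinite in the theorem, so that it contains a copy of the direct sum
  of any two such modules.

  \<open>beta00\<close>, \<open>beta01\<close>, \<open>beta10\<close> are the components of \<open>\<beta>\<^sub>2\<close> on \<open>L\<^sub>0 \<boxtimes> L\<^sub>0\<close>, \<open>L\<^sub>0 \<boxtimes> L\<^sub>1\<close>, \<open>L\<^sub>1 \<boxtimes> L\<^sub>0\<close>; the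
  component on \<open>L\<^sub>1 \<boxtimes> L\<^sub>1\<close> is zero.\<close>

record ('h, 'u) linf2 =
  deg0 :: "('h, 'u) module"
  deg1 :: "('h, 'u) module"
  beta1 :: "'u \<Rightarrow> 'u"
  beta00 :: "'u \<Rightarrow> 'u \<Rightarrow> ('h, 'u) tens"
  beta01 :: "'u \<Rightarrow> 'u \<Rightarrow> ('h, 'u) tens"
  beta10 :: "'u \<Rightarrow> 'u \<Rightarrow> ('h, 'u) tens"
  beta3 :: "'u \<Rightarrow> 'u \<Rightarrow> 'u \<Rightarrow> ('h, 'u) tens"

record ('h, 'u) lie2 =
  lcat :: "('h, 'u) internal_cat"
  br0 :: "'u \<Rightarrow> 'u \<Rightarrow> ('h, 'u) tens"
  br1 :: "'u \<Rightarrow> 'u \<Rightarrow> ('h, 'u) tens"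
  jac :: "'u \<Rightarrow> 'u \<Rightarrow> 'u \<Rightarrow> ('h, 'u) tens"

text \<open>Morphisms of both categories are triples. To make equality of morphisms the equality of their
  restrictions to the carriers, the components are required to be \<open>undefined\<close> elsewhere.\<close>

type_synonym ('h, 'u) mor = "('u \<Rightarrow> 'u) \<times> ('u \<Rightarrow> 'u) \<times> ('u \<Rightarrow> 'u \<Rightarrow> ('h, 'u) tens)"

definition extensional2 :: "'a set \<Rightarrow> ('a \<Rightarrow> 'a \<Rightarrow> 'b) set" where
  "extensional2 A = {f \<in> extensional A. \<forall>x\<in>A. f x \<in> extensional A}"

locale comult_data =
  fixes scale :: "'k::field \<Rightarrow> 'h::ring_1 \<Rightarrow> 'h" (infixr \<open>*\<^sub>k\<close> 75)
    and comult :: "'h \<Rightarrow> 'h pow"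
begin

inductive_set pow_rel :: "nat \<Rightarrow> ('h list \<Rightarrow>\<^sub>0 int) set" for n :: nat where
  zero: "0 \<in> pow_rel n"
| diff: "\<lbrakk>r \<in> pow_rel n; s \<in> pow_rel n\<rbrakk> \<Longrightarrow> r - s \<in> pow_rel n"
| additive: "length as + length bs + 1 = n \<Longrightarrow>
    frag_of (as @ [a + b] @ bs) - frag_of (as @ [a] @ bs) - frag_of (as @ [b] @ bs) \<in> pow_rel n"
| balanced: "length as + length bs + length cs + 2 = n \<Longrightarrow>
    frag_of (as @ [c *\<^sub>k a] @ bs @ [b] @ cs) - frag_of (as @ [a] @ bs @ [c *\<^sub>k b] @ cs) \<in> pow_rel n"

definition pow_carrier :: "nat \<Rightarrow> 'h pow set" where
  "pow_carrier n = {x +o pow_rel n |x. \<forall>hs\<in>Poly_Mapping.keys x. length hs = n}"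

definition pure :: "'h list \<Rightarrow> 'h pow" where
  "pure hs = frag_of hs +o pow_rel (length hs)"

definition pow_mult :: "nat \<Rightarrow> 'h pow \<Rightarrow> 'h pow \<Rightarrow> 'h pow" where
  "pow_mult n X Y = lin_extend (pow_rel n) (\<lambda>as. lin_extend (pow_rel n) (\<lambda>bs. pure (map2 (*) as bs)) Y) X"

text \<open>\<open>iter_comult n : H \<rightarrow> H\<^sup>\<otimes>\<^sup>(\<^sup>n\<^sup>+\<^sup>1\<^sup>)\<close> is \<open>h \<mapsto> h\<^sub>(\<^sub>1\<^sub>) \<otimes> \<dots> \<otimes> h\<^sub>(\<^sub>n\<^sub>+\<^sub>1\<^sub>)\<close>.\<close>

primrec iter_comult :: "nat \<Rightarrow> 'h \<Rightarrow> 'h pow" where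
  "iter_comult 0 h = pure [h]"
| "iter_comult (Suc n) h =
     lin_extend (pow_rel (n + 2)) (\<lambda>as. lin_extend (pow_rel (n + 2)) (\<lambda>ds. pure (ds @ tl as)) (comult (hd as)))
       (iter_comult n h)"

text \<open>In \<open>over_H\<close>, \<open>d\<close> is any formal sum representing \<open>h\<^sub>(\<^sub>1\<^sub>) \<otimes> \<dots> \<otimes> h\<^sub>(\<^sub>n\<^sub>)\<close>.\<close>

inductive_set tens_rel :: "nat \<Rightarrow> ('h, 'm) module \<Rightarrow> ('h list \<times> 'm \<Rightarrow>\<^sub>0 int) set"
  for n :: nat and M :: "('h, 'm) module" where
  zero: "0 \<in> tens_rel n M"
| diff: "\<lbrakk>r \<in> tens_rel n M; s \<in> tens_rel n M\<rbrakk> \<Longrightarrow> r - s \<in> tens_rel n M"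
| power: "\<lbrakk>r \<in> pow_rel n; m \<in> carrier M\<rbrakk> \<Longrightarrow>
    frag_extend (\<lambda>hs. frag_of (hs, m)) r \<in> tens_rel n M"
| additive: "\<lbrakk>length hs = n; x \<in> carrier M; y \<in> carrier M\<rbrakk> \<Longrightarrow>
    frag_of (hs, x \<oplus>\<^bsub>M\<^esub> y) - frag_of (hs, x) - frag_of (hs, y) \<in> tens_rel n M"
| over_H: "\<lbrakk>length hs = n; m \<in> carrier M; d \<in> iter_comult (n - 1) h\<rbrakk> \<Longrightarrow>
    frag_extend (\<lambda>ds. frag_of (map2 (*) hs ds, m)) d - frag_of (hs, h \<odot>\<^bsub>M\<^esub> m) \<in> tens_rel n M"

definition tpure :: "('h, 'm) module \<Rightarrow> 'h list \<times> 'm \<Rightarrow> ('h, 'm) tens" where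
  "tpure M = (\<lambda>(hs, m). frag_of (hs, m) +o tens_rel (length hs) M)"

text \<open>\<open>H\<^sup>\<otimes>\<^sup>n \<otimes>\<^sub>H M\<close> as a left \<open>H\<^sup>\<otimes>\<^sup>n\<close>-module by left multiplication on the first factor.\<close>

definition tens :: "nat \<Rightarrow> ('h, 'm) module \<Rightarrow> ('h pow, ('h, 'm) tens) module" where
  "tens n M =
     \<lparr>carrier = {x +o tens_rel n M |x. \<forall>(hs, m)\<in>Poly_Mapping.keys x. length hs = n \<and> m \<in> carrier M},
      mult = undefined, one = undefined,
      zero = tens_rel n M,
      add = (+),
      smult = (\<lambda>A X. lin_extend (tens_rel n M)
                       (\<lambda>as. lin_extend (tens_rel n M) (\<lambda>(hs, m). tpure M (map2 (*) as hs, m)) X) A)\<rparr>"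

text \<open>\<open>tmap n N f\<close> is \<open>id \<otimes>\<^sub>H f : H\<^sup>\<otimes>\<^sup>n \<otimes>\<^sub>H M \<rightarrow> H\<^sup>\<otimes>\<^sup>n \<otimes>\<^sub>H N\<close>.\<close>

definition tmap :: "nat \<Rightarrow> ('h, 'n) module \<Rightarrow> ('m \<Rightarrow> 'n) \<Rightarrow> ('h, 'm) tens \<Rightarrow> ('h, 'n) tens" where
  "tmap n N f = lin_extend (tens_rel n N) (\<lambda>(hs, m). tpure N (hs, f m))"

text \<open>Permutation of the factors of \<open>H\<^sup>\<otimes>\<^sup>n\<close>: factor \<open>i\<close> of the result is factor \<open>\<sigma> ! i\<close> of the argument.
  A term whose arguments are written in the order \<open>y, x, z\<close>, say, is brought to the fixed order
  \<open>x, y, z\<close> by \<open>slots M [1, 0, 2]\<close>: the list \<open>\<sigma>\<close> gives the positions, counted from 0, of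
  \<open>x, y, z\<close> in the term.\<close>

definition slots :: "('h, 'm) module \<Rightarrow> nat list \<Rightarrow> ('h, 'm) tens \<Rightarrow> ('h, 'm) tens" where
  "slots M \<sigma> = lin_extend (tens_rel (length \<sigma>) M) (\<lambda>(hs, m). tpure M (map ((!) hs) \<sigma>, m))"

text \<open>Composition of polylinear maps: \<open>plug n N m \<phi> X\<close> is \<open>\<phi>(\<dots>, X, \<dots>)\<close> in \<open>H\<^sup>\<otimes>\<^sup>n \<otimes>\<^sub>H N\<close>,
  where \<open>\<phi> e\<close> is the value of the outer map at \<open>e\<close> in its argument number \<open>m\<close> (counted from 0),
  the remaining arguments being fixed.\<close>

definition plug :: "nat \<Rightarrow> ('h, 'n) module \<Rightarrow> nat \<Rightarrow> ('m \<Rightarrow> ('h, 'n) tens) \<Rightarrow> ('h, 'm) tens \<Rightarrow> ('h, 'n) tens" where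
  "plug n N m \<phi> = lin_extend (tens_rel n N) (\<lambda>(hs, e).
     lin_extend (tens_rel n N) (\<lambda>(fs, e').
       lin_extend (tens_rel n N) (\<lambda>ds. tpure N (take m fs @ map2 (*) hs ds @ drop (Suc m) fs, e'))
         (iter_comult (length hs - 1) (fs ! m)))
       (\<phi> e))"

text \<open>Linear maps out of \<open>L\<^sub>1 \<boxtimes> \<dots> \<boxtimes> L\<^sub>n\<close>, given on pure tensors. Balancedness over the ground field
  is contained in the last condition.\<close>

definition polylinear2 ::
    "('h, 'a) module \<Rightarrow> ('h, 'b) module \<Rightarrow> ('h, 'm) module \<Rightarrow> ('a \<Rightarrow> 'b \<Rightarrow> ('h, 'm) tens) \<Rightarrow> bool" where
  "polylinear2 A B M f \<longleftrightarrow>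
     (\<forall>y\<in>carrier B. (\<lambda>x. f x y) \<in> hom (add_monoid A) (add_monoid (tens 2 M))) \<and>
     (\<forall>x\<in>carrier A. (\<lambda>y. f x y) \<in> hom (add_monoid B) (add_monoid (tens 2 M))) \<and>
     (\<forall>x\<in>carrier A. \<forall>y\<in>carrier B. \<forall>g h.
        f (g \<odot>\<^bsub>A\<^esub> x) (h \<odot>\<^bsub>B\<^esub> y) = pure [g, h] \<odot>\<^bsub>tens 2 M\<^esub> f x y)"

definition polylinear3 :: "('h, 'a) module \<Rightarrow> ('h, 'm) module \<Rightarrow> ('a \<Rightarrow> 'a \<Rightarrow> 'a \<Rightarrow> ('h, 'm) tens) \<Rightarrow> bool" where
  "polylinear3 A M f \<longleftrightarrow>
     (\<forall>y\<in>carrier A. \<forall>z\<in>carrier A.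
        (\<lambda>x. f x y z) \<in> hom (add_monoid A) (add_monoid (tens 3 M)) \<and>
        (\<lambda>x. f y x z) \<in> hom (add_monoid A) (add_monoid (tens 3 M)) \<and>
        (\<lambda>x. f y z x) \<in> hom (add_monoid A) (add_monoid (tens 3 M))) \<and>
     (\<forall>x\<in>carrier A. \<forall>y\<in>carrier A. \<forall>z\<in>carrier A. \<forall>g h k.
        f (g \<odot>\<^bsub>A\<^esub> x) (h \<odot>\<^bsub>A\<^esub> y) (k \<odot>\<^bsub>A\<^esub> z) = pure [g, h, k] \<odot>\<^bsub>tens 3 M\<^esub> f x y z)"

definition skew2 :: "('h, 'a) module \<Rightarrow> ('h, 'm) module \<Rightarrow> ('a \<Rightarrow> 'a \<Rightarrow> ('h, 'm) tens) \<Rightarrow> bool" where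
  "skew2 A M f \<longleftrightarrow>
     (\<forall>x\<in>carrier A. \<forall>y\<in>carrier A. slots M [1, 0] (f y x) = \<ominus>\<^bsub>tens 2 M\<^esub> f x y)"

definition skew3 :: "('h, 'a) module \<Rightarrow> ('h, 'm) module \<Rightarrow> ('a \<Rightarrow> 'a \<Rightarrow> 'a \<Rightarrow> ('h, 'm) tens) \<Rightarrow> bool" where
  "skew3 A M f \<longleftrightarrow>
     (\<forall>x\<in>carrier A. \<forall>y\<in>carrier A. \<forall>z\<in>carrier A.
        slots M [1, 0, 2] (f y x z) = \<ominus>\<^bsub>tens 3 M\<^esub> f x y z \<and>
        slots M [0, 2, 1] (f x z y) = \<ominus>\<^bsub>tens 3 M\<^esub> f x y z \<and>
        slots M [2, 1, 0] (f z y x) = \<ominus>\<^bsub>tens 3 M\<^esub> f x y z)"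


subsection \<open>2-term \<open>L\<^sub>\<infinity>\<close> \<open>H\<close>-pseudoalgebras\<close>

definition is_linf2 :: "('h, 'u) linf2 \<Rightarrow> bool" where
  "is_linf2 L \<longleftrightarrow>
    (let L0 = deg0 L; L1 = deg1 L; T30 = tens 3 L0; T31 = tens 3 L1; T4 = tens 4 L1 in
     left_module L0 \<and> left_module L1 \<and> beta1 L \<in> lhom L1 L0 \<and>
     polylinear2 L0 L0 L0 (beta00 L) \<and> polylinear2 L0 L1 L1 (beta01 L) \<and> polylinear2 L1 L0 L1 (beta10 L) \<and>
     skew2 L0 L0 (beta00 L) \<and>
     (\<forall>x\<in>carrier L0. \<forall>u\<in>carrier L1. slots L1 [1, 0] (beta10 L u x) = \<ominus>\<^bsub>tens 2 L1\<^esub> beta01 L x u) \<and>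
     polylinear3 L0 L1 (beta3 L) \<and> skew3 L0 L1 (beta3 L) \<and>
     (\<forall>x\<in>carrier L0. \<forall>u\<in>carrier L1. tmap 2 L0 (beta1 L) (beta01 L x u) = beta00 L x (beta1 L u)) \<and>
     (\<forall>u\<in>carrier L1. \<forall>v\<in>carrier L1. beta01 L (beta1 L u) v = beta10 L u (beta1 L v)) \<and>
     (\<forall>x\<in>carrier L0. \<forall>y\<in>carrier L0. \<forall>z\<in>carrier L0.
        plug 3 L0 0 (\<lambda>e. beta00 L e z) (beta00 L x y)
        \<ominus>\<^bsub>T30\<^esub> plug 3 L0 1 (\<lambda>e. beta00 L x e) (beta00 L y z)
        \<oplus>\<^bsub>T30\<^esub> slots L0 [1, 0, 2] (plug 3 L0 1 (\<lambda>e. beta00 L y e) (beta00 L x z))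
        = \<ominus>\<^bsub>T30\<^esub> tmap 3 L0 (beta1 L) (beta3 L x y z)) \<and>
     (\<forall>x\<in>carrier L0. \<forall>y\<in>carrier L0. \<forall>v\<in>carrier L1.
        plug 3 L1 0 (\<lambda>e. beta01 L e v) (beta00 L x y)
        \<ominus>\<^bsub>T31\<^esub> plug 3 L1 1 (\<lambda>e. beta01 L x e) (beta01 L y v)
        \<oplus>\<^bsub>T31\<^esub> slots L1 [1, 0, 2] (plug 3 L1 1 (\<lambda>e. beta01 L y e) (beta01 L x v))
        = \<ominus>\<^bsub>T31\<^esub> beta3 L x y (beta1 L v)) \<and>
     (\<forall>x\<in>carrier L0. \<forall>y\<in>carrier L0. \<forall>z\<in>carrier L0. \<forall>w\<in>carrier L0.
        plug 4 L1 1 (\<lambda>e. beta01 L x e) (beta3 L y z w)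
        \<ominus>\<^bsub>T4\<^esub> slots L1 [1, 0, 2, 3] (plug 4 L1 1 (\<lambda>e. beta01 L y e) (beta3 L x z w))
        \<oplus>\<^bsub>T4\<^esub> slots L1 [1, 2, 0, 3] (plug 4 L1 1 (\<lambda>e. beta01 L z e) (beta3 L x y w))
        \<ominus>\<^bsub>T4\<^esub> slots L1 [1, 2, 3, 0] (plug 4 L1 1 (\<lambda>e. beta01 L w e) (beta3 L x y z))
        \<ominus>\<^bsub>T4\<^esub> plug 4 L1 0 (\<lambda>e. beta3 L e z w) (beta00 L x y)
        \<oplus>\<^bsub>T4\<^esub> slots L1 [0, 2, 1, 3] (plug 4 L1 0 (\<lambda>e. beta3 L e y w) (beta00 L x z))
        \<ominus>\<^bsub>T4\<^esub> slots L1 [0, 2, 3, 1] (plug 4 L1 0 (\<lambda>e. beta3 L e y z) (beta00 L x w))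
        \<ominus>\<^bsub>T4\<^esub> slots L1 [2, 0, 1, 3] (plug 4 L1 0 (\<lambda>e. beta3 L e x w) (beta00 L y z))
        \<oplus>\<^bsub>T4\<^esub> slots L1 [2, 0, 3, 1] (plug 4 L1 0 (\<lambda>e. beta3 L e x z) (beta00 L y w))
        \<ominus>\<^bsub>T4\<^esub> slots L1 [2, 3, 0, 1] (plug 4 L1 0 (\<lambda>e. beta3 L e x y) (beta00 L z w))
        = \<zero>\<^bsub>T4\<^esub>))"

text \<open>The homotopy identity for \<open>f\<^sub>2\<close> is imposed with the element of degree 1 in either argument, i.e.\
  on both summands of \<open>(L \<otimes> L)\<^sub>1 = L\<^sub>0 \<otimes> L\<^sub>1 \<oplus> L\<^sub>1 \<otimes> L\<^sub>0\<close>. As \<open>f\<^sub>2\<close> is not assumed to be skew-symmetric,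
  neither half implies the other, and with one half only morphisms would not be closed under composition.\<close>

definition linf2_hom :: "('h, 'u) linf2 \<Rightarrow> ('h, 'u) linf2 \<Rightarrow> ('h, 'u) mor set" where
  "linf2_hom L L' = {(f0, f1, f2).
    let L0 = deg0 L; L1 = deg1 L; M0 = deg0 L'; M1 = deg1 L';
        T20 = tens 2 M0; T21 = tens 2 M1; T3 = tens 3 M1 in
     f0 \<in> lhom L0 M0 \<inter> extensional (carrier L0) \<and>
     f1 \<in> lhom L1 M1 \<inter> extensional (carrier L1) \<and>
     polylinear2 L0 L0 M1 f2 \<and> f2 \<in> extensional2 (carrier L0) \<and>
     (\<forall>u\<in>carrier L1. beta1 L' (f1 u) = f0 (beta1 L u)) \<and>
     (\<forall>x\<in>carrier L0. \<forall>y\<in>carrier L0.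
        tmap 2 M0 f0 (beta00 L x y) \<ominus>\<^bsub>T20\<^esub> beta00 L' (f0 x) (f0 y) = tmap 2 M0 (beta1 L') (f2 x y)) \<and>
     (\<forall>x\<in>carrier L0. \<forall>u\<in>carrier L1.
        tmap 2 M1 f1 (beta01 L x u) \<ominus>\<^bsub>T21\<^esub> beta01 L' (f0 x) (f1 u) = f2 x (beta1 L u) \<and>
        tmap 2 M1 f1 (beta10 L u x) \<ominus>\<^bsub>T21\<^esub> beta10 L' (f1 u) (f0 x) = f2 (beta1 L u) x) \<and>
     (\<forall>x\<in>carrier L0. \<forall>y\<in>carrier L0. \<forall>z\<in>carrier L0.
        plug 3 M1 0 (\<lambda>e. beta10 L' e (f0 z)) (f2 x y)
        \<ominus>\<^bsub>T3\<^esub> plug 3 M1 1 (\<lambda>e. beta01 L' (f0 x) e) (f2 y z)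
        \<oplus>\<^bsub>T3\<^esub> slots M1 [1, 0, 2] (plug 3 M1 1 (\<lambda>e. beta01 L' (f0 y) e) (f2 x z))
        \<oplus>\<^bsub>T3\<^esub> plug 3 M1 0 (\<lambda>e. f2 e z) (beta00 L x y)
        \<ominus>\<^bsub>T3\<^esub> plug 3 M1 1 (\<lambda>e. f2 x e) (beta00 L y z)
        \<oplus>\<^bsub>T3\<^esub> slots M1 [1, 0, 2] (plug 3 M1 1 (\<lambda>e. f2 y e) (beta00 L x z))
        = beta3 L' (f0 x) (f0 y) (f0 z) \<ominus>\<^bsub>T3\<^esub> tmap 3 M1 f1 (beta3 L x y z))}"

definition linf2_id :: "('h, 'u) linf2 \<Rightarrow> ('h, 'u) mor" where
  "linf2_id L =
     (\<lambda>x\<in>carrier (deg0 L). x, \<lambda>u\<in>carrier (deg1 L). u,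
      \<lambda>x\<in>carrier (deg0 L). \<lambda>y\<in>carrier (deg0 L). \<zero>\<^bsub>tens 2 (deg1 L)\<^esub>)"

definition linf2_comp ::
    "('h, 'u) linf2 \<Rightarrow> ('h, 'u) linf2 \<Rightarrow> ('h, 'u) linf2 \<Rightarrow> ('h, 'u) mor \<Rightarrow> ('h, 'u) mor \<Rightarrow> ('h, 'u) mor" where
  "linf2_comp L L' L'' = (\<lambda>(g0, g1, g2) (f0, f1, f2).
     (\<lambda>x\<in>carrier (deg0 L). g0 (f0 x), \<lambda>u\<in>carrier (deg1 L). g1 (f1 u),
      \<lambda>x\<in>carrier (deg0 L). \<lambda>y\<in>carrier (deg0 L).
        g2 (f0 x) (f0 y) \<oplus>\<^bsub>tens 2 (deg1 L'')\<^esub> tmap 2 (deg1 L'') g1 (f2 x y)))"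

definition two_shLie :: "(('h, 'u) linf2, ('h, 'u) mor) category" where
  "two_shLie = \<lparr>Obj = Collect is_linf2, Hom = linf2_hom, Idt = linf2_id, Cmp = linf2_comp\<rparr>"


subsection \<open>Lie-2 \<open>H\<close>-pseudoalgebras\<close>

text \<open>The composition of \<open>H\<^sup>\<otimes>\<^sup>n \<otimes>\<^sub>H C\<close> is \<open>id \<otimes>\<^sub>H cmp\<close>, transported along the identification of
  \<open>H\<^sup>\<otimes>\<^sup>n \<otimes>\<^sub>H (C\<^sub>1 \<times>\<^bsub>C\<^sub>0\<^esub> C\<^sub>1)\<close> with the module of composable pairs in \<open>H\<^sup>\<otimes>\<^sup>n \<otimes>\<^sub>H C\<^sub>1\<close>.\<close>

definition tens_cat :: "nat \<Rightarrow> ('h, 'm) internal_cat \<Rightarrow> ('h pow, ('h, 'm) tens) internal_cat" where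
  "tens_cat n C =
     \<lparr>Ob = tens n (Ob C), Ar = tens n (Ar C),
      src = tmap n (Ob C) (src C), tgt = tmap n (Ob C) (tgt C), idn = tmap n (Ar C) (idn C),
      cmp = (\<lambda>(g, f). THE e. \<exists>p\<in>carrier (tens n (composable C)).
               tmap n (Ar C) fst p = g \<and> tmap n (Ar C) snd p = f \<and> e = tmap n (Ar C) (cmp C) p)\<rparr>"

text \<open>\<open>[[x * y] * z]\<close>, \<open>[x * [y * z]]\<close> and \<open>[x * [y * z]] - [y * [x * z]]\<close>, for objects or for arrows.\<close>

definition br_l :: "('h, 'u) module \<Rightarrow> ('u \<Rightarrow> 'u \<Rightarrow> ('h, 'u) tens) \<Rightarrow> 'u \<Rightarrow> 'u \<Rightarrow> 'u \<Rightarrow> ('h, 'u) tens" where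
  "br_l M b x y z = plug 3 M 0 (\<lambda>e. b e z) (b x y)"

definition br_r :: "('h, 'u) module \<Rightarrow> ('u \<Rightarrow> 'u \<Rightarrow> ('h, 'u) tens) \<Rightarrow> 'u \<Rightarrow> 'u \<Rightarrow> 'u \<Rightarrow> ('h, 'u) tens" where
  "br_r M b x y z = plug 3 M 1 (\<lambda>e. b x e) (b y z)"

definition br_j :: "('h, 'u) module \<Rightarrow> ('u \<Rightarrow> 'u \<Rightarrow> ('h, 'u) tens) \<Rightarrow> 'u \<Rightarrow> 'u \<Rightarrow> 'u \<Rightarrow> ('h, 'u) tens" where
  "br_j M b x y z = br_r M b x y z \<ominus>\<^bsub>tens 3 M\<^esub> slots M [1, 0, 2] (br_r M b y x z)"

text \<open>In \<open>C \<otimes> C\<close> composition is factorwise, \<open>(a' \<otimes> b') \<circ> (a \<otimes> b) = (a' \<circ> a) \<otimes> (b' \<circ> b)\<close>.\<close>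

definition bracket_functor ::
    "('h, 'u) internal_cat \<Rightarrow> ('u \<Rightarrow> 'u \<Rightarrow> ('h, 'u) tens) \<Rightarrow> ('u \<Rightarrow> 'u \<Rightarrow> ('h, 'u) tens) \<Rightarrow> bool" where
  "bracket_functor C b0 b1 \<longleftrightarrow>
     polylinear2 (Ob C) (Ob C) (Ob C) b0 \<and> skew2 (Ob C) (Ob C) b0 \<and>
     polylinear2 (Ar C) (Ar C) (Ar C) b1 \<and> skew2 (Ar C) (Ar C) b1 \<and>
     (\<forall>a\<in>carrier (Ar C). \<forall>b\<in>carrier (Ar C).
        arrow_in (tens_cat 2 C) (b1 a b) (b0 (src C a) (src C b)) (b0 (tgt C a) (tgt C b))) \<and>
     (\<forall>x\<in>carrier (Ob C). \<forall>y\<in>carrier (Ob C).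
        b1 (idn C x) (idn C y) = idn (tens_cat 2 C) (b0 x y)) \<and>
     (\<forall>(a', a)\<in>carrier (composable C). \<forall>(b', b)\<in>carrier (composable C).
        b1 (cmp C (a', a)) (cmp C (b', b)) = cmp (tens_cat 2 C) (b1 a' b', b1 a b))"

definition jacobiator ::
    "('h, 'u) internal_cat \<Rightarrow> ('u \<Rightarrow> 'u \<Rightarrow> ('h, 'u) tens) \<Rightarrow> ('u \<Rightarrow> 'u \<Rightarrow> ('h, 'u) tens) \<Rightarrow>
     ('u \<Rightarrow> 'u \<Rightarrow> 'u \<Rightarrow> ('h, 'u) tens) \<Rightarrow> bool" where
  "jacobiator C b0 b1 J \<longleftrightarrow>
     polylinear3 (Ob C) (Ar C) J \<and>
     skew3 (Ob C) (Ar C) (\<lambda>x y z. J x y z \<ominus>\<^bsub>tens 3 (Ar C)\<^esub> idn (tens_cat 3 C) (br_l (Ob C) b0 x y z)) \<and>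
     (\<forall>x\<in>carrier (Ob C). \<forall>y\<in>carrier (Ob C). \<forall>z\<in>carrier (Ob C).
        iso_arrow_in (tens_cat 3 C) (J x y z) (br_l (Ob C) b0 x y z) (br_j (Ob C) b0 x y z)) \<and>
     (\<forall>a\<in>carrier (Ar C). \<forall>b\<in>carrier (Ar C). \<forall>c\<in>carrier (Ar C).
        cmp (tens_cat 3 C) (J (tgt C a) (tgt C b) (tgt C c), br_l (Ar C) b1 a b c) =
        cmp (tens_cat 3 C) (br_j (Ar C) b1 a b c, J (src C a) (src C b) (src C c)))"

text \<open>The two composites of the coherence law. In \<open>jac_path2\<close>, the first summand of \<open>S2\<close> is the
  identity of \<open>[[x * y] * [z * w]]\<close> and the last two of \<open>S3\<close> are the identities of
  \<open>[z * [x * [y * w]]]\<close> and \<open>[z * [y * [x * w]]]\<close>.\<close>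

definition jac_path1 :: "('h, 'u) lie2 \<Rightarrow> 'u \<Rightarrow> 'u \<Rightarrow> 'u \<Rightarrow> 'u \<Rightarrow> ('h, 'u) tens" where
  "jac_path1 G x y z w =
    (let C = lcat G; A = Ar C; T = tens 4 A; J = jac G; b0 = br0 G; b1 = br1 G; i = idn C;
         S1 = plug 4 A 0 (\<lambda>e. b1 e (i w)) (J x y z);
         S2 = plug 4 A 1 (\<lambda>e. J x e w) (b0 y z)
              \<ominus>\<^bsub>T\<^esub> slots A [1, 0, 2, 3] (plug 4 A 1 (\<lambda>e. J y e w) (b0 x z));
         S3 = plug 4 A 1 (\<lambda>e. b1 (i x) e) (J y z w)
              \<ominus>\<^bsub>T\<^esub> slots A [2, 0, 1, 3] (plug 4 A 2 (\<lambda>e. J y z e) (b0 x w))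
              \<ominus>\<^bsub>T\<^esub> slots A [1, 0, 2, 3] (plug 4 A 1 (\<lambda>e. b1 (i y) e) (J x z w))
              \<oplus>\<^bsub>T\<^esub> slots A [0, 2, 1, 3] (plug 4 A 2 (\<lambda>e. J x z e) (b0 y w))
     in cmp (tens_cat 4 C) (S3, cmp (tens_cat 4 C) (S2, S1)))"

definition jac_path2 :: "('h, 'u) lie2 \<Rightarrow> 'u \<Rightarrow> 'u \<Rightarrow> 'u \<Rightarrow> 'u \<Rightarrow> ('h, 'u) tens" where
  "jac_path2 G x y z w =
    (let C = lcat G; O0 = Ob C; A = Ar C; T = tens 4 A; J = jac G; b0 = br0 G; b1 = br1 G; i = idn C;
         i4 = idn (tens_cat 4 C);
         S1 = plug 4 A 0 (\<lambda>e. J e z w) (b0 x y);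
         S2 = i4 (plug 4 O0 0 (\<lambda>e. br_r O0 b0 e z w) (b0 x y))
              \<ominus>\<^bsub>T\<^esub> slots A [1, 2, 0, 3] (plug 4 A 1 (\<lambda>e. b1 (i z) e) (J x y w));
         S3 = plug 4 A 2 (\<lambda>e. J x y e) (b0 z w)
              \<ominus>\<^bsub>T\<^esub> i4 (slots O0 [1, 2, 0, 3] (plug 4 O0 1 (\<lambda>e. b0 z e) (br_r O0 b0 x y w)))
              \<oplus>\<^bsub>T\<^esub> i4 (slots O0 [2, 1, 0, 3] (plug 4 O0 1 (\<lambda>e. b0 z e) (br_r O0 b0 y x w)))
     in cmp (tens_cat 4 C) (S3, cmp (tens_cat 4 C) (S2, S1)))"

definition is_lie2 :: "('h, 'u) lie2 \<Rightarrow> bool" where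
  "is_lie2 G \<longleftrightarrow>
     left_2_module (lcat G) \<and>
     bracket_functor (lcat G) (br0 G) (br1 G) \<and>
     jacobiator (lcat G) (br0 G) (br1 G) (jac G) \<and>
     (\<forall>x\<in>carrier (Ob (lcat G)). \<forall>y\<in>carrier (Ob (lcat G)).
      \<forall>z\<in>carrier (Ob (lcat G)). \<forall>w\<in>carrier (Ob (lcat G)).
        jac_path1 G x y z w = jac_path2 G x y z w)"

definition lie2_hom :: "('h, 'u) lie2 \<Rightarrow> ('h, 'u) lie2 \<Rightarrow> ('h, 'u) mor set" where
  "lie2_hom G G' = {(F0, F1, F2).
    let C = lcat G; C' = lcat G'; O0 = carrier (Ob C); A' = Ar C';
        D2 = tens_cat 2 C'; D3 = tens_cat 3 C'; T3 = tens 3 A' in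
     left_2_module_hom C C' F0 F1 \<and>
     F0 \<in> extensional O0 \<and> F1 \<in> extensional (carrier (Ar C)) \<and>
     polylinear2 (Ob C) (Ob C) A' F2 \<and> F2 \<in> extensional2 O0 \<and>
     (\<forall>x\<in>O0. \<forall>y\<in>O0. iso_arrow_in D2 (F2 x y) (br0 G' (F0 x) (F0 y)) (tmap 2 (Ob C') F0 (br0 G x y))) \<and>
     (\<forall>a\<in>carrier (Ar C). \<forall>b\<in>carrier (Ar C).
        cmp D2 (F2 (tgt C a) (tgt C b), br1 G' (F1 a) (F1 b)) =
        cmp D2 (tmap 2 A' F1 (br1 G a b), F2 (src C a) (src C b))) \<and>
     (\<forall>x\<in>O0. \<forall>y\<in>O0. \<forall>z\<in>O0.
        cmp D3
          (plug 3 A' 1 (\<lambda>e. F2 x e) (br0 G y z)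
             \<ominus>\<^bsub>T3\<^esub> slots A' [1, 0, 2] (plug 3 A' 1 (\<lambda>e. F2 y e) (br0 G x z)),
           cmp D3
            (plug 3 A' 1 (\<lambda>e. br1 G' (idn C' (F0 x)) e) (F2 y z)
               \<ominus>\<^bsub>T3\<^esub> slots A' [1, 0, 2] (plug 3 A' 1 (\<lambda>e. br1 G' (idn C' (F0 y)) e) (F2 x z)),
             jac G' (F0 x) (F0 y) (F0 z))) =
        cmp D3
          (tmap 3 A' F1 (jac G x y z),
           cmp D3
            (plug 3 A' 0 (\<lambda>e. F2 e z) (br0 G x y),
             plug 3 A' 0 (\<lambda>e. br1 G' e (idn C' (F0 z))) (F2 x y))))}"

definition lie2_id :: "('h, 'u) lie2 \<Rightarrow> ('h, 'u) mor" where
  "lie2_id G =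
     (\<lambda>x\<in>carrier (Ob (lcat G)). x, \<lambda>a\<in>carrier (Ar (lcat G)). a,
      \<lambda>x\<in>carrier (Ob (lcat G)). \<lambda>y\<in>carrier (Ob (lcat G)). idn (tens_cat 2 (lcat G)) (br0 G x y))"

definition lie2_comp ::
    "('h, 'u) lie2 \<Rightarrow> ('h, 'u) lie2 \<Rightarrow> ('h, 'u) lie2 \<Rightarrow> ('h, 'u) mor \<Rightarrow> ('h, 'u) mor \<Rightarrow> ('h, 'u) mor" where
  "lie2_comp C C' C'' = (\<lambda>(G0, G1, G2) (F0, F1, F2).
     (\<lambda>x\<in>carrier (Ob (lcat C)). G0 (F0 x), \<lambda>a\<in>carrier (Ar (lcat C)). G1 (F1 a),
      \<lambda>x\<in>carrier (Ob (lcat C)). \<lambda>y\<in>carrier (Ob (lcat C)).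
        cmp (tens_cat 2 (lcat C'')) (tmap 2 (Ar (lcat C'')) G1 (F2 x y), G2 (F0 x) (F0 y))))"

definition Lie2 :: "(('h, 'u) lie2, ('h, 'u) mor) category" where
  "Lie2 = \<lparr>Obj = Collect is_lie2, Hom = lie2_hom, Idt = lie2_id, Cmp = lie2_comp\<rparr>"

end


section \<open>Cocommutative Hopf algebras\<close>

text \<open>Equations with values in \<open>H\<close> are stated in \<open>H\<^sup>\<otimes>\<^sup>1\<close>, whose elements are the classes \<open>pure [h]\<close>.\<close>

locale cocommutative_hopf_algebra = comult_data scale comult + vector_space scale
  for scale :: "'k::field \<Rightarrow> 'h::ring_1 \<Rightarrow> 'h" (infixr \<open>*\<^sub>k\<close> 75)
    and comult :: "'h \<Rightarrow> 'h pow" +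
  fixes counit :: "'h \<Rightarrow> 'k"
    and antipode :: "'h \<Rightarrow> 'h"
  assumes scale_mult_left: "(c *\<^sub>k a) * b = c *\<^sub>k (a * b)"
    and scale_mult_right: "a * (c *\<^sub>k b) = c *\<^sub>k (a * b)"
    and comult_closed: "comult h \<in> pow_carrier 2"
    and comult_add: "comult (g + h) = comult g + comult h"
    and comult_scale: "comult (c *\<^sub>k h) = pow_mult 2 (pure [c *\<^sub>k 1, 1]) (comult h)"
    and comult_mult: "comult (g * h) = pow_mult 2 (comult g) (comult h)"
    and comult_1: "comult 1 = pure [1, 1]"
    and coassoc:
      "lin_extend (pow_rel 3) (\<lambda>as. lin_extend (pow_rel 3) (\<lambda>ds. pure (ds @ [as ! 1])) (comult (as ! 0))) (comult h) =
       lin_extend (pow_rel 3) (\<lambda>as. lin_extend (pow_rel 3) (\<lambda>ds. pure ([as ! 0] @ ds)) (comult (as ! 1))) (comult h)"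
    and counit_linear: "Vector_Spaces.linear scale (*) counit"
    and counit_mult: "counit (g * h) = counit g * counit h"
    and counit_1: "counit 1 = 1"
    and counit_left: "lin_extend (pow_rel 1) (\<lambda>as. pure [counit (as ! 0) *\<^sub>k (as ! 1)]) (comult h) = pure [h]"
    and counit_right: "lin_extend (pow_rel 1) (\<lambda>as. pure [counit (as ! 1) *\<^sub>k (as ! 0)]) (comult h) = pure [h]"
    and antipode_linear: "Vector_Spaces.linear scale scale antipode"
    and antipode_left:
      "lin_extend (pow_rel 1) (\<lambda>as. pure [antipode (as ! 0) * (as ! 1)]) (comult h) = pure [counit h *\<^sub>k 1]"
    and antipode_right:
      "lin_extend (pow_rel 1) (\<lambda>as. pure [(as ! 0) * antipode (as ! 1)]) (comult h) = pure [counit h *\<^sub>k 1]"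
    and cocommutative: "lin_extend (pow_rel 2) (\<lambda>as. pure [as ! 1, as ! 0]) (comult h) = comult h"

end

theory Submission
  imports Defs
begin

text \<open>An arrow \<open>a\<close> of a left-2 module is the sum of the identity of its source and of the element
  \<open>a - 1\<^bsub>s(a)\<^esub>\<close> of \<open>L\<^sub>1 = ker s\<close>, and \<open>g \<circ> f = f + (g - 1\<^bsub>s(g)\<^esub>)\<close>; the same holds in
  \<open>H\<^sup>\<otimes>\<^sup>n \<otimes>\<^sub>H C\<close>. So a bracket functor is determined by its values on objects and by its components
  \<open>L\<^sub>0 \<boxtimes> L\<^sub>1\<close> and \<open>L\<^sub>1 \<boxtimes> L\<^sub>0 \<rightarrow> H\<^sup>\<otimes>\<^sup>2 \<otimes>\<^sub>H L\<^sub>1\<close>, where targets give (i) and the interchange law gives (ii), and a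
  jacobiator is determined by its arrow part \<open>\<beta>\<^sub>3\<close>, where targets give (iii) and naturality gives (iv). Both composites of
  the coherence law have the same source, and equality of their arrow parts is (v). In the same way
  a morphism is determined by \<open>F\<^sub>0\<close>, the restriction of \<open>F\<^sub>1\<close> to \<open>L\<^sub>1\<close> and the arrow part of \<open>F\<^sub>2\<close>.

  This relates the objects of the two categories by splittings. Every object of either category has one, and the
  morphisms between two split objects correspond bijectively, compatibly with identities and
  composition. The equivalence and the category axioms of \<open>Lie2\<close> follow from those of \<open>two_shLie\<close>.

  Identities between iterated brackets are reduced to three properties of \<open>plug\<close>: it is associative, insertions in
  different arguments commute, and it is equivariant under permutations of the arguments. They
  express coassociativity, multiplicativity and cocommutativity of the coproduct.\<close>

section \<open>Cosets\<close>

text \<open>The decomposition of arrows survives tensoring because it consists of linear maps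
  (\<open>src\<close>, \<open>idn\<close>, \<open>\<iota>\<close>, \<open>p\<close>) and equations
  between them, which \<open>tmap n\<close> preserves, being functorial and additive in the map. It
  also evaluates the composition of \<open>tens_cat\<close>, which is defined by a description
  through lifts to composable pairs. The obstacle is that elements are cosets of formal sums and
  that \<open>lin_extend\<close> works with representatives picked by choice. Well-definedness is
  therefore isolated in two predicates on functions of generators, \<open>mlin\<close> for tensor
  powers and \<open>tlin\<close> for tensors with a module. Coproducts are replaced by finite lists
  of words, and identities between additive maps are then checked on generators. Splittings are a
  relation and not a function because the two passages are not inverse to each other on objects: the
  arrows built from \<open>L\<close> are encoded pairs in \<open>'u\<close>, and the kernel of their
  source map is isomorphic to \<open>deg1 L\<close> but need not be equal to it. An object has
  several partners, and the functors pick one.\<close>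

definition subgrp :: "'a::ab_group_add set \<Rightarrow> bool" where
  "subgrp R \<longleftrightarrow> 0 \<in> R \<and> (\<forall>r\<in>R. \<forall>s\<in>R. r - s \<in> R)"

definition is_coset :: "'a::ab_group_add set \<Rightarrow> 'a set \<Rightarrow> bool" where
  "is_coset R X \<longleftrightarrow> (\<exists>x. X = x +o R)"

lemma subgrp_0: "subgrp R \<Longrightarrow> 0 \<in> R"
  and subgrp_diff: "subgrp R \<Longrightarrow> r \<in> R \<Longrightarrow> s \<in> R \<Longrightarrow> r - s \<in> R"
  by (auto simp: subgrp_def)

lemma subgrp_minus: "subgrp R \<Longrightarrow> r \<in> R \<Longrightarrow> - r \<in> R"
  by (metis diff_0 subgrp_def)

lemma subgrp_add: "subgrp R \<Longrightarrow> r \<in> R \<Longrightarrow> s \<in> R \<Longrightarrow> r + s \<in> R"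
  by (metis diff_minus_eq_add subgrp_diff subgrp_minus)

lemma subgrp_plus: assumes "subgrp R" shows "R + R = R"
proof
  show "R + R \<subseteq> R"
    using assms by (auto simp: set_plus_def intro: subgrp_add)
  show "R \<subseteq> R + R"
    by (rule set_zero_plus2) (rule subgrp_0[OF assms])
qed

lemma coset_eq_iff: "subgrp R \<Longrightarrow> x +o R = y +o R \<longleftrightarrow> x - y \<in> R"
proof
  assume R: "subgrp R" and eq: "x +o R = y +o R"
  have "x \<in> x +o R" using set_plus_intro2[OF subgrp_0[OF R], of x] by simp
  then show "x - y \<in> R" unfolding eq by (rule set_plus_imp_minus)
next
  have *: "x +o R \<subseteq> y +o R" if R: "subgrp R" "x - y \<in> R" for x y
  proof
    fix z assume "z \<in> x +o R"
    then have "(z - x) + (x - y) \<in> R" using R by (metis set_plus_imp_minus subgrp_add)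
    then show "z \<in> y +o R" by (intro set_minus_imp_plus) simp
  qed
  assume R: "subgrp R" "x - y \<in> R"
  then have "y - x \<in> R" using subgrp_minus[OF R] by simp
  with R show "x +o R = y +o R" by (intro subset_antisym *)
qed

lemma coset_add: "subgrp R \<Longrightarrow> (x +o R) + (y +o R) = (x + y) +o R"
  by (simp add: set_plus_rearrange subgrp_plus)

lemma coset_eq_self: "subgrp R \<Longrightarrow> r \<in> R \<Longrightarrow> r +o R = R"
  using coset_eq_iff[of R r 0] by simp

lemma coset_mem_eq: "subgrp R \<Longrightarrow> y \<in> x +o R \<Longrightarrow> y +o R = x +o R"
  by (simp add: coset_eq_iff set_plus_imp_minus)

lemma is_coset_elem: "subgrp R \<Longrightarrow> is_coset R X \<Longrightarrow> y \<in> X \<Longrightarrow> X = y +o R"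
  unfolding is_coset_def by (auto dest: coset_mem_eq)

lemma is_coset_nonempty: "subgrp R \<Longrightarrow> is_coset R X \<Longrightarrow> \<exists>y. y \<in> X"
  unfolding is_coset_def using set_plus_intro2 subgrp_0 by blast

lemma is_coset_some: "subgrp R \<Longrightarrow> is_coset R X \<Longrightarrow> X = (SOME y. y \<in> X) +o R"
  by (metis is_coset_elem is_coset_nonempty someI_ex)

lemma is_coset_add [intro]: "subgrp R \<Longrightarrow> is_coset R X \<Longrightarrow> is_coset R Y \<Longrightarrow> is_coset R (X + Y)"
  unfolding is_coset_def using coset_add by blast

lemma is_coset_coset [simp, intro]: "is_coset R (x +o R)"
  by (auto simp: is_coset_def)

lemma is_coset_self: "is_coset R R"
  unfolding is_coset_def by (metis set_zero_plus)

lemma is_coset_add_zero: "subgrp R \<Longrightarrow> is_coset R X \<Longrightarrow> X + R = X" 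
  unfolding is_coset_def using coset_add[of R _ 0] by auto

text \<open>Elementwise addition of sets is not cancellative in general; on the cosets of a fixed
  subgroup it is the addition of the quotient group.\<close>

lemma coset_cancel:
  assumes "subgrp R" "is_coset R X" "is_coset R Y" "is_coset R Z" "X + Z = Y + Z"
  shows "X = Y"
proof -
  obtain x y z where xyz: "X = x +o R" "Y = y +o R" "Z = z +o R"
    using assms by (auto simp: is_coset_def)
  then show ?thesis using assms(1,5) by (simp add: coset_add coset_eq_iff)
qed

lemma sum_list_coset:
  assumes "subgrp R" "l \<noteq> []"
  shows "(\<Sum>g\<leftarrow>l. y g +o R) = sum_list (map y l) +o R"
  using assms(2)
proof (induction l)
  case (Cons a l)
  \<comment> \<open>As a simp rule, \<open>set_zero\<close> rewrites the neutral set
    \<open>0\<close> to \<open>{0}\<close>, where \<open>add_0_right\<close> no longer matches;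
    hence its removal here and in later sums of cosets.\<close>
  then show ?case by (cases "l = []") (simp_all add: coset_add assms del: set_zero)
qed simp

lemma is_coset_sum_list:
  assumes "subgrp R" "l \<noteq> []" "\<And>g. g \<in> set l \<Longrightarrow> is_coset R (f g)"
  shows "is_coset R (sum_list (map f l))"
  using assms(2,3)
proof (induction l)
  case (Cons a l)
  then show ?case by (cases "l = []") (auto simp: assms simp del: set_zero)
qed simp

lemma frag_extend_sum_list: "frag_extend y (sum_list (map frag_of l)) = sum_list (map y l)"
  by (induction l) (simp_all add: frag_extend_add)

text \<open>Signs disappear if every generator in \<open>S\<close> has a partner of opposite class
  modulo \<open>K\<close>: a negative term is replaced by its partner. The generator
  \<open>z\<close> of class zero stands in for the empty sum, so that the list can always be taken
  nonempty.\<close>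

lemma frag_nonneg_representative:
  assumes "subgrp K" "z \<in> S" "frag_of z \<in> K"
    and "\<And>g. g \<in> S \<Longrightarrow> \<exists>g'\<in>S. frag_of g + frag_of g' \<in> K"
    and "Poly_Mapping.keys x \<subseteq> S"
  shows "\<exists>l. l \<noteq> [] \<and> set l \<subseteq> S \<and> x +o K = sum_list (map frag_of l) +o K"
  using assms(5)
proof (induction x rule: frag_induction[where S=S])
  case zero
  show ?case using assms(1-3) by (intro exI[of _ "[z]"]) (simp add: coset_eq_self)
next
  case (one x)
  then show ?case by (intro exI[of _ "[x]"]) auto
next
  case (diff a b)
  then obtain l k where l: "l \<noteq> []" "set l \<subseteq> S" "a +o K = sum_list (map frag_of l) +o K"
    and k: "k \<noteq> []" "set k \<subseteq> S" "b +o K = sum_list (map frag_of k) +o K" by auto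
  obtain n where n: "\<And>g. g \<in> S \<Longrightarrow> n g \<in> S \<and> frag_of g + frag_of (n g) \<in> K"
    using assms(4) by metis
  have neg: "sum_list (map frag_of k) + sum_list (map frag_of (map n k)) \<in> K" using k(2)
  proof (induction k)
    case (Cons g k)
    then have "(frag_of g + frag_of (n g)) +
        (sum_list (map frag_of k) + sum_list (map frag_of (map n k))) \<in> K"
      using n Cons by (intro subgrp_add[OF assms(1), of "frag_of g + frag_of (n g)"]) auto
    then show ?case by (simp add: algebra_simps)
  qed (simp add: subgrp_0 assms)
  have "(a - sum_list (map frag_of l)) - (b - sum_list (map frag_of k))
      - (sum_list (map frag_of k) + sum_list (map frag_of (map n k))) \<in> K"
    using l(3) k(3) neg by (meson subgrp_diff assms(1) coset_eq_iff)
  then have "(a - b) +o K = sum_list (map frag_of (l @ map n k)) +o K"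
    by (simp add: coset_eq_iff assms algebra_simps)
  with l k n show ?case by (intro exI[of _ "l @ map n k"]) auto
qed

text \<open>\<open>resp\<close> says that the additive extension maps \<open>K\<close> into
  \<open>R\<close>. The representative picked by \<open>SOME\<close> differs from \<open>x\<close>
  by an element of \<open>K\<close>, so it may be replaced by \<open>x\<close>.\<close>

lemma lin_extend_coset:
  assumes K: "subgrp K" and R: "subgrp R"
    and resp: "\<And>k. k \<in> K \<Longrightarrow> frag_extend (\<lambda>g. SOME y. y \<in> f g) k \<in> R"
  shows "lin_extend R f (x +o K) = frag_extend (\<lambda>g. SOME y. y \<in> f g) x +o R"
proof -
  have "(SOME x'. x' \<in> x +o K) \<in> x +o K"
    using is_coset_nonempty[OF K] by (intro someI_ex[of "\<lambda>x'. x' \<in> x +o K"]) auto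
  then have "(SOME x'. x' \<in> x +o K) - x \<in> K" by (rule set_plus_imp_minus)
  from resp[OF this] show ?thesis
    unfolding lin_extend_def by (simp add: coset_eq_iff R frag_extend_diff)
qed

lemma lin_extend_sum_list:
  assumes K: "subgrp K" and R: "subgrp R"
    and resp: "\<And>k. k \<in> K \<Longrightarrow> frag_extend (\<lambda>g. SOME y. y \<in> f g) k \<in> R"
    and l: "l \<noteq> []" "\<And>g. g \<in> set l \<Longrightarrow> is_coset R (f g)"
  shows "lin_extend R f (\<Sum>g\<leftarrow>l. frag_of g +o K) = sum_list (map f l)"
proof -
  have "map f l = map (\<lambda>g. (SOME y. y \<in> f g) +o R) l"
    using l(2) is_coset_some[OF R] by auto
  then show ?thesis
    by (simp only: sum_list_coset[OF K l(1)] sum_list_coset[OF R l(1)]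
        lin_extend_coset[OF K R resp] frag_extend_sum_list)
qed

lemma lin_extend_add:
  assumes K: "subgrp K" and R: "subgrp R"
    and resp: "\<And>k. k \<in> K \<Longrightarrow> frag_extend (\<lambda>g. SOME y. y \<in> f g) k \<in> R"
    and "is_coset K X" "is_coset K Y"
  shows "lin_extend R f (X + Y) = lin_extend R f X + lin_extend R f Y"
proof -
  obtain x y where "X = x +o K" "Y = y +o K" using assms(4,5) by (auto simp: is_coset_def)
  then show ?thesis by (simp add: coset_add K R lin_extend_coset[OF K R resp] frag_extend_add)
qed

lemma sum_list_map_cong: "(\<And>x. x \<in> set l \<Longrightarrow> f x = g x) \<Longrightarrow> sum_list (map f l) = sum_list (map g l)"
  by (metis map_cong)

lemma sum_list_swap:
  fixes f :: "'a \<Rightarrow> 'b \<Rightarrow> 'c::comm_monoid_add"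
  shows "(\<Sum>x\<leftarrow>l. \<Sum>y\<leftarrow>k. f x y) = (\<Sum>y\<leftarrow>k. \<Sum>x\<leftarrow>l. f x y)"
  by (induction l) (simp_all add: sum_list_addf del: set_zero)

section \<open>Sweedler calculus\<close>

text \<open>The effect on words of applying to tensor factor \<open>j\<close> a map with values in a
  tensor power, or of composing polylinear maps: \<open>es\<close> takes the place of the letter
  \<open>w ! j\<close>, and the letters after it move by \<open>length es - 1\<close>.\<close>

definition splice_at :: "nat \<Rightarrow> 'a list \<Rightarrow> 'a list \<Rightarrow> 'a list" where
  "splice_at j w es = take j w @ es @ drop (Suc j) w"

lemma length_splice_at: "j < length w \<Longrightarrow> length (splice_at j w es) = length w - 1 + length es"
  by (simp add: splice_at_def)

lemma splice_at_update_same: "splice_at j (w[j := x]) es = splice_at j w es"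
  by (simp add: splice_at_def)

lemma splice_at_update_less: "i < j \<Longrightarrow> j < length w \<Longrightarrow> splice_at j (w[i := x]) es = (splice_at j w es)[i := x]"
  by (simp add: splice_at_def take_update_swap list_update_append)

lemma splice_at_update_greater:
  "j < i \<Longrightarrow> i < length w \<Longrightarrow> splice_at j (w[i := x]) es = (splice_at j w es)[i - 1 + length es := x]"
  by (auto simp: splice_at_def drop_update_swap list_update_append intro: arg_cong2[where f="list_update _"])

lemma splice_at_update_inner:
  "j < length w \<Longrightarrow> i < length es \<Longrightarrow> splice_at j w (es[i := x]) = (splice_at j w es)[j + i := x]"
  by (simp add: splice_at_def list_update_append)

lemma nth_splice_at_less: "i < j \<Longrightarrow> j < length w \<Longrightarrow> splice_at j w es ! i = w ! i"
  by (simp add: splice_at_def nth_append)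

lemma nth_splice_at_inner: "j < length w \<Longrightarrow> i < length es \<Longrightarrow> splice_at j w es ! (j + i) = es ! i"
  by (simp add: splice_at_def nth_append)

lemma nth_splice_at_greater:
  assumes "j < i" "i < length w" shows "splice_at j w es ! (i - 1 + length es) = w ! i"
proof -
  have "min (length w) j = j" "Suc (j + (i - 1 - j)) = i" using assms by auto
  then show ?thesis using assms by (auto simp: splice_at_def nth_append)
qed

lemma splice_at_nth: "j < length w \<Longrightarrow> splice_at j w [w ! j] = w"
  by (simp add: splice_at_def id_take_nth_drop[symmetric])

section \<open>Multilinear functions of words\<close>

context comult_data
begin

definition scale_at :: "nat \<Rightarrow> 'k \<Rightarrow> 'h list \<Rightarrow> 'h list" where
  "scale_at i c w = w[i := c *\<^sub>k w ! i]"

text \<open>The functions on words that factor through \<open>H\<^sup>\<otimes>\<^sup>n\<close>.\<close>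

definition mlin :: "nat \<Rightarrow> ('b \<Rightarrow>\<^sub>0 int) set \<Rightarrow> ('h list \<Rightarrow> ('b \<Rightarrow>\<^sub>0 int) set) \<Rightarrow> bool" where
  "mlin n R F \<longleftrightarrow> subgrp R \<and> (\<forall>w. length w = n \<longrightarrow> is_coset R (F w)) \<and>
     (\<forall>w i a b. length w = n \<longrightarrow> i < n \<longrightarrow> F (w[i := a + b]) = F (w[i := a]) + F (w[i := b])) \<and>
     (\<forall>w i j c. length w = n \<longrightarrow> i < n \<longrightarrow> j < n \<longrightarrow> F (scale_at i c w) = F (scale_at j c w))"

lemma mlinI:
  assumes "subgrp R" "\<And>w. length w = n \<Longrightarrow> is_coset R (F w)"
    "\<And>w i a b. length w = n \<Longrightarrow> i < n \<Longrightarrow> F (w[i := a + b]) = F (w[i := a]) + F (w[i := b])"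
    "\<And>w i j c. length w = n \<Longrightarrow> i < n \<Longrightarrow> j < n \<Longrightarrow> F (scale_at i c w) = F (scale_at j c w)"
  shows "mlin n R F"
  unfolding mlin_def using assms by blast

lemma mlin_subgrp: "mlin n R F \<Longrightarrow> subgrp R"
  and mlin_coset: "mlin n R F \<Longrightarrow> length w = n \<Longrightarrow> is_coset R (F w)"
  and mlin_add: "mlin n R F \<Longrightarrow> length w = n \<Longrightarrow> i < n \<Longrightarrow> F (w[i := a + b]) = F (w[i := a]) + F (w[i := b])"
  and mlin_scale: "mlin n R F \<Longrightarrow> length w = n \<Longrightarrow> i < n \<Longrightarrow> j < n \<Longrightarrow> F (scale_at i c w) = F (scale_at j c w)"
  unfolding mlin_def by blast+

lemma mlin_cong:
  assumes "\<And>w. length w = n \<Longrightarrow> F w = G w"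
  shows "mlin n R F \<longleftrightarrow> mlin n R G"
  unfolding mlin_def scale_at_def by (simp add: assms)

lemma mlin_zero:
  assumes "mlin n R F" "length w = n" "i < n"
  shows "F (w[i := 0]) = R"
proof -
  have c: "is_coset R (F (w[i := 0]))" and R: "subgrp R"
    using assms by (auto intro: mlin_coset mlin_subgrp)
  have "F (w[i := 0]) + F (w[i := 0]) = R + F (w[i := 0])"
    using mlin_add[OF assms, of 0 0] is_coset_add_zero[OF R c] by (simp add: add.commute)
  then show ?thesis by (rule coset_cancel[OF R c is_coset_self c])
qed

lemma subgrp_pow_rel: "subgrp (pow_rel n)"
  by (simp add: subgrp_def pow_rel.zero pow_rel.diff)

text \<open>The induction follows the generation of \<open>pow_rel n\<close>. Each clause of
  \<open>mlin\<close> disposes of one kind of generator, once the cosets are written with the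
  representatives \<open>y\<close>.\<close>

lemma mlin_respects:
  assumes F: "mlin n R F" and r: "r \<in> pow_rel n"
  shows "frag_extend (\<lambda>g. SOME y. y \<in> F g) r \<in> R"
  using r
proof induction
  note R = mlin_subgrp[OF F]
  define y where "y g = (SOME y. y \<in> F g)" for g
  have y: "F w = y w +o R" if "length w = n" for w
    unfolding y_def by (rule is_coset_some[OF R mlin_coset[OF F that]])
  have y_eq: "(\<lambda>g. SOME y. y \<in> F g) = y" by (simp add: y_def fun_eq_iff)
  {
    case zero show ?case by (simp add: subgrp_0 R)
  next
    case (diff r s) then show ?case by (simp add: frag_extend_diff subgrp_diff R)
  next
    case (additive as bs a b)
    have "F (as @ [a + b] @ bs) = F (as @ [a] @ bs) + F (as @ [b] @ bs)"
      using mlin_add[OF F, of "as @ [a] @ bs" "length as" a b] additive by simp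
    then have "y (as @ [a + b] @ bs) - (y (as @ [a] @ bs) + y (as @ [b] @ bs)) \<in> R"
      using additive by (simp add: y coset_add coset_eq_iff R)
    then show ?case by (simp add: y_eq frag_extend_diff frag_extend_add diff_diff_eq)
  next
    case (balanced as bs cs c a b)
    have "F (as @ [c *\<^sub>k a] @ bs @ [b] @ cs) = F (as @ [a] @ bs @ [c *\<^sub>k b] @ cs)"
      using mlin_scale[OF F, of "as @ [a] @ bs @ [b] @ cs" "length as" "length (as @ [a] @ bs)" c] balanced
      by (simp add: scale_at_def nth_append list_update_append)
    then have "y (as @ [c *\<^sub>k a] @ bs @ [b] @ cs) - y (as @ [a] @ bs @ [c *\<^sub>k b] @ cs) \<in> R"
      using balanced by (simp add: y coset_add coset_eq_iff R)
    then show ?case by (simp add: y_eq frag_extend_diff)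
  }
qed

text \<open>The list is nonempty since an empty sum of cosets would be \<open>{0}\<close> and not the zero coset.\<close>

definition words :: "nat \<Rightarrow> 'h list list \<Rightarrow> bool" where
  "words n l \<longleftrightarrow> l \<noteq> [] \<and> (\<forall>w\<in>set l. length w = n)"

lemma map_pure_words: "words n l \<Longrightarrow> map pure l = map (\<lambda>w. frag_of w +o pow_rel n) l"
  by (auto simp: words_def pure_def)

lemma mlin_extend:
  assumes F: "mlin n R F" and l: "words n l"
  shows "lin_extend R F (sum_list (map pure l)) = sum_list (map F l)"
  unfolding map_pure_words[OF l]
  using l by (intro lin_extend_sum_list[OF subgrp_pow_rel mlin_subgrp[OF F] mlin_respects[OF F]])
    (auto simp: words_def mlin_coset[OF F])

lemma mlin_extend_pure: "mlin n R F \<Longrightarrow> length w = n \<Longrightarrow> lin_extend R F (pure w) = F w"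
  using mlin_extend[of n R F "[w]"] by (simp add: words_def del: set_zero)

text \<open>The universal property of the tensor power in Sweedler form: an identity between sums of
  pure tensors may be applied under any multilinear \<open>F\<close>. The axioms on the coproduct
  enter the later calculations through this rule.\<close>

lemma mlin_sum_eq:
  assumes "mlin n R F" "words n l" "words n k" "sum_list (map pure l) = sum_list (map pure k)"
  shows "sum_list (map F l) = sum_list (map F k)"
  using mlin_extend[OF assms(1,2)] mlin_extend[OF assms(1,3)] assms(4) by simp

lemma mlin_pure: "mlin n (pow_rel n) pure"
proof (rule mlinI[OF subgrp_pow_rel])
  note R = subgrp_pow_rel[of n]
  show "is_coset (pow_rel n) (pure w)" if "length w = n" for w
    using that by (auto simp: pure_def)
  show "pure (w[i := a + b]) = pure (w[i := a]) + pure (w[i := b])" if "length w = n" "i < n" for w i a b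
    using that pow_rel.additive[of "take i w" "drop (Suc i) w" n a b]
    by (simp add: pure_def coset_add coset_eq_iff R upd_conv_take_nth_drop algebra_simps)
  have *: "pure (scale_at i c w) = pure (scale_at j c w)" if "length w = n" "i < j" "j < n" for w i j c
  proof -
    \<comment> \<open>\<open>pow_rel.balanced\<close> relates a scalar at an earlier factor to the
      same scalar at a later one, so the word is cut at the positions \<open>i < j\<close>. The case
      \<open>j < i\<close> follows at the end by symmetry.\<close>
    define as bs cs where "as = take i w" "bs = take (j - Suc i) (drop (Suc i) w)" "cs = drop (Suc j) w"
    have dj: "drop (Suc i) w = bs @ [w ! j] @ cs"
      using that id_take_nth_drop[of "j - Suc i" "drop (Suc i) w"] unfolding as_bs_cs_def by simp
    have w: "w = as @ [w ! i] @ bs @ [w ! j] @ cs"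
      using id_take_nth_drop[of i w] that unfolding dj by (simp add: as_bs_cs_def(1))
    have len: "length as = i" "length bs = j - Suc i" "length cs = n - Suc j"
      using that by (auto simp: as_bs_cs_def)
    have j: "j = length (as @ [w ! i] @ bs)" using len that by simp
    have "scale_at i c w = (as @ [w ! i] @ bs @ [w ! j] @ cs)[i := c *\<^sub>k w ! i]"
      unfolding scale_at_def using w by (rule arg_cong)
    then have 1: "scale_at i c w = as @ [c *\<^sub>k w ! i] @ bs @ [w ! j] @ cs"
      using len by (simp add: list_update_append)
    have "scale_at j c w = ((as @ [w ! i] @ bs) @ [w ! j] @ cs)[j := c *\<^sub>k w ! j]"
      unfolding scale_at_def using w by (intro arg_cong[where f="\<lambda>v. v[j := c *\<^sub>k w ! j]"]) simp
    also have "\<dots> = (as @ [w ! i] @ bs) @ [c *\<^sub>k w ! j] @ cs"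
      by (subst j) (simp add: list_update_append del: append_assoc)
    finally have 2: "scale_at j c w = as @ [w ! i] @ bs @ [c *\<^sub>k w ! j] @ cs" by simp
    have n: "length as + length bs + length cs + 2 = n" using len that by simp
    then have l: "length (as @ [x] @ bs @ [y] @ cs) = n" for x y by simp
    show ?thesis unfolding pure_def 1 2 l coset_eq_iff[OF R] by (rule pow_rel.balanced[OF n])
  qed
  show "pure (scale_at i c w) = pure (scale_at j c w)" if "length w = n" "i < n" "j < n" for w i j c
    using that *[of w i j c] *[of w j i c] by (metis linorder_neqE_nat)
qed

text \<open>Negating the first letter negates the class of a word, and setting it to 0 gives the
  zero class; this is what \<open>frag_nonneg_representative\<close> asks for. A first letter exists
  because \<open>n \<ge> 1\<close>.\<close>

lemma pow_carrier_words:
  assumes "X \<in> pow_carrier n" "n \<ge> 1"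
  shows "\<exists>l. words n l \<and> X = sum_list (map pure l)"
proof -
  let ?S = "{w :: 'h list. length w = n}"
  obtain x where x: "X = x +o pow_rel n" "Poly_Mapping.keys x \<subseteq> ?S"
    using assms by (auto simp: pow_carrier_def)
  have z: "frag_of (w[0 := 0]) \<in> pow_rel n" if "length w = n" for w :: "'h list"
    using mlin_zero[OF mlin_pure that, of 0] assms(2) that
      coset_eq_iff[OF subgrp_pow_rel, of "frag_of (w[0 := 0])" n 0]
    by (simp add: pure_def)
  have "\<exists>l. l \<noteq> [] \<and> set l \<subseteq> ?S \<and> x +o pow_rel n = sum_list (map frag_of l) +o pow_rel n"
  proof (rule frag_nonneg_representative[OF subgrp_pow_rel _ z])
    show "length (replicate n (0::'h)) = n" "(replicate n 0)[0 := 0] \<in> ?S" by auto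
    fix w :: "'h list" assume "w \<in> ?S"
    then have w: "length w = n" by simp
    then have "pow_rel n = pure w + pure (w[0 := - w ! 0])"
      using mlin_add[OF mlin_pure w, of 0 "w ! 0" "- w ! 0"] mlin_zero[OF mlin_pure w, of 0] assms(2) by simp
    then have "0 +o pow_rel n = (frag_of w + frag_of (w[0 := - w ! 0])) +o pow_rel n"
      using w by (simp add: pure_def coset_add subgrp_pow_rel)
    then have "0 - (frag_of w + frag_of (w[0 := - w ! 0])) \<in> pow_rel n"
      using coset_eq_iff[OF subgrp_pow_rel] by blast
    from subgrp_minus[OF subgrp_pow_rel this]
    have "frag_of w + frag_of (w[0 := - w ! 0]) \<in> pow_rel n" by (simp only: minus_diff_eq diff_0_right)
    moreover have "w[0 := - w ! 0] \<in> ?S" using w by simp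
    ultimately show "\<exists>g'\<in>?S. frag_of w + frag_of g' \<in> pow_rel n" by blast
  qed (use x in auto)
  then obtain l where l: "words n l" "X = sum_list (map frag_of l) +o pow_rel n"
    unfolding x(1) words_def by auto
  have "sum_list (map pure l) = sum_list (map frag_of l) +o pow_rel n"
    unfolding map_pure_words[OF l(1)]
    using l(1) by (intro sum_list_coset[OF subgrp_pow_rel]) (simp add: words_def)
  with l show ?thesis by auto
qed

text \<open>A family of formal sums \<open>D h\<close> of words that represents a linear map \<open>H \<rightarrow> H\<^sup>\<otimes>\<^sup>l\<close>.\<close>

definition lin_family :: "nat \<Rightarrow> ('h \<Rightarrow> 'h list list) \<Rightarrow> bool" where
  "lin_family l D \<longleftrightarrow> l \<ge> 1 \<and> (\<forall>h. words l (D h)) \<and>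
     (\<forall>a b. sum_list (map pure (D (a + b))) = sum_list (map pure (D a @ D b))) \<and>
     (\<forall>c a. sum_list (map pure (D (c *\<^sub>k a))) = sum_list (map pure (map (scale_at 0 c) (D a))))"

lemma words_append: "words n l \<Longrightarrow> words n k \<Longrightarrow> words n (l @ k)"
  by (auto simp: words_def)

lemma words_map: "words n l \<Longrightarrow> (\<And>w. length w = n \<Longrightarrow> length (f w) = m) \<Longrightarrow> words m (map f l)"
  by (auto simp: words_def)

lemma words_concat_map:
  "words n l \<Longrightarrow> (\<And>w. length w = n \<Longrightarrow> words m (f w)) \<Longrightarrow> words m (concat (map f l))"
  by (cases l) (auto simp: words_def)

lemma length_scale_at [simp]: "length (scale_at i c w) = length w"
  by (simp add: scale_at_def)

lemma lin_family_words: "lin_family l D \<Longrightarrow> words l (D h)"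
  by (simp add: lin_family_def)

lemma lin_family_length: "lin_family l D \<Longrightarrow> w \<in> set (D h) \<Longrightarrow> length w = l"
  by (simp add: lin_family_def words_def)

lemma lin_family_add:
  assumes "lin_family l D" "mlin l R F"
  shows "sum_list (map F (D (a + b))) = sum_list (map F (D a)) + sum_list (map F (D b))"
proof -
  have "sum_list (map F (D (a + b))) = sum_list (map F (D a @ D b))"
    using assms by (intro mlin_sum_eq[OF assms(2)]) (auto simp: lin_family_def intro: words_append)
  then show ?thesis by (simp del: set_zero)
qed

lemma lin_family_scale:
  assumes "lin_family l D" "mlin l R F" "q < l"
  shows "sum_list (map F (D (c *\<^sub>k a))) = (\<Sum>w\<leftarrow>D a. F (scale_at q c w))"
proof -
  have "sum_list (map F (D (c *\<^sub>k a))) = sum_list (map F (map (scale_at 0 c) (D a)))"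
    using assms by (intro mlin_sum_eq[OF assms(2)]) (auto simp: lin_family_def intro: words_map)
  also have "\<dots> = (\<Sum>w\<leftarrow>D a. F (scale_at q c w))"
    unfolding map_map o_def using assms(3) lin_family_length[OF assms(1)]
    by (intro sum_list_map_cong mlin_scale[OF assms(2)]) auto
  finally show ?thesis .
qed

text \<open>The equation \<open>N + 1 = n + l\<close> counts letters: one of the \<open>n\<close>
  letters is traded for \<open>l\<close> new ones.\<close>

lemma mlin_splice_inner:
  assumes G: "mlin N R G" and w: "length w = n" "j < n" and N: "N + 1 = n + l"
  shows "mlin l R (\<lambda>es. G (splice_at j w es))"
proof (rule mlinI[OF mlin_subgrp[OF G]])
  have len: "length (splice_at j w es) = N" if "length es = l" for es
    using that w N by (simp add: length_splice_at)
  show "is_coset R (G (splice_at j w es))" if "length es = l" for es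
    by (rule mlin_coset[OF G len[OF that]])
  show "G (splice_at j w (es[i := a + b])) = G (splice_at j w (es[i := a])) + G (splice_at j w (es[i := b]))"
    if "length es = l" "i < l" for es i a b
    using that w N by (simp add: splice_at_update_inner mlin_add[OF G len])
  have sc: "splice_at j w (scale_at i c es) = scale_at (j + i) c (splice_at j w es)"
    if "length es = l" "i < l" for es i c
    using that w by (simp add: scale_at_def splice_at_update_inner nth_splice_at_inner)
  show "G (splice_at j w (scale_at i c es)) = G (splice_at j w (scale_at i' c es))"
    if "length es = l" "i < l" "i' < l" for es i i' c
    using that w N by (simp add: sc mlin_scale[OF G len, of _ "j + i" "j + i'"])
qed

text \<open>A linear family applied to factor \<open>j\<close> gives a well-defined map on the
  tensor power. A change of letter \<open>j\<close> passes through \<open>D\<close> by linearity of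
  the family, a change of another letter passes through \<open>G\<close> at its shifted
  position.\<close>

lemma mlin_splice:
  assumes D: "lin_family l D" and G: "mlin N R G" and j: "j < n" and N: "N + 1 = n + l"
  shows "mlin n R (\<lambda>w. (\<Sum>es\<leftarrow>D (w ! j). G (splice_at j w es)))"
proof (rule mlinI[OF mlin_subgrp[OF G]])
  have len: "length (splice_at j w es) = N" if "length w = n" "es \<in> set (D h)" for w es h
    using that j N lin_family_length[OF D that(2)] by (simp add: length_splice_at)
  show "is_coset R (\<Sum>es\<leftarrow>D (w ! j). G (splice_at j w es))" if "length w = n" for w
    using lin_family_words[OF D, of "w ! j"] len[OF that] mlin_coset[OF G]
    by (intro is_coset_sum_list[OF mlin_subgrp[OF G]]) (auto simp: words_def)
  show "(\<Sum>es\<leftarrow>D (w[i := a + b] ! j). G (splice_at j (w[i := a + b]) es)) =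
        (\<Sum>es\<leftarrow>D (w[i := a] ! j). G (splice_at j (w[i := a]) es)) +
        (\<Sum>es\<leftarrow>D (w[i := b] ! j). G (splice_at j (w[i := b]) es))"
    if w: "length w = n" "i < n" for w i a b
  proof (cases i j rule: linorder_cases)
    case equal
    then show ?thesis using w j
      by (simp add: splice_at_update_same lin_family_add[OF D mlin_splice_inner[OF G w(1) j N]])
  next
    case less
    then show ?thesis using w j N
      by (auto simp: splice_at_update_less sum_list_addf[symmetric] mlin_add[OF G len] intro!: sum_list_map_cong)
  next
    case greater
    have "i - 1 + length es < N" if "es \<in> set (D h)" for es h
      using w greater N lin_family_length[OF D that] by simp
    with greater show ?thesis using w j
      by (auto simp: splice_at_update_greater sum_list_addf[symmetric] mlin_add[OF G len] intro!: sum_list_map_cong)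
  qed
  \<comment> \<open>Every scalar is compared with one at position 0 of the spliced word, to which
    \<open>mlin_scale\<close> moves it. For \<open>i = j\<close> it first has to pass through
    \<open>D\<close>.\<close>
  have *: "(\<Sum>es\<leftarrow>D (scale_at i c w ! j). G (splice_at j (scale_at i c w) es)) =
      (\<Sum>es\<leftarrow>D (w ! j). G (scale_at 0 c (splice_at j w es)))"
    if w: "length w = n" "i < n" for w i c
  proof -
    have l: "l \<ge> 1" using D by (simp add: lin_family_def)
    have 0: "G (scale_at q c (splice_at j w es)) = G (scale_at 0 c (splice_at j w es))"
      if "q < N" "es \<in> set (D h)" for q es h
      using that by (intro mlin_scale[OF G len[OF w(1)]]) auto
    show ?thesis
    proof (cases i j rule: linorder_cases)
      case equal
      have "splice_at j w (scale_at 0 c es) = scale_at j c (splice_at j w es)" if "es \<in> set (D h)" for es h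
        using w j l lin_family_length[OF D that] nth_splice_at_inner[of j w 0 es]
        by (simp add: scale_at_def splice_at_update_inner)
      then show ?thesis using w j l equal N 0[of j]
        by (auto simp: scale_at_def[of j c w] splice_at_update_same
            lin_family_scale[OF D mlin_splice_inner[OF G w(1) j N], of 0] intro!: sum_list_map_cong)
    next
      case less
      then have "splice_at j (scale_at i c w) es = scale_at i c (splice_at j w es)" for es
        using w j by (simp add: scale_at_def splice_at_update_less nth_splice_at_less)
      with less show ?thesis using w j l N
        by (auto simp: scale_at_def[of i c w] intro!: sum_list_map_cong 0)
    next
      case greater
      then have "splice_at j (scale_at i c w) es = scale_at (i - 1 + length es) c (splice_at j w es)" for es
        using w nth_splice_at_greater[of j i w es] by (simp add: scale_at_def splice_at_update_greater)
      moreover have "i - 1 + length es < N" if "es \<in> set (D h)" for es h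
        using w greater N lin_family_length[OF D that] by simp
      ultimately show ?thesis using w j l N greater
        by (auto simp: scale_at_def[of i c w] intro!: sum_list_map_cong 0)
    qed
  qed
  show "(\<Sum>es\<leftarrow>D (scale_at i c w ! j). G (splice_at j (scale_at i c w) es)) =
      (\<Sum>es\<leftarrow>D (scale_at i' c w ! j). G (splice_at j (scale_at i' c w) es))"
    if "length w = n" "i < n" "i' < n" for w i i' c
    using that by (simp only: *)
qed

end

section \<open>Lists of Sweedler terms\<close>

context cocommutative_hopf_algebra
begin

text \<open>\<open>cop n h\<close> lists the Sweedler terms \<open>[h\<^sub>(\<^sub>1\<^sub>), \<dots>, h\<^sub>(\<^sub>n\<^sub>+\<^sub>1\<^sub>)]\<close> of a representative of
  \<open>iter_comult n h\<close>; signs can be absorbed, \<open>-[h\<^sub>1, \<dots>]\<close> being the class of \<open>[-h\<^sub>1, \<dots>]\<close>.\<close>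

definition cop1 :: "'h \<Rightarrow> 'h list list" where
  "cop1 h = (SOME l. words 2 l \<and> comult h = sum_list (map pure l))"

primrec cop :: "nat \<Rightarrow> 'h \<Rightarrow> 'h list list" where
  "cop 0 h = [[h]]"
| "cop (Suc n) h = concat (map (\<lambda>as. map (splice_at 0 as) (cop1 (as ! 0))) (cop n h))"

lemma cop1: "words 2 (cop1 h)" "comult h = sum_list (map pure (cop1 h))"
  using someI_ex[OF pow_carrier_words[OF comult_closed]] unfolding cop1_def by auto

lemma scale_1_mult: "(c *\<^sub>k 1) * a = c *\<^sub>k a"
  by (simp add: scale_mult_left)

lemma mlin_map2:
  assumes F: "mlin n R F" and "length hs = n"
  shows "mlin n R (\<lambda>w. F (map2 (*) hs w))"
proof (rule mlinI[OF mlin_subgrp[OF F]])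
  have upd: "map2 (*) hs (w[i := x]) = (map2 (*) hs w)[i := hs ! i * x]" if "length w = n" "i < n" for w i x
    using that assms(2) by (auto intro!: nth_equalityI simp: nth_list_update)
  show "is_coset R (F (map2 (*) hs w))" if "length w = n" for w
    using that assms(2) by (intro mlin_coset[OF F]) simp
  show "F (map2 (*) hs (w[i := a + b])) = F (map2 (*) hs (w[i := a])) + F (map2 (*) hs (w[i := b]))"
    if "length w = n" "i < n" for w i a b
    using that assms(2) by (simp add: upd distrib_left mlin_add[OF F])
  have sc: "map2 (*) hs (scale_at i c w) = scale_at i c (map2 (*) hs w)" if "length w = n" "i < n" for w i c
    using that assms(2) by (simp add: scale_at_def upd scale_mult_right)
  show "F (map2 (*) hs (scale_at i c w)) = F (map2 (*) hs (scale_at j c w))"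
    if "length w = n" "i < n" "j < n" for w i j c
    using that assms(2) by (simp add: sc mlin_scale[OF F, of _ i j])
qed

lemma mlin_map2_left:
  assumes F: "mlin n R F" and "length hs = n"
  shows "mlin n R (\<lambda>w. F (map2 (*) w hs))"
proof (rule mlinI[OF mlin_subgrp[OF F]])
  have upd: "map2 (*) (w[i := x]) hs = (map2 (*) w hs)[i := x * hs ! i]" if "length w = n" "i < n" for w i x
    using that assms(2) by (auto intro!: nth_equalityI simp: nth_list_update)
  show "is_coset R (F (map2 (*) w hs))" if "length w = n" for w
    using that assms(2) by (intro mlin_coset[OF F]) simp
  show "F (map2 (*) (w[i := a + b]) hs) = F (map2 (*) (w[i := a]) hs) + F (map2 (*) (w[i := b]) hs)"
    if "length w = n" "i < n" for w i a b
    using that assms(2) by (simp add: upd distrib_right mlin_add[OF F])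
  have sc: "map2 (*) (scale_at i c w) hs = scale_at i c (map2 (*) w hs)" if "length w = n" "i < n" for w i c
    using that assms(2) by (simp add: scale_at_def upd scale_mult_left)
  show "F (map2 (*) (scale_at i c w) hs) = F (map2 (*) (scale_at j c w) hs)"
    if "length w = n" "i < n" "j < n" for w i j c
    using that assms(2) by (simp add: sc mlin_scale[OF F, of _ i j])
qed

lemma mlin_sum:
  assumes "subgrp R" "l \<noteq> []" "\<And>x. x \<in> set l \<Longrightarrow> mlin n R (F x)"
  shows "mlin n R (\<lambda>w. (\<Sum>x\<leftarrow>l. F x w))"
proof (rule mlinI[OF assms(1)])
  show "is_coset R (\<Sum>x\<leftarrow>l. F x w)" if "length w = n" for w
    by (intro is_coset_sum_list[OF assms(1,2)] mlin_coset[OF assms(3)] that)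
  show "(\<Sum>x\<leftarrow>l. F x (w[i := a + b])) =
      (\<Sum>x\<leftarrow>l. F x (w[i := a])) + (\<Sum>x\<leftarrow>l. F x (w[i := b]))"
    if "length w = n" "i < n" for w i a b
    unfolding sum_list_addf[symmetric]
    by (intro sum_list_map_cong mlin_add[OF assms(3)] that)
  show "(\<Sum>x\<leftarrow>l. F x (scale_at i c w)) = (\<Sum>x\<leftarrow>l. F x (scale_at j c w))"
    if "length w = n" "i < n" "j < n" for w i j c
    by (intro sum_list_map_cong mlin_scale[OF assms(3)] that)
qed

lemma pow_mult_words:
  assumes "words n l" "words n k"
  shows "pow_mult n (sum_list (map pure l)) (sum_list (map pure k)) =
    (\<Sum>as\<leftarrow>l. \<Sum>bs\<leftarrow>k. pure (map2 (*) as bs))"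
proof -
  have 1: "lin_extend (pow_rel n) (\<lambda>bs. pure (map2 (*) as bs)) (sum_list (map pure k)) =
      (\<Sum>bs\<leftarrow>k. pure (map2 (*) as bs))" if "length as = n" for as
    by (rule mlin_extend[OF mlin_map2[OF mlin_pure that] assms(2)])
  have "mlin n (pow_rel n) (\<lambda>as. (\<Sum>bs\<leftarrow>k. pure (map2 (*) as bs)))"
    using assms(2) by (intro mlin_sum mlin_map2_left mlin_pure subgrp_pow_rel) (auto simp: words_def)
  then have "mlin n (pow_rel n) (\<lambda>as. lin_extend (pow_rel n) (\<lambda>bs. pure (map2 (*) as bs)) (sum_list (map pure k)))"
    using mlin_cong[of n "\<lambda>as. lin_extend (pow_rel n) (\<lambda>bs. pure (map2 (*) as bs)) (sum_list (map pure k))", OF 1]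
    by blast
  then show ?thesis unfolding pow_mult_def
    using assms(1) by (subst mlin_extend[OF _ assms(1)]) (auto simp: words_def 1 intro!: sum_list_map_cong)
qed

lemma lin_family_cop1: "lin_family 2 cop1"
  unfolding lin_family_def
proof (intro conjI allI)
  show "sum_list (map pure (cop1 (a + b))) = sum_list (map pure (cop1 a @ cop1 b))" for a b
    using comult_add[of a b] by (simp add: cop1(2) del: set_zero)
  show "sum_list (map pure (cop1 (c *\<^sub>k a))) = sum_list (map pure (map (scale_at 0 c) (cop1 a)))" for c a
  proof -
    have "sum_list (map pure (cop1 (c *\<^sub>k a))) = pow_mult 2 (pure [c *\<^sub>k 1, 1]) (sum_list (map pure (cop1 a)))"
      using comult_scale[of c a] by (simp add: cop1(2)[symmetric])
    also have "\<dots> = (\<Sum>bs\<leftarrow>cop1 a. pure (map2 (*) [c *\<^sub>k 1, 1] bs))"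
      using pow_mult_words[OF _ cop1(1), of "[[c *\<^sub>k 1, 1]]" a] by (simp add: words_def del: set_zero)
    also have "\<dots> = (\<Sum>w\<leftarrow>cop1 a. pure (scale_at 0 c w))"
    proof (intro sum_list_map_cong)
      fix w assume "w \<in> set (cop1 a)"
      then have "length w = 2" using cop1(1) by (auto simp: words_def)
      then obtain x y where "w = [x, y]" by (auto simp: numeral_2_eq_2 length_Suc_conv)
      then show "pure (map2 (*) [c *\<^sub>k 1, 1] w) = pure (scale_at 0 c w)"
        by (simp add: scale_at_def scale_1_mult)
    qed
    finally show ?thesis by (simp add: o_def)
  qed
qed (use cop1 in auto)

lemma sum_list_concat_map:
  "sum_list (map F (concat (map f l))) = (\<Sum>x\<leftarrow>l. sum_list (map F (f x)))"
  by (induction l) (simp_all del: set_zero)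

lemma sum_cop_Suc:
  "sum_list (map F (cop (Suc n) h)) =
   (\<Sum>as\<leftarrow>cop n h. \<Sum>ds\<leftarrow>cop1 (as ! 0). F (splice_at 0 as ds))"
  by (simp add: sum_list_concat_map o_def)

lemma words_cop: "words (Suc n) (cop n h)"
proof (induction n)
  case (Suc n)
  then show ?case using cop1(1)
    by (auto intro!: words_concat_map words_map[of 2] simp: length_splice_at)
qed (simp add: words_def)

lemma lin_family_cop: "lin_family (Suc n) (cop n)"
proof (induction n)
  case 0
  show ?case using mlin_add[OF mlin_pure, of "[0]" 1 0]
    by (auto simp: lin_family_def words_def scale_at_def simp del: set_zero)
next
  case (Suc n)
  let ?F = "\<lambda>as. (\<Sum>ds\<leftarrow>cop1 (as ! 0). pure (splice_at 0 as ds))"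
  have F: "mlin (Suc n) (pow_rel (Suc (Suc n))) ?F"
    by (rule mlin_splice[OF lin_family_cop1 mlin_pure]) auto
  show ?case unfolding lin_family_def
  proof (intro conjI allI)
    show "sum_list (map pure (cop (Suc n) (a + b))) = sum_list (map pure (cop (Suc n) a @ cop (Suc n) b))" for a b
      by (simp only: map_append sum_list_append sum_cop_Suc lin_family_add[OF Suc F])
    show "sum_list (map pure (cop (Suc n) (c *\<^sub>k a))) = sum_list (map pure (map (scale_at 0 c) (cop (Suc n) a)))" for c a
    proof -
      have "?F (scale_at 0 c as) = (\<Sum>ds\<leftarrow>cop1 (as ! 0). pure (scale_at 0 c (splice_at 0 as ds)))"
        if "as \<in> set (cop n a)" for as
      proof -
        have as: "length as = Suc n" using that words_cop by (auto simp: words_def)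
        then have "?F (scale_at 0 c as) = (\<Sum>ds\<leftarrow>cop1 (c *\<^sub>k as ! 0). pure (splice_at 0 as ds))"
          by (simp add: scale_at_def splice_at_update_same)
        also have "\<dots> = (\<Sum>ds\<leftarrow>cop1 (as ! 0). pure (splice_at 0 as (scale_at 0 c ds)))"
          using as by (intro lin_family_scale[OF lin_family_cop1 mlin_splice_inner[OF mlin_pure[of "Suc (Suc n)"]]]) auto
        also have "\<dots> = (\<Sum>ds\<leftarrow>cop1 (as ! 0). pure (scale_at 0 c (splice_at 0 as ds)))"
        proof (intro sum_list_map_cong)
          fix ds assume "ds \<in> set (cop1 (as ! 0))"
          then have "length ds = 2" using cop1(1) by (auto simp: words_def)
          then show "pure (splice_at 0 as (scale_at 0 c ds)) = pure (scale_at 0 c (splice_at 0 as ds))"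
            using as nth_splice_at_inner[of 0 as 0 ds] by (simp add: scale_at_def splice_at_update_inner)
        qed
        finally show ?thesis .
      qed
      then have "(\<Sum>as\<leftarrow>cop n a. ?F (scale_at 0 c as)) =
         (\<Sum>as\<leftarrow>cop n a. \<Sum>ds\<leftarrow>cop1 (as ! 0). pure (scale_at 0 c (splice_at 0 as ds)))"
        by (rule sum_list_map_cong)
      then show ?thesis
        by (simp only: sum_cop_Suc lin_family_scale[OF Suc F, of 0] map_map o_def zero_less_Suc)
    qed
  qed (use words_cop[of "Suc n"] in simp_all)
qed

text \<open>Ties the lists back to \<open>iter_comult\<close> of the definitions. Both split the
  first factor at each step, there written with \<open>hd\<close> and \<open>tl\<close>, here as
  \<open>splice_at 0\<close>.\<close>

lemma iter_comult_cop: "iter_comult n h = sum_list (map pure (cop n h))"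
proof (induction n)
  case (Suc n)
  let ?F = "\<lambda>as. (\<Sum>ds\<leftarrow>cop1 (as ! 0). pure (splice_at 0 as ds))"
  let ?G = "\<lambda>as. lin_extend (pow_rel (n + 2)) (\<lambda>ds. pure (ds @ tl as)) (comult (hd as))"
  have F: "mlin (Suc n) (pow_rel (n + 2)) ?F"
    by (rule mlin_splice[OF lin_family_cop1 mlin_pure]) auto
  have FG: "?G as = ?F as" if as: "length as = Suc n" for as
  proof -
    have "mlin 2 (pow_rel (n + 2)) (\<lambda>ds. pure (splice_at 0 as ds))"
      using as by (intro mlin_splice_inner[OF mlin_pure as]) auto
    then have "lin_extend (pow_rel (n + 2)) (\<lambda>ds. pure (splice_at 0 as ds)) (comult (hd as)) =
        (\<Sum>ds\<leftarrow>cop1 (hd as). pure (splice_at 0 as ds))"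
      by (subst cop1(2)) (rule mlin_extend[OF _ cop1(1)])
    moreover have "hd as = as ! 0" using as by (intro hd_conv_nth) auto
    ultimately show ?thesis by (simp add: splice_at_def drop_Suc)
  qed
  then have G: "mlin (Suc n) (pow_rel (n + 2)) ?G" using mlin_cong[of "Suc n" ?G ?F] F by blast
  have "iter_comult (Suc n) h = sum_list (map ?G (cop n h))"
    by (simp only: iter_comult.simps Suc mlin_extend[OF G words_cop])
  also have "\<dots> = sum_list (map ?F (cop n h))"
    using words_cop[of n h] by (intro sum_list_map_cong FG) (auto simp: words_def)
  finally show ?case by (simp only: sum_cop_Suc)
qed simp

section \<open>Multiplicativity and coassociativity in Sweedler form\<close>

lemma sum_cop1_mult:
  assumes F: "mlin 2 R F"
  shows "sum_list (map F (cop1 (g * h))) =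
    (\<Sum>as\<leftarrow>cop1 g. \<Sum>bs\<leftarrow>cop1 h. F (map2 (*) as bs))"
proof -
  let ?k = "concat (map (\<lambda>as. map (map2 (*) as) (cop1 h)) (cop1 g))"
  have "sum_list (map pure (cop1 (g * h))) = sum_list (map pure ?k)"
    using comult_mult[of g h] pow_mult_words[OF cop1(1) cop1(1)]
    by (simp only: cop1(2)[symmetric] sum_list_concat_map map_map o_def)
  moreover have "words 2 ?k"
    using cop1(1) by (auto intro!: words_concat_map words_map[of 2])
  ultimately have "sum_list (map F (cop1 (g * h))) = sum_list (map F ?k)"
    by (intro mlin_sum_eq[OF F cop1(1)])
  then show ?thesis by (simp only: sum_list_concat_map map_map o_def)
qed

lemma length_cop: "w \<in> set (cop n h) \<Longrightarrow> length w = Suc n"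
  and length_cop1: "w \<in> set (cop1 h) \<Longrightarrow> length w = 2"
  using words_cop[of n h] cop1(1)[of h] by (auto simp: words_def)

lemma splice_at_0: "splice_at 0 w es = es @ tl w"
  by (simp add: splice_at_def drop_Suc)

text \<open>Induction on \<open>n\<close>. The leading letter of a product word is the product of
  the leading letters, so its coproduct splits by the binary case; then the sum over the terms of
  \<open>h\<close> is exchanged with the sum over the splittings of the first word.\<close>

lemma sum_cop_mult:
  assumes F: "mlin (Suc n) R F"
  shows "sum_list (map F (cop n (g * h))) =
    (\<Sum>as\<leftarrow>cop n g. \<Sum>bs\<leftarrow>cop n h. F (map2 (*) as bs))"
  using F
proof (induction n arbitrary: F)
  case (Suc n)
  let ?F = "\<lambda>as. (\<Sum>ds\<leftarrow>cop1 (as ! 0). F (splice_at 0 as ds))"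
  have "mlin (Suc n) R ?F"
    by (rule mlin_splice[OF lin_family_cop1 Suc.prems]) auto
  from Suc.IH[OF this]
  have "sum_list (map F (cop (Suc n) (g * h))) =
      (\<Sum>as\<leftarrow>cop n g. \<Sum>bs\<leftarrow>cop n h. ?F (map2 (*) as bs))"
    by (simp only: sum_cop_Suc)
  also have "\<dots> = (\<Sum>as\<leftarrow>cop n g. \<Sum>bs\<leftarrow>cop n h. \<Sum>ds\<leftarrow>cop1 (as ! 0). (\<Sum>es\<leftarrow>cop1 (bs ! 0). F (map2 (*) (splice_at 0 as ds) (splice_at 0 bs es))))"
  proof (intro sum_list_map_cong)
    fix as bs assume "as \<in> set (cop n g)" "bs \<in> set (cop n h)"
    then have l: "length as = Suc n" "length bs = Suc n" by (auto dest: length_cop)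
    have "mlin 2 R (\<lambda>es. F (splice_at 0 (map2 (*) as bs) es))"
      using l by (intro mlin_splice_inner[OF Suc.prems, of _ "Suc n"]) auto
    from sum_cop1_mult[OF this, of "as ! 0" "bs ! 0"]
    have "?F (map2 (*) as bs) = (\<Sum>ds\<leftarrow>cop1 (as ! 0). (\<Sum>es\<leftarrow>cop1 (bs ! 0). F (splice_at 0 (map2 (*) as bs) (map2 (*) ds es))))"
      using l by simp
    also have "\<dots> = (\<Sum>ds\<leftarrow>cop1 (as ! 0). (\<Sum>es\<leftarrow>cop1 (bs ! 0). F (map2 (*) (splice_at 0 as ds) (splice_at 0 bs es))))"
    proof (intro sum_list_map_cong arg_cong[where f=F])
      fix ds es assume "ds \<in> set (cop1 (as ! 0))" "es \<in> set (cop1 (bs ! 0))"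
      then have "length ds = length es" by (metis length_cop1)
      then show "splice_at 0 (map2 (*) as bs) (map2 (*) ds es) = map2 (*) (splice_at 0 as ds) (splice_at 0 bs es)"
        using l by (cases as; cases bs) (auto simp: splice_at_0)
    qed
    finally show "?F (map2 (*) as bs) = (\<Sum>ds\<leftarrow>cop1 (as ! 0). (\<Sum>es\<leftarrow>cop1 (bs ! 0). F (map2 (*) (splice_at 0 as ds) (splice_at 0 bs es))))" .
  qed
  also have "\<dots> = (\<Sum>as\<leftarrow>cop n g. \<Sum>ds\<leftarrow>cop1 (as ! 0). \<Sum>bs\<leftarrow>cop n h. (\<Sum>es\<leftarrow>cop1 (bs ! 0). F (map2 (*) (splice_at 0 as ds) (splice_at 0 bs es))))"
    by (intro sum_list_map_cong sum_list_swap)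
  finally show ?case by (simp only: sum_cop_Suc)
qed (simp del: set_zero)

lemma sum_cop1_coassoc:
  assumes F: "mlin 3 R F"
  shows "(\<Sum>ds\<leftarrow>cop1 h. \<Sum>es\<leftarrow>cop1 (ds ! 1). F (splice_at 1 ds es)) =
    (\<Sum>ds\<leftarrow>cop1 h. \<Sum>es\<leftarrow>cop1 (ds ! 0). F (splice_at 0 ds es))"
proof -
  have w3: "words 3 (concat (map (\<lambda>ds. map (splice_at j ds) (cop1 (ds ! j))) (cop1 h)))" if "j < 2" for j
    using that cop1(1) by (auto intro!: words_concat_map words_map[of 2] simp: length_splice_at)
  \<comment> \<open>The common form of the two sides of \<open>coassoc\<close>: \<open>j\<close> is
    the factor to which the second coproduct is applied, and \<open>g\<close> abstracts from the way
    the axiom writes the resulting word.\<close>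
  have main: "lin_extend (pow_rel 3) (\<lambda>as. lin_extend (pow_rel 3) (g as) (comult (as ! j))) (comult h) =
      sum_list (map pure (concat (map (\<lambda>ds. map (splice_at j ds) (cop1 (ds ! j))) (cop1 h))))"
    if j: "j < 2" and g: "\<And>as ds. length as = 2 \<Longrightarrow> length ds = 2 \<Longrightarrow> g as ds = pure (splice_at j as ds)" for j g
  proof -
    have 1: "lin_extend (pow_rel 3) (g as) (comult (as ! j)) =
        (\<Sum>es\<leftarrow>cop1 (as ! j). pure (splice_at j as es))" if "length as = 2" for as
    proof -
      have "mlin 2 (pow_rel 3) (\<lambda>es. pure (splice_at j as es))"
        using that j by (intro mlin_splice_inner[OF mlin_pure that]) auto
      then have "mlin 2 (pow_rel 3) (g as)"
        using mlin_cong[of 2 "g as" "\<lambda>es. pure (splice_at j as es)"] g that by blast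
      then have "lin_extend (pow_rel 3) (g as) (comult (as ! j)) = sum_list (map (g as) (cop1 (as ! j)))"
        by (subst cop1(2)) (rule mlin_extend[OF _ cop1(1)])
      also have "\<dots> = (\<Sum>es\<leftarrow>cop1 (as ! j). pure (splice_at j as es))"
        by (intro sum_list_map_cong g that length_cop1)
      finally show ?thesis .
    qed
    have "mlin 2 (pow_rel 3) (\<lambda>as. (\<Sum>es\<leftarrow>cop1 (as ! j). pure (splice_at j as es)))"
      using j by (intro mlin_splice[OF lin_family_cop1 mlin_pure]) auto
    then have "mlin 2 (pow_rel 3) (\<lambda>as. lin_extend (pow_rel 3) (g as) (comult (as ! j)))"
      using mlin_cong[of 2 "\<lambda>as. lin_extend (pow_rel 3) (g as) (comult (as ! j))", OF 1] by blast
    then have "lin_extend (pow_rel 3) (\<lambda>as. lin_extend (pow_rel 3) (g as) (comult (as ! j))) (comult h) =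
        (\<Sum>as\<leftarrow>cop1 h. lin_extend (pow_rel 3) (g as) (comult (as ! j)))"
      by (subst (2) cop1(2)) (rule mlin_extend[OF _ cop1(1)])
    also have "\<dots> = (\<Sum>as\<leftarrow>cop1 h. \<Sum>es\<leftarrow>cop1 (as ! j). pure (splice_at j as es))"
      by (intro sum_list_map_cong 1 length_cop1)
    finally show ?thesis by (simp only: sum_list_concat_map map_map o_def)
  qed
  have 0: "pure (ds @ [as ! 1]) = pure (splice_at 0 as ds)" "pure ([as ! 0] @ ds) = pure (splice_at 1 as ds)"
    if "length as = 2" for as ds :: "'h list"
    using that by (auto simp: splice_at_def numeral_2_eq_2 length_Suc_conv)
  let ?S = "\<lambda>j. sum_list (map pure (concat (map (\<lambda>ds. map (splice_at j ds) (cop1 (ds ! j))) (cop1 h))))"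
  have m0: "lin_extend (pow_rel 3) (\<lambda>as. lin_extend (pow_rel 3) (\<lambda>ds. pure (ds @ [as ! 1])) (comult (as ! 0))) (comult h) = ?S 0"
    by (rule main[OF _ 0(1)]) simp
  have m1: "lin_extend (pow_rel 3) (\<lambda>as. lin_extend (pow_rel 3) (\<lambda>ds. pure ([as ! 0] @ ds)) (comult (as ! 1))) (comult h) = ?S 1"
    by (rule main[OF _ 0(2)]) simp
  have "?S 1 = ?S 0"
    by (rule trans[OF m1[symmetric] trans[OF coassoc[symmetric] m0]])
  then have "sum_list (map F (concat (map (\<lambda>ds. map (splice_at 1 ds) (cop1 (ds ! 1))) (cop1 h)))) =
        sum_list (map F (concat (map (\<lambda>ds. map (splice_at 0 ds) (cop1 (ds ! 0))) (cop1 h))))"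
    by (intro mlin_sum_eq[OF F w3 w3]) auto
  then show ?thesis by (simp only: sum_list_concat_map map_map o_def)
qed

text \<open>\<open>cop\<close> always splits the first factor; here any factor \<open>j\<close> may
  be split instead. For \<open>j = 0\<close> this is the definition and for \<open>j = 1\<close> it
  is coassociativity of the last splitting. For \<open>j \<ge> 2\<close> the splitting of factor
  \<open>j\<close> commutes with that of the first factor, which lowers both \<open>n\<close> and
  \<open>j\<close> by one.\<close>

lemma sum_cop_coassoc1:
  assumes F: "mlin (Suc (Suc n)) R F" and j: "j \<le> n"
  shows "(\<Sum>as\<leftarrow>cop n h. \<Sum>es\<leftarrow>cop1 (as ! j). F (splice_at j as es)) =
    sum_list (map F (cop (Suc n) h))"
  using F j
proof (induction n arbitrary: F j)
  case 0
  then show ?case by (simp only: sum_cop_Suc le_zero_eq)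
next
  case (Suc n)
  consider "j = 0" | "j = 1" | i where "j = Suc i" "i \<ge> 1" "i \<le> n"
    using Suc.prems(2) by (cases j; cases "j - 1") auto
  then show ?case
  proof cases
    case 1
    then show ?thesis by (simp only: sum_cop_Suc)
  next
    case 2
    have "(\<Sum>as\<leftarrow>cop (Suc n) h. \<Sum>es\<leftarrow>cop1 (as ! 1). F (splice_at 1 as es)) =
      (\<Sum>as\<leftarrow>cop n h. \<Sum>ds\<leftarrow>cop1 (as ! 0). \<Sum>es\<leftarrow>cop1 (splice_at 0 as ds ! 1). F (splice_at 1 (splice_at 0 as ds) es))"
      by (rule sum_cop_Suc)
    also have "\<dots> = (\<Sum>as\<leftarrow>cop n h. \<Sum>ds\<leftarrow>cop1 (as ! 0). \<Sum>es\<leftarrow>cop1 (splice_at 0 as ds ! 0). F (splice_at 0 (splice_at 0 as ds) es))"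
    proof (rule sum_list_map_cong)
      fix as assume "as \<in> set (cop n h)"
      then have as: "length as = Suc n" by (rule length_cop)
      have m: "mlin 3 R (\<lambda>es. F (splice_at 0 as es))"
        using as by (intro mlin_splice_inner[OF Suc.prems(1) as]) auto
      have l: "splice_at 1 (splice_at 0 as ds) es = splice_at 0 as (splice_at 1 ds es)"
        "splice_at 0 (splice_at 0 as ds) es = splice_at 0 as (splice_at 0 ds es)"
        "splice_at 0 as ds ! 1 = ds ! 1" "splice_at 0 as ds ! 0 = ds ! 0" if "ds \<in> set (cop1 (as ! 0))" for ds es
        using length_cop1[OF that] as
        by (auto simp: splice_at_def nth_append numeral_2_eq_2 length_Suc_conv)
      show "(\<Sum>ds\<leftarrow>cop1 (as ! 0). \<Sum>es\<leftarrow>cop1 (splice_at 0 as ds ! 1). F (splice_at 1 (splice_at 0 as ds) es)) =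
        (\<Sum>ds\<leftarrow>cop1 (as ! 0). \<Sum>es\<leftarrow>cop1 (splice_at 0 as ds ! 0). F (splice_at 0 (splice_at 0 as ds) es))"
        using sum_cop1_coassoc[OF m, of "as ! 0"] by (simp add: l del: One_nat_def cong: map_cong)
    qed
    also have "\<dots> = sum_list (map F (cop (Suc (Suc n)) h))"
      by (simp only: sum_cop_Suc)
    finally show ?thesis by (simp only: 2)
  next
    case 3
    have "(\<Sum>as\<leftarrow>cop (Suc n) h. \<Sum>es\<leftarrow>cop1 (as ! j). F (splice_at j as es)) =
      (\<Sum>as\<leftarrow>cop n h. \<Sum>ds\<leftarrow>cop1 (as ! 0). \<Sum>es\<leftarrow>cop1 (splice_at 0 as ds ! j). F (splice_at j (splice_at 0 as ds) es))"
      by (rule sum_cop_Suc)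
    \<comment> \<open>Position 0 of \<open>splice_at i as es\<close> does not depend on
      \<open>es\<close>, because \<open>i \<ge> 1\<close>. The free \<open>es\<close> is a dummy;
      the next step sets it to \<open>[]\<close> and exchanges the two sums.\<close>
    also have "\<dots> = (\<Sum>as\<leftarrow>cop n h. \<Sum>ds\<leftarrow>cop1 (splice_at i as es ! 0). \<Sum>es\<leftarrow>cop1 (as ! i). F (splice_at 0 (splice_at i as es) ds))" for es
    proof (intro sum_list_map_cong)
      fix as assume "as \<in> set (cop n h)"
      then have as: "length as = Suc n" by (rule length_cop)
      have l: "splice_at j (splice_at 0 as ds) es = splice_at 0 (splice_at i as es) ds"
        "splice_at 0 as ds ! j = as ! i" if "ds \<in> set (cop1 (as ! 0))" for ds es
      proof -
        from that obtain d1 d2 where "ds = [d1, d2]"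
          by (auto dest!: length_cop1 simp: numeral_2_eq_2 length_Suc_conv)
        moreover obtain a as' where "as = a # as'" using as by (cases as) auto
        moreover obtain i' where "i = Suc i'" using 3 by (cases i) auto
        ultimately show "splice_at j (splice_at 0 as ds) es = splice_at 0 (splice_at i as es) ds"
          "splice_at 0 as ds ! j = as ! i"
          using 3 as by (auto simp: splice_at_def)
      qed
      have z: "splice_at i as es ! 0 = as ! 0" using 3 as by (intro nth_splice_at_less) auto
      show "(\<Sum>ds\<leftarrow>cop1 (as ! 0). \<Sum>es\<leftarrow>cop1 (splice_at 0 as ds ! j). F (splice_at j (splice_at 0 as ds) es)) =
        (\<Sum>ds\<leftarrow>cop1 (splice_at i as es ! 0). \<Sum>es\<leftarrow>cop1 (as ! i). F (splice_at 0 (splice_at i as es) ds))"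
        by (simp add: l z cong: map_cong)
    qed
    also have "\<dots> [] = (\<Sum>as\<leftarrow>cop n h. \<Sum>es\<leftarrow>cop1 (as ! i). \<Sum>ds\<leftarrow>cop1 (splice_at i as es ! 0). F (splice_at 0 (splice_at i as es) ds))"
    proof (intro sum_list_map_cong)
      fix as assume "as \<in> set (cop n h)"
      then have as: "length as = Suc n" by (rule length_cop)
      have z: "splice_at i as es ! 0 = as ! 0" for es using 3 as by (intro nth_splice_at_less) auto
      show "(\<Sum>ds\<leftarrow>cop1 (splice_at i as [] ! 0). \<Sum>es\<leftarrow>cop1 (as ! i). F (splice_at 0 (splice_at i as es) ds)) =
        (\<Sum>es\<leftarrow>cop1 (as ! i). \<Sum>ds\<leftarrow>cop1 (splice_at i as es ! 0). F (splice_at 0 (splice_at i as es) ds))"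
        unfolding z by (rule sum_list_swap)
    qed
    also have "\<dots> = (\<Sum>as\<leftarrow>cop (Suc n) h. \<Sum>ds\<leftarrow>cop1 (as ! 0). F (splice_at 0 as ds))"
      using 3 by (intro Suc.IH mlin_splice[OF lin_family_cop1 Suc.prems(1)]) auto
    finally show ?thesis by (simp only: sum_cop_Suc)
  qed
qed

lemma splice_at_splice_at:
  assumes "j < length as" "i < length es"
  shows "splice_at j as (splice_at i es ds) = splice_at (j + i) (splice_at j as es) ds"
  using assms by (simp add: splice_at_def)

text \<open>Induction on \<open>l\<close>: among the letters that replace factor \<open>j\<close>,
  the first one, which again stands at position \<open>j\<close>, is split once more. This is a case
  of \<open>sum_cop_coassoc1\<close>.\<close>

lemma sum_cop_coassoc:
  assumes F: "mlin (Suc (n + l)) R F" and j: "j \<le> n"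
  shows "(\<Sum>as\<leftarrow>cop n h. \<Sum>es\<leftarrow>cop l (as ! j). F (splice_at j as es)) =
    sum_list (map F (cop (n + l) h))"
  using F
proof (induction l arbitrary: F)
  case 0
  have "F (splice_at j as [as ! j]) = F as" if "as \<in> set (cop n h)" for as
    using length_cop[OF that] j by (simp add: splice_at_nth)
  then show ?case by (simp del: set_zero cong: map_cong)
next
  case (Suc l)
  let ?F = "\<lambda>w. (\<Sum>ds\<leftarrow>cop1 (w ! j). F (splice_at j w ds))"
  have F: "mlin (Suc (n + l)) R ?F"
    using j Suc.prems by (intro mlin_splice[OF lin_family_cop1 Suc.prems]) auto
  have "(\<Sum>as\<leftarrow>cop n h. \<Sum>es\<leftarrow>cop (Suc l) (as ! j). F (splice_at j as es)) =
      (\<Sum>as\<leftarrow>cop n h. \<Sum>es\<leftarrow>cop l (as ! j). ?F (splice_at j as es))"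
  proof (unfold sum_cop_Suc, intro sum_list_map_cong)
    fix as es assume "as \<in> set (cop n h)" "es \<in> set (cop l (as ! j))"
    then have l: "length as = Suc n" "length es = Suc l" by (auto dest: length_cop)
    have "splice_at j as es ! (j + 0) = es ! 0"
      using l j by (intro nth_splice_at_inner) auto
    moreover have "splice_at j as (splice_at 0 es ds) = splice_at (j + 0) (splice_at j as es) ds" for ds
      using l j by (intro splice_at_splice_at) auto
    ultimately show "(\<Sum>ds\<leftarrow>cop1 (es ! 0). F (splice_at j as (splice_at 0 es ds))) = ?F (splice_at j as es)"
      by (simp del: set_zero)
  qed
  also have "\<dots> = sum_list (map ?F (cop (n + l) h))" by (rule Suc.IH[OF F])
  also have "\<dots> = sum_list (map F (cop (n + Suc l) h))"
    using sum_cop_coassoc1[of "n + l" R F j h] Suc.prems j by simp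
  finally show ?case .
qed

section \<open>Cocommutativity and permutations of Sweedler factors\<close>

definition perm :: "nat list \<Rightarrow> 'a list \<Rightarrow> 'a list" where
  "perm \<sigma> w = map ((!) w) \<sigma>"

text \<open>By cocommutativity every permutation has this property; it is proved for adjacent transpositions
  and for the products of them that occur below. It is what makes \<open>slots\<close> well defined.\<close>

definition cop_inv :: "nat list \<Rightarrow> bool" where
  "cop_inv \<sigma> \<longleftrightarrow> distinct \<sigma> \<and> set \<sigma> = {..<length \<sigma>} \<and> \<sigma> \<noteq> [] \<and>
     (\<forall>h. sum_list (map pure (map (perm \<sigma>) (cop (length \<sigma> - 1) h))) = sum_list (map pure (cop (length \<sigma> - 1) h)))"

lemma length_perm [simp]: "length (perm \<sigma> w) = length \<sigma>"
  by (simp add: perm_def)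

lemma perm_update:
  assumes "distinct \<sigma>" "p < length \<sigma>" "i = \<sigma> ! p" "i < length w"
  shows "perm \<sigma> (w[i := x]) = (perm \<sigma> w)[p := x]"
  using assms by (auto intro!: nth_equalityI simp: perm_def nth_list_update nth_eq_iff_index_eq)

text \<open>As \<open>\<sigma>\<close> is a permutation, each letter of a word is read exactly once,
  so a change of one letter changes exactly one letter of the permuted word.\<close>

lemma mlin_perm:
  assumes \<sigma>: "distinct \<sigma>" "set \<sigma> = {..<length \<sigma>}" and F: "mlin (length \<sigma>) R F"
  shows "mlin (length \<sigma>) R (\<lambda>w. F (perm \<sigma> w))"
proof (rule mlinI[OF mlin_subgrp[OF F]])
  note d = \<sigma>(1)
  have ex: "\<exists>p<length \<sigma>. i = \<sigma> ! p" if "i < length \<sigma>" for i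
    using that \<sigma>(2) by (metis in_set_conv_nth lessThan_iff)
  show "is_coset R (F (perm \<sigma> w))" if "length w = length \<sigma>" for w
    by (rule mlin_coset[OF F]) simp
  show "F (perm \<sigma> (w[i := a + b])) = F (perm \<sigma> (w[i := a])) + F (perm \<sigma> (w[i := b]))"
    if "length w = length \<sigma>" "i < length \<sigma>" for w i a b
    using that ex[of i] by (auto simp: perm_update[OF d] mlin_add[OF F])
  have sc: "\<exists>p<length \<sigma>. perm \<sigma> (scale_at i c w) = scale_at p c (perm \<sigma> w)"
    if w: "length w = length \<sigma>" "i < length \<sigma>" for w i c
  proof -
    obtain p where p: "p < length \<sigma>" "i = \<sigma> ! p" using ex[OF w(2)] by blast
    then have "perm \<sigma> (scale_at i c w) = scale_at p c (perm \<sigma> w)"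
      using w perm_update[OF d p, of w "c *\<^sub>k w ! i"] by (simp add: scale_at_def) (simp add: perm_def)
    with p show ?thesis by auto
  qed
  show "F (perm \<sigma> (scale_at i c w)) = F (perm \<sigma> (scale_at j c w))"
    if w: "length w = length \<sigma>" "i < length \<sigma>" "j < length \<sigma>" for w i j c
    using sc[OF w(1,2), of c] sc[OF w(1,3), of c] mlin_scale[OF F, of "perm \<sigma> w" _ _ c] by (metis length_perm)
qed

lemma sum_cop_perm:
  assumes \<sigma>: "cop_inv \<sigma>" and F: "mlin (length \<sigma>) R F"
  shows "(\<Sum>w\<leftarrow>cop (length \<sigma> - 1) h. F (perm \<sigma> w)) = sum_list (map F (cop (length \<sigma> - 1) h))"
proof -
  have "words (length \<sigma>) (cop (length \<sigma> - 1) h)"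
    using words_cop[of "length \<sigma> - 1" h] \<sigma> by (auto simp: cop_inv_def)
  then have "sum_list (map F (map (perm \<sigma>) (cop (length \<sigma> - 1) h))) = sum_list (map F (cop (length \<sigma> - 1) h))"
    using \<sigma> by (intro mlin_sum_eq[OF F] words_map[of "length \<sigma>"]) (auto simp: cop_inv_def)
  then show ?thesis by (simp add: o_def)
qed

text \<open>The permutation applied last stands outside, and the product list reads
  \<open>\<tau>\<close> at the positions \<open>\<sigma>\<close>. This fixes the order in all
  products of slot permutations below.\<close>

lemma perm_perm: "set \<sigma> \<subseteq> {..<length \<tau>} \<Longrightarrow> perm \<sigma> (perm \<tau> w) = perm (perm \<sigma> \<tau>) w"
  by (auto simp: perm_def)

lemma cop_inv_comp:
  assumes \<sigma>: "cop_inv \<sigma>" and \<tau>: "cop_inv \<tau>" and l: "length \<sigma> = length \<tau>"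
  shows "cop_inv (perm \<sigma> \<tau>)"
proof -
  have inj: "inj_on ((!) \<tau>) (set \<sigma>)"
    using \<tau> \<sigma> l by (auto simp: cop_inv_def inj_on_def nth_eq_iff_index_eq)
  have im: "(!) \<tau> ` {..<length \<tau>} = set \<tau>" by (auto simp: set_conv_nth)
  have "(\<Sum>w\<leftarrow>cop (length \<sigma> - 1) h. pure (perm (perm \<sigma> \<tau>) w)) =
     sum_list (map pure (cop (length \<sigma> - 1) h))" for h
  proof -
    have "(\<Sum>w\<leftarrow>cop (length \<sigma> - 1) h. pure (perm (perm \<sigma> \<tau>) w)) =
       (\<Sum>w\<leftarrow>cop (length \<tau> - 1) h. pure (perm \<sigma> (perm \<tau> w)))"
      using \<sigma> l by (simp add: perm_perm cop_inv_def)
    also have "\<dots> = (\<Sum>w\<leftarrow>cop (length \<tau> - 1) h. pure (perm \<sigma> w))"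
      using mlin_perm[OF _ _ mlin_pure, of \<sigma>] \<sigma> l by (intro sum_cop_perm[OF \<tau>]) (auto simp: cop_inv_def)
    also have "\<dots> = sum_list (map pure (cop (length \<sigma> - 1) h))"
      unfolding l[symmetric] by (rule sum_cop_perm[OF \<sigma> mlin_pure])
    finally show ?thesis .
  qed
  then show ?thesis
    unfolding cop_inv_def using \<sigma> \<tau> l inj im
    by (auto simp: o_def cop_inv_def) (auto simp: perm_def distinct_map cop_inv_def)
qed

lemma sum_cop1_cocomm:
  assumes F: "mlin 2 R F"
  shows "(\<Sum>w\<leftarrow>cop1 h. F (perm [1, 0] w)) = sum_list (map F (cop1 h))"
proof -
  let ?f = "\<lambda>as::'h list. pure [as ! 1, as ! 0]"
  have "mlin 2 (pow_rel 2) ?f"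
    using mlin_perm[OF _ _ mlin_pure, of "[1, 0]"] by (simp add: perm_def numeral_2_eq_2 lessThan_Suc insert_commute)
  then have "sum_list (map ?f (cop1 h)) = lin_extend (pow_rel 2) ?f (sum_list (map pure (cop1 h)))"
    by (rule mlin_extend[OF _ cop1(1), symmetric])
  also have "\<dots> = sum_list (map pure (cop1 h))"
    using cocommutative[of h] by (simp only: cop1(2)[symmetric])
  finally have "sum_list (map pure (map (perm [1, 0]) (cop1 h))) = sum_list (map pure (cop1 h))"
    by (simp only: map_map o_def perm_def list.map)
  then have "sum_list (map F (map (perm [1, 0]) (cop1 h))) = sum_list (map F (cop1 h))"
    by (intro mlin_sum_eq[OF F] cop1(1) words_map[OF cop1(1)]) auto
  then show ?thesis by (simp only: map_map o_def)
qed

text \<open>By coassociativity, factors \<open>q\<close> and \<open>q + 1\<close> of an iterated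
  coproduct arise by splitting factor \<open>q\<close> of the coproduct with one factor less.
  Exchanging them is cocommutativity of that last splitting.\<close>

lemma cop_inv_adjacent:
  assumes "Suc q < n"
  shows "cop_inv ([0..<q] @ [Suc q, q] @ [Suc (Suc q)..<n])" (is "cop_inv ?\<sigma>")
proof -
  have len: "length ?\<sigma> = n" and \<sigma>: "distinct ?\<sigma>" "set ?\<sigma> = {..<n}" using assms by auto
  obtain m where m: "n = Suc (Suc m)" using assms by (cases n; cases "n - 1") auto
  have "(\<Sum>w\<leftarrow>cop (n - 1) h. pure (perm ?\<sigma> w)) = sum_list (map pure (cop (n - 1) h))" for h
  proof -
    have sp: "perm ?\<sigma> (splice_at q as es) = splice_at q as (perm [1, 0] es)"
      if l: "length as = Suc m" "length es = 2" for as es :: "'h list"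
    proof -
      obtain x y where es: "es = [x, y]" using l by (auto simp: numeral_2_eq_2 length_Suc_conv)
      have q: "q < length as" using l assms m by simp
      show ?thesis
      proof (rule nth_equalityI)
        show "length (perm ?\<sigma> (splice_at q as es)) = length (splice_at q as (perm [1, 0] es))"
          using len l m q by (simp add: length_splice_at)
        fix i assume "i < length (perm ?\<sigma> (splice_at q as es))"
        then have i: "i < n" using len by simp
        then have \<sigma>i: "?\<sigma> ! i = (if i = q then Suc q else if i = Suc q then q else i)"
          using assms by (auto simp: nth_append nth_Cons')
        have "i < length ?\<sigma>" using i len by simp
        then have "perm ?\<sigma> (splice_at q as es) ! i = splice_at q as es ! (?\<sigma> ! i)"
          unfolding perm_def by (rule nth_map)
        then show "perm ?\<sigma> (splice_at q as es) ! i = splice_at q as (perm [1, 0] es) ! i"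
          unfolding \<sigma>i using q i m l
          by (auto simp: splice_at_def es perm_def nth_append nth_Cons' numeral_2_eq_2)
      qed
    qed
    have F2: "mlin 2 (pow_rel n) (\<lambda>es. pure (splice_at q as es))" if "length as = Suc m" for as
      using that assms m by (intro mlin_splice_inner[OF mlin_pure that]) auto
    have mp: "mlin n (pow_rel n) (\<lambda>w. pure (perm ?\<sigma> w))"
      by (rule mlin_perm[OF \<sigma>(1) _ mlin_pure, unfolded len, OF \<sigma>(2)])
    have "(\<Sum>w\<leftarrow>cop (Suc m) h. pure (perm ?\<sigma> w)) =
       (\<Sum>as\<leftarrow>cop m h. \<Sum>es\<leftarrow>cop1 (as ! q). pure (perm ?\<sigma> (splice_at q as es)))"
      using mp assms m by (intro sum_cop_coassoc1[symmetric]) auto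
    also have "\<dots> = (\<Sum>as\<leftarrow>cop m h. \<Sum>es\<leftarrow>cop1 (as ! q). pure (splice_at q as es))"
    proof (rule sum_list_map_cong)
      fix as assume "as \<in> set (cop m h)"
      then have as: "length as = Suc m" by (rule length_cop)
      have "(\<Sum>es\<leftarrow>cop1 (as ! q). pure (perm ?\<sigma> (splice_at q as es))) =
          (\<Sum>es\<leftarrow>cop1 (as ! q). pure (splice_at q as (perm [1, 0] es)))"
        by (intro sum_list_map_cong arg_cong[where f=pure] sp[OF as] length_cop1)
      also have "\<dots> = (\<Sum>es\<leftarrow>cop1 (as ! q). pure (splice_at q as es))"
        by (rule sum_cop1_cocomm[OF F2[OF as]])
      finally show "(\<Sum>es\<leftarrow>cop1 (as ! q). pure (perm ?\<sigma> (splice_at q as es))) =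
          (\<Sum>es\<leftarrow>cop1 (as ! q). pure (splice_at q as es))" .
    qed
    also have "\<dots> = sum_list (map pure (cop (Suc m) h))"
      using assms m by (intro sum_cop_coassoc1[OF mlin_pure]) auto
    finally show ?thesis using m by simp
  qed
  then show ?thesis using \<sigma> unfolding cop_inv_def len by (auto simp: o_def)
qed

text \<open>The slot permutations that occur in the definitions, together with a few auxiliary ones;
  each is an adjacent transposition or a product of such.\<close>

lemma cop_inv_perms:
  "cop_inv [1, 0]"
  "cop_inv [1, 0, 2]" "cop_inv [0, 2, 1]" "cop_inv [2, 1, 0]" "cop_inv [1, 2, 0]" "cop_inv [2, 0, 1]"
  "cop_inv [1, 0, 2, 3]" "cop_inv [0, 2, 1, 3]" "cop_inv [0, 1, 3, 2]"
  "cop_inv [2, 0, 1, 3]" "cop_inv [1, 2, 0, 3]" "cop_inv [2, 1, 0, 3]"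
  "cop_inv [1, 2, 3, 0]" "cop_inv [0, 2, 3, 1]" "cop_inv [2, 0, 3, 1]" "cop_inv [2, 3, 0, 1]"
proof -
  note c = cop_inv_comp[unfolded perm_def]
  show a: "cop_inv [1, 0]" using cop_inv_adjacent[of 0 2] by (simp add: upt_rec numeral_eq_Suc)
  show b: "cop_inv [1, 0, 2]" using cop_inv_adjacent[of 0 3] by (simp add: upt_rec numeral_eq_Suc)
  show b': "cop_inv [0, 2, 1]" using cop_inv_adjacent[of 1 3] by (simp add: upt_rec numeral_eq_Suc)
  show "cop_inv [2, 1, 0]" using c[OF b c[OF b' b]] by simp
  show "cop_inv [1, 2, 0]" using c[OF b' b] by simp
  show "cop_inv [2, 0, 1]" using c[OF b b'] by simp
  show d: "cop_inv [1, 0, 2, 3]" using cop_inv_adjacent[of 0 4] by (simp add: upt_rec numeral_eq_Suc)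
  show d': "cop_inv [0, 2, 1, 3]" using cop_inv_adjacent[of 1 4] by (simp add: upt_rec numeral_eq_Suc)
  show d'': "cop_inv [0, 1, 3, 2]" using cop_inv_adjacent[of 2 4] by (simp add: upt_rec numeral_eq_Suc)
  show e: "cop_inv [2, 0, 1, 3]" using c[OF d d'] by simp
  show f: "cop_inv [1, 2, 0, 3]" using c[OF d' d] by simp
  show "cop_inv [2, 1, 0, 3]" using c[OF f d'] by simp
  show "cop_inv [1, 2, 3, 0]" using c[OF d'' f] by simp
  show g: "cop_inv [0, 2, 3, 1]" using c[OF d'' d'] by simp
  show i: "cop_inv [2, 0, 3, 1]" using c[OF d g] by simp
  show "cop_inv [2, 3, 0, 1]" using c[OF d' i] by simp
qed

end

section \<open>The modules \<open>H\<^sup>\<otimes>\<^sup>n \<otimes>\<^sub>H M\<close>\<close>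

context cocommutative_hopf_algebra
begin

definition gens :: "nat \<Rightarrow> ('h, 'm) module \<Rightarrow> ('h list \<times> 'm) set" where
  "gens n M = {(w, m). length w = n \<and> m \<in> carrier M}"

lemma subgrp_tens_rel: "subgrp (tens_rel n M)"
  by (simp add: subgrp_def tens_rel.zero tens_rel.diff)

text \<open>The functions on generators that factor through \<open>H\<^sup>\<otimes>\<^sup>n \<otimes>\<^sub>H M\<close>.\<close>

definition tlin :: "nat \<Rightarrow> ('h, 'm) module \<Rightarrow> ('b \<Rightarrow>\<^sub>0 int) set \<Rightarrow> ('h list \<times> 'm \<Rightarrow> ('b \<Rightarrow>\<^sub>0 int) set) \<Rightarrow> bool" where
  "tlin n M R f \<longleftrightarrow> n \<ge> 1 \<and> left_module M \<and> subgrp R \<and>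
     (\<forall>m\<in>carrier M. mlin n R (\<lambda>w. f (w, m))) \<and>
     (\<forall>w. \<forall>x\<in>carrier M. \<forall>y\<in>carrier M. length w = n \<longrightarrow> f (w, x \<oplus>\<^bsub>M\<^esub> y) = f (w, x) + f (w, y)) \<and>
     (\<forall>w h. \<forall>m\<in>carrier M. length w = n \<longrightarrow>
        f (w, h \<odot>\<^bsub>M\<^esub> m) = (\<Sum>ds\<leftarrow>cop (n - 1) h. f (map2 (*) w ds, m)))"

lemma words_cop': "n \<ge> 1 \<Longrightarrow> words n (cop (n - 1) h)"
  using words_cop[of "n - 1" h] by simp

lemma length_cop': "n \<ge> 1 \<Longrightarrow> w \<in> set (cop (n - 1) h) \<Longrightarrow> length w = n"
  using words_cop'[of n h] by (simp add: words_def)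

lemma tlin_coset: "tlin n M R f \<Longrightarrow> g \<in> gens n M \<Longrightarrow> is_coset R (f g)"
  by (auto simp: tlin_def gens_def intro: mlin_coset)

lemma tlin_respects:
  assumes f: "tlin n M R f" and r: "r \<in> tens_rel n M"
  shows "frag_extend (\<lambda>g. SOME y. y \<in> f g) r \<in> R"
  using r
proof induction
  have R: "subgrp R" and n: "n \<ge> 1" and M: "left_module M" using f by (auto simp: tlin_def)
  interpret M: left_module M by (rule M)
  define y where "y g = (SOME y. y \<in> f g)" for g
  have y: "f (w, m) = y (w, m) +o R" if "length w = n" "m \<in> carrier M" for w m
    unfolding y_def using that by (intro is_coset_some[OF R] tlin_coset[OF f]) (simp add: gens_def)
  have y_eq: "(\<lambda>g. SOME y. y \<in> f g) = y" by (simp add: y_def fun_eq_iff)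
  {
    case zero show ?case by (simp add: subgrp_0 R)
  next
    case (diff r s) then show ?case by (simp add: frag_extend_diff subgrp_diff R)
  next
    case (power r m)
    have "mlin n R (\<lambda>w. f (w, m))" using f power by (auto simp: tlin_def)
    from mlin_respects[OF this power(1)] show ?case
      using frag_extend_compose[of y "\<lambda>hs. (hs, m)" r] by (simp add: y_eq y_def o_def)
  next
    case (additive w a b)
    have "f (w, a \<oplus>\<^bsub>M\<^esub> b) = f (w, a) + f (w, b)" using f additive by (auto simp: tlin_def)
    then have "y (w, a \<oplus>\<^bsub>M\<^esub> b) - (y (w, a) + y (w, b)) \<in> R"
      using additive by (simp add: y coset_add coset_eq_iff R)
    then show ?case by (simp add: y_eq frag_extend_diff frag_extend_add diff_diff_eq)
  next
    case (over_H w m d h)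
    let ?F = "\<lambda>ds. f (map2 (*) w ds, m)"
    let ?y = "\<lambda>ds. y (map2 (*) w ds, m)"
    let ?c = "cop (n - 1) h"
    note c = words_cop'[OF n, of h]
    have F: "mlin n R ?F" using f over_H by (intro mlin_map2) (auto simp: tlin_def)
    \<comment> \<open>\<open>d\<close> is an arbitrary formal sum in the class of the iterated
      coproduct. It differs from the chosen list \<open>?c\<close> by an element of
      \<open>pow_rel n\<close>, which \<open>?F\<close> respects.\<close>
    have "iter_comult (n - 1) h = sum_list (map frag_of ?c) +o pow_rel n"
      unfolding iter_comult_cop map_pure_words[OF c]
      using c by (intro sum_list_coset[OF subgrp_pow_rel]) (simp add: words_def)
    then have "d - sum_list (map frag_of ?c) \<in> pow_rel n"
      using over_H(3) by (simp add: set_plus_imp_minus)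
    from mlin_respects[OF F this] have "frag_extend ?y d - sum_list (map ?y ?c) \<in> R"
      by (simp add: y_def[symmetric] frag_extend_diff frag_extend_sum_list)
    moreover have "f (w, h \<odot>\<^bsub>M\<^esub> m) = sum_list (map ?F ?c)" using f over_H by (auto simp: tlin_def)
    then have "y (w, h \<odot>\<^bsub>M\<^esub> m) +o R = (\<Sum>ds\<leftarrow>?c. ?y ds +o R)"
      using over_H length_cop'[OF n] by (simp add: y M.smult_closed cong: map_cong)
    then have "y (w, h \<odot>\<^bsub>M\<^esub> m) - sum_list (map ?y ?c) \<in> R"
      using sum_list_coset[OF R, of ?c ?y] c by (simp add: words_def coset_eq_iff R)
    ultimately have "frag_extend ?y d - y (w, h \<odot>\<^bsub>M\<^esub> m) \<in> R"
      using subgrp_diff[OF R] by force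
    then show ?case
      using frag_extend_compose[of y "\<lambda>ds. (map2 (*) w ds, m)" d] by (simp add: y_eq frag_extend_diff o_def)
  }
qed

lemma map_tpure_gens: "set l \<subseteq> gens n M \<Longrightarrow> map (tpure M) l = map (\<lambda>g. frag_of g +o tens_rel n M) l"
  by (auto simp: gens_def tpure_def)

lemma tlin_extend:
  assumes f: "tlin n M R f" and l: "l \<noteq> []" "set l \<subseteq> gens n M"
  shows "lin_extend R f (sum_list (map (tpure M) l)) = sum_list (map f l)"
  unfolding map_tpure_gens[OF l(2)]
  using l f by (intro lin_extend_sum_list[OF subgrp_tens_rel _ tlin_respects[OF f]])
    (auto intro: tlin_coset simp: tlin_def)

lemma tlin_extend_tpure: "tlin n M R f \<Longrightarrow> g \<in> gens n M \<Longrightarrow> lin_extend R f (tpure M g) = f g"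
  using tlin_extend[of n M R f "[g]"] by (simp del: set_zero)

lemma carrier_tens_iff:
  "X \<in> carrier (tens n M) \<longleftrightarrow> (\<exists>x. X = x +o tens_rel n M \<and> Poly_Mapping.keys x \<subseteq> gens n M)"
  by (auto simp: tens_def gens_def)

lemma tens_add [simp]: "add (tens n M) = (+)"
  and tens_zero [simp]: "zero (tens n M) = tens_rel n M"
  by (simp_all add: tens_def)

lemma tens_add_closed: "X \<in> carrier (tens n M) \<Longrightarrow> Y \<in> carrier (tens n M) \<Longrightarrow> X + Y \<in> carrier (tens n M)"
proof -
  assume "X \<in> carrier (tens n M)" "Y \<in> carrier (tens n M)"
  then obtain x y where "X = x +o tens_rel n M" "Y = y +o tens_rel n M"
    "Poly_Mapping.keys x \<subseteq> gens n M" "Poly_Mapping.keys y \<subseteq> gens n M" by (auto simp: carrier_tens_iff)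
  then show ?thesis using keys_add[of x y]
    by (auto simp: carrier_tens_iff coset_add subgrp_tens_rel intro!: exI[of _ "x + y"])
qed

lemma tpure_closed: "g \<in> gens n M \<Longrightarrow> tpure M g \<in> carrier (tens n M)"
  unfolding carrier_tens_iff by (intro exI[of _ "frag_of g"]) (auto simp: tpure_def gens_def)

lemma abelian_group_tens: "abelian_group (tens n M)"
proof (rule abelian_groupI, unfold tens_add tens_zero)
  let ?R = "tens_rel n M"
  show "?R \<in> carrier (tens n M)" unfolding carrier_tens_iff by (intro exI[of _ 0]) auto
  show "X + Y = Y + X" for X Y :: "('h list \<times> 'b \<Rightarrow>\<^sub>0 int) set" by (rule add.commute)
  show "X + Y + Z = X + (Y + Z)" for X Y Z :: "('h list \<times> 'b \<Rightarrow>\<^sub>0 int) set" by (rule add.assoc)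
  fix X assume "X \<in> carrier (tens n M)"
  then obtain x where x: "X = x +o ?R" "Poly_Mapping.keys x \<subseteq> gens n M" by (auto simp: carrier_tens_iff)
  show "?R + X = X" using coset_add[OF subgrp_tens_rel, of 0 n M x] by (simp add: x)
  show "\<exists>Y\<in>carrier (tens n M). Y + X = ?R"
    using x by (intro bexI[of _ "(- x) +o ?R"])
      (auto simp: coset_add subgrp_tens_rel carrier_tens_iff intro!: exI[of _ "- x"])
qed (rule tens_add_closed)

lemma is_coset_tens: "X \<in> carrier (tens n M) \<Longrightarrow> is_coset (tens_rel n M) X"
  by (auto simp: carrier_tens_iff)

lemma tens_a_inv: "x +o tens_rel n M \<in> carrier (tens n M) \<Longrightarrow>
  \<ominus>\<^bsub>tens n M\<^esub> (x +o tens_rel n M) = (- x) +o tens_rel n M"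
proof -
  interpret T: abelian_group "tens n M" by (rule abelian_group_tens)
  let ?R = "tens_rel n M"
  assume X: "x +o ?R \<in> carrier (tens n M)"
  \<comment> \<open>The given representative \<open>x\<close> may contain pairs outside
    \<open>gens n M\<close>. The inverse is first found for a representative \<open>y\<close> that
    is supported in \<open>gens n M\<close>.\<close>
  then obtain y where y: "x +o ?R = y +o ?R" "Poly_Mapping.keys y \<subseteq> gens n M" by (auto simp: carrier_tens_iff)
  have "(- y) +o ?R \<in> carrier (tens n M)" using y by (auto simp: carrier_tens_iff intro!: exI[of _ "- y"])
  moreover have "(x +o ?R) + ((- y) +o ?R) = ?R" unfolding y(1) by (simp add: coset_add subgrp_tens_rel)
  ultimately have "\<ominus>\<^bsub>tens n M\<^esub> (x +o ?R) = (- y) +o ?R"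
    using X T.minus_equality[of "(- y) +o ?R" "x +o ?R"] by (simp add: add.commute)
  moreover have "- y - (- x) \<in> ?R" using y(1) by (simp add: coset_eq_iff subgrp_tens_rel)
  ultimately show ?thesis by (simp add: coset_eq_iff subgrp_tens_rel)
qed

lemma tens_minus: "y +o tens_rel n M \<in> carrier (tens n M) \<Longrightarrow>
  (x +o tens_rel n M) \<ominus>\<^bsub>tens n M\<^esub> (y +o tens_rel n M) = (x - y) +o tens_rel n M"
  by (simp add: a_minus_def tens_a_inv coset_add subgrp_tens_rel)

text \<open>As for tensor powers, except that the sign is absorbed by the module element:
  \<open>(w, m)\<close> and \<open>(w, \<ominus> m)\<close> have opposite classes, and a pair with
  second component zero has class zero.\<close>

lemma carrier_tens_gens:
  assumes "left_module M" "X \<in> carrier (tens n M)"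
  shows "\<exists>l. l \<noteq> [] \<and> set l \<subseteq> gens n M \<and> X = sum_list (map (tpure M) l)"
proof -
  interpret M: left_module M by fact
  let ?K = "tens_rel n M"
  obtain x where x: "X = x +o ?K" "Poly_Mapping.keys x \<subseteq> gens n M"
    using assms(2) by (auto simp: carrier_tens_iff)
  have add: "frag_of (w, a \<oplus>\<^bsub>M\<^esub> b) - frag_of (w, a) - frag_of (w, b) \<in> ?K"
    if "length w = n" "a \<in> carrier M" "b \<in> carrier M" for w a b
    using that by (rule tens_rel.additive)
  have z: "frag_of (w, \<zero>\<^bsub>M\<^esub>) \<in> ?K" if "length w = n" for w
    using subgrp_minus[OF subgrp_tens_rel add[OF that, of "\<zero>\<^bsub>M\<^esub>" "\<zero>\<^bsub>M\<^esub>"]] by simp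
  have "\<exists>l. l \<noteq> [] \<and> set l \<subseteq> gens n M \<and> x +o ?K = sum_list (map frag_of l) +o ?K"
  proof (rule frag_nonneg_representative[OF subgrp_tens_rel _ z])
    show "(replicate n 0, \<zero>\<^bsub>M\<^esub>) \<in> gens n M" by (simp add: gens_def)
    fix g assume "g \<in> gens n M"
    then obtain w m where g: "g = (w, m)" "length w = n" "m \<in> carrier M" by (auto simp: gens_def)
    have "frag_of (w, \<zero>\<^bsub>M\<^esub>) - (frag_of (w, m \<oplus>\<^bsub>M\<^esub> \<ominus>\<^bsub>M\<^esub> m) - frag_of (w, m) - frag_of (w, \<ominus>\<^bsub>M\<^esub> m)) \<in> ?K"
      using g by (intro subgrp_diff[OF subgrp_tens_rel] add z) auto
    then have "frag_of (w, m) + frag_of (w, \<ominus>\<^bsub>M\<^esub> m) \<in> ?K"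
      using g by (simp add: M.r_neg add.commute)
    then show "\<exists>g'\<in>gens n M. frag_of g + frag_of g' \<in> ?K"
      using g by (intro bexI[of _ "(w, \<ominus>\<^bsub>M\<^esub> m)"]) (auto simp: gens_def add.commute)
  qed (use x in auto)
  then obtain l where l: "l \<noteq> []" "set l \<subseteq> gens n M" "X = sum_list (map frag_of l) +o ?K"
    unfolding x(1) by auto
  have "sum_list (map (tpure M) l) = sum_list (map frag_of l) +o ?K"
    unfolding map_tpure_gens[OF l(2)] by (intro sum_list_coset[OF subgrp_tens_rel] l(1))
  with l show ?thesis by auto
qed

lemma tens_sum_closed:
  "l \<noteq> [] \<Longrightarrow> (\<And>x. x \<in> set l \<Longrightarrow> F x \<in> carrier (tens n M)) \<Longrightarrow> sum_list (map F l) \<in> carrier (tens n M)"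
proof (induction l)
  case (Cons a l)
  then show ?case by (cases "l = []") (auto intro: tens_add_closed simp del: set_zero)
qed simp

text \<open>The working principle for the tensor modules: an identity between additive maps has to
  be checked only on generators. There is no case for negatives because every class is a nonempty
  sum of generators.\<close>

lemma tens_induct [consumes 2, case_names gen add]:
  assumes "X \<in> carrier (tens n M)" "left_module M"
    and gen: "\<And>w m. length w = n \<Longrightarrow> m \<in> carrier M \<Longrightarrow> P (tpure M (w, m))"
    and add: "\<And>X Y. X \<in> carrier (tens n M) \<Longrightarrow> Y \<in> carrier (tens n M) \<Longrightarrow> P X \<Longrightarrow> P Y \<Longrightarrow> P (X + Y)"
  shows "P X"
proof -
  obtain l where l: "l \<noteq> []" "set l \<subseteq> gens n M" "X = sum_list (map (tpure M) l)"
    using carrier_tens_gens[OF assms(2,1)] by auto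
  show ?thesis unfolding l(3) using l(1,2)
  proof (induction l)
    case (Cons g l)
    show ?case
    proof (cases "l = []")
      case True
      then show ?thesis using Cons.prems by (auto simp: gens_def intro: gen simp del: set_zero)
    next
      case False
      then have "P (tpure M g + sum_list (map (tpure M) l))"
        using Cons by (intro add tpure_closed tens_sum_closed) (auto simp: gens_def intro: gen)
      then show ?thesis by simp
    qed
  qed simp
qed

lemma tlin_extend_add:
  assumes "tlin n M R f" "X \<in> carrier (tens n M)" "Y \<in> carrier (tens n M)"
  shows "lin_extend R f (X + Y) = lin_extend R f X + lin_extend R f Y"
  using assms by (intro lin_extend_add[OF subgrp_tens_rel _ tlin_respects[OF assms(1)]] is_coset_tens)
    (auto simp: tlin_def)

lemma tlin_extend_closed:
  assumes f: "tlin n M R f" and "\<And>g. g \<in> gens n M \<Longrightarrow> f g \<in> carrier (tens k N)" "X \<in> carrier (tens n M)"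
  shows "lin_extend R f X \<in> carrier (tens k N)"
proof -
  have M: "left_module M" using f by (simp add: tlin_def)
  show ?thesis using assms(3) M
  proof (induction rule: tens_induct)
    case (gen w m)
    then have "(w, m) \<in> gens n M" by (simp add: gens_def)
    then show ?case by (simp add: tlin_extend_tpure[OF f] assms(2))
  next
    case (add X Y)
    then show ?case by (simp add: tlin_extend_add[OF f] tens_add_closed)
  qed
qed

lemma tlin_sum_list:
  assumes f: "tlin n M R f" "l \<noteq> []" "\<And>x. x \<in> set l \<Longrightarrow> F x \<in> carrier (tens n M)"
  shows "lin_extend R f (sum_list (map F l)) = (\<Sum>x\<leftarrow>l. lin_extend R f (F x))"
  using f(2,3)
proof (induction l)
  case (Cons a l)
  then show ?case
    by (cases "l = []") (auto simp: tlin_extend_add[OF f(1)] tens_sum_closed simp del: set_zero)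
qed simp

lemma mlin_tpure:
  assumes "m \<in> carrier M"
  shows "mlin n (tens_rel n M) (\<lambda>w. tpure M (w, m))"
proof (rule mlinI[OF subgrp_tens_rel])
  note R = subgrp_pow_rel[of n] subgrp_tens_rel[of n M]
  have pw: "frag_extend (\<lambda>hs. frag_of (hs, m)) r \<in> tens_rel n M" if "r \<in> pow_rel n" for r
    using that assms by (rule tens_rel.power)
  show "is_coset (tens_rel n M) (tpure M (w, m))" if "length w = n" for w
    using that by (auto simp: tpure_def)
  show "tpure M (w[i := a + b], m) = tpure M (w[i := a], m) + tpure M (w[i := b], m)"
    if "length w = n" "i < n" for w i a b
  proof -
    have "frag_of (w[i := a + b]) - (frag_of (w[i := a]) + frag_of (w[i := b])) \<in> pow_rel n"
      using mlin_add[OF mlin_pure that, of a b] that by (simp add: pure_def coset_add coset_eq_iff R)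
    from pw[OF this] show ?thesis
      using that by (simp add: tpure_def coset_add coset_eq_iff R frag_extend_diff frag_extend_add)
  qed
  show "tpure M (scale_at i c w, m) = tpure M (scale_at j c w, m)"
    if "length w = n" "i < n" "j < n" for w i j c
  proof -
    have "frag_of (scale_at i c w) - frag_of (scale_at j c w) \<in> pow_rel n"
      using mlin_scale[OF mlin_pure that, of c] that by (simp add: pure_def coset_eq_iff R)
    from pw[OF this] show ?thesis
      using that by (simp add: tpure_def coset_eq_iff R frag_extend_diff)
  qed
qed

lemma tpure_add:
  assumes "length w = n" "x \<in> carrier M" "y \<in> carrier M"
  shows "tpure M (w, x \<oplus>\<^bsub>M\<^esub> y) = tpure M (w, x) + tpure M (w, y)"
  using tens_rel.additive[OF assms] assms(1)
  by (simp add: tpure_def coset_add coset_eq_iff subgrp_tens_rel diff_diff_eq)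

text \<open>The relation over \<open>H\<close> for the Sweedler terms chosen by \<open>cop\<close>.
  As \<open>n \<ge> 1\<close>, the words of \<open>cop (n - 1)\<close> have exactly \<open>n\<close>
  letters.\<close>

lemma tpure_smult:
  assumes "length w = n" "m \<in> carrier M" "n \<ge> 1"
  shows "tpure M (w, h \<odot>\<^bsub>M\<^esub> m) = (\<Sum>ds\<leftarrow>cop (n - 1) h. tpure M (map2 (*) w ds, m))"
proof -
  let ?c = "cop (n - 1) h" and ?R = "tens_rel n M"
  note c = words_cop'[OF assms(3), of h]
  have "iter_comult (n - 1) h = sum_list (map frag_of ?c) +o pow_rel n"
    unfolding iter_comult_cop map_pure_words[OF c]
    using c by (intro sum_list_coset[OF subgrp_pow_rel]) (simp add: words_def)
  then have "sum_list (map frag_of ?c) \<in> iter_comult (n - 1) h"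
    using set_plus_intro2[OF subgrp_0[OF subgrp_pow_rel], of "sum_list (map frag_of ?c)" n] by simp
  from tens_rel.over_H[OF assms(1,2) this]
  have "(\<Sum>ds\<leftarrow>?c. frag_of (map2 (*) w ds, m)) - frag_of (w, h \<odot>\<^bsub>M\<^esub> m) \<in> ?R"
    by (simp add: frag_extend_sum_list)
  then have "(\<Sum>ds\<leftarrow>?c. frag_of (map2 (*) w ds, m)) +o ?R = frag_of (w, h \<odot>\<^bsub>M\<^esub> m) +o ?R"
    by (simp only: coset_eq_iff[OF subgrp_tens_rel])
  moreover have "map (\<lambda>ds. tpure M (map2 (*) w ds, m)) ?c = map (\<lambda>ds. frag_of (map2 (*) w ds, m) +o ?R) ?c"
    using length_cop'[OF assms(3)] assms(1) by (auto simp: tpure_def)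
  moreover have "(\<Sum>ds\<leftarrow>?c. frag_of (map2 (*) w ds, m) +o ?R) =
      (\<Sum>ds\<leftarrow>?c. frag_of (map2 (*) w ds, m)) +o ?R"
    using c by (intro sum_list_coset[OF subgrp_tens_rel]) (simp add: words_def)
  moreover have "tpure M (w, h \<odot>\<^bsub>M\<^esub> m) = frag_of (w, h \<odot>\<^bsub>M\<^esub> m) +o ?R"
    using assms(1) by (simp add: tpure_def)
  ultimately show ?thesis by (simp only:)
qed

lemma tlinI:
  assumes "n \<ge> 1" "left_module M" "subgrp R"
    "\<And>m. m \<in> carrier M \<Longrightarrow> mlin n R (\<lambda>w. f (w, m))"
    "\<And>w x y. length w = n \<Longrightarrow> x \<in> carrier M \<Longrightarrow> y \<in> carrier M \<Longrightarrow> f (w, x \<oplus>\<^bsub>M\<^esub> y) = f (w, x) + f (w, y)"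
    "\<And>w h m. length w = n \<Longrightarrow> m \<in> carrier M \<Longrightarrow>
      f (w, h \<odot>\<^bsub>M\<^esub> m) = (\<Sum>ds\<leftarrow>cop (n - 1) h. f (map2 (*) w ds, m))"
  shows "tlin n M R f"
  unfolding tlin_def using assms by blast

subsection \<open>Functoriality, permutation of the factors, multiplication\<close>

lemma lhomD:
  assumes "f \<in> lhom M N"
  shows "x \<in> carrier M \<Longrightarrow> f x \<in> carrier N"
    "x \<in> carrier M \<Longrightarrow> y \<in> carrier M \<Longrightarrow> f (x \<oplus>\<^bsub>M\<^esub> y) = f x \<oplus>\<^bsub>N\<^esub> f y"
    "x \<in> carrier M \<Longrightarrow> f (r \<odot>\<^bsub>M\<^esub> x) = r \<odot>\<^bsub>N\<^esub> f x"
  using assms by (auto simp: lhom_def hom_def)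

lemma tlin_tmap:
  assumes "n \<ge> 1" "left_module M" "f \<in> lhom M N"
  shows "tlin n M (tens_rel n N) (\<lambda>(hs, m). tpure N (hs, f m))"
  using assms lhomD[OF assms(3)]
  by (intro tlinI) (auto simp: subgrp_tens_rel mlin_tpure tpure_add tpure_smult)

lemma tmap_tpure:
  assumes "n \<ge> 1" "left_module M" "f \<in> lhom M N" "length w = n" "m \<in> carrier M"
  shows "tmap n N f (tpure M (w, m)) = tpure N (w, f m)"
  unfolding tmap_def using assms by (subst tlin_extend_tpure[OF tlin_tmap]) (auto simp: gens_def)

lemma tmap_add:
  assumes "n \<ge> 1" "left_module M" "f \<in> lhom M N" "X \<in> carrier (tens n M)" "Y \<in> carrier (tens n M)"
  shows "tmap n N f (X + Y) = tmap n N f X + tmap n N f Y"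
  unfolding tmap_def using assms by (intro tlin_extend_add[OF tlin_tmap]) auto

lemma tmap_closed:
  assumes "n \<ge> 1" "left_module M" "f \<in> lhom M N" "X \<in> carrier (tens n M)"
  shows "tmap n N f X \<in> carrier (tens n N)"
  unfolding tmap_def using assms lhomD(1)[OF assms(3)]
  by (intro tlin_extend_closed[OF tlin_tmap]) (auto simp: gens_def intro!: tpure_closed)

lemma perm_map2:
  assumes "set \<sigma> \<subseteq> {..<length as}" "length as = length bs"
  shows "perm \<sigma> (map2 (*) as bs) = map2 (*) (perm \<sigma> as) (perm \<sigma> bs)"
proof (rule nth_equalityI)
  fix i assume "i < length (perm \<sigma> (map2 (*) as bs))"
  then have i: "i < length \<sigma>" by simp
  then have "\<sigma> ! i < length as" using assms(1) nth_mem by fastforce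
  then show "perm \<sigma> (map2 (*) as bs) ! i = map2 (*) (perm \<sigma> as) (perm \<sigma> bs) ! i"
    using i assms(2) by (simp add: perm_def)
qed simp

lemma cop_invD: "cop_inv \<sigma> \<Longrightarrow> set \<sigma> = {..<length \<sigma>}" "cop_inv \<sigma> \<Longrightarrow> length \<sigma> \<ge> 1"
  by (auto simp: cop_inv_def Suc_le_eq)

text \<open>This is where cocommutativity makes \<open>slots\<close> well defined: moving
  \<open>h\<close> across the tensor sign multiplies all factors by the iterated coproduct of
  \<open>h\<close>, and the permuted relation has the same form because that coproduct is invariant
  under \<open>\<sigma>\<close>.\<close>

lemma tlin_slots:
  assumes \<sigma>: "cop_inv \<sigma>" and M: "left_module M"
  shows "tlin (length \<sigma>) M (tens_rel (length \<sigma>) M) (\<lambda>(hs, m). tpure M (map ((!) hs) \<sigma>, m))"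
  unfolding perm_def[symmetric]
proof (intro tlinI cop_invD[OF \<sigma>] M subgrp_tens_rel; clarsimp)
  interpret M: left_module M by (rule M)
  note n = cop_invD(2)[OF \<sigma>]
  show "mlin (length \<sigma>) (tens_rel (length \<sigma>) M) (\<lambda>w. tpure M (perm \<sigma> w, m))" if "m \<in> carrier M" for m
    using \<sigma> by (intro mlin_perm mlin_tpure that) (auto simp: cop_inv_def)
  show "tpure M (perm \<sigma> w, x \<oplus>\<^bsub>M\<^esub> y) = tpure M (perm \<sigma> w, x) + tpure M (perm \<sigma> w, y)"
    if "x \<in> carrier M" "y \<in> carrier M" for w :: "'h list" and x y
    by (rule tpure_add) (use that in auto)
  show "tpure M (perm \<sigma> w, h \<odot>\<^bsub>M\<^esub> m) =
      (\<Sum>ds\<leftarrow>cop (length \<sigma> - Suc 0) h. tpure M (perm \<sigma> (map2 (*) w ds), m))"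
    if "length w = length \<sigma>" "m \<in> carrier M" for w h m
  proof -
    have "tpure M (perm \<sigma> w, h \<odot>\<^bsub>M\<^esub> m) =
        (\<Sum>ds\<leftarrow>cop (length \<sigma> - 1) h. tpure M (map2 (*) (perm \<sigma> w) ds, m))"
      using that n by (intro tpure_smult) auto
    also have "\<dots> = (\<Sum>ds\<leftarrow>cop (length \<sigma> - 1) h. tpure M (map2 (*) (perm \<sigma> w) (perm \<sigma> ds), m))"
      by (rule sum_cop_perm[OF \<sigma> mlin_map2[OF mlin_tpure], symmetric]) (use that in auto)
    also have "\<dots> = (\<Sum>ds\<leftarrow>cop (length \<sigma> - 1) h. tpure M (perm \<sigma> (map2 (*) w ds), m))"
      using that n cop_invD(1)[OF \<sigma>] length_cop'[OF n] by (intro sum_list_map_cong) (simp add: perm_map2)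
    finally show ?thesis by simp
  qed
qed

lemma slots_tpure:
  assumes "cop_inv \<sigma>" "left_module M" "length w = length \<sigma>" "m \<in> carrier M"
  shows "slots M \<sigma> (tpure M (w, m)) = tpure M (perm \<sigma> w, m)"
  unfolding slots_def using assms by (subst tlin_extend_tpure[OF tlin_slots]) (auto simp: gens_def perm_def)

lemma slots_add:
  assumes "cop_inv \<sigma>" "left_module M" "X \<in> carrier (tens (length \<sigma>) M)" "Y \<in> carrier (tens (length \<sigma>) M)"
  shows "slots M \<sigma> (X + Y) = slots M \<sigma> X + slots M \<sigma> Y"
  unfolding slots_def using assms by (intro tlin_extend_add[OF tlin_slots]) auto

lemma slots_closed:
  assumes "cop_inv \<sigma>" "left_module M" "X \<in> carrier (tens (length \<sigma>) M)"
  shows "slots M \<sigma> X \<in> carrier (tens (length \<sigma>) M)"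
  unfolding slots_def using assms
  by (intro tlin_extend_closed[OF tlin_slots]) (auto simp: gens_def intro!: tpure_closed)

section \<open>Left multiplication by a word\<close>

definition lmul :: "('h, 'm) module \<Rightarrow> 'h list \<Rightarrow> ('h, 'm) tens \<Rightarrow> ('h, 'm) tens" where
  "lmul M as X = pure as \<odot>\<^bsub>tens (length as) M\<^esub> X"

text \<open>The action of \<open>tens\<close> is extended both in the scalar and in the vector. For
  a scalar \<open>pure as\<close> the outer extension can be evaluated (\<open>lmul_eq\<close>), and
  this single extension remains.\<close>

definition lmul0 :: "('h, 'm) module \<Rightarrow> 'h list \<Rightarrow> ('h, 'm) tens \<Rightarrow> ('h, 'm) tens" where
  "lmul0 M as = lin_extend (tens_rel (length as) M) (\<lambda>(hs, m). tpure M (map2 (*) as hs, m))"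

lemma map2_mult_assoc:
  "length as = length bs \<Longrightarrow> length bs = length cs \<Longrightarrow>
    map2 (*) (map2 (*) as bs) cs = map2 (*) as (map2 (*) bs (cs :: 'h list))"
  by (auto intro!: nth_equalityI simp: mult.assoc)

lemma tlin_lmul0:
  assumes "n \<ge> 1" "left_module M" "length as = n"
  shows "tlin n M (tens_rel n M) (\<lambda>(hs, m). tpure M (map2 (*) as hs, m))"
proof (intro tlinI assms subgrp_tens_rel; clarsimp)
  show "mlin n (tens_rel n M) (\<lambda>w. tpure M (map2 (*) as w, m))" if "m \<in> carrier M" for m
    by (rule mlin_map2[OF mlin_tpure[OF that] assms(3)])
  show "tpure M (map2 (*) as w, x \<oplus>\<^bsub>M\<^esub> y) = tpure M (map2 (*) as w, x) + tpure M (map2 (*) as w, y)"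
    if "x \<in> carrier M" "y \<in> carrier M" for w x y
    by (rule tpure_add) (use that in auto)
  show "tpure M (map2 (*) as w, h \<odot>\<^bsub>M\<^esub> m) =
      (\<Sum>ds\<leftarrow>cop (length w - Suc 0) h. tpure M (map2 (*) as (map2 (*) w ds), m))"
    if "n = length w" "m \<in> carrier M" for w h m
  proof -
    have "tpure M (map2 (*) as w, h \<odot>\<^bsub>M\<^esub> m) =
        (\<Sum>ds\<leftarrow>cop (n - 1) h. tpure M (map2 (*) (map2 (*) as w) ds, m))"
      using that assms by (intro tpure_smult) auto
    also have "\<dots> = (\<Sum>ds\<leftarrow>cop (n - 1) h. tpure M (map2 (*) as (map2 (*) w ds), m))"
    proof (rule sum_list_map_cong)
      fix ds assume "ds \<in> set (cop (n - 1) h)"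
      then have "length ds = n" by (rule length_cop'[OF assms(1)])
      then show "tpure M (map2 (*) (map2 (*) as w) ds, m) = tpure M (map2 (*) as (map2 (*) w ds), m)"
        using that(1) assms(3) by (intro arg_cong[where f="\<lambda>v. tpure M (v, m)"] map2_mult_assoc) auto
    qed
    finally show ?thesis unfolding that(1) by simp
  qed
qed

lemma lmul0_tpure:
  assumes "left_module M" "length as = n" "n \<ge> 1" "length w = n" "m \<in> carrier M"
  shows "lmul0 M as (tpure M (w, m)) = tpure M (map2 (*) as w, m)"
  unfolding lmul0_def using assms by (subst tlin_extend_tpure[OF tlin_lmul0]) (auto simp: gens_def)

lemma lmul_eq:
  assumes "left_module M" "length as = n" "n \<ge> 1" "X \<in> carrier (tens n M)"
  shows "lmul M as X = lmul0 M as X"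
proof -
  obtain l where l: "l \<noteq> []" "set l \<subseteq> gens n M" "X = sum_list (map (tpure M) l)"
    using carrier_tens_gens[OF assms(1,4)] by auto
  have eq: "lin_extend (tens_rel n M) (\<lambda>(hs, m). tpure M (map2 (*) bs hs, m)) X =
      (\<Sum>(hs, m)\<leftarrow>l. tpure M (map2 (*) bs hs, m))" if "length bs = n" for bs
    unfolding l(3) by (rule tlin_extend[OF tlin_lmul0]) (use assms that l in auto)
  have "mlin n (tens_rel n M) (\<lambda>bs. (\<Sum>g\<leftarrow>l. (case g of (hs, m) \<Rightarrow> tpure M (map2 (*) bs hs, m))))"
    using l(1,2) by (intro mlin_sum subgrp_tens_rel) (auto simp: gens_def intro!: mlin_map2_left mlin_tpure)
  then have "mlin n (tens_rel n M) (\<lambda>bs. lin_extend (tens_rel n M) (\<lambda>(hs, m). tpure M (map2 (*) bs hs, m)) X)"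
    using mlin_cong[of n "\<lambda>bs. lin_extend (tens_rel n M) (\<lambda>(hs, m). tpure M (map2 (*) bs hs, m)) X", OF eq] by blast
  from mlin_extend_pure[OF this assms(2)] show ?thesis
    by (simp add: lmul_def tens_def lmul0_def assms(2))
qed

lemma lmul_tpure:
  assumes "left_module M" "length as = n" "n \<ge> 1" "length w = n" "m \<in> carrier M"
  shows "lmul M as (tpure M (w, m)) = tpure M (map2 (*) as w, m)"
  using assms by (subst lmul_eq) (auto simp: lmul0_tpure gens_def intro: tpure_closed)

lemma lmul_closed:
  assumes "left_module M" "length as = n" "n \<ge> 1" "X \<in> carrier (tens n M)"
  shows "lmul M as X \<in> carrier (tens n M)"
  using assms
  by (subst lmul_eq; simp) (auto simp: lmul0_def gens_def intro!: tlin_extend_closed[OF tlin_lmul0] tpure_closed)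

lemma lmul_add:
  assumes "left_module M" "length as = n" "n \<ge> 1" "X \<in> carrier (tens n M)" "Y \<in> carrier (tens n M)"
  shows "lmul M as (X + Y) = lmul M as X + lmul M as Y"
  using assms tlin_extend_add[OF tlin_lmul0[of n M as], of X Y]
  by (simp add: lmul_eq tens_add_closed lmul0_def)

end

subsection \<open>Composition of polylinear maps\<close>

context cocommutative_hopf_algebra
begin

text \<open>The value of \<open>plug n N m \<phi>\<close> on a generator \<open>(hs, e)\<close>, as a function of \<open>\<phi> e\<close>.\<close>

definition ins :: "nat \<Rightarrow> ('h, 'm) module \<Rightarrow> nat \<Rightarrow> 'h list \<Rightarrow> ('h, 'm) tens \<Rightarrow> ('h, 'm) tens" where
  "ins n N m hs = lin_extend (tens_rel n N) (\<lambda>(fs, e').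
     lin_extend (tens_rel n N) (\<lambda>ds. tpure N (take m fs @ map2 (*) hs ds @ drop (Suc m) fs, e'))
       (iter_comult (length hs - 1) (fs ! m)))"

abbreviation ins_gen :: "('h, 'm) module \<Rightarrow> nat \<Rightarrow> 'h list \<Rightarrow> 'h list \<times> 'm \<Rightarrow> ('h, 'm) tens" where
  "ins_gen N m hs g \<equiv> (\<Sum>ds\<leftarrow>cop (length hs - 1) (fst g ! m). tpure N (splice_at m (fst g) (map2 (*) hs ds), snd g))"

lemma map2_splice_at:
  assumes "length as = length bs" "length cs = length ds" "m < length as"
  shows "map2 (*) (splice_at m as cs) (splice_at m bs ds) = splice_at m (map2 (*) as bs) (map2 (*) cs (ds :: 'h list))"
  using assms by (simp add: splice_at_def zip_append take_zip drop_zip take_map drop_map)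

lemma mlin_ins_inner:
  assumes "e \<in> carrier N" "length hs = l" "length fs = k" "m < k" "n + 1 = k + l"
  shows "mlin l (tens_rel n N) (\<lambda>ds. tpure N (splice_at m fs (map2 (*) hs ds), e))"
  using assms by (intro mlin_map2[OF mlin_splice_inner[OF mlin_tpure]]) auto

lemma lin_family_cop': "l \<ge> 1 \<Longrightarrow> lin_family l (\<lambda>h. cop (l - 1) h)"
  using lin_family_cop[of "l - 1"] by (simp add: eta_contract_eq)

lemma ins_gen_eq:
  assumes "e \<in> carrier N" "length hs = l" "length fs = k" "m < k" "n + 1 = k + l" "l \<ge> 1"
  shows "lin_extend (tens_rel n N) (\<lambda>ds. tpure N (take m fs @ map2 (*) hs ds @ drop (Suc m) fs, e))
       (iter_comult (length hs - 1) (fs ! m)) = ins_gen N m hs (fs, e)"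
  unfolding iter_comult_cop using assms mlin_extend[OF mlin_ins_inner[OF assms(1-5)] words_cop'[OF assms(6)]]
  by (simp add: splice_at_def)

text \<open>Replacing slot \<open>m\<close> by \<open>l\<close> slots respects the relation over
  \<open>H\<close>. The coproduct of \<open>h\<close> acts on the \<open>k\<close> old slots; in
  slot \<open>m\<close> its factor is split further. Multiplicativity separates it from the letter
  already there, and coassociativity merges the two coproducts into one with \<open>n\<close>
  factors.\<close>

lemma tlin_ins_gen:
  assumes N: "left_module N" and l: "length hs = l" "l \<ge> 1" and m: "m < k" and n: "n + 1 = k + l"
  shows "tlin k N (tens_rel n N) (ins_gen N m hs)"
proof (intro tlinI N subgrp_tens_rel)
  interpret N: left_module N by (rule N)
  have k1: "k \<ge> 1" and n1: "n \<ge> 1" using m n l by auto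
  show "k \<ge> 1" by fact
  show "mlin k (tens_rel n N) (\<lambda>w. ins_gen N m hs (w, e))" if e: "e \<in> carrier N" for e
  proof -
    \<comment> \<open>Padding \<open>hs\<close> with ones turns the multiplication inside the
      inserted block into a multiplication of the whole word of length \<open>n\<close>, so that
      \<open>mlin_splice\<close> applies.\<close>
    let ?u = "splice_at m (replicate k 1) hs"
    have len: "length ?u = n" using m n l by (simp add: length_splice_at)
    have "mlin k (tens_rel n N) (\<lambda>w. (\<Sum>es\<leftarrow>cop (l - 1) (w ! m). tpure N (map2 (*) ?u (splice_at m w es), e)))"
      by (rule mlin_splice[OF lin_family_cop'[OF l(2)] mlin_map2[OF mlin_tpure[OF e] len] m n])
    moreover have "map2 (*) ?u (splice_at m w es) = splice_at m w (map2 (*) hs es)"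
      if "length w = k" "es \<in> set (cop (l - 1) h)" for w es h
      using that l m length_cop'[OF l(2) that(2)]
      by (subst map2_splice_at) (auto intro!: arg_cong[where f="\<lambda>v. splice_at m v _"] nth_equalityI)
    ultimately show ?thesis
      using mlin_cong[of k "\<lambda>w. ins_gen N m hs (w, e)"
        "\<lambda>w. (\<Sum>es\<leftarrow>cop (l - 1) (w ! m). tpure N (map2 (*) ?u (splice_at m w es), e))"] l
      by (simp cong: map_cong)
  qed
  have len: "length (splice_at m w (map2 (*) hs ds)) = n" if "length w = k" "ds \<in> set (cop (l - 1) h)" for w ds h
    using that length_cop'[OF l(2) that(2)] l m n by (simp add: length_splice_at)
  show "ins_gen N m hs (w, x \<oplus>\<^bsub>N\<^esub> y) = ins_gen N m hs (w, x) + ins_gen N m hs (w, y)"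
    if "length w = k" "x \<in> carrier N" "y \<in> carrier N" for w x y
    unfolding sum_list_addf[symmetric] fst_conv snd_conv
    by (intro sum_list_map_cong tpure_add[of _ n] that len) (use that l in auto)
  show "ins_gen N m hs (w, h \<odot>\<^bsub>N\<^esub> e) = (\<Sum>ds\<leftarrow>cop (k - 1) h. ins_gen N m hs (map2 (*) w ds, e))"
    if w: "length w = k" and e: "e \<in> carrier N" for w h e
  proof -
    let ?G = "\<lambda>v. tpure N (v, e)"
    have "(\<Sum>ds\<leftarrow>cop (k - 1) h. ins_gen N m hs (map2 (*) w ds, e)) =
        (\<Sum>ds\<leftarrow>cop (k - 1) h. \<Sum>as\<leftarrow>cop (l - 1) (w ! m). (\<Sum>bs\<leftarrow>cop (l - 1) (ds ! m). ?G (map2 (*) (splice_at m w (map2 (*) hs as)) (splice_at m ds bs))))"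
    proof (rule sum_list_map_cong)
      fix ds assume "ds \<in> set (cop (k - 1) h)"
      then have ds: "length ds = k" by (rule length_cop'[OF k1])
      have F: "mlin (Suc (l - 1)) (tens_rel n N) (\<lambda>es. ?G (splice_at m (map2 (*) w ds) (map2 (*) hs es)))"
        using mlin_ins_inner[OF e l(1), of "map2 (*) w ds" k m n] w ds m n l by simp
      have "ins_gen N m hs (map2 (*) w ds, e) =
          (\<Sum>es\<leftarrow>cop (l - 1) (w ! m * ds ! m). ?G (splice_at m (map2 (*) w ds) (map2 (*) hs es)))"
        using w ds m l by simp
      also have "\<dots> = (\<Sum>as\<leftarrow>cop (l - 1) (w ! m). (\<Sum>bs\<leftarrow>cop (l - 1) (ds ! m). ?G (splice_at m (map2 (*) w ds) (map2 (*) hs (map2 (*) as bs)))))"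
        by (rule sum_cop_mult[OF F])
      also have "\<dots> = (\<Sum>as\<leftarrow>cop (l - 1) (w ! m). (\<Sum>bs\<leftarrow>cop (l - 1) (ds ! m). ?G (map2 (*) (splice_at m w (map2 (*) hs as)) (splice_at m ds bs))))"
      proof (intro sum_list_map_cong)
        fix as bs assume "as \<in> set (cop (l - 1) (w ! m))" "bs \<in> set (cop (l - 1) (ds ! m))"
        then have "length as = l" "length bs = l" using length_cop'[OF l(2)] by blast+
        then show "?G (splice_at m (map2 (*) w ds) (map2 (*) hs (map2 (*) as bs))) =
            ?G (map2 (*) (splice_at m w (map2 (*) hs as)) (splice_at m ds bs))"
          using w ds l m by (subst map2_splice_at) (auto simp: map2_mult_assoc)
      qed
      finally show "ins_gen N m hs (map2 (*) w ds, e) = (\<Sum>as\<leftarrow>cop (l - 1) (w ! m). (\<Sum>bs\<leftarrow>cop (l - 1) (ds ! m). ?G (map2 (*) (splice_at m w (map2 (*) hs as)) (splice_at m ds bs))))" .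
    qed
    also have "\<dots> = (\<Sum>as\<leftarrow>cop (l - 1) (w ! m). \<Sum>ds\<leftarrow>cop (k - 1) h. (\<Sum>bs\<leftarrow>cop (l - 1) (ds ! m). ?G (map2 (*) (splice_at m w (map2 (*) hs as)) (splice_at m ds bs))))"
      by (rule sum_list_swap)
    also have "\<dots> = (\<Sum>as\<leftarrow>cop (l - 1) (w ! m). (\<Sum>es\<leftarrow>cop (n - 1) h. ?G (map2 (*) (splice_at m w (map2 (*) hs as)) es)))"
    proof (rule sum_list_map_cong)
      fix as assume as: "as \<in> set (cop (l - 1) (w ! m))"
      have eq: "k - 1 + (l - 1) = n - 1" "Suc (n - 1) = n" using n k1 l n1 by auto
      have F: "mlin (Suc (k - 1 + (l - 1))) (tens_rel n N) (\<lambda>es. ?G (map2 (*) (splice_at m w (map2 (*) hs as)) es))"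
        unfolding eq by (rule mlin_map2[OF mlin_tpure[OF e] len[OF w as]])
      have "m \<le> k - 1" using m by simp
      from sum_cop_coassoc[OF F this, of h]
      show "(\<Sum>ds\<leftarrow>cop (k - 1) h. (\<Sum>bs\<leftarrow>cop (l - 1) (ds ! m). ?G (map2 (*) (splice_at m w (map2 (*) hs as)) (splice_at m ds bs)))) =
        (\<Sum>es\<leftarrow>cop (n - 1) h. ?G (map2 (*) (splice_at m w (map2 (*) hs as)) es))"
        unfolding eq .
    qed
    also have "\<dots> = (\<Sum>as\<leftarrow>cop (l - 1) (w ! m). tpure N (splice_at m w (map2 (*) hs as), h \<odot>\<^bsub>N\<^esub> e))"
      by (intro sum_list_map_cong tpure_smult[symmetric] len[OF w] e n1)
    finally show ?thesis using l by simp
  qed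
qed

lemma tlin_cong:
  assumes f: "tlin n M R f" and eq: "\<And>g. g \<in> gens n M \<Longrightarrow> f' g = f g"
  shows "tlin n M R f'"
proof -
  have M: "left_module M" and n: "n \<ge> 1" and R: "subgrp R" using f by (auto simp: tlin_def)
  interpret M: left_module M by (rule M)
  have eq': "f' (w, m) = f (w, m)" if "length w = n" "m \<in> carrier M" for w m
    using that by (intro eq) (simp add: gens_def)
  show ?thesis
  proof (intro tlinI n M R)
    show "mlin n R (\<lambda>w. f' (w, m))" if "m \<in> carrier M" for m
      using f that mlin_cong[of n "\<lambda>w. f' (w, m)" "\<lambda>w. f (w, m)"] eq' by (auto simp: tlin_def)
    show "f' (w, x \<oplus>\<^bsub>M\<^esub> y) = f' (w, x) + f' (w, y)"
      if "length w = n" "x \<in> carrier M" "y \<in> carrier M" for w x y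
      using f that by (simp add: eq') (simp add: tlin_def)
    show "f' (w, h \<odot>\<^bsub>M\<^esub> m) = (\<Sum>ds\<leftarrow>cop (n - 1) h. f' (map2 (*) w ds, m))"
      if "length w = n" "m \<in> carrier M" for w h m
    proof -
      have "f' (w, h \<odot>\<^bsub>M\<^esub> m) = (\<Sum>ds\<leftarrow>cop (n - 1) h. f (map2 (*) w ds, m))"
        using f that by (simp add: eq' M.smult_closed) (simp add: tlin_def)
      also have "\<dots> = (\<Sum>ds\<leftarrow>cop (n - 1) h. f' (map2 (*) w ds, m))"
        using that length_cop'[OF n] by (intro sum_list_map_cong eq'[symmetric]) auto
      finally show ?thesis .
    qed
  qed
qed

text \<open>Bookkeeping of arities: \<open>k\<close> is the number of slots of the outer value,
  \<open>m\<close> the slot that is filled, \<open>l\<close> the number of slots that replace it,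
  and \<open>n\<close> the resulting total.\<close>

definition ins_ok :: "('h, 'm) module \<Rightarrow> nat \<Rightarrow> nat \<Rightarrow> nat \<Rightarrow> nat \<Rightarrow> bool" where
  "ins_ok N n k l m \<longleftrightarrow> left_module N \<and> l \<ge> 1 \<and> m < k \<and> n + 1 = k + l"

lemma tlin_ins:
  assumes "ins_ok N n k l m" "length hs = l"
  shows "tlin k N (tens_rel n N) (\<lambda>(fs, e'). lin_extend (tens_rel n N)
    (\<lambda>ds. tpure N (take m fs @ map2 (*) hs ds @ drop (Suc m) fs, e')) (iter_comult (length hs - 1) (fs ! m)))"
proof (rule tlin_cong[of _ _ _ "ins_gen N m hs"])
  show "tlin k N (tens_rel n N) (ins_gen N m hs)"
    using assms by (intro tlin_ins_gen) (auto simp: ins_ok_def)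
  fix g assume "g \<in> gens k N"
  then obtain fs e where g: "g = (fs, e)" "length fs = k" "e \<in> carrier N" by (auto simp: gens_def)
  show "(case g of (fs, e') \<Rightarrow> lin_extend (tens_rel n N)
     (\<lambda>ds. tpure N (take m fs @ map2 (*) hs ds @ drop (Suc m) fs, e')) (iter_comult (length hs - 1) (fs ! m))) =
     ins_gen N m hs g"
    unfolding g(1) prod.case using assms g by (intro ins_gen_eq) (auto simp: ins_ok_def)
qed

lemma ins_tpure:
  assumes "ins_ok N n k l m" "length hs = l" "length fs = k" "e \<in> carrier N"
  shows "ins n N m hs (tpure N (fs, e)) =
    (\<Sum>ds\<leftarrow>cop (l - 1) (fs ! m). tpure N (splice_at m fs (map2 (*) hs ds), e))"
proof -
  have "ins n N m hs (tpure N (fs, e)) = lin_extend (tens_rel n N)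
     (\<lambda>ds. tpure N (take m fs @ map2 (*) hs ds @ drop (Suc m) fs, e)) (iter_comult (length hs - 1) (fs ! m))"
    unfolding ins_def using assms by (subst tlin_extend_tpure[OF tlin_ins[OF assms(1,2)]]) (auto simp: gens_def)
  also have "\<dots> = ins_gen N m hs (fs, e)"
    using assms by (intro ins_gen_eq) (auto simp: ins_ok_def)
  finally show ?thesis using assms by simp
qed

lemma ins_add:
  assumes "ins_ok N n k l m" "length hs = l" "X \<in> carrier (tens k N)" "Y \<in> carrier (tens k N)"
  shows "ins n N m hs (X + Y) = ins n N m hs X + ins n N m hs Y"
  unfolding ins_def by (rule tlin_extend_add[OF tlin_ins[OF assms(1,2)] assms(3,4)])

lemma ins_sum_list:
  assumes "ins_ok N n k l m" "length hs = l" "L \<noteq> []" "\<And>x. x \<in> set L \<Longrightarrow> F x \<in> carrier (tens k N)"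
  shows "ins n N m hs (sum_list (map F L)) = (\<Sum>x\<leftarrow>L. ins n N m hs (F x))"
  unfolding ins_def by (rule tlin_sum_list[OF tlin_ins[OF assms(1,2)] assms(3,4)])

lemma ins_ok_cop: "ins_ok N n k l m \<Longrightarrow> words l (cop (l - 1) h)"
  by (rule words_cop') (simp add: ins_ok_def)

lemma ins_ok_cop_length: "ins_ok N n k l m \<Longrightarrow> w \<in> set (cop (l - 1) h) \<Longrightarrow> length w = l"
  by (metis ins_ok_cop words_def)

lemma ins_closed:
  assumes ok: "ins_ok N n k l m" and hs: "length hs = l" and X: "X \<in> carrier (tens k N)"
  shows "ins n N m hs X \<in> carrier (tens n N)"
proof -
  have N: "left_module N" using ok by (simp add: ins_ok_def)
  show ?thesis using X N
  proof (induction rule: tens_induct)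
    case (gen w e)
    have "tpure N (splice_at m w (map2 (*) hs ds), e) \<in> carrier (tens n N)" if "ds \<in> set (cop (l - 1) (w ! m))" for ds
    proof -
      have "length ds = l" by (rule ins_ok_cop_length[OF ok that])
      then show ?thesis using ok gen hs by (intro tpure_closed) (auto simp: gens_def ins_ok_def length_splice_at)
    qed
    moreover have "cop (l - 1) (w ! m) \<noteq> []" using ins_ok_cop[OF ok, of "w ! m"] by (simp add: words_def)
    ultimately show ?case unfolding ins_tpure[OF ok hs gen] by (intro tens_sum_closed)
  next
    case (add X Y)
    then show ?case by (simp add: ins_add[OF ok hs] tens_add_closed)
  qed
qed

definition unit_at :: "nat \<Rightarrow> nat \<Rightarrow> 'h \<Rightarrow> 'h list" where
  "unit_at k m h = (replicate k 1)[m := h]"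

lemma length_unit_at [simp]: "length (unit_at k m h) = k"
  by (simp add: unit_at_def)

lemma map2_unit_at: "length w = k \<Longrightarrow> m < k \<Longrightarrow> map2 (*) (unit_at k m h) w = w[m := h * w ! m]"
  by (auto intro!: nth_equalityI simp: unit_at_def nth_list_update)

lemma map2_replicate_1 [simp]: "length w = k \<Longrightarrow> map2 (*) (replicate k 1) w = (w :: 'h list)"
  by (auto intro!: nth_equalityI)

text \<open>\<open>\<phi>\<close> is the restriction of a polylinear map \<open>L\<^sub>1 \<boxtimes> \<dots> \<boxtimes> L\<^sub>k \<rightarrow> H\<^sup>\<otimes>\<^sup>k \<otimes>\<^sub>H N\<close> to its argument
  number \<open>m\<close>.\<close>

definition slin :: "('h, 'a) module \<Rightarrow> ('h, 'b) module \<Rightarrow> nat \<Rightarrow> nat \<Rightarrow> ('a \<Rightarrow> ('h, 'b) tens) \<Rightarrow> bool" where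
  "slin M N k m \<phi> \<longleftrightarrow> m < k \<and> (\<forall>x\<in>carrier M. \<phi> x \<in> carrier (tens k N)) \<and>
     (\<forall>x\<in>carrier M. \<forall>y\<in>carrier M. \<phi> (x \<oplus>\<^bsub>M\<^esub> y) = \<phi> x + \<phi> y) \<and>
     (\<forall>x\<in>carrier M. \<forall>h. \<phi> (h \<odot>\<^bsub>M\<^esub> x) = lmul N (unit_at k m h) (\<phi> x))"

lemma slinD:
  assumes "slin M N k m \<phi>"
  shows "m < k" "x \<in> carrier M \<Longrightarrow> \<phi> x \<in> carrier (tens k N)"
    "x \<in> carrier M \<Longrightarrow> y \<in> carrier M \<Longrightarrow> \<phi> (x \<oplus>\<^bsub>M\<^esub> y) = \<phi> x + \<phi> y"
    "x \<in> carrier M \<Longrightarrow> \<phi> (h \<odot>\<^bsub>M\<^esub> x) = lmul N (unit_at k m h) (\<phi> x)"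
  using assms by (auto simp: slin_def)

lemma map2_unit_splice:
  fixes gs :: "'h list"
  assumes "length gs = k" "length w = k" "gs ! m = 1" "length as = l" "length hs = l" "length ds = l" "m < k"
  shows "splice_at m (map2 (*) gs w) (map2 (*) (map2 (*) as hs) ds) =
    map2 (*) (splice_at m gs as) (splice_at m w (map2 (*) hs ds))"
  using assms by (subst map2_splice_at) (auto simp: map2_mult_assoc)

text \<open>Multiplication by \<open>gs\<close> outside slot \<open>m\<close> and multiplication of
  the inserted word by \<open>as\<close> combine to multiplication by the spliced word. The letter
  \<open>gs ! m\<close> is 1, since a factor in slot \<open>m\<close> would enter through its
  coproduct, as in \<open>ins_lmul_slot\<close>.\<close>

lemma ins_lmul:
  assumes ok: "ins_ok N n k l m" and hs: "length hs = l" and as: "length as = l"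
    and gs: "length gs = k" "gs ! m = 1" and X: "X \<in> carrier (tens k N)"
  shows "ins n N m (map2 (*) as hs) (lmul N gs X) = lmul N (splice_at m gs as) (ins n N m hs X)"
proof -
  have N: "left_module N" and k: "k \<ge> 1" and n: "n \<ge> 1" and m: "m < k" and nk: "n + 1 = k + l"
    using ok by (auto simp: ins_ok_def)
  have l': "length (map2 (*) as hs) = l" using hs as by simp
  have ls: "length (splice_at m gs as) = n" using gs as m nk by (simp add: length_splice_at)
  show ?thesis using X N
  proof (induction rule: tens_induct)
    case (gen w e)
    let ?c = "cop (l - 1) (w ! m)"
    have w: "length (map2 (*) gs w) = k" using gen gs by simp
    have len: "length (splice_at m w (map2 (*) hs ds)) = n" if "ds \<in> set ?c" for ds
      using gen hs m nk ins_ok_cop_length[OF ok that] by (simp add: length_splice_at)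
    have "ins n N m (map2 (*) as hs) (lmul N gs (tpure N (w, e))) =
        (\<Sum>ds\<leftarrow>?c. tpure N (splice_at m (map2 (*) gs w) (map2 (*) (map2 (*) as hs) ds), e))"
      using gen gs m by (simp add: lmul_tpure[OF N gs(1) k] ins_tpure[OF ok l' w])
    also have "\<dots> = (\<Sum>ds\<leftarrow>?c. lmul N (splice_at m gs as) (tpure N (splice_at m w (map2 (*) hs ds), e)))"
      using gen gs m hs as ins_ok_cop_length[OF ok, of _ "w ! m"]
      by (intro sum_list_map_cong) (simp add: lmul_tpure[OF N ls n len] map2_unit_splice[of _ k _ _ _ l])
    also have "\<dots> = lmul0 N (splice_at m gs as) (\<Sum>ds\<leftarrow>?c. tpure N (splice_at m w (map2 (*) hs ds), e))"
    proof -
      have c: "tpure N (splice_at m w (map2 (*) hs ds), e) \<in> carrier (tens n N)" if "ds \<in> set ?c" for ds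
        using len[OF that] gen by (intro tpure_closed) (simp add: gens_def)
      show ?thesis
        unfolding lmul0_def ls using ins_ok_cop[OF ok, of "w ! m"]
        by (subst tlin_sum_list[OF tlin_lmul0[OF n N ls] _ c])
          (auto simp: words_def lmul_eq[OF N ls n c] lmul0_def ls intro!: sum_list_map_cong)
    qed
    also have "\<dots> = lmul N (splice_at m gs as) (ins n N m hs (tpure N (w, e)))"
      using gen by (subst lmul_eq[OF N ls n ins_closed[OF ok hs tpure_closed]])
        (auto simp: ins_tpure[OF ok hs] gens_def)
    finally show ?case .
  next
    case (add X Y)
    then show ?case
      by (simp add: lmul_add[OF N gs(1) k] lmul_add[OF N ls n] ins_add[OF ok hs] ins_add[OF ok l'] lmul_closed[OF N gs(1) k] ins_closed[OF ok hs])
  qed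
qed

text \<open>By multiplicativity of the coproduct, a factor \<open>h\<close> in the filled slot turns
  into right multiplication of the inserted word by the terms of the coproduct of \<open>h\<close>.
  This is the relation over \<open>H\<close> that \<open>plug\<close> has to respect in its
  argument.\<close>

lemma ins_lmul_slot:
  assumes ok: "ins_ok N n k l m" and hs: "length hs = l" and X: "X \<in> carrier (tens k N)"
  shows "ins n N m hs (lmul N (unit_at k m h) X) = (\<Sum>ds\<leftarrow>cop (l - 1) h. ins n N m (map2 (*) hs ds) X)"
proof -
  have N: "left_module N" and k: "k \<ge> 1" and m: "m < k" and l: "l \<ge> 1" and nk: "n + 1 = k + l"
    using ok by (auto simp: ins_ok_def)
  have u: "length (unit_at k m h) = k" by simp
  have l': "length (map2 (*) hs ds) = l" if "ds \<in> set (cop (l - 1) h)" for ds h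
    using hs ins_ok_cop_length[OF ok that] by simp
  show ?thesis using X N
  proof (induction rule: tens_induct)
    case (gen w e)
    let ?F = "\<lambda>es. tpure N (splice_at m w (map2 (*) hs es), e)"
    have F: "mlin (Suc (l - 1)) (tens_rel n N) ?F"
      using mlin_ins_inner[OF gen(2) hs gen(1) m nk] l by simp
    have "ins n N m hs (lmul N (unit_at k m h) (tpure N (w, e))) = sum_list (map ?F (cop (l - 1) (h * w ! m)))"
      using gen m by (simp add: lmul_tpure[OF N u k] map2_unit_at ins_tpure[OF ok hs] splice_at_update_same)
    also have "\<dots> = (\<Sum>as\<leftarrow>cop (l - 1) h. \<Sum>bs\<leftarrow>cop (l - 1) (w ! m). ?F (map2 (*) as bs))"
      by (rule sum_cop_mult[OF F])
    also have "\<dots> = (\<Sum>ds\<leftarrow>cop (l - 1) h. ins n N m (map2 (*) hs ds) (tpure N (w, e)))"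
    proof (rule sum_list_map_cong)
      fix as assume as: "as \<in> set (cop (l - 1) h)"
      show "(\<Sum>bs\<leftarrow>cop (l - 1) (w ! m). ?F (map2 (*) as bs)) = ins n N m (map2 (*) hs as) (tpure N (w, e))"
        unfolding ins_tpure[OF ok l'[OF as] gen]
        using hs ins_ok_cop_length[OF ok as] ins_ok_cop_length[OF ok, of _ "w ! m"]
        by (intro sum_list_map_cong) (simp add: map2_mult_assoc)
    qed
    finally show ?case .
  next
    case (add X Y)
    then show ?case
      using lmul_closed[OF N u k] l'[of _ h]
      by (simp add: lmul_add[OF N u k] ins_add[OF ok hs] ins_add[OF ok l'] sum_list_addf cong: map_cong)
  qed
qed

section \<open>Composition of polylinear maps as an additive map\<close>

lemma plug_ins: "plug n N m \<phi> = lin_extend (tens_rel n N) (\<lambda>(hs, e). ins n N m hs (\<phi> e))"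
  unfolding plug_def ins_def ..

definition plug_ok :: "('h, 'a) module \<Rightarrow> ('h, 'b) module \<Rightarrow> nat \<Rightarrow> nat \<Rightarrow> nat \<Rightarrow> nat \<Rightarrow> bool" where
  "plug_ok M N n k l m \<longleftrightarrow> left_module M \<and> ins_ok N n k l m"

text \<open>Well-definedness of composition. Linearity in the word \<open>hs\<close> becomes visible
  after expanding \<open>\<phi> e\<close> into generators. The relation over \<open>H\<close> holds
  by linearity of \<open>\<phi>\<close> in slot \<open>m\<close> and
  \<open>ins_lmul_slot\<close>.\<close>

lemma tlin_plug:
  assumes ok: "plug_ok M N n k l m" and \<phi>: "slin M N k m \<phi>"
  shows "tlin l M (tens_rel n N) (\<lambda>(hs, e). ins n N m hs (\<phi> e))"
proof (intro tlinI subgrp_tens_rel; (unfold prod.case)?)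
  have iok: "ins_ok N n k l m" and M: "left_module M" using ok by (auto simp: plug_ok_def)
  have N: "left_module N" and m: "m < k" and l: "l \<ge> 1" and nk: "n + 1 = k + l"
    using iok by (auto simp: ins_ok_def)
  show "left_module M" "l \<ge> 1" by fact+
  show "mlin l (tens_rel n N) (\<lambda>hs. ins n N m hs (\<phi> e))" if e: "e \<in> carrier M" for e
  proof -
    obtain L where L: "L \<noteq> []" "set L \<subseteq> gens k N" "\<phi> e = sum_list (map (tpure N) L)"
      using carrier_tens_gens[OF N slinD(2)[OF \<phi> e]] by auto
    have eq: "ins n N m hs (\<phi> e) = (\<Sum>g\<leftarrow>L. (\<Sum>ds\<leftarrow>cop (l - 1) (fst g ! m). tpure N (splice_at m (fst g) (map2 (*) hs ds), snd g)))"
      if hs: "length hs = l" for hs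
    proof -
      have "ins n N m hs (\<phi> e) = (\<Sum>g\<leftarrow>L. ins n N m hs (tpure N g))"
        unfolding L(3) using L by (intro ins_sum_list[OF iok hs] tpure_closed) auto
      also have "\<dots> = (\<Sum>g\<leftarrow>L. (\<Sum>ds\<leftarrow>cop (l - 1) (fst g ! m). tpure N (splice_at m (fst g) (map2 (*) hs ds), snd g)))"
      proof (rule sum_list_map_cong)
        fix g assume "g \<in> set L"
        then obtain w x where "g = (w, x)" "length w = k" "x \<in> carrier N" using L(2) by (auto simp: gens_def)
        then show "ins n N m hs (tpure N g) = (\<Sum>ds\<leftarrow>cop (l - 1) (fst g ! m). tpure N (splice_at m (fst g) (map2 (*) hs ds), snd g))"
          using ins_tpure[OF iok hs] by simp
      qed
      finally show ?thesis .
    qed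
    have "mlin l (tens_rel n N) (\<lambda>hs. (\<Sum>g\<leftarrow>L. (\<Sum>ds\<leftarrow>cop (l - 1) (fst g ! m). tpure N (splice_at m (fst g) (map2 (*) hs ds), snd g))))"
    proof (intro mlin_sum subgrp_tens_rel L(1))
      fix g ds assume g: "g \<in> set L" and ds: "ds \<in> set (cop (l - 1) (fst g ! m))"
      have "length (fst g) = k" "snd g \<in> carrier N" using g L(2) by (auto simp: gens_def)
      then show "mlin l (tens_rel n N) (\<lambda>hs. tpure N (splice_at m (fst g) (map2 (*) hs ds), snd g))"
        using m nk ins_ok_cop_length[OF iok ds]
        by (intro mlin_map2_left[OF mlin_splice_inner[OF mlin_tpure]]) auto
    next
      fix g
      show "cop (l - 1) (fst g ! m) \<noteq> []" using ins_ok_cop[OF iok, of "fst g ! m"] by (simp add: words_def)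
    qed
    then show ?thesis using mlin_cong[of l "\<lambda>hs. ins n N m hs (\<phi> e)", OF eq] by blast
  qed
  show "ins n N m hs (\<phi> (x \<oplus>\<^bsub>M\<^esub> y)) = ins n N m hs (\<phi> x) + ins n N m hs (\<phi> y)"
    if "length hs = l" "x \<in> carrier M" "y \<in> carrier M" for hs x y
    using that slinD[OF \<phi>] by (simp add: ins_add[OF iok])
  show "ins n N m hs (\<phi> (h \<odot>\<^bsub>M\<^esub> e)) = (\<Sum>ds\<leftarrow>cop (l - 1) h. ins n N m (map2 (*) hs ds) (\<phi> e))"
    if "length hs = l" "e \<in> carrier M" for hs h e
    using that slinD[OF \<phi>] by (simp add: ins_lmul_slot[OF iok])
qed

lemma plug_tpure:
  assumes "plug_ok M N n k l m" "slin M N k m \<phi>" "length hs = l" "e \<in> carrier M"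
  shows "plug n N m \<phi> (tpure M (hs, e)) = ins n N m hs (\<phi> e)"
  unfolding plug_ins using assms by (subst tlin_extend_tpure[OF tlin_plug]) (auto simp: gens_def)

lemma plug_add:
  assumes "plug_ok M N n k l m" "slin M N k m \<phi>" "X \<in> carrier (tens l M)" "Y \<in> carrier (tens l M)"
  shows "plug n N m \<phi> (X + Y) = plug n N m \<phi> X + plug n N m \<phi> Y"
  unfolding plug_ins by (rule tlin_extend_add[OF tlin_plug[OF assms(1,2)] assms(3,4)])

lemma plug_sum_list:
  assumes "plug_ok M N n k l m" "slin M N k m \<phi>" "L \<noteq> []" "\<And>x. x \<in> set L \<Longrightarrow> F x \<in> carrier (tens l M)"
  shows "plug n N m \<phi> (sum_list (map F L)) = (\<Sum>x\<leftarrow>L. plug n N m \<phi> (F x))"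
  unfolding plug_ins by (rule tlin_sum_list[OF tlin_plug[OF assms(1,2)] assms(3,4)])

lemma plug_okD:
  assumes "plug_ok M N n k l m"
  shows "ins_ok N n k l m" "left_module M" "left_module N" "m < k" "l \<ge> 1" "n + 1 = k + l" "k \<ge> 1" "n \<ge> 1"
  using assms by (auto simp: plug_ok_def ins_ok_def)

lemma plug_okI:
  "left_module M \<Longrightarrow> left_module N \<Longrightarrow> l \<ge> 1 \<Longrightarrow> m < k \<Longrightarrow> n + 1 = k + l \<Longrightarrow> plug_ok M N n k l m"
  by (simp add: plug_ok_def ins_ok_def)

lemma plug_closed:
  assumes ok: "plug_ok M N n k l m" and \<phi>: "slin M N k m \<phi>" and X: "X \<in> carrier (tens l M)"
  shows "plug n N m \<phi> X \<in> carrier (tens n N)"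
  unfolding plug_ins
  using slinD(2)[OF \<phi>] plug_okD(1)[OF ok]
  by (intro tlin_extend_closed[OF tlin_plug[OF ok \<phi>] _ X]) (auto simp: gens_def intro: ins_closed)

lemma ins_tmap:
  assumes ok: "ins_ok N n k l m" and g: "g \<in> lhom N N'" and N': "left_module N'"
    and hs: "length hs = l" and X: "X \<in> carrier (tens k N)"
  shows "tmap n N' g (ins n N m hs X) = ins n N' m hs (tmap k N' g X)"
proof -
  have N: "left_module N" and k: "k \<ge> 1" and n: "n \<ge> 1" and m: "m < k" and nk: "n + 1 = k + l"
    using ok by (auto simp: ins_ok_def)
  have ok': "ins_ok N' n k l m" using ok N' by (simp add: ins_ok_def)
  show ?thesis using X N
  proof (induction rule: tens_induct)
    case (gen w e)
    have len: "length (splice_at m w (map2 (*) hs ds)) = n" if "ds \<in> set (cop (l - 1) (w ! m))" for ds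
      using gen hs m nk ins_ok_cop_length[OF ok that] by (simp add: length_splice_at)
    have c: "tpure N (splice_at m w (map2 (*) hs ds), e) \<in> carrier (tens n N)" if "ds \<in> set (cop (l - 1) (w ! m))" for ds
      using len[OF that] gen by (intro tpure_closed) (simp add: gens_def)
    have "tmap n N' g (ins n N m hs (tpure N (w, e))) =
        (\<Sum>ds\<leftarrow>cop (l - 1) (w ! m). tmap n N' g (tpure N (splice_at m w (map2 (*) hs ds), e)))"
      unfolding ins_tpure[OF ok hs gen] tmap_def using ins_ok_cop[OF ok, of "w ! m"]
      by (intro tlin_sum_list[OF tlin_tmap[OF n N g] _ c]) (auto simp: words_def)
    also have "\<dots> = (\<Sum>ds\<leftarrow>cop (l - 1) (w ! m). tpure N' (splice_at m w (map2 (*) hs ds), g e))"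
      using gen len by (intro sum_list_map_cong tmap_tpure[OF n N g])
    finally show ?case
      using gen lhomD(1)[OF g] by (simp add: tmap_tpure[OF k N g] ins_tpure[OF ok' hs])
  next
    case (add X Y)
    then show ?case
      by (simp add: tmap_add[OF k N g] tmap_add[OF n N g] ins_add[OF ok hs] ins_add[OF ok' hs]
          ins_closed[OF ok hs] tmap_closed[OF k N g])
  qed
qed

lemma lmul_tmap:
  assumes N: "left_module N" and N': "left_module N'" and g: "g \<in> lhom N N'" and as: "length as = k" "k \<ge> 1"
    and X: "X \<in> carrier (tens k N)"
  shows "tmap k N' g (lmul N as X) = lmul N' as (tmap k N' g X)"
  using X N
proof (induction rule: tens_induct)
  case (gen w e)
  then show ?case using lhomD(1)[OF g]
    by (simp add: lmul_tpure[OF N as] lmul_tpure[OF N' as] tmap_tpure[OF as(2) N g] as)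
next
  case (add X Y)
  then show ?case
    by (simp add: lmul_add[OF N as] lmul_add[OF N' as] tmap_add[OF as(2) N g] lmul_closed[OF N as] tmap_closed[OF as(2) N g])
qed

lemma slin_tmap:
  assumes "left_module N" "left_module N'" "g \<in> lhom N N'" "slin M N k m \<phi>"
  shows "slin M N' k m (\<lambda>x. tmap k N' g (\<phi> x))"
proof -
  have k: "k \<ge> 1" using slinD(1)[OF assms(4)] by simp
  show ?thesis
    using slinD[OF assms(4)] unfolding slin_def
    by (simp add: tmap_closed[OF k assms(1,3)] tmap_add[OF k assms(1,3)] lmul_tmap[OF assms(1-3) _ k])
qed

lemma slin_comp:
  assumes "slin M N k m \<phi>" "g \<in> lhom M' M"
  shows "slin M' N k m (\<lambda>x. \<phi> (g x))"
  using assms slinD[OF assms(1)] lhomD[OF assms(2)] by (simp add: slin_def)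

lemma slin_add:
  assumes N: "left_module N" and "slin M N k m \<phi>" "slin M N k m \<psi>"
  shows "slin M N k m (\<lambda>x. \<phi> x + \<psi> x)"
proof -
  have k: "k \<ge> 1" using slinD(1)[OF assms(2)] by simp
  show ?thesis
    using slinD[OF assms(2)] slinD[OF assms(3)] unfolding slin_def
    by (auto simp: tens_add_closed lmul_add[OF N _ k] ac_simps)
qed

lemma tmap_plug:
  assumes ok: "plug_ok M N n k l m" and \<phi>: "slin M N k m \<phi>" and N': "left_module N'" and g: "g \<in> lhom N N'"
    and X: "X \<in> carrier (tens l M)"
  shows "tmap n N' g (plug n N m \<phi> X) = plug n N' m (\<lambda>e. tmap k N' g (\<phi> e)) X"
proof -
  note o = plug_okD[OF ok]
  have ok': "plug_ok M N' n k l m" using ok N' by (simp add: plug_ok_def ins_ok_def)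
  note \<phi>' = slin_tmap[OF o(3) N' g \<phi>]
  show ?thesis using X o(2)
  proof (induction rule: tens_induct)
    case (gen w e)
    then show ?case
      by (simp add: plug_tpure[OF ok \<phi>] plug_tpure[OF ok' \<phi>'] ins_tmap[OF o(1) g N'] slinD(2)[OF \<phi>])
  next
    case (add X Y)
    then show ?case
      by (simp add: plug_add[OF ok \<phi>] plug_add[OF ok' \<phi>'] tmap_add[OF o(8) o(3) g] plug_closed[OF ok \<phi>])
  qed
qed

lemma plug_tmap:
  assumes ok: "plug_ok M N n k l m" and \<phi>: "slin M N k m \<phi>" and M': "left_module M'" and g: "g \<in> lhom M' M"
    and X: "X \<in> carrier (tens l M')"
  shows "plug n N m \<phi> (tmap l M g X) = plug n N m (\<lambda>e. \<phi> (g e)) X"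
proof -
  note o = plug_okD[OF ok]
  have ok': "plug_ok M' N n k l m" using ok M' by (simp add: plug_ok_def)
  note \<phi>' = slin_comp[OF \<phi> g]
  show ?thesis using X M'
  proof (induction rule: tens_induct)
    case (gen w e)
    then show ?case
      by (simp add: plug_tpure[OF ok \<phi>] plug_tpure[OF ok' \<phi>'] tmap_tpure[OF o(5) M' g] lhomD(1)[OF g])
  next
    case (add X Y)
    then show ?case
      by (simp add: plug_add[OF ok \<phi>] plug_add[OF ok' \<phi>'] tmap_add[OF o(5) M' g] tmap_closed[OF o(5) M' g])
  qed
qed

lemma plug_add_fun:
  assumes ok: "plug_ok M N n k l m" and \<phi>: "slin M N k m \<phi>" and \<psi>: "slin M N k m \<psi>"
    and X: "X \<in> carrier (tens l M)"
  shows "plug n N m (\<lambda>e. \<phi> e + \<psi> e) X = plug n N m \<phi> X + plug n N m \<psi> X"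
proof -
  note o = plug_okD[OF ok]
  note \<theta> = slin_add[OF o(3) \<phi> \<psi>]
  show ?thesis using X o(2)
  proof (induction rule: tens_induct)
    case (gen w e)
    then show ?case
      by (simp add: plug_tpure[OF ok \<phi>] plug_tpure[OF ok \<psi>] plug_tpure[OF ok \<theta>] ins_add[OF o(1)]
          slinD(2)[OF \<phi>] slinD(2)[OF \<psi>])
  next
    case (add X Y)
    then show ?case
      by (simp add: plug_add[OF ok \<phi>] plug_add[OF ok \<psi>] plug_add[OF ok \<theta>] ac_simps)
  qed
qed

lemma slin_cong:
  assumes "left_module M" "slin M N k m \<phi>" "\<And>x. x \<in> carrier M \<Longrightarrow> \<psi> x = \<phi> x"
  shows "slin M N k m \<psi>"
proof -
  interpret M: left_module M by fact
  show ?thesis using assms(2,3) by (auto simp: slin_def M.smult_closed)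
qed

lemma plug_cong:
  assumes ok: "plug_ok M N n k l m" and \<phi>: "slin M N k m \<phi>" and eq: "\<And>x. x \<in> carrier M \<Longrightarrow> \<phi> x = \<psi> x"
    and X: "X \<in> carrier (tens l M)"
  shows "plug n N m \<phi> X = plug n N m \<psi> X"
proof -
  note o = plug_okD[OF ok]
  have \<psi>: "slin M N k m \<psi>" using slin_cong[OF o(2) \<phi>] eq by force
  show ?thesis using X o(2)
  proof (induction rule: tens_induct)
    case (gen w e)
    then show ?case by (simp add: plug_tpure[OF ok \<phi>] plug_tpure[OF ok \<psi>] eq)
  next
    case (add X Y)
    then show ?case by (simp add: plug_add[OF ok \<phi>] plug_add[OF ok \<psi>])
  qed
qed

lemma slots_tmap:
  assumes \<sigma>: "cop_inv \<sigma>" and M: "left_module M" and N: "left_module N" and g: "g \<in> lhom M N"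
    and X: "X \<in> carrier (tens n M)" and n: "length \<sigma> = n"
  shows "tmap n N g (slots M \<sigma> X) = slots N \<sigma> (tmap n N g X)"
proof -
  have n1: "n \<ge> 1" using cop_invD(2)[OF \<sigma>] n by simp
  show ?thesis using X M
  proof (induction rule: tens_induct)
    case (gen w e)
    then show ?case using n lhomD(1)[OF g]
      by (simp add: slots_tpure[OF \<sigma> M] slots_tpure[OF \<sigma> N] tmap_tpure[OF n1 M g])
  next
    case (add X Y)
    then show ?case using slots_closed[OF \<sigma> M] n
      by (simp add: slots_add[OF \<sigma> M] slots_add[OF \<sigma> N] tmap_add[OF n1 M g] tmap_closed[OF n1 M g])
  qed
qed

lemma slots_slots:
  assumes \<sigma>: "cop_inv \<sigma>" and \<tau>: "cop_inv \<tau>" and M: "left_module M"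
    and n: "length \<sigma> = n" "length \<tau> = n" and X: "X \<in> carrier (tens n M)"
  shows "slots M \<sigma> (slots M \<tau> X) = slots M (map ((!) \<tau>) \<sigma>) X"
proof -
  have \<rho>: "cop_inv (map ((!) \<tau>) \<sigma>)" using cop_inv_comp[OF \<sigma> \<tau>] n by (simp add: perm_def)
  show ?thesis using X M
  proof (induction rule: tens_induct)
    case (gen w e)
    then show ?case using n cop_invD(1)[OF \<sigma>]
      by (simp add: slots_tpure[OF \<sigma> M] slots_tpure[OF \<tau> M] slots_tpure[OF \<rho> M] perm_perm perm_def[of \<sigma> \<tau>])
  next
    case (add X Y)
    then show ?case using slots_closed[OF \<tau> M] n
      by (simp add: slots_add[OF \<sigma> M] slots_add[OF \<tau> M] slots_add[OF \<rho> M])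
  qed
qed

lemma slots_id:
  assumes \<sigma>: "cop_inv [0..<n]" and M: "left_module M" and X: "X \<in> carrier (tens n M)"
  shows "slots M [0..<n] X = X"
  using X M
proof (induction rule: tens_induct)
  case (gen w e)
  then show ?case using map_nth[of w] by (simp add: slots_tpure[OF \<sigma> M] perm_def)
next
  case (add X Y)
  then show ?case by (simp add: slots_add[OF \<sigma> M])
qed

lemma slin_slots:
  assumes \<tau>: "cop_inv \<tau>" "length \<tau> = k" and N: "left_module N" and \<phi>: "slin M N k m \<phi>" and m: "m' < k" "\<tau> ! m' = m"
  shows "slin M N k m' (\<lambda>x. slots N \<tau> (\<phi> x))"
proof -
  have k: "k \<ge> 1" using m by simp
  have u: "length (unit_at k m h) = k" "length (unit_at k m' h) = k" for h by auto
  have mk: "m < k" using slinD(1)[OF \<phi>] .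
  have "slots N \<tau> (lmul N (unit_at k m h) X) = lmul N (unit_at k m' h) (slots N \<tau> X)" if "X \<in> carrier (tens k N)" for X h
    using that N
  proof (induction rule: tens_induct)
    case (gen w e)
    have 1: "perm \<tau> (w[m := h * w ! m]) = (perm \<tau> w)[m' := h * w ! m]"
      using \<tau> m mk gen by (intro perm_update) (auto simp: cop_inv_def)
    have 2: "perm \<tau> w ! m' = w ! m" using m \<tau> by (simp add: perm_def)
    show ?case using gen \<tau> m mk
      by (simp add: lmul_tpure[OF N u(1) k] lmul_tpure[OF N u(2) k] slots_tpure[OF \<tau>(1) N] map2_unit_at 1 2)
  next
    case (add X Y)
    then show ?case
      using slots_closed[OF \<tau>(1) N] \<tau>(2)
      by (simp add: lmul_add[OF N u(1) k] lmul_add[OF N u(2) k] slots_add[OF \<tau>(1) N] lmul_closed[OF N u(1) k])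
  qed
  then show ?thesis
    using slinD[OF \<phi>] m slots_closed[OF \<tau>(1) N] slots_add[OF \<tau>(1) N] \<tau>(2) by (simp add: slin_def)
qed

lemma splice_unit_at_inner:
  "m < k \<Longrightarrow> j < l \<Longrightarrow> n + 1 = k + l \<Longrightarrow> splice_at m (replicate k 1) (unit_at l j h) = unit_at n (m + j) h"
  by (rule nth_equalityI)
    (auto simp: length_splice_at unit_at_def splice_at_def nth_append nth_list_update)

lemma splice_unit_at_outer:
  assumes "m < k" "i < k" "i \<noteq> m" "n + 1 = k + l"
  shows "splice_at m (unit_at k i h) (replicate l 1) = unit_at n (if i < m then i else i + l - 1) h"
proof -
  have "splice_at m (replicate k (1::'h)) (replicate l 1) = replicate m 1 @ replicate l 1 @ replicate (k - Suc m) 1"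
    using assms by (simp add: splice_at_def min_def)
  also have "\<dots> = replicate (m + (l + (k - Suc m))) 1" by (simp only: replicate_add)
  also have "m + (l + (k - Suc m)) = n" using assms by simp
  finally have 1: "splice_at m (replicate k (1::'h)) (replicate l 1) = replicate n 1" .
  show ?thesis
  proof (cases "i < m")
    case True
    then show ?thesis using assms by (simp add: unit_at_def splice_at_update_less 1)
  next
    case False
    then have "m < i" "i - 1 + l = i + l - 1" using assms by auto
    then show ?thesis using assms False by (simp add: unit_at_def splice_at_update_greater 1)
  qed
qed

lemma lmul_ones:
  assumes N: "left_module N" and X: "X \<in> carrier (tens k N)" and k: "k \<ge> 1"
  shows "lmul N (replicate k 1) X = X"
proof -
  have u: "length (replicate k (1::'h)) = k" by simp
  show ?thesis using X N
  proof (induction rule: tens_induct)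
    case (gen w e)
    then show ?case by (simp add: lmul_tpure[OF N u k])
  next
    case (add X Y)
    then show ?case by (simp add: lmul_add[OF N u k])
  qed
qed

lemma slin_plug_inner:
  assumes ok: "plug_ok M' N n k l m" and \<phi>: "slin M' N k m \<phi>" and \<psi>: "slin M M' l j \<psi>"
  shows "slin M N n (m + j) (\<lambda>x. plug n N m \<phi> (\<psi> x))"
proof -
  note o = plug_okD[OF ok]
  have j: "j < l" using slinD(1)[OF \<psi>] .
  have u: "length (unit_at l j h) = l" "length (unit_at n (m + j) h) = n" for h by auto
  have "plug n N m \<phi> (lmul M' (unit_at l j h) X) = lmul N (unit_at n (m + j) h) (plug n N m \<phi> X)"
    if "X \<in> carrier (tens l M')" for X h
    using that o(2)
  proof (induction rule: tens_induct)
    case (gen w e)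
    have "ins n N m (map2 (*) (unit_at l j h) w) (lmul N (replicate k 1) (\<phi> e)) =
        lmul N (splice_at m (replicate k 1) (unit_at l j h)) (ins n N m w (\<phi> e))"
      using gen o slinD[OF \<phi>] by (intro ins_lmul[OF o(1)]) auto
    then have "ins n N m (map2 (*) (unit_at l j h) w) (\<phi> e) = lmul N (unit_at n (m + j) h) (ins n N m w (\<phi> e))"
      using gen slinD(2)[OF \<phi>] by (simp add: lmul_ones[OF o(3) _ o(7)] splice_unit_at_inner[OF o(4) j o(6)])
    then show ?case using gen by (simp add: lmul_tpure[OF o(2) u(1) o(5)] plug_tpure[OF ok \<phi>])
  next
    case (add X Y)
    then show ?case
      by (simp add: lmul_add[OF o(2) u(1) o(5)] lmul_add[OF o(3) u(2) o(8)] plug_add[OF ok \<phi>]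
          lmul_closed[OF o(2) u(1) o(5)] plug_closed[OF ok \<phi>])
  qed
  then show ?thesis
    using slinD[OF \<psi>] o j by (auto simp: slin_def plug_closed[OF ok \<phi>] plug_add[OF ok \<phi>])
qed

text \<open>Linearity of a composite in an argument \<open>i\<close> of the outer map other than the
  filled one. The filled slot is widened to \<open>l\<close> slots, so arguments to its right move
  by \<open>l - 1\<close> and those to its left stay.\<close>

lemma slin_plug_param:
  assumes ok: "plug_ok M N n k l m" and \<phi>: "\<And>x. x \<in> carrier A \<Longrightarrow> slin M N k m (\<phi> x)"
    and \<psi>: "\<And>y. y \<in> carrier M \<Longrightarrow> slin A N k i (\<lambda>x. \<phi> x y)" and i: "i < k" "i \<noteq> m"
    and A: "left_module A" and X: "X \<in> carrier (tens l M)"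
  shows "slin A N n (if i < m then i else i + l - 1) (\<lambda>x. plug n N m (\<phi> x) X)"
proof -
  interpret A: left_module A by (rule A)
  note o = plug_okD[OF ok]
  let ?i = "if i < m then i else i + l - 1"
  have iu: "?i < n" using o i by auto
  have u: "length (unit_at k i h) = k" "length (unit_at n ?i h) = n" for h by auto
  have uim: "unit_at k i h ! m = 1" for h using i o by (simp add: unit_at_def)
  have "plug n N m (\<phi> (h \<odot>\<^bsub>A\<^esub> x)) X = lmul N (unit_at n ?i h) (plug n N m (\<phi> x) X)" if x: "x \<in> carrier A" for x h
  proof -
    have hx: "h \<odot>\<^bsub>A\<^esub> x \<in> carrier A" using x by (rule A.smult_closed)
    show ?thesis using X o(2)
    proof (induction rule: tens_induct)
      case (gen w e)
      have "ins n N m (map2 (*) (replicate l 1) w) (lmul N (unit_at k i h) (\<phi> x e)) =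
          lmul N (splice_at m (unit_at k i h) (replicate l 1)) (ins n N m w (\<phi> x e))"
        using gen o slinD(2)[OF \<phi>[OF x]] uim by (intro ins_lmul[OF o(1)]) auto
      then show ?case
        using gen slinD(4)[OF \<psi>[OF gen(2)] x]
        by (simp add: plug_tpure[OF ok \<phi>[OF x]] plug_tpure[OF ok \<phi>[OF hx]] splice_unit_at_outer[OF o(4) i o(6)])
    next
      case (add X Y)
      then show ?case
        by (simp only: lmul_add[OF o(3) u(2) o(8)] plug_add[OF ok \<phi>[OF x]] plug_add[OF ok \<phi>[OF hx]] plug_closed[OF ok \<phi>[OF x]])
    qed
  qed
  moreover have "plug n N m (\<phi> (x \<oplus>\<^bsub>A\<^esub> y)) X = plug n N m (\<phi> x) X + plug n N m (\<phi> y) X"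
    if xy: "x \<in> carrier A" "y \<in> carrier A" for x y
  proof -
    have "plug n N m (\<phi> (x \<oplus>\<^bsub>A\<^esub> y)) X = plug n N m (\<lambda>e. \<phi> x e + \<phi> y e) X"
      using slinD(3)[OF \<psi> xy] xy by (intro plug_cong[OF ok \<phi> _ X]) auto
    then show ?thesis by (simp only: plug_add_fun[OF ok \<phi>[OF xy(1)] \<phi>[OF xy(2)] X])
  qed
  ultimately show ?thesis
    using iu plug_closed[OF ok \<phi> X] unfolding slin_def by blast
qed

text \<open>Slot \<open>m\<close> of the outer value is split into \<open>p\<close> letters, the
  \<open>j\<close>-th of which is multiplied by \<open>gs ! j\<close> and split again into
  \<open>l\<close>. Multiplicativity separates the coproduct of \<open>gs ! j\<close>, and
  coassociativity merges the two splittings of \<open>w ! m\<close> into one with \<open>q\<close>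
  letters.\<close>

lemma ins_ins:
  assumes okq: "ins_ok N n k q m" and okr: "ins_ok N r k p m" and okn: "ins_ok N n r l (m + j)"
    and okp: "ins_ok N' q p l j"
    and hs: "length hs = l" and gs: "length gs = p" and Z: "Z \<in> carrier (tens k N)"
  shows "ins n N (m + j) hs (ins r N m gs Z) =
    (\<Sum>as\<leftarrow>cop (l - 1) (gs ! j). ins n N m (splice_at j gs (map2 (*) hs as)) Z)"
proof -
  have N: "left_module N" and k: "k \<ge> 1" and m: "m < k" and j: "j < p" and l: "l \<ge> 1" and p: "p \<ge> 1"
    and rk: "r + 1 = k + p" and ql: "q + 1 = p + l" and nk: "n + 1 = k + q" and nr: "n + 1 = r + l" and q1: "q \<ge> 1"
    using okq okr okn okp by (auto simp: ins_ok_def)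
  have lq: "length (splice_at j gs (map2 (*) hs as)) = q" if "as \<in> set (cop (l - 1) (gs ! j))" for as
    using ins_ok_cop_length[OF okp that] gs hs j ql by (simp add: length_splice_at)
  show ?thesis using Z N
  proof (induction rule: tens_induct)
    case (gen w e)
    let ?G = "\<lambda>v. tpure N (v, e)"
    have G: "mlin n (tens_rel n N) ?G" by (rule mlin_tpure[OF gen(2)])
    have lr: "length (splice_at m w (map2 (*) gs ds)) = r" if "ds \<in> set (cop (p - 1) h)" for ds h
      using ins_ok_cop_length[OF okr that] gen gs m rk by (simp add: length_splice_at)
    have "ins n N (m + j) hs (ins r N m gs (tpure N (w, e))) =
        (\<Sum>ds\<leftarrow>cop (p - 1) (w ! m). ins n N (m + j) hs (?G (splice_at m w (map2 (*) gs ds))))"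
      unfolding ins_tpure[OF okr gs gen]
      using ins_ok_cop[OF okr, of "w ! m"] gen lr[of _ "w ! m"]
      by (intro ins_sum_list[OF okn hs] tpure_closed) (auto simp: words_def gens_def)
    also have "\<dots> = (\<Sum>ds\<leftarrow>cop (p - 1) (w ! m). \<Sum>as\<leftarrow>cop (l - 1) (gs ! j). (\<Sum>bs\<leftarrow>cop (l - 1) (ds ! j). ?G (splice_at m w (map2 (*) (splice_at j gs (map2 (*) hs as)) (splice_at j ds bs)))))"
    proof (rule sum_list_map_cong)
      fix ds assume dsc: "ds \<in> set (cop (p - 1) (w ! m))"
      then have ds: "length ds = p" by (rule ins_ok_cop_length[OF okr])
      let ?v = "splice_at m w (map2 (*) gs ds)"
      have vj: "?v ! (m + j) = gs ! j * ds ! j"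
        using gen m j gs ds by (subst nth_splice_at_inner) auto
      have F: "mlin (Suc (l - 1)) (tens_rel n N) (\<lambda>es. ?G (splice_at (m + j) ?v (map2 (*) hs es)))"
        using mlin_ins_inner[OF gen(2) hs lr[OF dsc], of "m + j" n] m j rk nr l by simp
      have "ins n N (m + j) hs (?G ?v) =
          (\<Sum>es\<leftarrow>cop (l - 1) (gs ! j * ds ! j). ?G (splice_at (m + j) ?v (map2 (*) hs es)))"
        using ins_tpure[OF okn hs lr[OF dsc] gen(2)] vj by simp
      also have "\<dots> = (\<Sum>as\<leftarrow>cop (l - 1) (gs ! j). (\<Sum>bs\<leftarrow>cop (l - 1) (ds ! j). ?G (splice_at (m + j) ?v (map2 (*) hs (map2 (*) as bs)))))"
        by (rule sum_cop_mult[OF F])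
      also have "\<dots> = (\<Sum>as\<leftarrow>cop (l - 1) (gs ! j). (\<Sum>bs\<leftarrow>cop (l - 1) (ds ! j). ?G (splice_at m w (map2 (*) (splice_at j gs (map2 (*) hs as)) (splice_at j ds bs)))))"
      proof (intro sum_list_map_cong)
        fix as bs assume "as \<in> set (cop (l - 1) (gs ! j))" "bs \<in> set (cop (l - 1) (ds ! j))"
        then have "length as = l" "length bs = l" using ins_ok_cop_length[OF okp] by blast+
        moreover have "splice_at (m + j) ?v es = splice_at m w (splice_at j (map2 (*) gs ds) es)" for es
          using gen m j gs ds by (intro splice_at_splice_at[symmetric]) auto
        ultimately show "?G (splice_at (m + j) ?v (map2 (*) hs (map2 (*) as bs))) =
            ?G (splice_at m w (map2 (*) (splice_at j gs (map2 (*) hs as)) (splice_at j ds bs)))"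
          using gs ds hs j by (simp add: map2_splice_at map2_mult_assoc)
      qed
      finally show "ins n N (m + j) hs (?G ?v) = (\<Sum>as\<leftarrow>cop (l - 1) (gs ! j). (\<Sum>bs\<leftarrow>cop (l - 1) (ds ! j). ?G (splice_at m w (map2 (*) (splice_at j gs (map2 (*) hs as)) (splice_at j ds bs)))))" .
    qed
    also have "\<dots> = (\<Sum>as\<leftarrow>cop (l - 1) (gs ! j). \<Sum>ds\<leftarrow>cop (p - 1) (w ! m). (\<Sum>bs\<leftarrow>cop (l - 1) (ds ! j). ?G (splice_at m w (map2 (*) (splice_at j gs (map2 (*) hs as)) (splice_at j ds bs)))))"
      by (rule sum_list_swap)
    also have "\<dots> = (\<Sum>as\<leftarrow>cop (l - 1) (gs ! j). ins n N m (splice_at j gs (map2 (*) hs as)) (tpure N (w, e)))"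
    proof (rule sum_list_map_cong)
      fix as assume as: "as \<in> set (cop (l - 1) (gs ! j))"
      have eq: "p - 1 + (l - 1) = q - 1" "Suc (q - 1) = q" using p l ql q1 by auto
      have F: "mlin (Suc (p - 1 + (l - 1))) (tens_rel n N)
          (\<lambda>es. ?G (splice_at m w (map2 (*) (splice_at j gs (map2 (*) hs as)) es)))"
        unfolding eq by (rule mlin_ins_inner[OF gen(2) lq[OF as] gen(1) m nk])
      have "j \<le> p - 1" using j by simp
      from sum_cop_coassoc[OF F this, of "w ! m"]
      show "(\<Sum>ds\<leftarrow>cop (p - 1) (w ! m). (\<Sum>bs\<leftarrow>cop (l - 1) (ds ! j). ?G (splice_at m w (map2 (*) (splice_at j gs (map2 (*) hs as)) (splice_at j ds bs))))) = ins n N m (splice_at j gs (map2 (*) hs as)) (tpure N (w, e))"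
        unfolding ins_tpure[OF okq lq[OF as] gen] eq .
    qed
    finally show ?case .
  next
    case (add X Y)
    have "(\<Sum>as\<leftarrow>cop (l - 1) (gs ! j). ins n N m (splice_at j gs (map2 (*) hs as)) (X + Y)) =
      (\<Sum>as\<leftarrow>cop (l - 1) (gs ! j). ins n N m (splice_at j gs (map2 (*) hs as)) X + ins n N m (splice_at j gs (map2 (*) hs as)) Y)"
      using add by (intro sum_list_map_cong ins_add[OF okq lq])
    with add show ?case
      by (simp add: ins_add[OF okr gs] ins_add[OF okn hs] ins_closed[OF okr gs] sum_list_addf)
  qed
qed

text \<open>Associativity of composition, reduced to \<open>ins_ins\<close> on generators. The outer
  and inner maps have arities \<open>k\<close> and \<open>p\<close>, and \<open>X\<close> has
  \<open>l\<close> slots; \<open>q\<close> is the arity after filling the inner map,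
  \<open>r\<close> that of the composite of the two maps, and \<open>n\<close> the total.\<close>

lemma plug_plug:
  assumes okq: "plug_ok M' N n k q m" and okr: "plug_ok M' N r k p m" and okn: "plug_ok M N n r l (m + j)"
    and okp: "plug_ok M M' q p l j" and \<phi>: "slin M' N k m \<phi>" and \<psi>: "slin M M' p j \<psi>"
    and X: "X \<in> carrier (tens l M)"
  shows "plug n N m \<phi> (plug q M' j \<psi> X) = plug n N (m + j) (\<lambda>e. plug r N m \<phi> (\<psi> e)) X"
proof -
  note q = plug_okD[OF okq] and r = plug_okD[OF okr] and n = plug_okD[OF okn] and p = plug_okD[OF okp]
  note \<theta> = slin_plug_inner[OF okr \<phi> \<psi>]
  have main: "plug n N m \<phi> (ins q M' j hs Y) = ins n N (m + j) hs (plug r N m \<phi> Y)"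
    if hs: "length hs = l" and Y: "Y \<in> carrier (tens p M')" for hs Y
    using Y q(2)
  proof (induction rule: tens_induct)
    case (gen gs e)
    have l: "length (splice_at j gs (map2 (*) hs as)) = q" if "as \<in> set (cop (l - 1) (gs ! j))" for as
      using ins_ok_cop_length[OF p(1) that] gen hs p by (auto simp: length_splice_at)
    have "plug n N m \<phi> (ins q M' j hs (tpure M' (gs, e))) =
        (\<Sum>as\<leftarrow>cop (l - 1) (gs ! j). plug n N m \<phi> (tpure M' (splice_at j gs (map2 (*) hs as), e)))"
      unfolding ins_tpure[OF p(1) hs gen] using ins_ok_cop[OF p(1), of "gs ! j"] gen l
      by (intro plug_sum_list[OF okq \<phi>] tpure_closed) (auto simp: words_def gens_def)
    also have "\<dots> = (\<Sum>as\<leftarrow>cop (l - 1) (gs ! j). ins n N m (splice_at j gs (map2 (*) hs as)) (\<phi> e))"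
      by (intro sum_list_map_cong plug_tpure[OF okq \<phi> l gen(2)])
    also have "\<dots> = ins n N (m + j) hs (ins r N m gs (\<phi> e))"
      by (rule ins_ins[OF q(1) r(1) n(1) p(1) hs gen(1) slinD(2)[OF \<phi> gen(2)], symmetric])
    finally show ?case using gen by (simp add: plug_tpure[OF okr \<phi>])
  next
    case (add X Y)
    then show ?case
      by (simp add: ins_add[OF p(1) hs] ins_add[OF n(1) hs] plug_add[OF okq \<phi>] plug_add[OF okr \<phi>]
          ins_closed[OF p(1) hs] plug_closed[OF okr \<phi>])
  qed
  show ?thesis using X n(2)
  proof (induction rule: tens_induct)
    case (gen hs e)
    then show ?case
      by (simp add: plug_tpure[OF okp \<psi>] plug_tpure[OF okn \<theta>] main slinD(2)[OF \<psi>])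
  next
    case (add X Y)
    then show ?case
      by (simp add: plug_add[OF okp \<psi>] plug_add[OF okn \<theta>] plug_add[OF okq \<phi>] plug_closed[OF okp \<psi>])
  qed
qed

lemma splice_at_commute:
  fixes w :: "'a list"
  assumes "i < m" "m < length w"
  shows "splice_at i (splice_at m w ds) es = splice_at (m + length es - 1) (splice_at i w es) ds"
proof -
  define A B C where "A = take i w" "B = take (m - Suc i) (drop (Suc i) w)" "C = drop (Suc m) w"
  have "drop (Suc i) w = B @ w ! m # C"
    using assms id_take_nth_drop[of "m - Suc i" "drop (Suc i) w"] unfolding A_B_C_def by simp
  then have w: "w = A @ w ! i # B @ w ! m # C"
    using assms id_take_nth_drop[of i w] by (simp add: A_B_C_def(1))
  have len: "i = length A" "m = length (A @ w ! i # B)"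
    using assms by (auto simp: A_B_C_def)
  have sp: "splice_at (length X) (X @ y # Z) es = X @ es @ Z" for X Z es and y :: 'a
    by (simp add: splice_at_def)
  have 1: "splice_at m w ds = (A @ w ! i # B) @ ds @ C"
    using sp[of "A @ w ! i # B" "w ! m" C ds] w unfolding len(2)[symmetric] by simp
  have 2: "splice_at i w es = A @ es @ B @ w ! m # C"
    using sp[of A "w ! i" "B @ w ! m # C" es] w unfolding len(1)[symmetric] by simp
  have 3: "m + length es - 1 = length (A @ es @ B)" using len by simp
  have "splice_at i (splice_at m w ds) es = A @ es @ B @ ds @ C"
    unfolding 1 using sp[of A "w ! i" "B @ ds @ C" es] unfolding len(1)[symmetric] by simp
  moreover have "splice_at (m + length es - 1) (splice_at i w es) ds = A @ es @ B @ ds @ C"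
    unfolding 2 3 using sp[of "A @ es @ B" "w ! m" C ds] by simp
  ultimately show ?thesis by simp
qed

text \<open>The two coproducts act on different letters of the outer value, so this is an exchange
  of finite sums. Filling the earlier slot \<open>i\<close> by \<open>l\<close> slots moves slot
  \<open>m\<close> to \<open>m + l - 1\<close>.\<close>

lemma ins_commute:
  assumes okr: "ins_ok N r k p m" and okn: "ins_ok N n r l i" and okr': "ins_ok N r' k l i"
    and okn': "ins_ok N n r' p (m + l - 1)" and im: "i < m"
    and hs: "length hs = l" and gs: "length gs = p" and Z: "Z \<in> carrier (tens k N)"
  shows "ins n N i hs (ins r N m gs Z) = ins n N (m + l - 1) gs (ins r' N i hs Z)"
proof -
  have N: "left_module N" and k: "k \<ge> 1" and m: "m < k" and l: "l \<ge> 1" and p: "p \<ge> 1"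
    and rk: "r + 1 = k + p" and rk': "r' + 1 = k + l" and nr: "n + 1 = r + l"
    using okr okn okr' by (auto simp: ins_ok_def)
  show ?thesis using Z N
  proof (induction rule: tens_induct)
    case (gen w e)
    let ?G = "\<lambda>v. tpure N (v, e)"
    have lr: "length (splice_at m w (map2 (*) gs ds)) = r" if "ds \<in> set (cop (p - 1) (w ! m))" for ds
      using ins_ok_cop_length[OF okr that] gen gs m rk by (simp add: length_splice_at)
    have lr': "length (splice_at i w (map2 (*) hs ds)) = r'" if "ds \<in> set (cop (l - 1) (w ! i))" for ds
      using ins_ok_cop_length[OF okr' that] gen hs m im rk' by (simp add: length_splice_at)
    have "ins n N i hs (ins r N m gs (tpure N (w, e))) =
        (\<Sum>ds\<leftarrow>cop (p - 1) (w ! m). ins n N i hs (?G (splice_at m w (map2 (*) gs ds))))"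
      unfolding ins_tpure[OF okr gs gen]
      using ins_ok_cop[OF okr, of "w ! m"] gen lr
      by (intro ins_sum_list[OF okn hs] tpure_closed) (auto simp: words_def gens_def)
    also have "\<dots> = (\<Sum>ds\<leftarrow>cop (p - 1) (w ! m). (\<Sum>es\<leftarrow>cop (l - 1) (w ! i). ?G (splice_at i (splice_at m w (map2 (*) gs ds)) (map2 (*) hs es))))"
    proof (rule sum_list_map_cong)
      fix ds assume ds: "ds \<in> set (cop (p - 1) (w ! m))"
      have "splice_at m w (map2 (*) gs ds) ! i = w ! i" using im m gen by (intro nth_splice_at_less) auto
      then show "ins n N i hs (?G (splice_at m w (map2 (*) gs ds))) = (\<Sum>es\<leftarrow>cop (l - 1) (w ! i). ?G (splice_at i (splice_at m w (map2 (*) gs ds)) (map2 (*) hs es)))"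
        using ins_tpure[OF okn hs lr[OF ds] gen(2)] by simp
    qed
    also have "\<dots> = (\<Sum>es\<leftarrow>cop (l - 1) (w ! i). (\<Sum>ds\<leftarrow>cop (p - 1) (w ! m). ?G (splice_at i (splice_at m w (map2 (*) gs ds)) (map2 (*) hs es))))"
      by (rule sum_list_swap)
    also have "\<dots> = (\<Sum>es\<leftarrow>cop (l - 1) (w ! i). ins n N (m + l - 1) gs (?G (splice_at i w (map2 (*) hs es))))"
    proof (rule sum_list_map_cong)
      fix es assume es: "es \<in> set (cop (l - 1) (w ! i))"
      have le: "length (map2 (*) hs es) = l" using ins_ok_cop_length[OF okr' es] hs by simp
      have "splice_at i w (map2 (*) hs es) ! (m - 1 + length (map2 (*) hs es)) = w ! m"
        using im m gen by (intro nth_splice_at_greater) auto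
      moreover have "m - 1 + length (map2 (*) hs es) = m + l - 1" using le im by simp
      ultimately have "splice_at i w (map2 (*) hs es) ! (m + l - 1) = w ! m" by simp
      moreover have "splice_at i (splice_at m w ds) (map2 (*) hs es) =
          splice_at (m + l - 1) (splice_at i w (map2 (*) hs es)) ds" for ds
        using splice_at_commute[OF im, of w ds "map2 (*) hs es"] gen m le by simp
      ultimately show "(\<Sum>ds\<leftarrow>cop (p - 1) (w ! m). ?G (splice_at i (splice_at m w (map2 (*) gs ds)) (map2 (*) hs es))) =
        ins n N (m + l - 1) gs (?G (splice_at i w (map2 (*) hs es)))"
        using ins_tpure[OF okn' gs lr'[OF es] gen(2)] by simp
    qed
    also have "\<dots> = ins n N (m + l - 1) gs (ins r' N i hs (tpure N (w, e)))"
      unfolding ins_tpure[OF okr' hs gen]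
      using ins_ok_cop[OF okr', of "w ! i"] gen lr'
      by (intro ins_sum_list[OF okn' gs, symmetric] tpure_closed) (auto simp: words_def gens_def)
    finally show ?case .
  next
    case (add X Y)
    then show ?case
      by (simp add: ins_add[OF okr gs] ins_add[OF okn hs] ins_add[OF okr' hs] ins_add[OF okn' gs]
          ins_closed[OF okr gs] ins_closed[OF okr' hs] del: One_nat_def)
  qed
qed

text \<open>Both inserted elements vary, hence an induction over \<open>X\<close> with one over
  \<open>Y\<close> inside it; two generators are the case of \<open>ins_commute\<close>.\<close>

lemma plug_commute:
  assumes okr: "plug_ok B N r k p m" and okn: "plug_ok A N n r l i" and okr': "plug_ok A N r' k l i"
    and okn': "plug_ok B N n r' p (m + l - 1)" and im: "i < m"
    and \<phi>: "\<And>x. x \<in> carrier A \<Longrightarrow> slin B N k m (\<phi> x)" and \<psi>: "\<And>y. y \<in> carrier B \<Longrightarrow> slin A N k i (\<lambda>x. \<phi> x y)"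
    and X: "X \<in> carrier (tens l A)" and Y: "Y \<in> carrier (tens p B)"
  shows "plug n N i (\<lambda>x. plug r N m (\<phi> x) Y) X = plug n N (m + l - 1) (\<lambda>y. plug r' N i (\<lambda>x. \<phi> x y) X) Y"
proof -
  note r = plug_okD[OF okr] and n = plug_okD[OF okn] and r' = plug_okD[OF okr'] and n' = plug_okD[OF okn']
  have ik: "i < k" "i \<noteq> m" using im r(4) by auto
  have \<theta>: "slin A N r i (\<lambda>x. plug r N m (\<phi> x) Y)" if "Y \<in> carrier (tens p B)" for Y
    using slin_plug_param[OF okr \<phi> \<psi> ik n(2) that] im by simp
  have \<eta>: "slin B N r' (m + l - 1) (\<lambda>y. plug r' N i (\<lambda>x. \<phi> x y) X)" if "X \<in> carrier (tens l A)" for X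
    using slin_plug_param[where \<phi>="\<lambda>y x. \<phi> x y", OF okr' \<psi> \<phi> _ _ r(2) that] im r(4) by simp
  show ?thesis using X n(2)
  proof (induction rule: tens_induct)
    case (gen hs x)
    have 1: "plug n N i (\<lambda>x. plug r N m (\<phi> x) Y) (tpure A (hs, x)) = ins n N i hs (plug r N m (\<phi> x) Y)"
      by (rule plug_tpure[OF okn \<theta>[OF Y] gen])
    have c: "tpure A (hs, x) \<in> carrier (tens l A)" using gen by (intro tpure_closed) (simp add: gens_def)
    have "ins n N i hs (plug r N m (\<phi> x) Y) = plug n N (m + l - 1) (\<lambda>y. plug r' N i (\<lambda>x. \<phi> x y) (tpure A (hs, x))) Y"
      using Y r(2)
    proof (induction rule: tens_induct)
      case (gen gs y)
      note hx = \<open>length hs = l\<close> \<open>x \<in> carrier A\<close>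
      have "ins n N i hs (ins r N m gs (\<phi> x y)) = ins n N (m + l - 1) gs (ins r' N i hs (\<phi> x y))"
        by (rule ins_commute[OF r(1) n(1) r'(1) n'(1) im hx(1) gen(1) slinD(2)[OF \<phi>[OF hx(2)] gen(2)]])
      then show ?case
        using gen hx by (simp add: plug_tpure[OF okr \<phi>[OF hx(2)]] plug_tpure[OF okn' \<eta>[OF c]] plug_tpure[OF okr' \<psi>[OF gen(2)]] del: One_nat_def)
    next
      case (add Y Y')
      note hx = \<open>length hs = l\<close> \<open>x \<in> carrier A\<close>
      show ?case using add
        by (simp add: plug_add[OF okr \<phi>[OF hx(2)]] plug_add[OF okn' \<eta>[OF c]] ins_add[OF n(1) hx(1)] plug_closed[OF okr \<phi>[OF hx(2)]] del: One_nat_def)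
    qed
    with 1 show ?case by (simp only:)
  next
    case (add X X')
    have "plug n N (m + l - 1) (\<lambda>y. plug r' N i (\<lambda>x. \<phi> x y) (X + X')) Y =
        plug n N (m + l - 1) (\<lambda>y. plug r' N i (\<lambda>x. \<phi> x y) X + plug r' N i (\<lambda>x. \<phi> x y) X') Y"
      using add by (intro plug_cong[OF okn' \<eta> plug_add[OF okr' \<psi>] Y] tens_add_closed) auto
    also have "\<dots> = plug n N (m + l - 1) (\<lambda>y. plug r' N i (\<lambda>x. \<phi> x y) X) Y + plug n N (m + l - 1) (\<lambda>y. plug r' N i (\<lambda>x. \<phi> x y) X') Y"
      by (rule plug_add_fun[OF okn' \<eta>[OF add(1)] \<eta>[OF add(2)] Y])
    finally show ?case using add by (simp add: plug_add[OF okn \<theta>[OF Y]] del: One_nat_def)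
  qed
qed

text \<open>Equivariance under permutations of the arguments of the outer map: \<open>\<sigma>\<close> is the block
  permutation induced by \<open>\<tau>\<close>.\<close>

lemma slots_plug_outer:
  assumes ok: "plug_ok M N n k l m" and ok': "plug_ok M N n k l m'" and \<phi>: "slin M N k m \<phi>"
    and \<sigma>: "cop_inv \<sigma>" "length \<sigma> = n" and \<tau>: "cop_inv \<tau>" "length \<tau> = k" and m': "\<tau> ! m' = m"
    and blk: "\<And>fs es. length fs = k \<Longrightarrow> length es = l \<Longrightarrow>
      perm \<sigma> (splice_at m fs es) = splice_at m' (perm \<tau> fs) (es :: 'h list)"
    and X: "X \<in> carrier (tens l M)"
  shows "slots N \<sigma> (plug n N m \<phi> X) = plug n N m' (\<lambda>e. slots N \<tau> (\<phi> e)) X"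
proof -
  note o = plug_okD[OF ok] and o' = plug_okD[OF ok']
  note \<theta> = slin_slots[OF \<tau> o(3) \<phi> o'(4) m']
  have main: "slots N \<sigma> (ins n N m hs Z) = ins n N m' hs (slots N \<tau> Z)"
    if hs: "length hs = l" and Z: "Z \<in> carrier (tens k N)" for hs Z
    using Z o(3)
  proof (induction rule: tens_induct)
    case (gen w e)
    let ?c = "cop (l - 1) (w ! m)"
    have len: "length (splice_at m w (map2 (*) hs ds)) = n" if "ds \<in> set ?c" for ds
      using gen hs o(4,6) ins_ok_cop_length[OF o(1) that] by (simp add: length_splice_at)
    have "slots N \<sigma> (ins n N m hs (tpure N (w, e))) =
        (\<Sum>ds\<leftarrow>?c. slots N \<sigma> (tpure N (splice_at m w (map2 (*) hs ds), e)))"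
      unfolding ins_tpure[OF o(1) hs gen] slots_def
      using ins_ok_cop[OF o(1), of "w ! m"] gen len \<sigma>(2)
      by (intro tlin_sum_list[OF tlin_slots[OF \<sigma>(1) o(3)]] tpure_closed) (auto simp: words_def gens_def)
    also have "\<dots> = (\<Sum>ds\<leftarrow>?c. tpure N (splice_at m' (perm \<tau> w) (map2 (*) hs ds), e))"
    proof (rule sum_list_map_cong)
      fix ds assume ds: "ds \<in> set ?c"
      have "perm \<sigma> (splice_at m w (map2 (*) hs ds)) = splice_at m' (perm \<tau> w) (map2 (*) hs ds)"
        using gen hs ins_ok_cop_length[OF o(1) ds] by (intro blk) auto
      then show "slots N \<sigma> (tpure N (splice_at m w (map2 (*) hs ds), e)) =
          tpure N (splice_at m' (perm \<tau> w) (map2 (*) hs ds), e)"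
        using slots_tpure[OF \<sigma>(1) o(3) _ gen(2)] len[OF ds] \<sigma>(2) by simp
    qed
    also have "\<dots> = ins n N m' hs (slots N \<tau> (tpure N (w, e)))"
      using gen \<tau> m' o'(4) ins_tpure[OF o'(1) hs, of "perm \<tau> w" e]
      by (simp add: slots_tpure[OF \<tau>(1) o(3)]) (simp add: perm_def)
    finally show ?case .
  next
    case (add X Y)
    then show ?case
      using ins_closed[OF o(1) hs] \<sigma>(2) \<tau>(2) slots_closed[OF \<tau>(1) o(3)]
      by (simp add: ins_add[OF o(1) hs] ins_add[OF o'(1) hs] slots_add[OF \<sigma>(1) o(3)] slots_add[OF \<tau>(1) o(3)])
  qed
  show ?thesis using X o(2)
  proof (induction rule: tens_induct)
    case (gen w e)
    then show ?case by (simp add: plug_tpure[OF ok \<phi>] plug_tpure[OF ok' \<theta>] main slinD(2)[OF \<phi>])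
  next
    case (add X Y)
    then show ?case
      using plug_closed[OF ok \<phi>] \<sigma>(2)
      by (simp add: plug_add[OF ok \<phi>] plug_add[OF ok' \<theta>] slots_add[OF \<sigma>(1) o(3)])
  qed
qed

text \<open>Here \<open>\<sigma>\<close> permutes only the inserted block, in the way given by
  \<open>\<tau>\<close>. In this block the outer value contributes the coproduct of one letter,
  which is invariant under \<open>\<tau>\<close> by cocommutativity, so the permutation falls on the
  inserted tensor alone.\<close>

lemma slots_plug_inner:
  assumes ok: "plug_ok M N n k l m" and \<phi>: "slin M N k m \<phi>"
    and \<sigma>: "cop_inv \<sigma>" "length \<sigma> = n" and \<tau>: "cop_inv \<tau>" "length \<tau> = l"
    and blk: "\<And>fs es. length fs = k \<Longrightarrow> length es = l \<Longrightarrow>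
      perm \<sigma> (splice_at m fs es) = splice_at m fs (perm \<tau> (es :: 'h list))"
    and X: "X \<in> carrier (tens l M)"
  shows "slots N \<sigma> (plug n N m \<phi> X) = plug n N m \<phi> (slots M \<tau> X)"
proof -
  note o = plug_okD[OF ok]
  have main: "slots N \<sigma> (ins n N m hs Z) = ins n N m (perm \<tau> hs) Z"
    if hs: "length hs = l" and Z: "Z \<in> carrier (tens k N)" for hs Z
    using Z o(3)
  proof (induction rule: tens_induct)
    case (gen w e)
    let ?c = "cop (l - 1) (w ! m)"
    have phs: "length (perm \<tau> hs) = l" using \<tau> by simp
    have len: "length (splice_at m w (map2 (*) hs ds)) = n" if "ds \<in> set ?c" for ds
      using gen hs o(4,6) ins_ok_cop_length[OF o(1) that] by (simp add: length_splice_at)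
    have "slots N \<sigma> (ins n N m hs (tpure N (w, e))) =
        (\<Sum>ds\<leftarrow>?c. slots N \<sigma> (tpure N (splice_at m w (map2 (*) hs ds), e)))"
      unfolding ins_tpure[OF o(1) hs gen] slots_def
      using ins_ok_cop[OF o(1), of "w ! m"] gen len \<sigma>(2)
      by (intro tlin_sum_list[OF tlin_slots[OF \<sigma>(1) o(3)]] tpure_closed) (auto simp: words_def gens_def)
    also have "\<dots> = (\<Sum>ds\<leftarrow>?c. tpure N (splice_at m w (map2 (*) (perm \<tau> hs) (perm \<tau> ds)), e))"
    proof (rule sum_list_map_cong)
      fix ds assume ds: "ds \<in> set ?c"
      have dl: "length ds = l" by (rule ins_ok_cop_length[OF o(1) ds])
      have "perm \<sigma> (splice_at m w (map2 (*) hs ds)) = splice_at m w (perm \<tau> (map2 (*) hs ds))"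
        using gen hs dl by (intro blk) auto
      also have "perm \<tau> (map2 (*) hs ds) = map2 (*) (perm \<tau> hs) (perm \<tau> ds)"
        using hs dl \<tau> cop_invD(1)[OF \<tau>(1)] by (intro perm_map2) auto
      finally show "slots N \<sigma> (tpure N (splice_at m w (map2 (*) hs ds), e)) =
          tpure N (splice_at m w (map2 (*) (perm \<tau> hs) (perm \<tau> ds)), e)"
        using slots_tpure[OF \<sigma>(1) o(3) _ gen(2)] len[OF ds] \<sigma>(2) by simp
    qed
    also have "\<dots> = (\<Sum>ds\<leftarrow>?c. tpure N (splice_at m w (map2 (*) (perm \<tau> hs) ds), e))"
    proof -
      have "mlin (length \<tau>) (tens_rel n N) (\<lambda>ds. tpure N (splice_at m w (map2 (*) (perm \<tau> hs) ds), e))"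
        unfolding \<tau>(2) by (rule mlin_ins_inner[OF gen(2) phs gen(1) o(4,6)])
      from sum_cop_perm[OF \<tau>(1) this] show ?thesis unfolding \<tau>(2) .
    qed
    finally show ?case by (simp add: ins_tpure[OF o(1) phs gen])
  next
    case (add X Y)
    have "length (perm \<tau> hs) = l" using \<tau> by simp
    with add show ?case
      using ins_closed[OF o(1) hs] \<sigma>(2)
      by (simp add: ins_add[OF o(1)] hs slots_add[OF \<sigma>(1) o(3)])
  qed
  show ?thesis using X o(2)
  proof (induction rule: tens_induct)
    case (gen w e)
    then show ?case using \<tau>(2)
      by (simp add: plug_tpure[OF ok \<phi>] main slinD(2)[OF \<phi>] slots_tpure[OF \<tau>(1) o(2)])
  next
    case (add X Y)
    then show ?case
      using plug_closed[OF ok \<phi>] \<sigma>(2) \<tau>(2) slots_closed[OF \<tau>(1) o(2)]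
      by (simp add: plug_add[OF ok \<phi>] slots_add[OF \<sigma>(1) o(3)] slots_add[OF \<tau>(1) o(2)])
  qed
qed

subsection \<open>Calculations in the abelian groups \<open>H\<^sup>\<otimes>\<^sup>n \<otimes>\<^sub>H M\<close>\<close>

lemma tens_repE:
  assumes "X \<in> carrier (tens n M)"
  obtains x where "X = x +o tens_rel n M"
  using assms by (auto simp: carrier_tens_iff)

lemma tens_coset_closed:
  "x +o tens_rel n M \<in> carrier (tens n M) \<Longrightarrow> y +o tens_rel n M \<in> carrier (tens n M) \<Longrightarrow>
    (x + y) +o tens_rel n M \<in> carrier (tens n M)"
  "x +o tens_rel n M \<in> carrier (tens n M) \<Longrightarrow> y +o tens_rel n M \<in> carrier (tens n M) \<Longrightarrow>
    (x - y) +o tens_rel n M \<in> carrier (tens n M)"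
  "x +o tens_rel n M \<in> carrier (tens n M) \<Longrightarrow> (- x) +o tens_rel n M \<in> carrier (tens n M)"
proof -
  interpret T: abelian_group "tens n M" by (rule abelian_group_tens)
  let ?R = "tens_rel n M"
  show "x +o ?R \<in> carrier (tens n M) \<Longrightarrow> y +o ?R \<in> carrier (tens n M) \<Longrightarrow> (x + y) +o ?R \<in> carrier (tens n M)"
    using tens_add_closed by (metis coset_add subgrp_tens_rel)
  show "x +o ?R \<in> carrier (tens n M) \<Longrightarrow> y +o ?R \<in> carrier (tens n M) \<Longrightarrow> (x - y) +o ?R \<in> carrier (tens n M)"
    using T.minus_closed by (metis tens_minus)
  show "x +o ?R \<in> carrier (tens n M) \<Longrightarrow> (- x) +o ?R \<in> carrier (tens n M)"
    using T.a_inv_closed by (metis tens_a_inv)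
qed

lemma tens_zero_coset: "tens_rel n M = 0 +o tens_rel n M"
  by simp

text \<open>Turns an equation between classes into membership of a difference of representatives in
  \<open>tens_rel n M\<close>. The difference is a formal sum, that is, an element of an abelian
  group type where \<open>algebra_simps\<close> applies.\<close>

lemmas tens_calc = coset_add[OF subgrp_tens_rel] tens_minus tens_a_inv tens_coset_closed coset_eq_iff[OF subgrp_tens_rel]

lemma tens_closed:
  "tens_rel n M \<in> carrier (tens n M)"
  "X \<in> carrier (tens n M) \<Longrightarrow> Y \<in> carrier (tens n M) \<Longrightarrow> X + Y \<in> carrier (tens n M)"
  "X \<in> carrier (tens n M) \<Longrightarrow> Y \<in> carrier (tens n M) \<Longrightarrow> X \<ominus>\<^bsub>tens n M\<^esub> Y \<in> carrier (tens n M)"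
  "X \<in> carrier (tens n M) \<Longrightarrow> \<ominus>\<^bsub>tens n M\<^esub> X \<in> carrier (tens n M)"
proof -
  interpret T: abelian_group "tens n M" by (rule abelian_group_tens)
  show "tens_rel n M \<in> carrier (tens n M)" using T.zero_closed by simp
  show "X \<in> carrier (tens n M) \<Longrightarrow> Y \<in> carrier (tens n M) \<Longrightarrow> X + Y \<in> carrier (tens n M)" by (rule tens_add_closed)
qed (auto intro: abelian_group.minus_closed abelian_group.a_inv_closed abelian_group_tens)

lemma tens_add_zero [simp]:
  "X \<in> carrier (tens n M) \<Longrightarrow> X + tens_rel n M = X"
  "X \<in> carrier (tens n M) \<Longrightarrow> tens_rel n M + X = X"
  using is_coset_add_zero[OF subgrp_tens_rel is_coset_tens] by (auto simp: add.commute)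

lemma tens_add_cancel:
  assumes "X \<in> carrier (tens n M)" "Y \<in> carrier (tens n M)" "Z \<in> carrier (tens n M)"
  shows "X + Z = Y + Z \<longleftrightarrow> X = Y"
  using coset_cancel[OF subgrp_tens_rel is_coset_tens is_coset_tens is_coset_tens, OF assms] by auto

lemma tens_minus_minus: "X \<in> carrier (tens n M) \<Longrightarrow> \<ominus>\<^bsub>tens n M\<^esub> (\<ominus>\<^bsub>tens n M\<^esub> X) = X"
  by (rule abelian_group.minus_minus[OF abelian_group_tens])

lemma tens_minus_self: "X \<in> carrier (tens n M) \<Longrightarrow> X \<ominus>\<^bsub>tens n M\<^esub> X = tens_rel n M"
  using abelian_group.r_neg[OF abelian_group_tens, of X n M] by (simp add: a_minus_def)

lemma tens_minus_eq_iff: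
  assumes "X \<in> carrier (tens n M)" "Y \<in> carrier (tens n M)" "Z \<in> carrier (tens n M)"
  shows "X \<ominus>\<^bsub>tens n M\<^esub> Y = Z \<longleftrightarrow> X = Z + Y"
proof -
  obtain x y z where "X = x +o tens_rel n M" "Y = y +o tens_rel n M" "Z = z +o tens_rel n M"
    using assms by (auto elim!: tens_repE)
  then show ?thesis using assms by (simp add: tens_calc algebra_simps)
qed

lemma tens_minus_minus_distrib:
  assumes "X \<in> carrier (tens n M)" "Y \<in> carrier (tens n M)" "Z \<in> carrier (tens n M)"
  shows "X \<ominus>\<^bsub>tens n M\<^esub> (Y \<ominus>\<^bsub>tens n M\<^esub> Z) = X \<ominus>\<^bsub>tens n M\<^esub> Y + Z"
proof -
  obtain x y z where "X = x +o tens_rel n M" "Y = y +o tens_rel n M" "Z = z +o tens_rel n M"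
    using assms by (auto elim!: tens_repE)
  then show ?thesis using assms by (simp add: tens_calc subgrp_0[OF subgrp_tens_rel])
qed

lemma tens_neg_eq_iff:
  assumes "X \<in> carrier (tens n M)" "Y \<in> carrier (tens n M)"
  shows "\<ominus>\<^bsub>tens n M\<^esub> X = Y \<longleftrightarrow> X + Y = tens_rel n M"
proof -
  obtain x y where xy: "X = x +o tens_rel n M" "Y = y +o tens_rel n M"
    using assms by (auto elim!: tens_repE)
  then have "\<ominus>\<^bsub>tens n M\<^esub> X = Y \<longleftrightarrow> - x - y \<in> tens_rel n M"
    using assms by (simp add: tens_calc)
  also have "\<dots> \<longleftrightarrow> x + y - 0 \<in> tens_rel n M"
    using subgrp_minus[OF subgrp_tens_rel, of "- x - y" n M] subgrp_minus[OF subgrp_tens_rel, of "x + y" n M]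
    by (auto simp: algebra_simps)
  also have "\<dots> \<longleftrightarrow> X + Y = tens_rel n M"
    unfolding xy by (subst (2) tens_zero_coset) (simp only: tens_calc)
  finally show ?thesis .
qed

lemma tens_idem: "X \<in> carrier (tens n M) \<Longrightarrow> X + X = X \<Longrightarrow> X = tens_rel n M"
  using tens_add_cancel[of X n M "tens_rel n M" X] by (simp add: tens_closed)

lemma additive_zero:
  assumes "\<And>X Y. X \<in> carrier (tens n M) \<Longrightarrow> Y \<in> carrier (tens n M) \<Longrightarrow> f (X + Y) = f X + f Y"
    and "\<And>X. X \<in> carrier (tens n M) \<Longrightarrow> f X \<in> carrier (tens k N)"
  shows "f (tens_rel n M) = tens_rel k N"
proof -
  have "f (tens_rel n M) + f (tens_rel n M) = f (tens_rel n M)"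
    using assms(1)[of "tens_rel n M" "tens_rel n M"] by (simp add: tens_closed)
  then show ?thesis by (intro tens_idem assms(2) tens_closed)
qed

lemma additive_neg:
  assumes add: "\<And>X Y. X \<in> carrier (tens n M) \<Longrightarrow> Y \<in> carrier (tens n M) \<Longrightarrow> f (X + Y) = f X + f Y"
    and cl: "\<And>X. X \<in> carrier (tens n M) \<Longrightarrow> f X \<in> carrier (tens k N)"
    and X: "X \<in> carrier (tens n M)"
  shows "f (\<ominus>\<^bsub>tens n M\<^esub> X) = \<ominus>\<^bsub>tens k N\<^esub> f X"
proof -
  have "X + \<ominus>\<^bsub>tens n M\<^esub> X = tens_rel n M"
    using tens_minus_self[OF X] by (simp add: a_minus_def)
  then have "f X + f (\<ominus>\<^bsub>tens n M\<^esub> X) = tens_rel k N"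
    using add[of X "\<ominus>\<^bsub>tens n M\<^esub> X"] additive_zero[OF add cl] X by (simp add: tens_closed)
  then show ?thesis using tens_neg_eq_iff[of "f X" k N] cl X tens_closed(4)[OF X] by metis
qed

lemma additive_minus:
  assumes "\<And>X Y. X \<in> carrier (tens n M) \<Longrightarrow> Y \<in> carrier (tens n M) \<Longrightarrow> f (X + Y) = f X + f Y"
    and "\<And>X. X \<in> carrier (tens n M) \<Longrightarrow> f X \<in> carrier (tens k N)"
    and "X \<in> carrier (tens n M)" "Y \<in> carrier (tens n M)"
  shows "f (X \<ominus>\<^bsub>tens n M\<^esub> Y) = f X \<ominus>\<^bsub>tens k N\<^esub> f Y"
  using assms(1)[OF assms(3) tens_closed(4)[OF assms(4)]] additive_neg[OF assms(1,2,4)]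
  by (simp add: a_minus_def)

lemma tmap_zero: "n \<ge> 1 \<Longrightarrow> left_module M \<Longrightarrow> f \<in> lhom M N \<Longrightarrow> tmap n N f (tens_rel n M) = tens_rel n N"
  by (rule additive_zero) (auto simp: tmap_add tmap_closed)

lemma tmap_minus: "n \<ge> 1 \<Longrightarrow> left_module M \<Longrightarrow> f \<in> lhom M N \<Longrightarrow> X \<in> carrier (tens n M) \<Longrightarrow>
    Y \<in> carrier (tens n M) \<Longrightarrow> tmap n N f (X \<ominus>\<^bsub>tens n M\<^esub> Y) = tmap n N f X \<ominus>\<^bsub>tens n N\<^esub> tmap n N f Y"
  by (rule additive_minus) (auto simp: tmap_add tmap_closed)

lemma tmap_neg: "n \<ge> 1 \<Longrightarrow> left_module M \<Longrightarrow> f \<in> lhom M N \<Longrightarrow> X \<in> carrier (tens n M) \<Longrightarrow>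
    tmap n N f (\<ominus>\<^bsub>tens n M\<^esub> X) = \<ominus>\<^bsub>tens n N\<^esub> tmap n N f X"
  by (rule additive_neg) (auto simp: tmap_add tmap_closed)

lemma slots_closed': "cop_inv \<sigma> \<Longrightarrow> length \<sigma> = n \<Longrightarrow> left_module M \<Longrightarrow> X \<in> carrier (tens n M) \<Longrightarrow>
    slots M \<sigma> X \<in> carrier (tens n M)"
  using slots_closed by blast

lemma slots_add': "cop_inv \<sigma> \<Longrightarrow> length \<sigma> = n \<Longrightarrow> left_module M \<Longrightarrow> X \<in> carrier (tens n M) \<Longrightarrow>
    Y \<in> carrier (tens n M) \<Longrightarrow> slots M \<sigma> (X + Y) = slots M \<sigma> X + slots M \<sigma> Y"
  using slots_add by blast

lemma slots_minus: "cop_inv \<sigma> \<Longrightarrow> left_module M \<Longrightarrow> length \<sigma> = n \<Longrightarrow> X \<in> carrier (tens n M) \<Longrightarrow>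
    Y \<in> carrier (tens n M) \<Longrightarrow> slots M \<sigma> (X \<ominus>\<^bsub>tens n M\<^esub> Y) = slots M \<sigma> X \<ominus>\<^bsub>tens n M\<^esub> slots M \<sigma> Y"
  by (rule additive_minus) (auto simp: slots_add slots_closed)

lemma slots_neg: "cop_inv \<sigma> \<Longrightarrow> left_module M \<Longrightarrow> length \<sigma> = n \<Longrightarrow> X \<in> carrier (tens n M) \<Longrightarrow>
    slots M \<sigma> (\<ominus>\<^bsub>tens n M\<^esub> X) = \<ominus>\<^bsub>tens n M\<^esub> slots M \<sigma> X"
  by (rule additive_neg) (auto simp: slots_add slots_closed)

lemma plug_minus: "plug_ok M N n k l m \<Longrightarrow> slin M N k m \<phi> \<Longrightarrow> X \<in> carrier (tens l M) \<Longrightarrow>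
    Y \<in> carrier (tens l M) \<Longrightarrow> plug n N m \<phi> (X \<ominus>\<^bsub>tens l M\<^esub> Y) = plug n N m \<phi> X \<ominus>\<^bsub>tens n N\<^esub> plug n N m \<phi> Y"
  by (rule additive_minus) (auto simp: plug_add plug_closed)

lemma plug_neg: "plug_ok M N n k l m \<Longrightarrow> slin M N k m \<phi> \<Longrightarrow> X \<in> carrier (tens l M) \<Longrightarrow>
    plug n N m \<phi> (\<ominus>\<^bsub>tens l M\<^esub> X) = \<ominus>\<^bsub>tens n N\<^esub> plug n N m \<phi> X"
  by (rule additive_neg) (auto simp: plug_add plug_closed)

lemma lmul_neg: "left_module M \<Longrightarrow> length as = n \<Longrightarrow> n \<ge> 1 \<Longrightarrow> X \<in> carrier (tens n M) \<Longrightarrow>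
    lmul M as (\<ominus>\<^bsub>tens n M\<^esub> X) = \<ominus>\<^bsub>tens n M\<^esub> lmul M as X"
  by (rule additive_neg) (auto simp: lmul_add lmul_closed)

lemma neg_add: "X \<in> carrier (tens n M) \<Longrightarrow> Y \<in> carrier (tens n M) \<Longrightarrow>
    \<ominus>\<^bsub>tens n M\<^esub> (X + Y) = \<ominus>\<^bsub>tens n M\<^esub> X + \<ominus>\<^bsub>tens n M\<^esub> Y"
  using abelian_group.minus_add[OF abelian_group_tens, of X n M Y] by simp

lemma slin_neg:
  assumes N: "left_module N" and \<phi>: "slin M N k m \<phi>"
  shows "slin M N k m (\<lambda>x. \<ominus>\<^bsub>tens k N\<^esub> \<phi> x)"
proof -
  have k: "k \<ge> 1" using slinD(1)[OF \<phi>] by simp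
  show ?thesis using slinD[OF \<phi>] unfolding slin_def
    by (auto simp: tens_closed neg_add lmul_neg[OF N _ k])
qed

lemma plug_neg_fun:
  assumes ok: "plug_ok M N n k l m" and \<phi>: "slin M N k m \<phi>" and X: "X \<in> carrier (tens l M)"
  shows "plug n N m (\<lambda>e. \<ominus>\<^bsub>tens k N\<^esub> \<phi> e) X = \<ominus>\<^bsub>tens n N\<^esub> plug n N m \<phi> X"
proof -
  note o = plug_okD[OF ok]
  note \<theta> = slin_neg[OF o(3) \<phi>]
  have ins_neg: "ins n N m w (\<ominus>\<^bsub>tens k N\<^esub> Z) = \<ominus>\<^bsub>tens n N\<^esub> ins n N m w Z"
    if "length w = l" "Z \<in> carrier (tens k N)" for w Z
    using that by (intro additive_neg) (auto simp: ins_add[OF o(1)] ins_closed[OF o(1)])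
  show ?thesis using X o(2)
  proof (induction rule: tens_induct)
    case (gen w e)
    then show ?case by (simp add: plug_tpure[OF ok \<phi>] plug_tpure[OF ok \<theta>] ins_neg slinD(2)[OF \<phi>])
  next
    case (add X Y)
    then show ?case by (simp add: plug_add[OF ok \<phi>] plug_add[OF ok \<theta>] neg_add plug_closed[OF ok \<phi>])
  qed
qed

lemma plug_minus_fun:
  assumes ok: "plug_ok M N n k l m" and \<phi>: "slin M N k m \<phi>" and \<psi>: "slin M N k m \<psi>" and X: "X \<in> carrier (tens l M)"
  shows "plug n N m (\<lambda>e. \<phi> e \<ominus>\<^bsub>tens k N\<^esub> \<psi> e) X = plug n N m \<phi> X \<ominus>\<^bsub>tens n N\<^esub> plug n N m \<psi> X"
  using plug_add_fun[OF ok \<phi> slin_neg[OF plug_okD(3)[OF ok] \<psi>] X] plug_neg_fun[OF ok \<psi> X]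
  by (simp add: a_minus_def)

lemma tmap_tmap:
  assumes "n \<ge> 1" "left_module M" "left_module N" "f \<in> lhom M N" "g \<in> lhom N K" "X \<in> carrier (tens n M)"
  shows "tmap n K g (tmap n N f X) = tmap n K (\<lambda>x. g (f x)) X"
proof -
  have gf: "(\<lambda>x. g (f x)) \<in> lhom M K"
    using lhomD[OF assms(4)] lhomD[OF assms(5)] by (auto simp: lhom_def hom_def)
  show ?thesis using assms(6,2)
  proof (induction rule: tens_induct)
    case (gen w e)
    then show ?case using lhomD(1)[OF assms(4)]
      by (simp add: tmap_tpure[OF assms(1,2,4)] tmap_tpure[OF assms(1,3,5)] tmap_tpure[OF assms(1,2) gf])
  next
    case (add X Y)
    then show ?case
      by (simp add: tmap_add[OF assms(1,2,4)] tmap_add[OF assms(1,3,5)] tmap_add[OF assms(1,2) gf]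
          tmap_closed[OF assms(1,2,4)])
  qed
qed

lemma tmap_cong:
  assumes "n \<ge> 1" "left_module M" "f \<in> lhom M N" "X \<in> carrier (tens n M)" "\<And>x. x \<in> carrier M \<Longrightarrow> f x = g x"
  shows "tmap n N f X = tmap n N g X"
proof -
  interpret M: left_module M by fact
  have g: "g \<in> lhom M N"
    using lhomD[OF assms(3)] assms(5) by (auto simp: lhom_def hom_def M.smult_closed)
  show ?thesis using assms(4,2)
  proof (induction rule: tens_induct)
    case (gen w e)
    then show ?case using assms(5) by (simp add: tmap_tpure[OF assms(1,2,3)] tmap_tpure[OF assms(1,2) g])
  next
    case (add X Y)
    then show ?case by (simp add: tmap_add[OF assms(1,2,3)] tmap_add[OF assms(1,2) g])
  qed
qed

lemma tmap_ident:
  assumes "n \<ge> 1" "left_module M" "X \<in> carrier (tens n M)"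
  shows "tmap n M (\<lambda>x. x) X = X"
proof -
  have i: "(\<lambda>x. x) \<in> lhom M M" by (auto simp: lhom_def hom_def)
  show ?thesis using assms(3,2)
  proof (induction rule: tens_induct)
    case (gen w e)
    then show ?case by (simp add: tmap_tpure[OF assms(1,2) i])
  next
    case (add X Y)
    then show ?case by (simp add: tmap_add[OF assms(1,2) i])
  qed
qed

lemma tmap_plus:
  assumes "n \<ge> 1" "left_module M" "f \<in> lhom M N" "g \<in> lhom M N" "left_module N" "X \<in> carrier (tens n M)"
  shows "tmap n N (\<lambda>x. f x \<oplus>\<^bsub>N\<^esub> g x) X = tmap n N f X + tmap n N g X"
proof -
  interpret N: left_module N by fact
  have fg: "(\<lambda>x. f x \<oplus>\<^bsub>N\<^esub> g x) \<in> lhom M N"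
    using lhomD[OF assms(3)] lhomD[OF assms(4)]
    by (auto simp: lhom_def hom_def N.a_ac N.smult_add)
  show ?thesis using assms(6,2)
  proof (induction rule: tens_induct)
    case (gen w e)
    then show ?case using lhomD(1)[OF assms(3)] lhomD(1)[OF assms(4)]
      by (simp add: tmap_tpure[OF assms(1,2,3)] tmap_tpure[OF assms(1,2,4)] tmap_tpure[OF assms(1,2) fg] tpure_add)
  next
    case (add X Y)
    then show ?case
      by (simp add: tmap_add[OF assms(1,2,3)] tmap_add[OF assms(1,2,4)] tmap_add[OF assms(1,2) fg] ac_simps)
  qed
qed

lemma lhom_zero_map: "left_module N \<Longrightarrow> (\<lambda>x. \<zero>\<^bsub>N\<^esub>) \<in> lhom M N"
proof -
  assume "left_module N"
  then interpret N: left_module N .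
  have "h \<odot>\<^bsub>N\<^esub> \<zero>\<^bsub>N\<^esub> = \<zero>\<^bsub>N\<^esub>" for h
    using N.smult_add[of "\<zero>\<^bsub>N\<^esub>" "\<zero>\<^bsub>N\<^esub>" h] N.smult_closed[of "\<zero>\<^bsub>N\<^esub>" h] by simp
  then show ?thesis by (auto simp: lhom_def hom_def)
qed

lemma tmap_zero_map:
  assumes "n \<ge> 1" "left_module M" "left_module N" "X \<in> carrier (tens n M)"
  shows "tmap n N (\<lambda>x. \<zero>\<^bsub>N\<^esub>) X = tens_rel n N"
proof -
  interpret N: left_module N by fact
  note z = lhom_zero_map[OF assms(3)]
  have "tmap n N (\<lambda>x. \<zero>\<^bsub>N\<^esub> \<oplus>\<^bsub>N\<^esub> \<zero>\<^bsub>N\<^esub>) X = tmap n N (\<lambda>x. \<zero>\<^bsub>N\<^esub>) X + tmap n N (\<lambda>x. \<zero>\<^bsub>N\<^esub>) X"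
    by (rule tmap_plus[OF assms(1,2) z z assms(3,4)])
  then show ?thesis
    by (intro tens_idem tmap_closed[OF assms(1,2) z assms(4)]) simp
qed

subsection \<open>Polylinear maps\<close>

lemma polylinear2_iff:
  "polylinear2 A B M f \<longleftrightarrow>
    (\<forall>x\<in>carrier A. \<forall>y\<in>carrier B. f x y \<in> carrier (tens 2 M)) \<and>
    (\<forall>x\<in>carrier A. \<forall>x'\<in>carrier A. \<forall>y\<in>carrier B. f (x \<oplus>\<^bsub>A\<^esub> x') y = f x y + f x' y) \<and>
    (\<forall>x\<in>carrier A. \<forall>y\<in>carrier B. \<forall>y'\<in>carrier B. f x (y \<oplus>\<^bsub>B\<^esub> y') = f x y + f x y') \<and>
    (\<forall>x\<in>carrier A. \<forall>y\<in>carrier B. \<forall>g h. f (g \<odot>\<^bsub>A\<^esub> x) (h \<odot>\<^bsub>B\<^esub> y) = lmul M [g, h] (f x y))"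
  unfolding polylinear2_def hom_def lmul_def by (auto simp: numeral_2_eq_2)

lemma polylinear3_iff:
  "polylinear3 A M f \<longleftrightarrow>
    (\<forall>x\<in>carrier A. \<forall>y\<in>carrier A. \<forall>z\<in>carrier A. f x y z \<in> carrier (tens 3 M)) \<and>
    (\<forall>x\<in>carrier A. \<forall>x'\<in>carrier A. \<forall>y\<in>carrier A. \<forall>z\<in>carrier A.
      f (x \<oplus>\<^bsub>A\<^esub> x') y z = f x y z + f x' y z \<and>
      f y (x \<oplus>\<^bsub>A\<^esub> x') z = f y x z + f y x' z \<and>
      f y z (x \<oplus>\<^bsub>A\<^esub> x') = f y z x + f y z x') \<and>
    (\<forall>x\<in>carrier A. \<forall>y\<in>carrier A. \<forall>z\<in>carrier A. \<forall>g h k.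
      f (g \<odot>\<^bsub>A\<^esub> x) (h \<odot>\<^bsub>A\<^esub> y) (k \<odot>\<^bsub>A\<^esub> z) = lmul M [g, h, k] (f x y z))"
  unfolding polylinear3_def hom_def lmul_def by (auto simp: numeral_3_eq_3)

lemma polylinear2_closed: "polylinear2 A B M f \<Longrightarrow> x \<in> carrier A \<Longrightarrow> y \<in> carrier B \<Longrightarrow> f x y \<in> carrier (tens 2 M)"
  by (simp add: polylinear2_iff)

lemma polylinear3_closed:
  "polylinear3 A M f \<Longrightarrow> x \<in> carrier A \<Longrightarrow> y \<in> carrier A \<Longrightarrow> z \<in> carrier A \<Longrightarrow> f x y z \<in> carrier (tens 3 M)"
  by (simp add: polylinear3_iff)

lemma polylinear2_slin0:
  assumes f: "polylinear2 A B M f" and B: "left_module B" and y: "y \<in> carrier B"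
  shows "slin A M 2 0 (\<lambda>x. f x y)"
proof -
  interpret B: left_module B by fact
  have "f (h \<odot>\<^bsub>A\<^esub> x) (1 \<odot>\<^bsub>B\<^esub> y) = lmul M [h, 1] (f x y)" if "x \<in> carrier A" for x h
    using f that y unfolding polylinear2_iff by blast
  then show ?thesis using f y
    by (auto simp: slin_def polylinear2_iff unit_at_def numeral_2_eq_2 B.smult_1)
qed

lemma polylinear2_slin1:
  assumes f: "polylinear2 A B M f" and A: "left_module A" and x: "x \<in> carrier A"
  shows "slin B M 2 1 (f x)"
proof -
  interpret A: left_module A by fact
  have "f (1 \<odot>\<^bsub>A\<^esub> x) (h \<odot>\<^bsub>B\<^esub> y) = lmul M [1, h] (f x y)" if "y \<in> carrier B" for y h
    using f that x unfolding polylinear2_iff by blast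
  then show ?thesis using f x
    by (auto simp: slin_def polylinear2_iff unit_at_def numeral_2_eq_2 A.smult_1)
qed

lemma unit_at_3: "unit_at 3 0 g = [g, 1, 1]" "unit_at 3 1 g = [1, g, 1]" "unit_at 3 2 g = [1, 1, g]"
  by (simp_all add: unit_at_def numeral_3_eq_3 numeral_2_eq_2)

lemma polylinear3_slin:
  assumes f: "polylinear3 A M f" and A: "left_module A" and xy: "x \<in> carrier A" "y \<in> carrier A"
  shows "slin A M 3 0 (\<lambda>e. f e x y)" "slin A M 3 1 (\<lambda>e. f x e y)" "slin A M 3 2 (\<lambda>e. f x y e)"
proof -
  interpret A: left_module A by fact
  have "f (g \<odot>\<^bsub>A\<^esub> e) (1 \<odot>\<^bsub>A\<^esub> x) (1 \<odot>\<^bsub>A\<^esub> y) = lmul M [g, 1, 1] (f e x y)"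
    "f (1 \<odot>\<^bsub>A\<^esub> x) (g \<odot>\<^bsub>A\<^esub> e) (1 \<odot>\<^bsub>A\<^esub> y) = lmul M [1, g, 1] (f x e y)"
    "f (1 \<odot>\<^bsub>A\<^esub> x) (1 \<odot>\<^bsub>A\<^esub> y) (g \<odot>\<^bsub>A\<^esub> e) = lmul M [1, 1, g] (f x y e)" if "e \<in> carrier A" for e g
    using f that xy unfolding polylinear3_iff by blast+
  note * = this[unfolded A.smult_1[OF xy(1)] A.smult_1[OF xy(2)]]
  show "slin A M 3 0 (\<lambda>e. f e x y)" "slin A M 3 1 (\<lambda>e. f x e y)" "slin A M 3 2 (\<lambda>e. f x y e)"
    using f xy * unfolding slin_def unit_at_3 polylinear3_iff by auto
qed

lemma polylinear2_tmap:
  assumes "polylinear2 A B M f" "left_module M" "left_module N" "g \<in> lhom M N" "a \<in> lhom A' A" "b \<in> lhom B' B"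
  shows "polylinear2 A' B' N (\<lambda>x y. tmap 2 N g (f (a x) (b y)))"
proof -
  have 1: "(2::nat) \<ge> 1" by simp
  have l: "length [x, y :: 'h] = 2" for x y by simp
  show ?thesis
    using assms(1) lhomD[OF assms(5)] lhomD[OF assms(6)] unfolding polylinear2_iff
    by (simp add: tmap_closed[OF 1 assms(2,4)] tmap_add[OF 1 assms(2,4)] lmul_tmap[OF assms(2-4) l 1])
qed

lemma polylinear2_add:
  assumes "polylinear2 A B M f" "polylinear2 A B M g" "left_module M"
  shows "polylinear2 A B M (\<lambda>x y. f x y + g x y)"
proof -
  have l: "length [x, y :: 'h] = 2" "(2::nat) \<ge> 1" for x y by auto
  show ?thesis
    using assms(1,2) unfolding polylinear2_iff
    by (auto simp: tens_closed lmul_add[OF assms(3) l] ac_simps)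
qed

text \<open>Block permutations for an exchange of the two arguments of the outer map. For instance,
  \<open>[1, 2, 0]\<close> puts the block of two inserted slots in front of the single remaining
  one.\<close>

lemma slots_outer3:
  assumes M: "left_module M" and N: "left_module N"
  shows "slin M N 2 1 \<phi> \<Longrightarrow> X \<in> carrier (tens 2 M) \<Longrightarrow>
      slots N [1, 2, 0] (plug 3 N 1 \<phi> X) = plug 3 N 0 (\<lambda>e. slots N [1, 0] (\<phi> e)) X"
    "slin M N 2 0 \<phi> \<Longrightarrow> X \<in> carrier (tens 2 M) \<Longrightarrow>
      slots N [2, 0, 1] (plug 3 N 0 \<phi> X) = plug 3 N 1 (\<lambda>e. slots N [1, 0] (\<phi> e)) X"
proof -
  show "slots N [1, 2, 0] (plug 3 N 1 \<phi> X) = plug 3 N 0 (\<lambda>e. slots N [1, 0] (\<phi> e)) X" if "slin M N 2 1 \<phi>" "X \<in> carrier (tens 2 M)"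
    by (rule slots_plug_outer[where k=2 and l=2 and m=1 and \<tau>="[1, 0]"])
      (use that M N cop_inv_perms in \<open>auto simp: plug_okI perm_def splice_at_def length_Suc_conv numeral_eq_Suc\<close>)
  show "slots N [2, 0, 1] (plug 3 N 0 \<phi> X) = plug 3 N 1 (\<lambda>e. slots N [1, 0] (\<phi> e)) X" if "slin M N 2 0 \<phi>" "X \<in> carrier (tens 2 M)"
    by (rule slots_plug_outer[where k=2 and l=2 and m=0 and \<tau>="[1, 0]"])
      (use that M N cop_inv_perms in \<open>auto simp: plug_okI perm_def splice_at_def length_Suc_conv numeral_eq_Suc\<close>)
qed

lemma slots_outer4:
  assumes M: "left_module M" and N: "left_module N"
  shows "slin M N 2 1 \<phi> \<Longrightarrow> X \<in> carrier (tens 3 M) \<Longrightarrow>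
      slots N [1, 2, 3, 0] (plug 4 N 1 \<phi> X) = plug 4 N 0 (\<lambda>e. slots N [1, 0] (\<phi> e)) X"
    "slin M N 3 0 \<phi> \<Longrightarrow> X \<in> carrier (tens 2 M) \<Longrightarrow>
      slots N [2, 0, 1, 3] (plug 4 N 0 \<phi> X) = plug 4 N 1 (\<lambda>e. slots N [1, 0, 2] (\<phi> e)) X"
    "slin M N 3 1 \<phi> \<Longrightarrow> X \<in> carrier (tens 2 M) \<Longrightarrow>
      slots N [1, 2, 0, 3] (plug 4 N 1 \<phi> X) = plug 4 N 0 (\<lambda>e. slots N [1, 0, 2] (\<phi> e)) X"
    "slin M N 3 0 \<phi> \<Longrightarrow> X \<in> carrier (tens 2 M) \<Longrightarrow>
      slots N [2, 3, 0, 1] (plug 4 N 0 \<phi> X) = plug 4 N 2 (\<lambda>e. slots N [1, 2, 0] (\<phi> e)) X"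
proof -
  show "slots N [1, 2, 3, 0] (plug 4 N 1 \<phi> X) = plug 4 N 0 (\<lambda>e. slots N [1, 0] (\<phi> e)) X" if "slin M N 2 1 \<phi>" "X \<in> carrier (tens 3 M)"
    by (rule slots_plug_outer[where k=2 and l=3 and m=1 and \<tau>="[1, 0]"])
      (use that M N cop_inv_perms in \<open>auto simp: plug_okI perm_def splice_at_def length_Suc_conv numeral_eq_Suc\<close>)
  show "slots N [2, 0, 1, 3] (plug 4 N 0 \<phi> X) = plug 4 N 1 (\<lambda>e. slots N [1, 0, 2] (\<phi> e)) X" if "slin M N 3 0 \<phi>" "X \<in> carrier (tens 2 M)"
    by (rule slots_plug_outer[where k=3 and l=2 and m=0 and \<tau>="[1, 0, 2]"])
      (use that M N cop_inv_perms in \<open>auto simp: plug_okI perm_def splice_at_def length_Suc_conv numeral_eq_Suc\<close>)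
  show "slots N [1, 2, 0, 3] (plug 4 N 1 \<phi> X) = plug 4 N 0 (\<lambda>e. slots N [1, 0, 2] (\<phi> e)) X" if "slin M N 3 1 \<phi>" "X \<in> carrier (tens 2 M)"
    by (rule slots_plug_outer[where k=3 and l=2 and m=1 and \<tau>="[1, 0, 2]"])
      (use that M N cop_inv_perms in \<open>auto simp: plug_okI perm_def splice_at_def length_Suc_conv numeral_eq_Suc\<close>)
  show "slots N [2, 3, 0, 1] (plug 4 N 0 \<phi> X) = plug 4 N 2 (\<lambda>e. slots N [1, 2, 0] (\<phi> e)) X" if "slin M N 3 0 \<phi>" "X \<in> carrier (tens 2 M)"
    by (rule slots_plug_outer[where k=3 and l=2 and m=0 and \<tau>="[1, 2, 0]"])
      (use that M N cop_inv_perms in \<open>auto simp: plug_okI perm_def splice_at_def length_Suc_conv numeral_eq_Suc\<close>)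
qed

lemma slots_inner3:
  assumes M: "left_module M" and N: "left_module N"
  shows "slin M N 2 1 \<phi> \<Longrightarrow> X \<in> carrier (tens 2 M) \<Longrightarrow>
      slots N [0, 2, 1] (plug 3 N 1 \<phi> X) = plug 3 N 1 \<phi> (slots M [1, 0] X)"
    "slin M N 2 0 \<phi> \<Longrightarrow> X \<in> carrier (tens 2 M) \<Longrightarrow>
      slots N [1, 0, 2] (plug 3 N 0 \<phi> X) = plug 3 N 0 \<phi> (slots M [1, 0] X)"
proof -
  show "slots N [0, 2, 1] (plug 3 N 1 \<phi> X) = plug 3 N 1 \<phi> (slots M [1, 0] X)" if "slin M N 2 1 \<phi>" "X \<in> carrier (tens 2 M)"
    by (rule slots_plug_inner[where k=2 and l=2 and m=1 and \<tau>="[1, 0]"])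
      (use that M N cop_inv_perms in \<open>auto simp: plug_okI perm_def splice_at_def length_Suc_conv numeral_eq_Suc\<close>)
  show "slots N [1, 0, 2] (plug 3 N 0 \<phi> X) = plug 3 N 0 \<phi> (slots M [1, 0] X)" if "slin M N 2 0 \<phi>" "X \<in> carrier (tens 2 M)"
    by (rule slots_plug_inner[where k=2 and l=2 and m=0 and \<tau>="[1, 0]"])
      (use that M N cop_inv_perms in \<open>auto simp: plug_okI perm_def splice_at_def length_Suc_conv numeral_eq_Suc\<close>)
qed

lemma slots_inner4:
  assumes M: "left_module M" and N: "left_module N"
  shows "slin M N 2 0 \<phi> \<Longrightarrow> X \<in> carrier (tens 3 M) \<Longrightarrow>
      slots N [1, 0, 2, 3] (plug 4 N 0 \<phi> X) = plug 4 N 0 \<phi> (slots M [1, 0, 2] X)"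
    "slin M N 2 1 \<phi> \<Longrightarrow> X \<in> carrier (tens 3 M) \<Longrightarrow>
      slots N [0, 2, 1, 3] (plug 4 N 1 \<phi> X) = plug 4 N 1 \<phi> (slots M [1, 0, 2] X)"
proof -
  show "slots N [1, 0, 2, 3] (plug 4 N 0 \<phi> X) = plug 4 N 0 \<phi> (slots M [1, 0, 2] X)" if "slin M N 2 0 \<phi>" "X \<in> carrier (tens 3 M)"
    by (rule slots_plug_inner[where k=2 and l=3 and m=0 and \<tau>="[1, 0, 2]"])
      (use that M N cop_inv_perms in \<open>auto simp: plug_okI perm_def splice_at_def length_Suc_conv numeral_eq_Suc\<close>)
  show "slots N [0, 2, 1, 3] (plug 4 N 1 \<phi> X) = plug 4 N 1 \<phi> (slots M [1, 0, 2] X)" if "slin M N 2 1 \<phi>" "X \<in> carrier (tens 3 M)"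
    by (rule slots_plug_inner[where k=2 and l=3 and m=1 and \<tau>="[1, 0, 2]"])
      (use that M N cop_inv_perms in \<open>auto simp: plug_okI perm_def splice_at_def length_Suc_conv numeral_eq_Suc\<close>)
qed

end

declare One_nat_def [simp del] One_nat_def [symmetric, simp]

subsection \<open>Iterated brackets\<close>

locale polylinear_bracket = cocommutative_hopf_algebra scale comult counit antipode
  for scale :: "'k::field \<Rightarrow> 'h::ring_1 \<Rightarrow> 'h" (infixr \<open>*\<^sub>k\<close> 75)
    and comult :: "'h \<Rightarrow> ('h list \<Rightarrow>\<^sub>0 int) set" and counit :: "'h \<Rightarrow> 'k" and antipode :: "'h \<Rightarrow> 'h" +
  fixes M :: "('h, 'm) module" and b :: "'m \<Rightarrow> 'm \<Rightarrow> ('h list \<times> 'm \<Rightarrow>\<^sub>0 int) set"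
  assumes M: "left_module M" and b: "polylinear2 M M M b"
begin

lemma plug_oks [simp, intro]:
  "plug_ok M M 3 2 2 0" "plug_ok M M 3 2 2 1" "plug_ok M M 4 2 3 0" "plug_ok M M 4 2 3 1"
  "plug_ok M M 4 3 2 0" "plug_ok M M 4 3 2 1" "plug_ok M M 4 3 2 2"
  using M by (auto simp: plug_okI)

lemma b_slin0: "y \<in> carrier M \<Longrightarrow> slin M M 2 0 (\<lambda>x. b x y)"
  and b_slin1: "x \<in> carrier M \<Longrightarrow> slin M M 2 1 (b x)"
  and b_closed: "x \<in> carrier M \<Longrightarrow> y \<in> carrier M \<Longrightarrow> b x y \<in> carrier (tens 2 M)"
  using polylinear2_slin0[OF b M] polylinear2_slin1[OF b M] polylinear2_closed[OF b] by auto

lemma br_l_closed: "x \<in> carrier M \<Longrightarrow> y \<in> carrier M \<Longrightarrow> z \<in> carrier M \<Longrightarrow> br_l M b x y z \<in> carrier (tens 3 M)"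
  unfolding br_l_def by (rule plug_closed[OF plug_oks(1) b_slin0 b_closed])

lemma br_r_closed: "x \<in> carrier M \<Longrightarrow> y \<in> carrier M \<Longrightarrow> z \<in> carrier M \<Longrightarrow> br_r M b x y z \<in> carrier (tens 3 M)"
  unfolding br_r_def by (rule plug_closed[OF plug_oks(2) b_slin1 b_closed])

lemma br_j_closed: "x \<in> carrier M \<Longrightarrow> y \<in> carrier M \<Longrightarrow> z \<in> carrier M \<Longrightarrow> br_j M b x y z \<in> carrier (tens 3 M)"
  unfolding br_j_def
  by (intro tens_closed br_r_closed slots_closed' M cop_inv_perms) (auto simp: br_r_closed)

lemma br_l_slin:
  assumes "x \<in> carrier M" "y \<in> carrier M"
  shows "slin M M 3 0 (\<lambda>e. br_l M b e x y)" "slin M M 3 1 (\<lambda>e. br_l M b x e y)" "slin M M 3 2 (\<lambda>e. br_l M b x y e)"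
proof -
  show "slin M M 3 0 (\<lambda>e. br_l M b e x y)"
    unfolding br_l_def using slin_plug_inner[OF plug_oks(1) b_slin0[OF assms(2)] b_slin0[OF assms(1)]] by simp
  show "slin M M 3 1 (\<lambda>e. br_l M b x e y)"
    unfolding br_l_def using slin_plug_inner[OF plug_oks(1) b_slin0[OF assms(2)] b_slin1[OF assms(1)]] by simp
  show "slin M M 3 2 (\<lambda>e. br_l M b x y e)"
    unfolding br_l_def
    using slin_plug_param[where \<phi>="\<lambda>y e. b e y" and i=1, OF plug_oks(1) b_slin0 b_slin1 _ _ M b_closed[OF assms]]
    by simp
qed

lemma br_r_slin:
  assumes "x \<in> carrier M" "y \<in> carrier M"
  shows "slin M M 3 0 (\<lambda>e. br_r M b e x y)" "slin M M 3 1 (\<lambda>e. br_r M b x e y)" "slin M M 3 2 (\<lambda>e. br_r M b x y e)"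
proof -
  show "slin M M 3 0 (\<lambda>e. br_r M b e x y)"
    unfolding br_r_def
    using slin_plug_param[where \<phi>=b and i=0, OF plug_oks(2) b_slin1 b_slin0 _ _ M b_closed[OF assms]] by simp
  show "slin M M 3 1 (\<lambda>e. br_r M b x e y)"
    unfolding br_r_def using slin_plug_inner[OF plug_oks(2) b_slin1[OF assms(1)] b_slin0[OF assms(2)]] by simp
  show "slin M M 3 2 (\<lambda>e. br_r M b x y e)"
    unfolding br_r_def using slin_plug_inner[OF plug_oks(2) b_slin1[OF assms(1)] b_slin1[OF assms(2)]]
    by simp
qed

lemma slots_br_r_slin:
  assumes "x \<in> carrier M" "y \<in> carrier M"
  shows "slin M M 3 0 (\<lambda>e. slots M [1, 0, 2] (br_r M b x e y))" "slin M M 3 1 (\<lambda>e. slots M [1, 0, 2] (br_r M b e x y))"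
    "slin M M 3 2 (\<lambda>e. slots M [1, 0, 2] (br_r M b x y e))"
  by (rule slin_slots[OF cop_inv_perms(2) _ M br_r_slin(2)[OF assms]]; simp)
    (rule slin_slots[OF cop_inv_perms(2) _ M br_r_slin(1)[OF assms]] slin_slots[OF cop_inv_perms(2) _ M br_r_slin(3)[OF assms]]; simp)+

lemma br_l_br_l:
  assumes "x \<in> carrier M" "y \<in> carrier M" "z \<in> carrier M" "w \<in> carrier M"
  shows "plug 4 M 0 (\<lambda>e. b e w) (br_l M b x y z) = plug 4 M 0 (\<lambda>e. br_l M b e z w) (b x y)"
  unfolding br_l_def
  using plug_plug[where r=3 and p=2 and q=3 and m=0 and j=0, OF plug_oks(3) plug_oks(1) _ plug_oks(1)
      b_slin0[OF assms(4)] b_slin0[OF assms(3)] b_closed[OF assms(1,2)]] by simp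

lemma br_l_br_r:
  assumes "x \<in> carrier M" "y \<in> carrier M" "z \<in> carrier M" "w \<in> carrier M"
  shows "plug 4 M 0 (\<lambda>e. b e w) (br_r M b x y z) = plug 4 M 1 (\<lambda>e. br_l M b x e w) (b y z)"
  unfolding br_l_def br_r_def
  using plug_plug[where r=3 and p=2 and q=3 and m=0 and j=1, OF plug_oks(3) plug_oks(1) _ plug_oks(2)
      b_slin0[OF assms(4)] b_slin1[OF assms(1)] b_closed[OF assms(2,3)]] by simp

lemma br_r_br_l:
  assumes "x \<in> carrier M" "y \<in> carrier M" "z \<in> carrier M" "w \<in> carrier M"
  shows "plug 4 M 1 (b x) (br_l M b y z w) = plug 4 M 1 (\<lambda>e. br_r M b x e w) (b y z)"
  unfolding br_l_def br_r_def
  using plug_plug[where r=3 and p=2 and q=3 and m=1 and j=0, OF plug_oks(4) plug_oks(2) _ plug_oks(1)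
      b_slin1[OF assms(1)] b_slin0[OF assms(4)] b_closed[OF assms(2,3)]] by simp

text \<open>Two readings of [[x*y]*[z*w]]: the inner brackets fill different arguments of the outer
  one, and \<open>plug_commute\<close> allows either order.\<close>

lemma br_r_br_l_commute:
  assumes "x \<in> carrier M" "y \<in> carrier M" "z \<in> carrier M" "w \<in> carrier M"
  shows "plug 4 M 0 (\<lambda>e. br_r M b e z w) (b x y) = plug 4 M 2 (\<lambda>e. br_l M b x y e) (b z w)"
  unfolding br_l_def br_r_def
  using plug_commute[where \<phi>=b and k=2 and i=0 and m=1 and r=3 and r'=3 and l=2 and p=2 and n=4,
      OF plug_oks(2) plug_oks(5) plug_oks(1) _ _ b_slin1 b_slin0 b_closed[OF assms(1,2)] b_closed[OF assms(3,4)]]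
  by simp

lemma slots_slots4:
  assumes X: "X \<in> carrier (tens 4 M)"
  shows "slots M [1, 0, 2, 3] (slots M [2, 0, 1, 3] X) = slots M [0, 2, 1, 3] X"
    "slots M [1, 2, 0, 3] (slots M [0, 2, 1, 3] X) = slots M [2, 1, 0, 3] X"
  using slots_slots[of "[1, 0, 2, 3]" "[2, 0, 1, 3]", OF _ _ M _ _ X] slots_slots[of "[1, 2, 0, 3]" "[0, 2, 1, 3]", OF _ _ M _ _ X]
  by (simp_all add: cop_inv_perms)

text \<open>The composability of the two chains of arrows in the coherence law.\<close>

lemma jac_objects1:
  assumes "x \<in> carrier M" "y \<in> carrier M" "z \<in> carrier M" "w \<in> carrier M"
  shows "plug 4 M 0 (\<lambda>e. b e w) (br_j M b x y z) = plug 4 M 1 (\<lambda>e. br_l M b x e w) (b y z)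
    \<ominus>\<^bsub>tens 4 M\<^esub> slots M [1, 0, 2, 3] (plug 4 M 1 (\<lambda>e. br_l M b y e w) (b x z))"
proof -
  have "plug 4 M 0 (\<lambda>e. b e w) (slots M [1, 0, 2] (br_r M b y x z)) =
      slots M [1, 0, 2, 3] (plug 4 M 0 (\<lambda>e. b e w) (br_r M b y x z))"
    using assms by (intro slots_inner4(1)[OF M M b_slin0 br_r_closed, symmetric])
  then show ?thesis
    using assms slots_closed'[OF cop_inv_perms(2) _ M, of 3] unfolding br_j_def
    by (simp add: plug_minus[OF plug_oks(3) b_slin0] br_r_closed br_l_br_r)
qed

lemma plug_slots_br_r:
  assumes "x \<in> carrier M" "y \<in> carrier M" "z \<in> carrier M" "w \<in> carrier M"
  shows "plug 4 M 1 (\<lambda>e. slots M [1, 0, 2] (br_r M b e x w)) (b y z) =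
    slots M [2, 0, 1, 3] (plug 4 M 2 (\<lambda>e. br_l M b y z e) (b x w))"
  using assms slots_outer4(2)[OF M M br_r_slin(1), of x w "b y z"]
  by (simp add: b_closed br_r_br_l_commute)

lemma plug_br_j:
  assumes "x \<in> carrier M" "y \<in> carrier M" "z \<in> carrier M" "w \<in> carrier M"
  shows "plug 4 M 1 (\<lambda>e. br_j M b x e w) (b y z) = plug 4 M 1 (b x) (br_l M b y z w)
    \<ominus>\<^bsub>tens 4 M\<^esub> slots M [2, 0, 1, 3] (plug 4 M 2 (\<lambda>e. br_l M b y z e) (b x w))"
  using assms unfolding br_j_def
  by (simp only: plug_minus_fun[OF plug_oks(6) br_r_slin(2) slots_br_r_slin(2) b_closed] br_r_br_l plug_slots_br_r)

lemma slots4_closed: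
  assumes "X \<in> carrier (tens 4 M)"
  shows "slots M [1, 0, 2, 3] X \<in> carrier (tens 4 M)" "slots M [2, 0, 1, 3] X \<in> carrier (tens 4 M)"
    "slots M [0, 2, 1, 3] X \<in> carrier (tens 4 M)" "slots M [1, 2, 0, 3] X \<in> carrier (tens 4 M)"
    "slots M [2, 1, 0, 3] X \<in> carrier (tens 4 M)"
  using assms by (auto intro!: slots_closed' M cop_inv_perms)

lemma plug_br_closed:
  assumes "x \<in> carrier M" "y \<in> carrier M" "z \<in> carrier M" "w \<in> carrier M"
  shows "plug 4 M 1 (b x) (br_l M b y z w) \<in> carrier (tens 4 M)"
    "plug 4 M 1 (b x) (br_r M b y z w) \<in> carrier (tens 4 M)"
    "plug 4 M 2 (\<lambda>e. br_l M b x y e) (b z w) \<in> carrier (tens 4 M)"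
    "plug 4 M 0 (\<lambda>e. br_r M b e x y) (b z w) \<in> carrier (tens 4 M)"
  using assms
  by (auto intro!: plug_closed[OF plug_oks(4) b_slin1] plug_closed[OF plug_oks(7) br_l_slin(3)]
      plug_closed[OF plug_oks(5) br_r_slin(1)] br_l_closed br_r_closed b_closed)

text \<open>Both sides are [x*[[y*z]*w]] - [[y*z]*[x*w]] - [y*[[x*z]*w]] + [[x*z]*[y*w]], on the
  left as the target of the second step of the first chain, on the right as the source of its third
  step.\<close>

lemma jac_objects2:
  assumes "x \<in> carrier M" "y \<in> carrier M" "z \<in> carrier M" "w \<in> carrier M"
  shows "plug 4 M 1 (\<lambda>e. br_j M b x e w) (b y z)
      \<ominus>\<^bsub>tens 4 M\<^esub> slots M [1, 0, 2, 3] (plug 4 M 1 (\<lambda>e. br_j M b y e w) (b x z)) =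
    plug 4 M 1 (b x) (br_l M b y z w)
      \<ominus>\<^bsub>tens 4 M\<^esub> slots M [2, 0, 1, 3] (plug 4 M 2 (\<lambda>e. br_l M b y z e) (b x w))
      \<ominus>\<^bsub>tens 4 M\<^esub> slots M [1, 0, 2, 3] (plug 4 M 1 (b y) (br_l M b x z w))
      + slots M [0, 2, 1, 3] (plug 4 M 2 (\<lambda>e. br_l M b x z e) (b y w))"
proof -
  define A B C D where ABCD: "A = plug 4 M 1 (b x) (br_l M b y z w)"
    "B = slots M [2, 0, 1, 3] (plug 4 M 2 (\<lambda>e. br_l M b y z e) (b x w))"
    "C = plug 4 M 1 (b y) (br_l M b x z w)"
    "D = plug 4 M 2 (\<lambda>e. br_l M b x z e) (b y w)"
  have c: "A \<in> carrier (tens 4 M)" "B \<in> carrier (tens 4 M)" "C \<in> carrier (tens 4 M)" "D \<in> carrier (tens 4 M)"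
    unfolding ABCD using assms by (auto intro!: plug_br_closed slots4_closed)
  have "slots M [1, 0, 2, 3] (C \<ominus>\<^bsub>tens 4 M\<^esub> slots M [2, 0, 1, 3] D) =
      slots M [1, 0, 2, 3] C \<ominus>\<^bsub>tens 4 M\<^esub> slots M [0, 2, 1, 3] D"
    using c by (simp add: slots_minus[OF cop_inv_perms(7) M] slots_slots4 slots4_closed cop_inv_perms)
  then show ?thesis
    using assms c by (simp add: plug_br_j ABCD[symmetric] slots4_closed tens_minus_minus_distrib tens_closed)
qed

lemma jac_objects3:
  assumes "x \<in> carrier M" "y \<in> carrier M" "z \<in> carrier M" "w \<in> carrier M"
  shows "plug 4 M 0 (\<lambda>e. br_j M b e z w) (b x y) = plug 4 M 0 (\<lambda>e. br_r M b e z w) (b x y)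
    \<ominus>\<^bsub>tens 4 M\<^esub> slots M [1, 2, 0, 3] (plug 4 M 1 (b z) (br_l M b x y w))"
proof -
  have "plug 4 M 0 (\<lambda>e. slots M [1, 0, 2] (br_r M b z e w)) (b x y) =
      slots M [1, 2, 0, 3] (plug 4 M 1 (b z) (br_l M b x y w))"
    using assms slots_outer4(3)[OF M M br_r_slin(2), of z w "b x y"] by (simp add: b_closed br_r_br_l)
  then show ?thesis
    using assms unfolding br_j_def
    by (simp only: plug_minus_fun[OF plug_oks(5) br_r_slin(1) slots_br_r_slin(1) b_closed])
qed

text \<open>Both sides are [[x*y]*[z*w]] - [z*[x*[y*w]]] + [z*[y*[x*w]]], on the left as the target
  of the second step of the second chain, on the right as the source of its third step.\<close>

lemma jac_objects4:
  assumes "x \<in> carrier M" "y \<in> carrier M" "z \<in> carrier M" "w \<in> carrier M"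
  shows "plug 4 M 0 (\<lambda>e. br_r M b e z w) (b x y)
      \<ominus>\<^bsub>tens 4 M\<^esub> slots M [1, 2, 0, 3] (plug 4 M 1 (b z) (br_j M b x y w)) =
    plug 4 M 2 (\<lambda>e. br_l M b x y e) (b z w)
      \<ominus>\<^bsub>tens 4 M\<^esub> slots M [1, 2, 0, 3] (plug 4 M 1 (b z) (br_r M b x y w))
      + slots M [2, 1, 0, 3] (plug 4 M 1 (b z) (br_r M b y x w))"
proof -
  define A B C where ABC: "A = plug 4 M 2 (\<lambda>e. br_l M b x y e) (b z w)"
    "B = plug 4 M 1 (b z) (br_r M b x y w)" "C = plug 4 M 1 (b z) (br_r M b y x w)"
  have c: "A \<in> carrier (tens 4 M)" "B \<in> carrier (tens 4 M)" "C \<in> carrier (tens 4 M)"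
    unfolding ABC using assms by (auto intro!: plug_br_closed)
  have "plug 4 M 1 (b z) (slots M [1, 0, 2] (br_r M b y x w)) = slots M [0, 2, 1, 3] C"
    unfolding ABC using assms by (intro slots_inner4(2)[OF M M b_slin1 br_r_closed, symmetric])
  then have "plug 4 M 1 (b z) (br_j M b x y w) = B \<ominus>\<^bsub>tens 4 M\<^esub> slots M [0, 2, 1, 3] C"
    unfolding br_j_def using assms slots_closed'[OF cop_inv_perms(2) _ M, of 3]
    by (simp add: plug_minus[OF plug_oks(4) b_slin1] br_r_closed ABC del: One_nat_def)
  then have "slots M [1, 2, 0, 3] (plug 4 M 1 (b z) (br_j M b x y w)) =
      slots M [1, 2, 0, 3] B \<ominus>\<^bsub>tens 4 M\<^esub> slots M [2, 1, 0, 3] C"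
    using c by (simp add: slots_minus[where \<sigma>="[1, 2, 0, 3]", OF _ M] slots_slots4 slots4_closed cop_inv_perms)
  then show ?thesis
    using assms c by (simp add: br_r_br_l_commute ABC[symmetric] slots4_closed tens_minus_minus_distrib tens_closed)
qed

end

section \<open>The category of 2-term \<open>L\<^sub>\<infinity>\<close> \<open>H\<close>-pseudoalgebras\<close>

context cocommutative_hopf_algebra
begin

lemma plug_zero: "plug_ok M N n k l m \<Longrightarrow> slin M N k m \<phi> \<Longrightarrow> plug n N m \<phi> (tens_rel l M) = tens_rel n N"
  by (rule additive_zero) (auto simp: plug_add plug_closed)

lemma slots_zero: "cop_inv \<sigma> \<Longrightarrow> length \<sigma> = n \<Longrightarrow> left_module M \<Longrightarrow> slots M \<sigma> (tens_rel n M) = tens_rel n M"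
  by (rule additive_zero) (auto simp: slots_add' slots_closed')

lemma slin_zero: "m < k \<Longrightarrow> left_module N \<Longrightarrow> slin M N k m (\<lambda>e. tens_rel k N)"
  unfolding slin_def using tens_closed(1)[of k N]
  by (auto intro!: additive_zero[symmetric] simp: lmul_add lmul_closed)

lemma plug_zero_fun:
  assumes ok: "plug_ok M N n k l m" and X: "X \<in> carrier (tens l M)"
  shows "plug n N m (\<lambda>e. tens_rel k N) X = tens_rel n N"
proof -
  note o = plug_okD[OF ok]
  note z = slin_zero[OF o(4) o(3), of M]
  have "plug n N m (\<lambda>e. tens_rel k N + tens_rel k N) X = plug n N m (\<lambda>e. tens_rel k N) X + plug n N m (\<lambda>e. tens_rel k N) X"
    by (rule plug_add_fun[OF ok z z X])
  then show ?thesis by (intro tens_idem plug_closed[OF ok z X]) (simp add: tens_closed)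
qed

lemma lhomI:
  assumes "\<And>x. x \<in> carrier M \<Longrightarrow> f x \<in> carrier N"
    "\<And>x y. x \<in> carrier M \<Longrightarrow> y \<in> carrier M \<Longrightarrow> f (x \<oplus>\<^bsub>M\<^esub> y) = f x \<oplus>\<^bsub>N\<^esub> f y"
    "\<And>r x. x \<in> carrier M \<Longrightarrow> f (r \<odot>\<^bsub>M\<^esub> x) = r \<odot>\<^bsub>N\<^esub> f x"
  shows "f \<in> lhom M N"
  using assms by (auto simp: lhom_def hom_def)

lemma lhom_comp: "f \<in> lhom M N \<Longrightarrow> g \<in> lhom N K \<Longrightarrow> (\<lambda>x. g (f x)) \<in> lhom M K"
  by (intro lhomI) (simp_all add: lhomD)

lemma lhom_cong:
  assumes "left_module M" "f \<in> lhom M N" "\<And>x. x \<in> carrier M \<Longrightarrow> g x = f x"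
  shows "g \<in> lhom M N"
proof -
  interpret M: left_module M by fact
  show ?thesis using assms(2,3) by (auto simp: lhom_def hom_def M.smult_closed)
qed

lemma lhom_ident: "(\<lambda>x. x) \<in> lhom M M"
  by (auto simp: lhom_def hom_def)

lemma polylinear2_cong:
  assumes "left_module A" "left_module B" "polylinear2 A B M f"
    and "\<And>x y. x \<in> carrier A \<Longrightarrow> y \<in> carrier B \<Longrightarrow> g x y = f x y"
  shows "polylinear2 A B M g"
proof -
  interpret A: left_module A by fact
  interpret B: left_module B by fact
  show ?thesis using assms(3) by (simp add: polylinear2_iff assms(4) A.smult_closed B.smult_closed)
qed

lemma polylinear2_comp:
  assumes "polylinear2 A B M f" "a \<in> lhom A' A" "b \<in> lhom B' B"
  shows "polylinear2 A' B' M (\<lambda>x y. f (a x) (b y))"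
  using assms(1) lhomD[OF assms(2)] lhomD[OF assms(3)] unfolding polylinear2_iff by simp

lemma linf2D:
  assumes "is_linf2 L"
  shows "left_module (deg0 L)" "left_module (deg1 L)" "beta1 L \<in> lhom (deg1 L) (deg0 L)"
    "polylinear2 (deg0 L) (deg0 L) (deg0 L) (beta00 L)" "polylinear2 (deg0 L) (deg1 L) (deg1 L) (beta01 L)"
    "polylinear2 (deg1 L) (deg0 L) (deg1 L) (beta10 L)" "polylinear3 (deg0 L) (deg1 L) (beta3 L)"
  using assms by (simp_all add: is_linf2_def Let_def)

text \<open>The left-hand side of the last condition in \<open>linf2_hom\<close>: the contribution
  of \<open>f2\<close> and the brackets, without the \<open>beta3\<close> terms.\<close>

definition hexagon_defect :: "('h, 'u) linf2 \<Rightarrow> ('h, 'u) linf2 \<Rightarrow> ('u \<Rightarrow> 'u) \<Rightarrow> ('u \<Rightarrow> 'u \<Rightarrow> ('h, 'u) tens) \<Rightarrow>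
    'u \<Rightarrow> 'u \<Rightarrow> 'u \<Rightarrow> ('h, 'u) tens" where
  "hexagon_defect L L' f0 f2 x y z =
    (let M1 = deg1 L'; T3 = tens 3 M1 in
        plug 3 M1 0 (\<lambda>e. beta10 L' e (f0 z)) (f2 x y)
        \<ominus>\<^bsub>T3\<^esub> plug 3 M1 1 (\<lambda>e. beta01 L' (f0 x) e) (f2 y z)
        \<oplus>\<^bsub>T3\<^esub> slots M1 [1, 0, 2] (plug 3 M1 1 (\<lambda>e. beta01 L' (f0 y) e) (f2 x z))
        \<oplus>\<^bsub>T3\<^esub> plug 3 M1 0 (\<lambda>e. f2 e z) (beta00 L x y)
        \<ominus>\<^bsub>T3\<^esub> plug 3 M1 1 (\<lambda>e. f2 x e) (beta00 L y z)
        \<oplus>\<^bsub>T3\<^esub> slots M1 [1, 0, 2] (plug 3 M1 1 (\<lambda>e. f2 y e) (beta00 L x z)))"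

text \<open>Differences are moved to the other side, since sums of classes are easier to simplify.
  This requires all values to lie in the carriers, so the case where one of the three maps fails to
  be linear is separated; there both sides are false.\<close>

lemma linf2_hom_iff:
  assumes L: "is_linf2 L" and L': "is_linf2 L'"
  shows "(f0, f1, f2) \<in> linf2_hom L L' \<longleftrightarrow>
    f0 \<in> lhom (deg0 L) (deg0 L') \<and> f0 \<in> extensional (carrier (deg0 L)) \<and>
    f1 \<in> lhom (deg1 L) (deg1 L') \<and> f1 \<in> extensional (carrier (deg1 L)) \<and>
    polylinear2 (deg0 L) (deg0 L) (deg1 L') f2 \<and> f2 \<in> extensional2 (carrier (deg0 L)) \<and>
    (\<forall>u\<in>carrier (deg1 L). beta1 L' (f1 u) = f0 (beta1 L u)) \<and>
    (\<forall>x\<in>carrier (deg0 L). \<forall>y\<in>carrier (deg0 L).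
      tmap 2 (deg0 L') f0 (beta00 L x y) = tmap 2 (deg0 L') (beta1 L') (f2 x y) + beta00 L' (f0 x) (f0 y)) \<and>
    (\<forall>x\<in>carrier (deg0 L). \<forall>u\<in>carrier (deg1 L).
      tmap 2 (deg1 L') f1 (beta01 L x u) = f2 x (beta1 L u) + beta01 L' (f0 x) (f1 u) \<and>
      tmap 2 (deg1 L') f1 (beta10 L u x) = f2 (beta1 L u) x + beta10 L' (f1 u) (f0 x)) \<and>
    (\<forall>x\<in>carrier (deg0 L). \<forall>y\<in>carrier (deg0 L). \<forall>z\<in>carrier (deg0 L).
      hexagon_defect L L' f0 f2 x y z =
        beta3 L' (f0 x) (f0 y) (f0 z) \<ominus>\<^bsub>tens 3 (deg1 L')\<^esub> tmap 3 (deg1 L') f1 (beta3 L x y z))"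
    (is "?lhs = ?rhs")
proof (cases "f0 \<in> lhom (deg0 L) (deg0 L') \<and> f1 \<in> lhom (deg1 L) (deg1 L') \<and> polylinear2 (deg0 L) (deg0 L) (deg1 L') f2")
  case True
  then have a: "f0 \<in> lhom (deg0 L) (deg0 L')" "f1 \<in> lhom (deg1 L) (deg1 L')" "polylinear2 (deg0 L) (deg0 L) (deg1 L') f2"
    by blast+
  note l = linf2D[OF L] and l' = linf2D[OF L']
  have n: "(2::nat) \<ge> 1" by simp
  note closed = polylinear2_closed[OF l(4)] polylinear2_closed[OF l(5)] polylinear2_closed[OF l(6)] polylinear2_closed[OF l'(4)]
    polylinear2_closed[OF l'(5)] polylinear2_closed[OF l'(6)] polylinear2_closed[OF a(3)] lhomD(1)[OF a(1)] lhomD(1)[OF a(2)]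
    lhomD(1)[OF l(3)] tmap_closed[OF n l(1) a(1)] tmap_closed[OF n l(2) a(2)] tmap_closed[OF n l'(2) l'(3)]
  show ?thesis
    unfolding linf2_hom_def Let_def hexagon_defect_def mem_Collect_eq prod.case Int_iff
    by (simp add: a closed tens_minus_eq_iff cong: ball_cong conj_cong)
next
  case False
  then show ?thesis unfolding linf2_hom_def Let_def mem_Collect_eq prod.case Int_iff by blast
qed

lemma tmap_restrict_ident:
  assumes "n \<ge> 1" "left_module M" "X \<in> carrier (tens n M)"
  shows "tmap n M (\<lambda>x\<in>carrier M. x) X = X"
  using tmap_cong[OF assms(1,2) lhom_ident assms(3), of "\<lambda>x\<in>carrier M. x"] tmap_ident[OF assms] by simp

lemma linf2_id_hom:
  assumes L: "is_linf2 L"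
  shows "linf2_id L \<in> linf2_hom L L"
proof -
  note l = linf2D[OF L]
  interpret L0: left_module "deg0 L" by (rule l)
  interpret L1: left_module "deg1 L" by (rule l)
  let ?z = "\<lambda>x\<in>carrier (deg0 L). \<lambda>y\<in>carrier (deg0 L). tens_rel 2 (deg1 L)"
  have h: "(\<lambda>x\<in>carrier (deg0 L). x) \<in> lhom (deg0 L) (deg0 L)" "(\<lambda>u\<in>carrier (deg1 L). u) \<in> lhom (deg1 L) (deg1 L)"
    by (rule lhom_cong[OF l(1) lhom_ident]; simp) (rule lhom_cong[OF l(2) lhom_ident]; simp)
  have ok: "plug_ok (deg0 L) (deg1 L) 3 2 2 0" "plug_ok (deg0 L) (deg1 L) 3 2 2 1"
    "plug_ok (deg1 L) (deg1 L) 3 2 2 0" "plug_ok (deg1 L) (deg1 L) 3 2 2 1"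
    using l by (auto simp: plug_okI)
  have z0: "slin (deg0 L) (deg1 L) 2 0 (\<lambda>e. tens_rel 2 (deg1 L))" "slin (deg0 L) (deg1 L) 2 1 (\<lambda>e. tens_rel 2 (deg1 L))"
    by (auto intro: slin_zero l)
  have poly: "polylinear2 (deg0 L) (deg0 L) (deg1 L) ?z"
  proof -
    have "lmul (deg1 L) [g, h] (tens_rel 2 (deg1 L)) = tens_rel 2 (deg1 L)" for g h
      by (rule additive_zero) (auto simp: lmul_add[OF l(2)] lmul_closed[OF l(2)])
    then show ?thesis by (auto simp: polylinear2_iff tens_closed L0.smult_closed)
  qed
  have "hexagon_defect L L (\<lambda>x\<in>carrier (deg0 L). x) ?z x y z = tens_rel 3 (deg1 L)"
    if "x \<in> carrier (deg0 L)" "y \<in> carrier (deg0 L)" "z \<in> carrier (deg0 L)" for x y z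
  proof -
    have "plug 3 (deg1 L) 0 (\<lambda>e. beta10 L e z) (tens_rel 2 (deg1 L)) = tens_rel 3 (deg1 L)"
      "plug 3 (deg1 L) 1 (\<lambda>e. beta01 L x e) (tens_rel 2 (deg1 L)) = tens_rel 3 (deg1 L)"
      "plug 3 (deg1 L) 1 (\<lambda>e. beta01 L y e) (tens_rel 2 (deg1 L)) = tens_rel 3 (deg1 L)"
      using that by (auto intro!: plug_zero[OF ok(3)] plug_zero[OF ok(4)] polylinear2_slin0[OF l(6) l(1)] polylinear2_slin1[OF l(5) l(1)])
    moreover have "plug 3 (deg1 L) 0 (\<lambda>e. ?z e z) (beta00 L x y) = tens_rel 3 (deg1 L)"
      using that plug_cong[OF ok(1) z0(1), of "\<lambda>e. ?z e z" "beta00 L x y"] plug_zero_fun[OF ok(1)]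
      by (simp add: polylinear2_closed[OF l(4)])
    moreover have "plug 3 (deg1 L) 1 (\<lambda>e\<in>carrier (deg0 L). tens_rel 2 (deg1 L)) (beta00 L b c) = tens_rel 3 (deg1 L)"
      if "b \<in> carrier (deg0 L)" "c \<in> carrier (deg0 L)" for b c
      using that plug_cong[OF ok(2) z0(2), of "\<lambda>e\<in>carrier (deg0 L). tens_rel 2 (deg1 L)" "beta00 L b c"] plug_zero_fun[OF ok(2)]
      by (simp add: polylinear2_closed[OF l(4)])
    ultimately show ?thesis
      using that unfolding hexagon_defect_def Let_def
      by (simp add: slots_zero[OF cop_inv_perms(2) _ l(2)] tens_closed tens_minus_self)
  qed
  then show ?thesis
    unfolding linf2_id_def tens_zero linf2_hom_iff[OF L L]
    using h poly lhomD(1)[OF l(3)]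
    by (auto simp: extensional2_def tmap_restrict_ident l polylinear2_closed[OF l(4)] polylinear2_closed[OF l(5)]
        polylinear2_closed[OF l(6)] polylinear3_closed[OF l(7)] tmap_zero[OF _ l(2,3)] tens_minus_self)
qed

text \<open>For a composite of morphisms, \<open>p\<close> is the hexagon identity of the second
  morphism at the images of the elements, \<open>q\<close> the image of the identity of the first,
  and \<open>r\<close> collects the terms for the composite. The terms of \<open>r\<close> do not
  split one by one, only in the pairs 1 and 4, 2 and 5, 3 and 6.\<close>

lemma hexagon_arith:
  fixes n and M :: "('h, 'm) module"
  defines "T \<equiv> tens n M"
  assumes c: "p1 \<in> carrier T" "p2 \<in> carrier T" "p3 \<in> carrier T" "p4 \<in> carrier T" "p5 \<in> carrier T" "p6 \<in> carrier T"
    "q1 \<in> carrier T" "q2 \<in> carrier T" "q3 \<in> carrier T" "q4 \<in> carrier T" "q5 \<in> carrier T" "q6 \<in> carrier T"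
    "r1 \<in> carrier T" "r2 \<in> carrier T" "r3 \<in> carrier T" "r4 \<in> carrier T" "r5 \<in> carrier T" "r6 \<in> carrier T"
    "A \<in> carrier T" "B \<in> carrier T" "D \<in> carrier T"
    and p: "p1 \<ominus>\<^bsub>T\<^esub> p2 + p3 + p4 \<ominus>\<^bsub>T\<^esub> p5 + p6 = A \<ominus>\<^bsub>T\<^esub> B"
    and q: "q1 \<ominus>\<^bsub>T\<^esub> q2 + q3 + q4 \<ominus>\<^bsub>T\<^esub> q5 + q6 = B \<ominus>\<^bsub>T\<^esub> D"
    and r: "r1 + r4 = p1 + p4 + (q1 + q4)" "r2 + r5 = p2 + p5 + (q2 + q5)" "r3 + r6 = p3 + p6 + (q3 + q6)"
  shows "r1 \<ominus>\<^bsub>T\<^esub> r2 + r3 + r4 \<ominus>\<^bsub>T\<^esub> r5 + r6 = A \<ominus>\<^bsub>T\<^esub> D"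
proof -
  let ?R = "tens_rel n M"
  note c' = c[unfolded T_def]
  obtain x1 x2 x3 x4 x5 x6 where x: "p1 = x1 +o ?R" "p2 = x2 +o ?R" "p3 = x3 +o ?R" "p4 = x4 +o ?R" "p5 = x5 +o ?R" "p6 = x6 +o ?R"
    using c'(1-6) by (meson tens_repE)
  obtain y1 y2 y3 y4 y5 y6 where y: "q1 = y1 +o ?R" "q2 = y2 +o ?R" "q3 = y3 +o ?R" "q4 = y4 +o ?R" "q5 = y5 +o ?R" "q6 = y6 +o ?R"
    using c'(7-12) by (meson tens_repE)
  obtain z1 z2 z3 z4 z5 z6 where z: "r1 = z1 +o ?R" "r2 = z2 +o ?R" "r3 = z3 +o ?R" "r4 = z4 +o ?R" "r5 = z5 +o ?R" "r6 = z6 +o ?R"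
    using c'(13-18) by (meson tens_repE)
  obtain a b d where a: "A = a +o ?R" "B = b +o ?R" "D = d +o ?R"
    using c'(19-21) by (meson tens_repE)
  note S = subgrp_tens_rel[of n M]
  have P: "x1 - x2 + x3 + x4 - x5 + x6 - (a - b) \<in> ?R"
    using p c' unfolding T_def x a by (simp add: tens_calc)
  have Q: "y1 - y2 + y3 + y4 - y5 + y6 - (b - d) \<in> ?R"
    using q c' unfolding T_def y a by (simp add: tens_calc)
  have R: "z1 + z4 - (x1 + x4 + (y1 + y4)) \<in> ?R" "z2 + z5 - (x2 + x5 + (y2 + y5)) \<in> ?R" "z3 + z6 - (x3 + x6 + (y3 + y6)) \<in> ?R"
    using r c' unfolding x y z by (simp_all add: tens_calc)
  have "(x1 - x2 + x3 + x4 - x5 + x6 - (a - b)) + (y1 - y2 + y3 + y4 - y5 + y6 - (b - d))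
    + (z1 + z4 - (x1 + x4 + (y1 + y4))) - (z2 + z5 - (x2 + x5 + (y2 + y5))) + (z3 + z6 - (x3 + x6 + (y3 + y6))) \<in> ?R"
    by (rule subgrp_add[OF S subgrp_diff[OF S subgrp_add[OF S subgrp_add[OF S P Q] R(1)] R(2)] R(3)])
  also have "(x1 - x2 + x3 + x4 - x5 + x6 - (a - b)) + (y1 - y2 + y3 + y4 - y5 + y6 - (b - d))
    + (z1 + z4 - (x1 + x4 + (y1 + y4))) - (z2 + z5 - (x2 + x5 + (y2 + y5))) + (z3 + z6 - (x3 + x6 + (y3 + y6))) =
    z1 - z2 + z3 + z4 - z5 + z6 - (a - d)" by (simp add: algebra_simps)
  finally show ?thesis using c' unfolding T_def z a by (simp add: tens_calc)
qed

lemma linf2_homD: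
  assumes L: "is_linf2 L" and L': "is_linf2 L'" and f: "(f0, f1, f2) \<in> linf2_hom L L'"
  shows "f0 \<in> lhom (deg0 L) (deg0 L')" "f0 \<in> extensional (carrier (deg0 L))"
    "f1 \<in> lhom (deg1 L) (deg1 L')" "f1 \<in> extensional (carrier (deg1 L))"
    "polylinear2 (deg0 L) (deg0 L) (deg1 L') f2" "f2 \<in> extensional2 (carrier (deg0 L))"
    "u \<in> carrier (deg1 L) \<Longrightarrow> beta1 L' (f1 u) = f0 (beta1 L u)"
    "x \<in> carrier (deg0 L) \<Longrightarrow> y \<in> carrier (deg0 L) \<Longrightarrow>
      tmap 2 (deg0 L') f0 (beta00 L x y) = tmap 2 (deg0 L') (beta1 L') (f2 x y) + beta00 L' (f0 x) (f0 y)"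
    "x \<in> carrier (deg0 L) \<Longrightarrow> u \<in> carrier (deg1 L) \<Longrightarrow>
      tmap 2 (deg1 L') f1 (beta01 L x u) = f2 x (beta1 L u) + beta01 L' (f0 x) (f1 u)"
    "x \<in> carrier (deg0 L) \<Longrightarrow> u \<in> carrier (deg1 L) \<Longrightarrow>
      tmap 2 (deg1 L') f1 (beta10 L u x) = f2 (beta1 L u) x + beta10 L' (f1 u) (f0 x)"
    "x \<in> carrier (deg0 L) \<Longrightarrow> y \<in> carrier (deg0 L) \<Longrightarrow> z \<in> carrier (deg0 L) \<Longrightarrow>
      hexagon_defect L L' f0 f2 x y z =
        beta3 L' (f0 x) (f0 y) (f0 z) \<ominus>\<^bsub>tens 3 (deg1 L')\<^esub> tmap 3 (deg1 L') f1 (beta3 L x y z)"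
  using f unfolding linf2_hom_iff[OF L L'] by blast+

text \<open>Why the terms of the hexagon combine in pairs: the cross term
  \<open>plug 3 N m (\<lambda>u. \<gamma> (\<beta> u)) X\<close> appears once on each side, on the
  left because \<open>f\<close> preserves the bracket only up to \<open>\<beta>\<close> of
  \<open>X\<close>, on the right through the homotopy identity \<open>b\<close>.\<close>

lemma plug_composition:
  assumes M: "left_module M" "left_module M'" "left_module K" "left_module N" and m: "m < 2"
    and h: "f \<in> lhom M M'" "g \<in> lhom K N" "\<beta> \<in> lhom K M'"
    and s: "slin K K 2 m b" "slin N N 2 m b'" "slin M' N 2 m \<gamma>" "slin M K 2 m \<phi>" "slin M N 2 m \<theta>"
    and \<theta>: "\<And>e. e \<in> carrier M \<Longrightarrow> \<theta> e = \<gamma> (f e) + tmap 2 N g (\<phi> e)"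
    and b: "\<And>u. u \<in> carrier K \<Longrightarrow> tmap 2 N g (b u) = \<gamma> (\<beta> u) + b' (g u)"
    and c: "X \<in> carrier (tens 2 K)" "Y \<in> carrier (tens 2 M)" "Y' \<in> carrier (tens 2 M')" "Z \<in> carrier (tens 2 N)"
    and Y: "tmap 2 M' f Y = tmap 2 M' \<beta> X + Y'"
  shows "plug 3 N m b' (Z + tmap 2 N g X) + plug 3 N m \<theta> Y =
    plug 3 N m b' Z + plug 3 N m \<gamma> Y' + (tmap 3 N g (plug 3 K m b X) + tmap 3 N g (plug 3 K m \<phi> Y))"
proof -
  have n: "(2::nat) \<ge> 1" by simp
  have ok: "plug_ok A B 3 2 2 m" if "left_module A" "left_module B" for A :: "('h, 'z) module" and B :: "('h, 'y) module"
    using that m by (auto simp: plug_okI)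
  have 1: "plug 3 N m b' (Z + tmap 2 N g X) = plug 3 N m b' Z + plug 3 N m (\<lambda>u. b' (g u)) X"
    by (simp add: plug_add[OF ok[OF M(4,4)] s(2)] c tmap_closed[OF n M(3) h(2)] plug_tmap[OF ok[OF M(4,4)] s(2) M(3) h(2)])
  have 2: "tmap 3 N g (plug 3 K m b X) = plug 3 N m (\<lambda>u. \<gamma> (\<beta> u)) X + plug 3 N m (\<lambda>u. b' (g u)) X"
    using tmap_plug[OF ok[OF M(3,3)] s(1) M(4) h(2) c(1)] plug_cong[OF ok[OF M(3,4)] slin_tmap[OF M(3,4) h(2) s(1)] b c(1)]
      plug_add_fun[OF ok[OF M(3,4)] slin_comp[OF s(3) h(3)] slin_comp[OF s(2) h(2)] c(1)] by simp
  have 3: "plug 3 N m (\<lambda>e. \<gamma> (f e)) Y = plug 3 N m (\<lambda>u. \<gamma> (\<beta> u)) X + plug 3 N m \<gamma> Y'"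
    using plug_tmap[OF ok[OF M(2,4)] s(3) M(1) h(1) c(2)] plug_tmap[OF ok[OF M(2,4)] s(3) M(3) h(3) c(1)]
    by (simp add: Y plug_add[OF ok[OF M(2,4)] s(3)] tmap_closed[OF n M(3) h(3)] c)
  have 4: "plug 3 N m \<theta> Y = plug 3 N m (\<lambda>e. \<gamma> (f e)) Y + tmap 3 N g (plug 3 K m \<phi> Y)"
    using plug_cong[OF ok[OF M(1,4)] s(5) \<theta> c(2)] tmap_plug[OF ok[OF M(1,3)] s(4) M(4) h(2) c(2)]
      plug_add_fun[OF ok[OF M(1,4)] slin_comp[OF s(3) h(1)] slin_tmap[OF M(3,4) h(2) s(4)] c(2)] by simp
  show ?thesis unfolding 1 2 3 4 by (simp add: ac_simps)
qed

lemma linf2_comp_hom: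
  assumes L: "is_linf2 L" and L': "is_linf2 L'" and L'': "is_linf2 L''"
    and f: "f \<in> linf2_hom L L'" and g: "g \<in> linf2_hom L' L''"
  shows "linf2_comp L L' L'' g f \<in> linf2_hom L L''"
proof -
  obtain f0 f1 f2 where f_eq: "f = (f0, f1, f2)" by (cases f)
  obtain g0 g1 g2 where g_eq: "g = (g0, g1, g2)" by (cases g)
  note l = linf2D[OF L] and l' = linf2D[OF L'] and l'' = linf2D[OF L'']
  note F = linf2_homD[OF L L' f[unfolded f_eq]] and G = linf2_homD[OF L' L'' g[unfolded g_eq]]
  define h0 where "h0 = (\<lambda>x\<in>carrier (deg0 L). g0 (f0 x))"
  define h1 where "h1 = (\<lambda>u\<in>carrier (deg1 L). g1 (f1 u))"
  define h2 where "h2 = (\<lambda>x\<in>carrier (deg0 L). \<lambda>y\<in>carrier (deg0 L). g2 (f0 x) (f0 y) + tmap 2 (deg1 L'') g1 (f2 x y))"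
  have h0: "h0 x = g0 (f0 x)" if "x \<in> carrier (deg0 L)" for x using that by (simp add: h0_def)
  have h1: "h1 x = g1 (f1 x)" if "x \<in> carrier (deg1 L)" for x using that by (simp add: h1_def)
  have h2: "h2 x y = g2 (f0 x) (f0 y) + tmap 2 (deg1 L'') g1 (f2 x y)"
    if "x \<in> carrier (deg0 L)" "y \<in> carrier (deg0 L)" for x y using that by (simp add: h2_def)
  have gf0: "(\<lambda>x. g0 (f0 x)) \<in> lhom (deg0 L) (deg0 L'')" by (rule lhom_comp[OF F(1) G(1)])
  have gf1: "(\<lambda>x. g1 (f1 x)) \<in> lhom (deg1 L) (deg1 L'')" by (rule lhom_comp[OF F(3) G(3)])
  have h0l: "h0 \<in> lhom (deg0 L) (deg0 L'')" by (rule lhom_cong[OF l(1) gf0]) (simp add: h0)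
  have h1l: "h1 \<in> lhom (deg1 L) (deg1 L'')" by (rule lhom_cong[OF l(2) gf1]) (simp add: h1)
  have fg2: "polylinear2 (deg0 L) (deg0 L) (deg1 L'') (\<lambda>x y. g2 (f0 x) (f0 y))"
    by (rule polylinear2_comp[OF G(5) F(1) F(1)])
  have gf2: "polylinear2 (deg0 L) (deg0 L) (deg1 L'') (\<lambda>x y. tmap 2 (deg1 L'') g1 (f2 x y))"
    by (rule polylinear2_tmap[OF F(5) l'(2) l''(2) G(3) lhom_ident lhom_ident])
  have h2p: "polylinear2 (deg0 L) (deg0 L) (deg1 L'') h2"
    by (rule polylinear2_cong[OF l(1) l(1) polylinear2_add[OF fg2 gf2 l''(2)]]) (simp add: h2)
  have n: "(2::nat) \<ge> 1" "(3::nat) \<ge> 1" by auto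
  note f0c = lhomD(1)[OF F(1)] and f1c = lhomD(1)[OF F(3)]
  note g0c = lhomD(1)[OF G(1)] and g1c = lhomD(1)[OF G(3)]
  note b00c = polylinear2_closed[OF l(4)] and b00c' = polylinear2_closed[OF l'(4)]
  note f2c = polylinear2_closed[OF F(5)] and g2c = polylinear2_closed[OF G(5)] and h2c = polylinear2_closed[OF h2p]
  note b01c' = polylinear2_closed[OF l'(5)] and b10c' = polylinear2_closed[OF l'(6)]
  note tadd = tmap_add[OF n(1) l'(1) G(1)] tmap_add[OF n(1) l'(2) G(3)] tmap_add[OF n(1) l''(2) l''(3)]
  have T0: "tmap 2 (deg0 L'') h0 X = tmap 2 (deg0 L'') g0 (tmap 2 (deg0 L') f0 X)" if "X \<in> carrier (tens 2 (deg0 L))" for X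
    using tmap_cong[OF n(1) l(1) h0l that h0] tmap_tmap[OF n(1) l(1) l'(1) F(1) G(1) that] by simp
  have T1: "tmap k (deg1 L'') h1 X = tmap k (deg1 L'') g1 (tmap k (deg1 L') f1 X)" if "k \<ge> 1" "X \<in> carrier (tens k (deg1 L))" for X k
    using tmap_cong[OF that(1) l(2) h1l that(2) h1] tmap_tmap[OF that(1) l(2) l'(2) F(3) G(3) that(2)] by simp
  have TB: "tmap 2 (deg0 L'') g0 (tmap 2 (deg0 L') (beta1 L') X) = tmap 2 (deg0 L'') (beta1 L'') (tmap 2 (deg1 L'') g1 X)"
    if "X \<in> carrier (tens 2 (deg1 L'))" for X
  proof -
    have "tmap 2 (deg0 L'') (\<lambda>x. g0 (beta1 L' x)) X = tmap 2 (deg0 L'') (\<lambda>x. beta1 L'' (g1 x)) X"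
      by (rule tmap_cong[OF n(1) l'(2) lhom_comp[OF l'(3) G(1)] that]) (simp add: G(7))
    then show ?thesis
      by (simp add: tmap_tmap[OF n(1) l'(2) l'(1) l'(3) G(1) that] tmap_tmap[OF n(1) l'(2) l''(2) G(3) l''(3) that])
  qed
  have 1: "beta1 L'' (h1 u) = h0 (beta1 L u)" if "u \<in> carrier (deg1 L)" for u
    using that by (simp add: h0 h1 F(7) G(7) f1c lhomD(1)[OF l(3)])
  have 2: "tmap 2 (deg0 L'') h0 (beta00 L x y) = tmap 2 (deg0 L'') (beta1 L'') (h2 x y) + beta00 L'' (h0 x) (h0 y)"
    if "x \<in> carrier (deg0 L)" "y \<in> carrier (deg0 L)" for x y
    using that by (simp add: T0 b00c F(8) tadd tmap_closed[OF n(1) l'(2,3)] f2c b00c' f0c TB G(8) h0 h2 g2c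
        tmap_closed[OF n(1) l'(2) G(3)] ac_simps)
  have 3: "tmap 2 (deg1 L'') h1 (beta01 L x u) = h2 x (beta1 L u) + beta01 L'' (h0 x) (h1 u)"
    "tmap 2 (deg1 L'') h1 (beta10 L u x) = h2 (beta1 L u) x + beta10 L'' (h1 u) (h0 x)"
    if "x \<in> carrier (deg0 L)" "u \<in> carrier (deg1 L)" for x u
    using that by (simp_all add: T1 polylinear2_closed[OF l(5)] polylinear2_closed[OF l(6)] F(9,10) tadd f2c f0c f1c
        lhomD(1)[OF l(3)] G(9,10) h0 h1 h2 b01c' b10c' F(7) ac_simps)
  have ok: "plug_ok (deg0 L) (deg1 L'') 3 2 2 0" "plug_ok (deg0 L) (deg1 L'') 3 2 2 1"
    "plug_ok (deg1 L') (deg1 L'') 3 2 2 0" "plug_ok (deg1 L') (deg1 L'') 3 2 2 1"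
    "plug_ok (deg1 L'') (deg1 L'') 3 2 2 0" "plug_ok (deg1 L'') (deg1 L'') 3 2 2 1"
    "plug_ok (deg0 L') (deg1 L'') 3 2 2 0" "plug_ok (deg0 L') (deg1 L'') 3 2 2 1"
    "plug_ok (deg1 L') (deg1 L') 3 2 2 0" "plug_ok (deg1 L') (deg1 L') 3 2 2 1"
    "plug_ok (deg0 L) (deg1 L') 3 2 2 0" "plug_ok (deg0 L) (deg1 L') 3 2 2 1"
    using l l' l'' by (auto simp: plug_okI)
  note s10'' = polylinear2_slin0[OF l''(6) l''(1)] and s01'' = polylinear2_slin1[OF l''(5) l''(1)]
  note s10' = polylinear2_slin0[OF l'(6) l'(1)] and s01' = polylinear2_slin1[OF l'(5) l'(1)]
  note sg = polylinear2_slin0[OF G(5) l'(1)] polylinear2_slin1[OF G(5) l'(1)]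
  note sf = polylinear2_slin0[OF F(5) l(1)] polylinear2_slin1[OF F(5) l(1)]
  note sh = polylinear2_slin0[OF h2p l(1)] polylinear2_slin1[OF h2p l(1)]
  \<comment> \<open>For the first argument (\<open>m = 0\<close>) the homotopy identity of
    \<open>g\<close> is used with the element of degree 1 on the left; \<open>A1\<close> uses the
    other half.\<close>
  have A0: "plug 3 (deg1 L'') 0 (\<lambda>e. beta10 L'' e (h0 z)) (h2 x y) + plug 3 (deg1 L'') 0 (\<lambda>e. h2 e z) (beta00 L x y) =
      plug 3 (deg1 L'') 0 (\<lambda>e. beta10 L'' e (h0 z)) (g2 (f0 x) (f0 y))
        + plug 3 (deg1 L'') 0 (\<lambda>e. g2 e (f0 z)) (beta00 L' (f0 x) (f0 y))
      + (tmap 3 (deg1 L'') g1 (plug 3 (deg1 L') 0 (\<lambda>e. beta10 L' e (f0 z)) (f2 x y))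
        + tmap 3 (deg1 L'') g1 (plug 3 (deg1 L') 0 (\<lambda>e. f2 e z) (beta00 L x y)))"
    if x: "x \<in> carrier (deg0 L)" and y: "y \<in> carrier (deg0 L)" and z: "z \<in> carrier (deg0 L)" for x y z
    by (rule plug_composition[OF l(1) l'(1) l'(2) l''(2) _ F(1) G(3) l'(3) s10'[OF f0c[OF z]] s10''[OF g0c[OF f0c[OF z]]]
          sg(1)[OF f0c[OF z]] sf(1)[OF z] sh(1)[OF z] h2[OF _ z] G(10)[OF f0c[OF z]] f2c[OF x y] b00c[OF x y]
          b00c'[OF f0c[OF x] f0c[OF y]] g2c[OF f0c[OF x] f0c[OF y]] F(8)[OF x y], folded h0[OF z] h2[OF x y]]) simp
  have A1: "plug 3 (deg1 L'') 1 (\<lambda>e. beta01 L'' (h0 x) e) (h2 y z) + plug 3 (deg1 L'') 1 (\<lambda>e. h2 x e) (beta00 L y z) =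
      plug 3 (deg1 L'') 1 (\<lambda>e. beta01 L'' (h0 x) e) (g2 (f0 y) (f0 z))
        + plug 3 (deg1 L'') 1 (\<lambda>e. g2 (f0 x) e) (beta00 L' (f0 y) (f0 z))
      + (tmap 3 (deg1 L'') g1 (plug 3 (deg1 L') 1 (\<lambda>e. beta01 L' (f0 x) e) (f2 y z))
        + tmap 3 (deg1 L'') g1 (plug 3 (deg1 L') 1 (\<lambda>e. f2 x e) (beta00 L y z)))"
    if x: "x \<in> carrier (deg0 L)" and y: "y \<in> carrier (deg0 L)" and z: "z \<in> carrier (deg0 L)" for x y z
    by (rule plug_composition[OF l(1) l'(1) l'(2) l''(2) _ F(1) G(3) l'(3) s01'[OF f0c[OF x]] s01''[OF g0c[OF f0c[OF x]]]
          sg(2)[OF f0c[OF x]] sf(2)[OF x] sh(2)[OF x] h2[OF x] G(9)[OF f0c[OF x]] f2c[OF y z] b00c[OF y z]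
          b00c'[OF f0c[OF y] f0c[OF z]] g2c[OF f0c[OF y] f0c[OF z]] F(8)[OF y z], folded h0[OF x] h2[OF y z]]) simp
  have 4: "hexagon_defect L L'' h0 h2 x y z =
      beta3 L'' (h0 x) (h0 y) (h0 z) \<ominus>\<^bsub>tens 3 (deg1 L'')\<^esub> tmap 3 (deg1 L'') h1 (beta3 L x y z)"
    if x: "x \<in> carrier (deg0 L)" and y: "y \<in> carrier (deg0 L)" and z: "z \<in> carrier (deg0 L)" for x y z
  proof -
    note fx = f0c[OF x] and fy = f0c[OF y] and fz = f0c[OF z]
    note hc = lhomD(1)[OF h0l]
    let ?s = "slots (deg1 L'') [1, 0, 2]"
    note sc = slots_closed'[OF cop_inv_perms(2) _ l''(2), of 3]
    note sc' = slots_closed'[OF cop_inv_perms(2) _ l'(2), of 3]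
    note b3 = polylinear3_closed[OF l(7)] polylinear3_closed[OF l'(7)] polylinear3_closed[OF l''(7)]
    note tc3 = tmap_closed[OF n(2) l'(2) G(3)]
    have cl: "plug 3 (deg1 L'') 0 (\<lambda>e. beta10 L'' e c) X \<in> carrier (tens 3 (deg1 L''))"
        "plug 3 (deg1 L'') 1 (\<lambda>e. beta01 L'' c e) X \<in> carrier (tens 3 (deg1 L''))"
      if "c \<in> carrier (deg0 L'')" "X \<in> carrier (tens 2 (deg1 L''))" for c X
      using plug_closed[OF ok(5) s10''] plug_closed[OF ok(6) s01''] that by auto
    have cl': "plug 3 (deg1 L') 0 (\<lambda>e. beta10 L' e c) X \<in> carrier (tens 3 (deg1 L'))"
        "plug 3 (deg1 L') 1 (\<lambda>e. beta01 L' c e) X \<in> carrier (tens 3 (deg1 L'))"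
      if "c \<in> carrier (deg0 L')" "X \<in> carrier (tens 2 (deg1 L'))" for c X
      using plug_closed[OF ok(9) s10'] plug_closed[OF ok(10) s01'] that by auto
    have clf: "plug 3 (deg1 L') 0 (\<lambda>e. f2 e c) X \<in> carrier (tens 3 (deg1 L'))"
        "plug 3 (deg1 L') 1 (\<lambda>e. f2 c e) X \<in> carrier (tens 3 (deg1 L'))"
        "plug 3 (deg1 L'') 0 (\<lambda>e. h2 e c) X \<in> carrier (tens 3 (deg1 L''))"
        "plug 3 (deg1 L'') 1 (\<lambda>e. h2 c e) X \<in> carrier (tens 3 (deg1 L''))"
      if "c \<in> carrier (deg0 L)" "X \<in> carrier (tens 2 (deg0 L))" for c X
      using plug_closed[OF ok(11) sf(1)] plug_closed[OF ok(12) sf(2)] plug_closed[OF ok(1) sh(1)] plug_closed[OF ok(2) sh(2)] that by auto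
    have clg: "plug 3 (deg1 L'') 0 (\<lambda>e. g2 e c) X \<in> carrier (tens 3 (deg1 L''))"
        "plug 3 (deg1 L'') 1 (\<lambda>e. g2 c e) X \<in> carrier (tens 3 (deg1 L''))"
      if "c \<in> carrier (deg0 L')" "X \<in> carrier (tens 2 (deg0 L'))" for c X
      using plug_closed[OF ok(7) sg(1)] plug_closed[OF ok(8) sg(2)] that by auto
    note P = G(11)[OF fx fy fz, unfolded hexagon_defect_def Let_def tens_add]
    have Q: "tmap 3 (deg1 L'') g1 (plug 3 (deg1 L') 0 (\<lambda>e. beta10 L' e (f0 z)) (f2 x y))
        \<ominus>\<^bsub>tens 3 (deg1 L'')\<^esub> tmap 3 (deg1 L'') g1 (plug 3 (deg1 L') 1 (\<lambda>e. beta01 L' (f0 x) e) (f2 y z))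
        + ?s (tmap 3 (deg1 L'') g1 (plug 3 (deg1 L') 1 (\<lambda>e. beta01 L' (f0 y) e) (f2 x z)))
        + tmap 3 (deg1 L'') g1 (plug 3 (deg1 L') 0 (\<lambda>e. f2 e z) (beta00 L x y))
        \<ominus>\<^bsub>tens 3 (deg1 L'')\<^esub> tmap 3 (deg1 L'') g1 (plug 3 (deg1 L') 1 (\<lambda>e. f2 x e) (beta00 L y z))
        + ?s (tmap 3 (deg1 L'') g1 (plug 3 (deg1 L') 1 (\<lambda>e. f2 y e) (beta00 L x z))) =
        tmap 3 (deg1 L'') g1 (beta3 L' (f0 x) (f0 y) (f0 z)) \<ominus>\<^bsub>tens 3 (deg1 L'')\<^esub> tmap 3 (deg1 L'') h1 (beta3 L x y z)"
    proof -
      have "tmap 3 (deg1 L'') g1 (hexagon_defect L L' f0 f2 x y z) =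
          tmap 3 (deg1 L'') g1 (beta3 L' (f0 x) (f0 y) (f0 z) \<ominus>\<^bsub>tens 3 (deg1 L')\<^esub> tmap 3 (deg1 L') f1 (beta3 L x y z))"
        by (simp only: F(11)[OF x y z])
      then show ?thesis
        using x y z fx fy fz unfolding hexagon_defect_def Let_def tens_add
        by (simp add: tmap_add[OF n(2) l'(2) G(3)] tmap_minus[OF n(2) l'(2) G(3)] tens_closed cl' clf sc' f2c b00c
            b3 tmap_closed[OF n(2) l(2) F(3)] T1 slots_tmap[OF cop_inv_perms(2) l'(2) l''(2) G(3)])
    qed
    \<comment> \<open>Up to sign, the third and sixth terms of the hexagon are the second and fifth
      with \<open>x\<close> and \<open>y\<close> exchanged, brought back to the order
      \<open>x\<close>, \<open>y\<close>, \<open>z\<close> by the slot permutation.\<close>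
    have SA1: "?s (plug 3 (deg1 L'') 1 (\<lambda>e. beta01 L'' (h0 y) e) (h2 x z)) + ?s (plug 3 (deg1 L'') 1 (\<lambda>e. h2 y e) (beta00 L x z)) =
      ?s (plug 3 (deg1 L'') 1 (\<lambda>e. beta01 L'' (h0 y) e) (g2 (f0 x) (f0 z)))
        + ?s (plug 3 (deg1 L'') 1 (\<lambda>e. g2 (f0 y) e) (beta00 L' (f0 x) (f0 z)))
      + (?s (tmap 3 (deg1 L'') g1 (plug 3 (deg1 L') 1 (\<lambda>e. beta01 L' (f0 y) e) (f2 x z)))
        + ?s (tmap 3 (deg1 L'') g1 (plug 3 (deg1 L') 1 (\<lambda>e. f2 y e) (beta00 L x z))))"
      using arg_cong[OF A1[OF y x z], of ?s] x y z fx fy fz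
      by (simp add: slots_add'[OF cop_inv_perms(2) _ l''(2), of 3] tens_closed cl clf clg cl' tc3 h2c g2c f2c b00c b00c' hc g0c)
    show ?thesis
      unfolding hexagon_defect_def Let_def tens_add h0[OF x] h0[OF y] h0[OF z]
      using x y z fx fy fz
      by (intro hexagon_arith[OF _ _ _ _ _ _ _ _ _ _ _ _ _ _ _ _ _ _ _ _ _ P Q
            A0[OF x y z, unfolded h0[OF z]] A1[OF x y z, unfolded h0[OF x]] SA1[unfolded h0[OF y]]])
        (simp_all add: cl clf clg cl' tc3 sc h2c g2c f2c b00c b00c' g0c b3 tmap_closed[OF n(2) l(2) h1l])
  qed
  have "linf2_comp L L' L'' g f = (h0, h1, h2)"
    by (simp add: linf2_comp_def f_eq g_eq h0_def h1_def h2_def)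
  then show ?thesis
    unfolding linf2_hom_iff[OF L L''] by (simp add: h0l h1l h2p 1 2 3 4 linf2_hom_iff[OF L L'']) (auto simp: h0_def h1_def h2_def extensional2_def)
qed

lemma extensional2_eqI:
  assumes "f \<in> extensional2 A" "g \<in> extensional2 A" "\<And>x y. x \<in> A \<Longrightarrow> y \<in> A \<Longrightarrow> f x y = g x y"
  shows "f = g"
proof (rule extensionalityI[of f A g])
  show "f \<in> extensional A" "g \<in> extensional A" using assms by (auto simp: extensional2_def)
  show "f x = g x" if "x \<in> A" for x
    using that assms by (intro extensionalityI[of _ A]) (auto simp: extensional2_def)
qed

lemma extensional2_restrict: "(\<lambda>x\<in>A. \<lambda>y\<in>A. f x y) \<in> extensional2 A"
  by (auto simp: extensional2_def)

lemma two_shLie_category: "is_category (two_shLie :: (('h, 'u) linf2, ('h, 'u) mor) category)"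
  unfolding is_category_def two_shLie_def category.simps
proof (intro conjI ballI)
  fix X :: "('h, 'u) linf2" assume "X \<in> Collect is_linf2"
  then show "linf2_id X \<in> linf2_hom X X" by (simp add: linf2_id_hom)
next
  fix X Y Z :: "('h, 'u) linf2" and f g
  assume "X \<in> Collect is_linf2" "Y \<in> Collect is_linf2" "Z \<in> Collect is_linf2" "f \<in> linf2_hom X Y" "g \<in> linf2_hom Y Z"
  then show "linf2_comp X Y Z g f \<in> linf2_hom X Z" by (simp add: linf2_comp_hom)
next
  fix X Y :: "('h, 'u) linf2" and f
  assume XY: "X \<in> Collect is_linf2" "Y \<in> Collect is_linf2" and f: "f \<in> linf2_hom X Y"
  obtain f0 f1 f2 where f_eq: "f = (f0, f1, f2)" by (cases f)
  have X: "is_linf2 X" and Y: "is_linf2 Y" using XY by auto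
  note x = linf2D[OF X] and y = linf2D[OF Y] and F = linf2_homD[OF X Y f[unfolded f_eq]]
  have n: "(2::nat) \<ge> 1" by simp
  have "(\<lambda>a\<in>carrier (deg0 X). f0 ((\<lambda>x\<in>carrier (deg0 X). x) a)) = f0"
    "(\<lambda>a\<in>carrier (deg1 X). f1 ((\<lambda>x\<in>carrier (deg1 X). x) a)) = f1"
    using F(2,4) by (auto simp: fun_eq_iff extensional_def)
  moreover have "(\<lambda>a\<in>carrier (deg0 X). \<lambda>b\<in>carrier (deg0 X). f2 ((\<lambda>x\<in>carrier (deg0 X). x) a) ((\<lambda>x\<in>carrier (deg0 X). x) b)
      + tmap 2 (deg1 Y) f1 ((\<lambda>a\<in>carrier (deg0 X). \<lambda>b\<in>carrier (deg0 X). tens_rel 2 (deg1 X)) a b)) = f2"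
    by (rule extensional2_eqI[OF extensional2_restrict F(6)])
      (simp add: tmap_zero[OF n x(2) F(3)] polylinear2_closed[OF F(5)])
  ultimately show "linf2_comp X X Y f (linf2_id X) = f"
    by (simp only: linf2_comp_def linf2_id_def f_eq prod.case tens_add tens_zero)
  have "(\<lambda>a\<in>carrier (deg0 X). (\<lambda>x\<in>carrier (deg0 Y). x) (f0 a)) = f0"
    "(\<lambda>a\<in>carrier (deg1 X). (\<lambda>x\<in>carrier (deg1 Y). x) (f1 a)) = f1"
    using F(2,4) lhomD(1)[OF F(1)] lhomD(1)[OF F(3)] by (auto simp: fun_eq_iff extensional_def)
  moreover have "(\<lambda>a\<in>carrier (deg0 X). \<lambda>b\<in>carrier (deg0 X).
      (\<lambda>a\<in>carrier (deg0 Y). \<lambda>b\<in>carrier (deg0 Y). tens_rel 2 (deg1 Y)) (f0 a) (f0 b)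
      + tmap 2 (deg1 Y) (\<lambda>x\<in>carrier (deg1 Y). x) (f2 a b)) = f2"
    by (rule extensional2_eqI[OF extensional2_restrict F(6)])
      (simp add: lhomD(1)[OF F(1)] tmap_restrict_ident[OF n y(2)] polylinear2_closed[OF F(5)])
  ultimately show "linf2_comp X Y Y (linf2_id Y) f = f"
    by (simp only: linf2_comp_def linf2_id_def f_eq prod.case tens_add tens_zero)
next
  fix W X Y Z :: "('h, 'u) linf2" and f g h
  assume WXYZ: "W \<in> Collect is_linf2" "X \<in> Collect is_linf2" "Y \<in> Collect is_linf2" "Z \<in> Collect is_linf2"
    and f: "f \<in> linf2_hom W X" and g: "g \<in> linf2_hom X Y" and h: "h \<in> linf2_hom Y Z"
  obtain f0 f1 f2 where f_eq: "f = (f0, f1, f2)" by (cases f)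
  obtain g0 g1 g2 where g_eq: "g = (g0, g1, g2)" by (cases g)
  obtain h0 h1 h2 where h_eq: "h = (h0, h1, h2)" by (cases h)
  have W: "is_linf2 W" and X: "is_linf2 X" and Y: "is_linf2 Y" and Z: "is_linf2 Z" using WXYZ by auto
  note w = linf2D[OF W] and x = linf2D[OF X] and y = linf2D[OF Y] and z = linf2D[OF Z]
  note F = linf2_homD[OF W X f[unfolded f_eq]] and G = linf2_homD[OF X Y g[unfolded g_eq]]
    and H = linf2_homD[OF Y Z h[unfolded h_eq]]
  have n: "(2::nat) \<ge> 1" by simp
  have hg: "(\<lambda>u\<in>carrier (deg1 X). h1 (g1 u)) \<in> lhom (deg1 X) (deg1 Z)"
    by (rule lhom_cong[OF x(2) lhom_comp[OF G(3) H(3)]]) simp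
  have T: "tmap 2 (deg1 Z) (\<lambda>u\<in>carrier (deg1 X). h1 (g1 u)) U = tmap 2 (deg1 Z) h1 (tmap 2 (deg1 Y) g1 U)"
    if "U \<in> carrier (tens 2 (deg1 X))" for U
    using tmap_cong[OF n x(2) hg that, of "\<lambda>u. h1 (g1 u)"] tmap_tmap[OF n x(2) y(2) G(3) H(3) that] by simp
  have "(\<lambda>a\<in>carrier (deg0 W). \<lambda>b\<in>carrier (deg0 W).
      h2 ((\<lambda>a\<in>carrier (deg0 W). g0 (f0 a)) a) ((\<lambda>a\<in>carrier (deg0 W). g0 (f0 a)) b) + tmap 2 (deg1 Z) h1
       ((\<lambda>a\<in>carrier (deg0 W). \<lambda>b\<in>carrier (deg0 W). g2 (f0 a) (f0 b) + tmap 2 (deg1 Y) g1 (f2 a b)) a b)) =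
     (\<lambda>a\<in>carrier (deg0 W). \<lambda>b\<in>carrier (deg0 W).
      (\<lambda>a\<in>carrier (deg0 X). \<lambda>b\<in>carrier (deg0 X). h2 (g0 a) (g0 b) + tmap 2 (deg1 Z) h1 (g2 a b)) (f0 a) (f0 b)
      + tmap 2 (deg1 Z) (\<lambda>u\<in>carrier (deg1 X). h1 (g1 u)) (f2 a b))"
    by (rule extensional2_eqI[OF extensional2_restrict extensional2_restrict])
      (simp add: lhomD(1)[OF F(1)] T polylinear2_closed[OF F(5)] polylinear2_closed[OF G(5)]
        tmap_add[OF n y(2) H(3)] tmap_closed[OF n x(2) G(3)] add.assoc)
  moreover have "(\<lambda>a\<in>carrier (deg0 W). h0 ((\<lambda>a\<in>carrier (deg0 W). g0 (f0 a)) a)) =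
      (\<lambda>a\<in>carrier (deg0 W). (\<lambda>a\<in>carrier (deg0 X). h0 (g0 a)) (f0 a))"
    "(\<lambda>a\<in>carrier (deg1 W). h1 ((\<lambda>a\<in>carrier (deg1 W). g1 (f1 a)) a)) =
      (\<lambda>a\<in>carrier (deg1 W). (\<lambda>a\<in>carrier (deg1 X). h1 (g1 a)) (f1 a))"
    using lhomD(1)[OF F(1)] lhomD(1)[OF F(3)] by (auto simp: fun_eq_iff)
  ultimately show "linf2_comp W Y Z h (linf2_comp W X Y g f) = linf2_comp W X Z (linf2_comp X Y Z h g) f"
    by (simp only: linf2_comp_def f_eq g_eq h_eq prod.case tens_add)
qed

end

section \<open>Splitting a Lie-2 \<open>H\<close>-pseudoalgebra\<close>

context cocommutative_hopf_algebra
begin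

text \<open>\<open>\<iota>\<close> identifies \<open>K\<close> with the kernel of the source map, and \<open>p\<close> is the arrow part
  \<open>a \<mapsto> a - 1\<^bsub>s(a)\<^esub>\<close>.\<close>

definition splits :: "('h, 'u) internal_cat \<Rightarrow> ('h, 'u) module \<Rightarrow> ('u \<Rightarrow> 'u) \<Rightarrow> ('u \<Rightarrow> 'u) \<Rightarrow> ('u \<Rightarrow> 'u) \<Rightarrow> bool" where
  "splits C K \<iota> p \<beta> \<longleftrightarrow> left_2_module C \<and> left_module K \<and> \<iota> \<in> lhom K (Ar C) \<and> p \<in> lhom (Ar C) K \<and> \<beta> \<in> lhom K (Ob C) \<and>
     (\<forall>u\<in>carrier K. src C (\<iota> u) = \<zero>\<^bsub>Ob C\<^esub> \<and> tgt C (\<iota> u) = \<beta> u \<and> p (\<iota> u) = u) \<and>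
     (\<forall>a\<in>carrier (Ar C). a = idn C (src C a) \<oplus>\<^bsub>Ar C\<^esub> \<iota> (p a))"

text \<open>The arrows \<open>br1 G a b\<close> and \<open>jac G x y z\<close> are prescribed by their sources and arrow parts. That
  they have the required targets is not part of the definition: it amounts to (i) and (iii).\<close>

definition presents :: "('h, 'u) lie2 \<Rightarrow> ('h, 'u) linf2 \<Rightarrow> ('u \<Rightarrow> 'u) \<Rightarrow> ('u \<Rightarrow> 'u) \<Rightarrow> bool" where
  "presents G L \<iota> p \<longleftrightarrow>
    (let C = lcat G; O0 = Ob C; A = Ar C; K = deg1 L in
     splits C K \<iota> p (beta1 L) \<and> deg0 L = O0 \<and>
     polylinear2 O0 O0 O0 (beta00 L) \<and> polylinear2 O0 K K (beta01 L) \<and> polylinear2 K O0 K (beta10 L) \<and>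
     polylinear3 O0 K (beta3 L) \<and> br0 G = beta00 L \<and>
     (\<forall>a\<in>carrier A. \<forall>b\<in>carrier A. br1 G a b \<in> carrier (tens 2 A) \<and>
        tmap 2 O0 (src C) (br1 G a b) = beta00 L (src C a) (src C b) \<and>
        tmap 2 K p (br1 G a b) = beta01 L (src C a) (p b) + beta10 L (p a) (tgt C b)) \<and>
     (\<forall>x\<in>carrier O0. \<forall>y\<in>carrier O0. \<forall>z\<in>carrier O0. jac G x y z \<in> carrier (tens 3 A) \<and>
        tmap 3 O0 (src C) (jac G x y z) = br_l O0 (beta00 L) x y z \<and>
        tmap 3 K p (jac G x y z) = beta3 L x y z))"

lemma lhom_zero:
  assumes "left_module M" "left_module N" "f \<in> lhom M N"
  shows "f \<zero>\<^bsub>M\<^esub> = \<zero>\<^bsub>N\<^esub>"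
proof -
  interpret M: left_module M by fact
  interpret N: left_module N by fact
  have "f \<zero>\<^bsub>M\<^esub> \<oplus>\<^bsub>N\<^esub> f \<zero>\<^bsub>M\<^esub> = f \<zero>\<^bsub>M\<^esub>"
    using lhomD(2)[OF assms(3), of "\<zero>\<^bsub>M\<^esub>" "\<zero>\<^bsub>M\<^esub>"] by simp
  then show ?thesis using lhomD(1)[OF assms(3)] N.add.l_cancel_one by simp
qed

lemma lhom_neg:
  assumes "left_module M" "left_module N" "f \<in> lhom M N" "x \<in> carrier M"
  shows "f (\<ominus>\<^bsub>M\<^esub> x) = \<ominus>\<^bsub>N\<^esub> f x"
proof -
  interpret M: left_module M by fact
  interpret N: left_module N by fact
  have "f (\<ominus>\<^bsub>M\<^esub> x) \<oplus>\<^bsub>N\<^esub> f x = \<zero>\<^bsub>N\<^esub>"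
    using lhomD(2)[OF assms(3), of "\<ominus>\<^bsub>M\<^esub> x" x] lhom_zero[OF assms(1-3)] assms(4) by (simp add: M.l_neg)
  then show ?thesis using lhomD(1)[OF assms(3)] assms(4) by (intro N.minus_equality[symmetric]) auto
qed

text \<open>Transports a structure map such as \<open>src\<close>, \<open>tgt\<close> or
  \<open>p\<close> into an iterated bracket of arrows: if \<open>f\<close> turns the outer map
  \<open>\<phi>\<close> into \<open>\<psi>\<close> applied after \<open>h\<close>, then
  \<open>h\<close> falls on the inserted element.\<close>

lemma tmap_plug_via:
  assumes ok: "plug_ok M A n k l m" and \<phi>: "slin M A k m \<phi>" and f: "f \<in> lhom A N" and N: "left_module N"
    and h: "h \<in> lhom M M0" and M0: "left_module M0" and \<psi>: "slin M0 N k m \<psi>"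
    and eq: "\<And>e. e \<in> carrier M \<Longrightarrow> tmap k N f (\<phi> e) = \<psi> (h e)"
    and X: "X \<in> carrier (tens l M)"
  shows "tmap n N f (plug n A m \<phi> X) = plug n N m \<psi> (tmap l M0 h X)"
proof -
  note o = plug_okD[OF ok]
  have ok': "plug_ok M N n k l m" "plug_ok M0 N n k l m"
    using ok N M0 by (auto simp: plug_ok_def ins_ok_def)
  have "tmap n N f (plug n A m \<phi> X) = plug n N m (\<lambda>e. tmap k N f (\<phi> e)) X"
    by (rule tmap_plug[OF ok \<phi> N f X])
  also have "\<dots> = plug n N m (\<lambda>e. \<psi> (h e)) X"
    by (rule plug_cong[OF ok'(1) slin_tmap[OF o(3) N f \<phi>] eq X])
  also have "\<dots> = plug n N m \<psi> (tmap l M0 h X)"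
    by (rule plug_tmap[OF ok'(2) \<psi> o(2) h X, symmetric])
  finally show ?thesis .
qed

text \<open>The version with two summands is needed for the arrow part of a bracket of arrows, which
  has one term for the arrow part of each argument.\<close>

lemma tmap_plug_via2:
  assumes ok: "plug_ok M A n k l m" and \<phi>: "slin M A k m \<phi>" and f: "f \<in> lhom A N" and N: "left_module N"
    and h: "h \<in> lhom M M0" "h' \<in> lhom M M1" and M0: "left_module M0" "left_module M1"
    and \<psi>: "slin M0 N k m \<psi>" "slin M1 N k m \<psi>'"
    and eq: "\<And>e. e \<in> carrier M \<Longrightarrow> tmap k N f (\<phi> e) = \<psi> (h e) + \<psi>' (h' e)"
    and X: "X \<in> carrier (tens l M)"
  shows "tmap n N f (plug n A m \<phi> X) = plug n N m \<psi> (tmap l M0 h X) + plug n N m \<psi>' (tmap l M1 h' X)"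
proof -
  note o = plug_okD[OF ok]
  have ok': "plug_ok M N n k l m" "plug_ok M0 N n k l m" "plug_ok M1 N n k l m"
    using ok N M0 by (auto simp: plug_ok_def ins_ok_def)
  have "tmap n N f (plug n A m \<phi> X) = plug n N m (\<lambda>e. tmap k N f (\<phi> e)) X"
    by (rule tmap_plug[OF ok \<phi> N f X])
  also have "\<dots> = plug n N m (\<lambda>e. \<psi> (h e) + \<psi>' (h' e)) X"
    by (rule plug_cong[OF ok'(1) slin_tmap[OF o(3) N f \<phi>] eq X])
  also have "\<dots> = plug n N m (\<lambda>e. \<psi> (h e)) X + plug n N m (\<lambda>e. \<psi>' (h' e)) X"
    by (rule plug_add_fun[OF ok'(1) slin_comp[OF \<psi>(1) h(1)] slin_comp[OF \<psi>(2) h(2)] X])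
  also have "\<dots> = plug n N m \<psi> (tmap l M0 h X) + plug n N m \<psi>' (tmap l M1 h' X)"
    by (simp only: plug_tmap[OF ok'(2) \<psi>(1) o(2) h(1) X] plug_tmap[OF ok'(3) \<psi>(2) o(2) h(2) X])
  finally show ?thesis .
qed

end

section \<open>Arrows of a split category and of its tensor categories\<close>

locale split_category = cocommutative_hopf_algebra scale comult counit antipode
  for scale :: "'k::field \<Rightarrow> 'h::ring_1 \<Rightarrow> 'h" (infixr \<open>*\<^sub>k\<close> 75)
    and comult :: "'h \<Rightarrow> ('h list \<Rightarrow>\<^sub>0 int) set" and counit :: "'h \<Rightarrow> 'k" and antipode :: "'h \<Rightarrow> 'h" +
  fixes C :: "('h, 'u) internal_cat" and K :: "('h, 'u) module" and \<iota> p \<beta> :: "'u \<Rightarrow> 'u"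
  assumes splits: "splits C K \<iota> p \<beta>"
begin

abbreviation "O0 \<equiv> Ob C"
abbreviation "A \<equiv> Ar C"
abbreviation "S n \<equiv> tmap n O0 (src C)"
abbreviation "T n \<equiv> tmap n O0 (tgt C)"
abbreviation "P n \<equiv> tmap n K p"
abbreviation "B n \<equiv> tmap n O0 (\<beta>)"
abbreviation "I n \<equiv> tmap n A (idn C)"
abbreviation "J n \<equiv> tmap n A \<iota>"

lemma left_2_module: "left_2_module C"
  using splits by (simp add: splits_def)

lemma O0 [simp, intro]: "left_module O0" and A [simp, intro]: "left_module A" and K [simp, intro]: "left_module K"
  using splits by (simp_all add: splits_def left_2_module_def)

lemma src [simp, intro]: "src C \<in> lhom A O0" and tgt [simp, intro]: "tgt C \<in> lhom A O0"
  and idn [simp, intro]: "idn C \<in> lhom O0 A" and cmp: "cmp C \<in> lhom (composable C) A"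
  and \<iota> [simp, intro]: "\<iota> \<in> lhom K A" and p [simp, intro]: "p \<in> lhom A K"
  and \<beta>1 [simp, intro]: "\<beta> \<in> lhom K O0"
  using splits by (simp_all add: splits_def left_2_module_def)

lemmas hom_closed [simp] = lhomD(1)[OF src] lhomD(1)[OF tgt] lhomD(1)[OF idn] lhomD(1)[OF \<iota>] lhomD(1)[OF p] lhomD(1)[OF \<beta>1]

sublocale O0: left_module O0 by (rule O0)
sublocale A: left_module A by (rule A)
sublocale K: left_module K by (rule K)

lemma src_idn [simp]: "x \<in> carrier O0 \<Longrightarrow> src C (idn C x) = x"
  and tgt_idn [simp]: "x \<in> carrier O0 \<Longrightarrow> tgt C (idn C x) = x"
  and cmp_idn: "f \<in> carrier A \<Longrightarrow> cmp C (f, idn C (src C f)) = f" "f \<in> carrier A \<Longrightarrow> cmp C (idn C (tgt C f), f) = f"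
  using left_2_module by (simp_all add: left_2_module_def)

lemma src_\<iota> [simp]: "u \<in> carrier K \<Longrightarrow> src C (\<iota> u) = \<zero>\<^bsub>O0\<^esub>"
  and tgt_\<iota> [simp]: "u \<in> carrier K \<Longrightarrow> tgt C (\<iota> u) = \<beta> u"
  and p_\<iota> [simp]: "u \<in> carrier K \<Longrightarrow> p (\<iota> u) = u"
  and split: "a \<in> carrier A \<Longrightarrow> a = idn C (src C a) \<oplus>\<^bsub>A\<^esub> \<iota> (p a)"
  using splits by (auto simp: splits_def)

lemmas hom_zero [simp] = lhom_zero[OF A O0 src] lhom_zero[OF A O0 tgt] lhom_zero[OF O0 A idn] lhom_zero[OF K A \<iota>]
  lhom_zero[OF A K p] lhom_zero[OF K O0 \<beta>1]

text \<open>Applying \<open>p\<close> to the decomposition of the identity arrow counts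
  \<open>p (idn C x)\<close> twice.\<close>

lemma p_idn [simp]: "x \<in> carrier O0 \<Longrightarrow> p (idn C x) = \<zero>\<^bsub>K\<^esub>"
proof -
  assume x: "x \<in> carrier O0"
  have "p (idn C x) = p (idn C x \<oplus>\<^bsub>A\<^esub> \<iota> (p (idn C x)))" using split[of "idn C x"] x by simp
  also have "\<dots> = p (idn C x) \<oplus>\<^bsub>K\<^esub> p (idn C x)" using x by (simp add: lhomD(2)[OF p])
  finally show ?thesis using x K.add.l_cancel_one[of "p (idn C x)" "p (idn C x)"] by simp
qed

lemma tgt_eq: "a \<in> carrier A \<Longrightarrow> tgt C a = src C a \<oplus>\<^bsub>O0\<^esub> \<beta> (p a)"
  by (subst split) (simp_all add: lhomD(2)[OF tgt])

lemma slin_zero_arg: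
  assumes "slin M N k m \<phi>" "left_module M" shows "\<phi> \<zero>\<^bsub>M\<^esub> = tens_rel k N"
proof -
  interpret M: left_module M by fact
  show ?thesis using slinD(3)[OF assms(1), of "\<zero>\<^bsub>M\<^esub>" "\<zero>\<^bsub>M\<^esub>"] slinD(2)[OF assms(1)] by (intro tens_idem) auto
qed

lemma tmaps_closed [simp]:
  assumes "n \<ge> 1"
  shows "X \<in> carrier (tens n A) \<Longrightarrow> S n X \<in> carrier (tens n O0)" "X \<in> carrier (tens n A) \<Longrightarrow> T n X \<in> carrier (tens n O0)"
    "X \<in> carrier (tens n A) \<Longrightarrow> P n X \<in> carrier (tens n K)" "U \<in> carrier (tens n K) \<Longrightarrow> B n U \<in> carrier (tens n O0)"
    "Y \<in> carrier (tens n O0) \<Longrightarrow> I n Y \<in> carrier (tens n A)" "U \<in> carrier (tens n K) \<Longrightarrow> J n U \<in> carrier (tens n A)"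
  using assms by (simp_all add: tmap_closed[OF _ A src] tmap_closed[OF _ A tgt] tmap_closed[OF _ A p]
      tmap_closed[OF _ K \<beta>1] tmap_closed[OF _ O0 idn] tmap_closed[OF _ K \<iota>])

lemma tmaps_add:
  assumes "n \<ge> 1"
  shows "X \<in> carrier (tens n A) \<Longrightarrow> Y \<in> carrier (tens n A) \<Longrightarrow> S n (X + Y) = S n X + S n Y"
    "X \<in> carrier (tens n A) \<Longrightarrow> Y \<in> carrier (tens n A) \<Longrightarrow> T n (X + Y) = T n X + T n Y"
    "X \<in> carrier (tens n A) \<Longrightarrow> Y \<in> carrier (tens n A) \<Longrightarrow> P n (X + Y) = P n X + P n Y"
    "U \<in> carrier (tens n K) \<Longrightarrow> V \<in> carrier (tens n K) \<Longrightarrow> B n (U + V) = B n U + B n V"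
  using assms by (simp_all add: tmap_add[OF _ A src] tmap_add[OF _ A tgt] tmap_add[OF _ A p] tmap_add[OF _ K \<beta>1])

lemma tmaps_minus:
  assumes "n \<ge> 1"
  shows "X \<in> carrier (tens n A) \<Longrightarrow> Y \<in> carrier (tens n A) \<Longrightarrow> S n (X \<ominus>\<^bsub>tens n A\<^esub> Y) = S n X \<ominus>\<^bsub>tens n O0\<^esub> S n Y"
    "X \<in> carrier (tens n A) \<Longrightarrow> Y \<in> carrier (tens n A) \<Longrightarrow> T n (X \<ominus>\<^bsub>tens n A\<^esub> Y) = T n X \<ominus>\<^bsub>tens n O0\<^esub> T n Y"
    "X \<in> carrier (tens n A) \<Longrightarrow> Y \<in> carrier (tens n A) \<Longrightarrow> P n (X \<ominus>\<^bsub>tens n A\<^esub> Y) = P n X \<ominus>\<^bsub>tens n K\<^esub> P n Y"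
  using assms by (simp_all add: tmap_minus[OF _ A src] tmap_minus[OF _ A tgt] tmap_minus[OF _ A p])

lemma tmaps_neg:
  assumes "n \<ge> 1"
  shows "X \<in> carrier (tens n A) \<Longrightarrow> S n (\<ominus>\<^bsub>tens n A\<^esub> X) = \<ominus>\<^bsub>tens n O0\<^esub> S n X"
    "X \<in> carrier (tens n A) \<Longrightarrow> P n (\<ominus>\<^bsub>tens n A\<^esub> X) = \<ominus>\<^bsub>tens n K\<^esub> P n X"
    "U \<in> carrier (tens n K) \<Longrightarrow> B n (\<ominus>\<^bsub>tens n K\<^esub> U) = \<ominus>\<^bsub>tens n O0\<^esub> B n U"
  using assms by (simp_all add: tmap_neg[OF _ A src] tmap_neg[OF _ A p] tmap_neg[OF _ K \<beta>1])

lemma tmaps_slots: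
  assumes "cop_inv \<sigma>" "length \<sigma> = n" "X \<in> carrier (tens n A)"
  shows "S n (slots A \<sigma> X) = slots O0 \<sigma> (S n X)" "T n (slots A \<sigma> X) = slots O0 \<sigma> (T n X)"
    "P n (slots A \<sigma> X) = slots K \<sigma> (P n X)"
  using assms by (simp_all add: slots_tmap[OF _ A O0 src] slots_tmap[OF _ A O0 tgt] slots_tmap[OF _ A K p])

lemma tmaps_tmaps [simp]:
  assumes "n \<ge> 1"
  shows "Y \<in> carrier (tens n O0) \<Longrightarrow> S n (I n Y) = Y" "Y \<in> carrier (tens n O0) \<Longrightarrow> T n (I n Y) = Y"
    "Y \<in> carrier (tens n O0) \<Longrightarrow> P n (I n Y) = tens_rel n K"
    "U \<in> carrier (tens n K) \<Longrightarrow> S n (J n U) = tens_rel n O0" "U \<in> carrier (tens n K) \<Longrightarrow> T n (J n U) = B n U"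
    "U \<in> carrier (tens n K) \<Longrightarrow> P n (J n U) = U"
proof -
  show "S n (I n Y) = Y" if Y: "Y \<in> carrier (tens n O0)"
    using tmap_tmap[OF assms O0 A idn src Y] tmap_cong[OF assms O0 lhom_comp[OF idn src] Y, of "\<lambda>x. x"] tmap_ident[OF assms O0 Y] by simp
  show "T n (I n Y) = Y" if Y: "Y \<in> carrier (tens n O0)"
    using tmap_tmap[OF assms O0 A idn tgt Y] tmap_cong[OF assms O0 lhom_comp[OF idn tgt] Y, of "\<lambda>x. x"] tmap_ident[OF assms O0 Y] by simp
  show "P n (I n Y) = tens_rel n K" if Y: "Y \<in> carrier (tens n O0)"
    using tmap_tmap[OF assms O0 A idn p Y] tmap_cong[OF assms O0 lhom_comp[OF idn p] Y, of "\<lambda>x. \<zero>\<^bsub>K\<^esub>"]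
      tmap_zero_map[OF assms O0 K Y] by simp
  show "S n (J n U) = tens_rel n O0" if Y: "U \<in> carrier (tens n K)"
    using tmap_tmap[OF assms K A \<iota> src Y] tmap_cong[OF assms K lhom_comp[OF \<iota> src] Y, of "\<lambda>x. \<zero>\<^bsub>O0\<^esub>"]
      tmap_zero_map[OF assms K O0 Y] by simp
  show "T n (J n U) = B n U" if Y: "U \<in> carrier (tens n K)"
    using tmap_tmap[OF assms K A \<iota> tgt Y] tmap_cong[OF assms K lhom_comp[OF \<iota> tgt] Y, of "\<beta>"] by simp
  show "P n (J n U) = U" if Y: "U \<in> carrier (tens n K)"
    using tmap_tmap[OF assms K A \<iota> p Y] tmap_cong[OF assms K lhom_comp[OF \<iota> p] Y, of "\<lambda>x. x"] tmap_ident[OF assms K Y] by simp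
qed

lemma T_eq:
  assumes n: "n \<ge> 1" and X: "X \<in> carrier (tens n A)"
  shows "T n X = S n X + B n (P n X)"
proof -
  have "T n X = tmap n O0 (\<lambda>a. src C a \<oplus>\<^bsub>O0\<^esub> \<beta> (p a)) X"
    by (rule tmap_cong[OF n A tgt X]) (rule tgt_eq)
  also have "\<dots> = S n X + tmap n O0 (\<lambda>a. \<beta> (p a)) X"
    by (rule tmap_plus[OF n A src lhom_comp[OF p \<beta>1] O0 X])
  finally show ?thesis by (simp add: tmap_tmap[OF n A K p \<beta>1 X])
qed

lemma tens_split:
  assumes n: "n \<ge> 1" and X: "X \<in> carrier (tens n A)"
  shows "X = I n (S n X) + J n (P n X)"
proof -
  have "X = tmap n A (\<lambda>a. a) X" by (rule tmap_ident[OF n A X, symmetric])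
  also have "\<dots> = tmap n A (\<lambda>a. idn C (src C a) \<oplus>\<^bsub>A\<^esub> \<iota> (p a)) X"
    by (rule tmap_cong[OF n A lhom_ident X]) (rule split)
  also have "\<dots> = tmap n A (\<lambda>a. idn C (src C a)) X + tmap n A (\<lambda>a. \<iota> (p a)) X"
    by (rule tmap_plus[OF n A lhom_comp[OF src idn] lhom_comp[OF p \<iota>] A X])
  finally show ?thesis by (simp add: tmap_tmap[OF n A O0 src idn X] tmap_tmap[OF n A K p \<iota> X])
qed

text \<open>An arrow is determined by its source and its arrow part. Equations between arrows are
  reduced in this way to one equation over the objects and one over \<open>K\<close>.\<close>

lemma tens_A_eqI:
  assumes "n \<ge> 1" "X \<in> carrier (tens n A)" "Y \<in> carrier (tens n A)" "S n X = S n Y" "P n X = P n Y"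
  shows "X = Y"
  using tens_split[OF assms(1,2)] tens_split[OF assms(1,3)] assms(4,5) by simp

lemma composable_carrier: "(g, f) \<in> carrier (composable C) \<longleftrightarrow> g \<in> carrier A \<and> f \<in> carrier A \<and> src C g = tgt C f"
  by (simp add: composable_def)

text \<open>In the module of composable pairs, \<open>(g, f)\<close> is the sum of the pair of
  \<open>idn C (tgt C f)\<close> and \<open>f\<close> and the pair of \<open>\<iota> (p g)\<close>
  and 0. Composition is additive, and each summand has an identity as one of its factors, because 0
  is the identity of the zero object.\<close>

lemma cmp_eq:
  assumes "g \<in> carrier A" "f \<in> carrier A" "src C g = tgt C f"
  shows "cmp C (g, f) = f \<oplus>\<^bsub>A\<^esub> \<iota> (p g)"
proof -
  have "(g, f) = (idn C (tgt C f), f) \<oplus>\<^bsub>composable C\<^esub> (\<iota> (p g), \<zero>\<^bsub>A\<^esub>)"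
    using assms split[of g] by (simp add: composable_def)
  then have "cmp C (g, f) = cmp C (idn C (tgt C f), f) \<oplus>\<^bsub>A\<^esub> cmp C (\<iota> (p g), \<zero>\<^bsub>A\<^esub>)"
    using assms lhomD(2)[OF cmp, of "(idn C (tgt C f), f)" "(\<iota> (p g), \<zero>\<^bsub>A\<^esub>)"] by (simp add: composable_carrier)
  also have "cmp C (\<iota> (p g), \<zero>\<^bsub>A\<^esub>) = \<iota> (p g)"
    using cmp_idn(1)[of "\<iota> (p g)"] assms by simp
  finally show ?thesis using assms by (simp add: cmp_idn)
qed

lemma left_module_composable: "left_module (composable C)"
proof (rule left_module.intro)
  show "abelian_group (composable C)"
  proof (rule abelian_groupI)
    fix x assume "x \<in> carrier (composable C)"
    then obtain g f where x: "x = (g, f)" "g \<in> carrier A" "f \<in> carrier A" "src C g = tgt C f"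
      by (auto simp: composable_def)
    show "\<exists>y\<in>carrier (composable C). y \<oplus>\<^bsub>composable C\<^esub> x = \<zero>\<^bsub>composable C\<^esub>"
      using x by (intro bexI[of _ "(\<ominus>\<^bsub>A\<^esub> g, \<ominus>\<^bsub>A\<^esub> f)"]) (auto simp: composable_def A.l_neg lhom_neg[OF A O0 src] lhom_neg[OF A O0 tgt])
  qed (auto simp: composable_def A.a_ac lhomD(2)[OF src] lhomD(2)[OF tgt])
  show "left_module_axioms (composable C)"
    by unfold_locales (auto simp: composable_def A.smult_closed A.smult_add_scalar A.smult_add A.smult_mult A.smult_1
        lhomD(3)[OF src] lhomD(3)[OF tgt])
qed

lemma tens_cat_simps [simp]:
  "Ob (tens_cat n C) = tens n O0" "Ar (tens_cat n C) = tens n A"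
  "src (tens_cat n C) = S n" "tgt (tens_cat n C) = T n" "idn (tens_cat n C) = I n"
  by (simp_all add: tens_cat_def)

text \<open>A lift of \<open>(Y, X)\<close> to the tensor module of composable pairs is obtained by
  applying \<open>a \<mapsto> (\<iota> (p a), 0)\<close> to \<open>Y\<close> and
  \<open>a \<mapsto> (idn C (tgt C a), a)\<close> to \<open>X\<close> and adding. By
  \<open>cmp_eq\<close> the composite of any lift is a function of its two projections, so the
  description in \<open>tens_cat\<close> has a unique solution.\<close>

lemma tens_cmp:
  assumes n: "n \<ge> 1" and X: "X \<in> carrier (tens n A)" and Y: "Y \<in> carrier (tens n A)" and eq: "S n Y = T n X"
  shows "cmp (tens_cat n C) (Y, X) = X + J n (P n Y)"
proof -
  let ?c = "composable C"
  note c = left_module_composable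
  have f: "(\<lambda>a. (\<iota> (p a), \<zero>\<^bsub>A\<^esub>)) \<in> lhom A ?c" "(\<lambda>a. (idn C (tgt C a), a)) \<in> lhom A ?c"
    using lhomD(3)[OF lhom_zero_map[OF A]]
    by (auto intro!: lhomI simp: composable_def lhomD(2,3)[OF p] lhomD(2,3)[OF \<iota>] lhomD(2,3)[OF tgt] lhomD(2,3)[OF idn])
  have fst: "fst \<in> lhom ?c A" and snd: "snd \<in> lhom ?c A"
    by (auto intro!: lhomI simp: composable_def)
  have val: "tmap n A (cmp C) Q = tmap n A snd Q + J n (P n (tmap n A fst Q))" if Q: "Q \<in> carrier (tens n ?c)" for Q
  proof -
    have pf: "(\<lambda>x. \<iota> (p (fst x))) \<in> lhom ?c A" by (rule lhom_comp[OF lhom_comp[OF fst p] \<iota>])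
    have "tmap n A (cmp C) Q = tmap n A (\<lambda>x. snd x \<oplus>\<^bsub>A\<^esub> \<iota> (p (fst x))) Q"
      by (rule tmap_cong[OF n c cmp Q]) (auto simp: composable_def cmp_eq)
    also have "\<dots> = tmap n A snd Q + tmap n A (\<lambda>x. \<iota> (p (fst x))) Q"
      by (rule tmap_plus[OF n c snd pf A Q])
    finally show ?thesis
      using tmap_tmap[OF n c A fst lhom_comp[OF p \<iota>] Q] tmap_tmap[OF n A K p \<iota> tmap_closed[OF n c fst Q]] by simp
  qed
  define Q where "Q = tmap n ?c (\<lambda>a. (\<iota> (p a), \<zero>\<^bsub>A\<^esub>)) Y + tmap n ?c (\<lambda>a. (idn C (tgt C a), a)) X"
  have Qc: "Q \<in> carrier (tens n ?c)"
    unfolding Q_def by (intro tens_closed tmap_closed[OF n A f(1) Y] tmap_closed[OF n A f(2) X])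
  have Q1: "tmap n A fst Q = Y"
  proof -
    have "tmap n A fst Q = tmap n A (\<lambda>a. \<iota> (p a)) Y + tmap n A (\<lambda>a. idn C (tgt C a)) X"
      unfolding Q_def
      by (simp add: tmap_add[OF n c fst] tmap_closed[OF n A f(1) Y] tmap_closed[OF n A f(2) X]
          tmap_tmap[OF n A c f(1) fst Y] tmap_tmap[OF n A c f(2) fst X])
    also have "\<dots> = J n (P n Y) + I n (T n X)"
      by (simp add: tmap_tmap[OF n A K p \<iota> Y] tmap_tmap[OF n A O0 tgt idn X])
    also have "\<dots> = Y" using tens_split[OF n Y] eq by (simp add: add.commute)
    finally show ?thesis .
  qed
  have Q2: "tmap n A snd Q = X"
    unfolding Q_def using tmap_zero_map[OF n A A Y] tmap_ident[OF n A X] X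
    by (simp add: tmap_add[OF n c snd] tmap_closed[OF n A f(1) Y] tmap_closed[OF n A f(2) X]
          tmap_tmap[OF n A c f(1) snd Y] tmap_tmap[OF n A c f(2) snd X])
  show ?thesis
    unfolding tens_cat_def internal_cat.simps prod.case
  proof (rule the_equality)
    show "\<exists>q\<in>carrier (tens n ?c). tmap n A fst q = Y \<and> tmap n A snd q = X \<and> X + J n (P n Y) = tmap n A (cmp C) q"
      using Qc Q1 Q2 val[OF Qc] by (intro bexI[of _ Q]) auto
    show "e = X + J n (P n Y)"
      if "\<exists>q\<in>carrier (tens n ?c). tmap n A fst q = Y \<and> tmap n A snd q = X \<and> e = tmap n A (cmp C) q" for e
      using that val by auto
  qed
qed

lemma tens_cmp_parts:
  assumes n: "n \<ge> 1" and X: "X \<in> carrier (tens n A)" and Y: "Y \<in> carrier (tens n A)" and eq: "S n Y = T n X"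
  shows "cmp (tens_cat n C) (Y, X) \<in> carrier (tens n A)" "S n (cmp (tens_cat n C) (Y, X)) = S n X"
    "P n (cmp (tens_cat n C) (Y, X)) = P n X + P n Y" "T n (cmp (tens_cat n C) (Y, X)) = T n Y"
proof -
  show 1: "cmp (tens_cat n C) (Y, X) \<in> carrier (tens n A)" "S n (cmp (tens_cat n C) (Y, X)) = S n X"
    "P n (cmp (tens_cat n C) (Y, X)) = P n X + P n Y"
    unfolding tens_cmp[OF assms] using n X Y by (simp_all add: tmaps_add tens_closed)
  show "T n (cmp (tens_cat n C) (Y, X)) = T n Y"
    using eq by (simp add: T_eq[OF n] 1 X Y n tmaps_add ac_simps)
qed

text \<open>An internal category of modules is a groupoid: the arrow that starts at the target of
  \<open>f\<close> and has the negated arrow part is inverse to \<open>f\<close>. The isomorphism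
  conditions thus concern source and target only.\<close>

lemma iso_arrow_iff:
  assumes n: "n \<ge> 1"
  shows "iso_arrow_in (tens_cat n C) f x y \<longleftrightarrow> f \<in> carrier (tens n A) \<and> S n f = x \<and> T n f = y"
proof
  assume "f \<in> carrier (tens n A) \<and> S n f = x \<and> T n f = y"
  then have f: "f \<in> carrier (tens n A)" and x: "S n f = x" and y: "T n f = y" by auto
  define g where "g = I n y + J n (\<ominus>\<^bsub>tens n K\<^esub> P n f)"
  have yc: "y \<in> carrier (tens n O0)" using f y n by auto
  have xc: "x \<in> carrier (tens n O0)" using f x n by auto
  have gp: "g \<in> carrier (tens n A)" "S n g = y" "P n g = \<ominus>\<^bsub>tens n K\<^esub> P n f"
    unfolding g_def using n yc f by (simp_all add: tens_closed tmaps_add)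
  have "x + B n (P n f) + \<ominus>\<^bsub>tens n O0\<^esub> B n (P n f) = x"
    using tens_minus_self[of "B n (P n f)" n O0] f xc n by (simp add: add.assoc a_minus_def)
  then have gT: "T n g = x"
    using f y x n by (simp add: T_eq[OF n gp(1)] gp tmaps_neg) (simp add: T_eq[OF n f])
  have self: "P n f + \<ominus>\<^bsub>tens n K\<^esub> P n f = tens_rel n K"
    using tens_minus_self[of "P n f" n K] f n by (simp add: a_minus_def)
  have e: "S n g = T n f" "S n f = T n g" using gp gT x y by auto
  note gf = tens_cmp_parts[OF n f gp(1) e(1)] and fg = tens_cmp_parts[OF n gp(1) f e(2)]
  have "cmp (tens_cat n C) (g, f) = I n x"
    by (rule tens_A_eqI[OF n]) (use gf xc n gp x y self in auto)
  moreover have "cmp (tens_cat n C) (f, g) = I n y"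
    by (rule tens_A_eqI[OF n]) (use fg yc n gp gT x y self in \<open>auto simp: add.commute\<close>)
  ultimately show "iso_arrow_in (tens_cat n C) f x y"
    unfolding iso_arrow_in_def arrow_in_def using f x y gp gT by auto
qed (auto simp: iso_arrow_in_def arrow_in_def)

end

section \<open>Lie-2 data presented by 2-term data\<close>

locale presentation = split_category scale comult counit antipode "lcat G" "deg1 L" \<iota> p "beta1 L"
  for scale :: "'k::field \<Rightarrow> 'h::ring_1 \<Rightarrow> 'h" (infixr \<open>*\<^sub>k\<close> 75)
    and comult :: "'h \<Rightarrow> ('h list \<Rightarrow>\<^sub>0 int) set" and counit :: "'h \<Rightarrow> 'k" and antipode :: "'h \<Rightarrow> 'h"
    and G :: "('h, 'u) lie2" and L :: "('h, 'u) linf2" and \<iota> p :: "'u \<Rightarrow> 'u" +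
  assumes presents: "presents G L \<iota> p"
begin

abbreviation "C \<equiv> lcat G"
abbreviation "K \<equiv> deg1 L"

lemma deg0 [simp]: "deg0 L = O0" and br0 [simp]: "br0 G = beta00 L"
  using presents by (simp_all add: presents_def Let_def)

lemma b00 [simp, intro]: "polylinear2 O0 O0 O0 (beta00 L)"
  and b01 [simp, intro]: "polylinear2 O0 K K (beta01 L)"
  and b10 [simp, intro]: "polylinear2 K O0 K (beta10 L)"
  and b3 [simp, intro]: "polylinear3 O0 K (beta3 L)"
  using presents by (simp_all add: presents_def Let_def)

lemmas b_closed [simp] = polylinear2_closed[OF b00] polylinear2_closed[OF b01] polylinear2_closed[OF b10] polylinear3_closed[OF b3]

sublocale b: polylinear_bracket scale comult counit antipode O0 "beta00 L"
  by (rule polylinear_bracket.intro[OF cocommutative_hopf_algebra_axioms polylinear_bracket_axioms.intro[OF O0 b00]])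

lemma br1_closed [simp]: "a \<in> carrier A \<Longrightarrow> b \<in> carrier A \<Longrightarrow> br1 G a b \<in> carrier (tens 2 A)"
  and S_br1 [simp]: "a \<in> carrier A \<Longrightarrow> b \<in> carrier A \<Longrightarrow> S 2 (br1 G a b) = beta00 L (src C a) (src C b)"
  and P_br1 [simp]: "a \<in> carrier A \<Longrightarrow> b \<in> carrier A \<Longrightarrow> P 2 (br1 G a b) = beta01 L (src C a) (p b) + beta10 L (p a) (tgt C b)"
  and jac_closed [simp]: "x \<in> carrier O0 \<Longrightarrow> y \<in> carrier O0 \<Longrightarrow> z \<in> carrier O0 \<Longrightarrow> jac G x y z \<in> carrier (tens 3 A)"
  and S_jac [simp]: "x \<in> carrier O0 \<Longrightarrow> y \<in> carrier O0 \<Longrightarrow> z \<in> carrier O0 \<Longrightarrow> S 3 (jac G x y z) = br_l O0 (beta00 L) x y z"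
  and P_jac [simp]: "x \<in> carrier O0 \<Longrightarrow> y \<in> carrier O0 \<Longrightarrow> z \<in> carrier O0 \<Longrightarrow> P 3 (jac G x y z) = beta3 L x y z"
  using presents by (simp_all add: presents_def Let_def)

lemmas b00_slin = polylinear2_slin0[OF b00 O0] polylinear2_slin1[OF b00 O0]
lemmas b01_slin = polylinear2_slin0[OF b01 K] polylinear2_slin1[OF b01 O0]
lemmas b10_slin = polylinear2_slin0[OF b10 O0] polylinear2_slin1[OF b10 K]
lemmas b3_slin = polylinear3_slin[OF b3 O0]

lemma b_zero [simp]:
  "y \<in> carrier O0 \<Longrightarrow> beta00 L \<zero>\<^bsub>O0\<^esub> y = tens_rel 2 O0" "y \<in> carrier O0 \<Longrightarrow> beta00 L y \<zero>\<^bsub>O0\<^esub> = tens_rel 2 O0"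
  "u \<in> carrier K \<Longrightarrow> beta01 L \<zero>\<^bsub>O0\<^esub> u = tens_rel 2 K" "y \<in> carrier O0 \<Longrightarrow> beta01 L y \<zero>\<^bsub>K\<^esub> = tens_rel 2 K"
  "y \<in> carrier O0 \<Longrightarrow> beta10 L \<zero>\<^bsub>K\<^esub> y = tens_rel 2 K" "u \<in> carrier K \<Longrightarrow> beta10 L u \<zero>\<^bsub>O0\<^esub> = tens_rel 2 K"
  by (simp_all add: slin_zero_arg[OF b00_slin(1) O0] slin_zero_arg[OF b00_slin(2) O0] slin_zero_arg[OF b01_slin(1) O0]
      slin_zero_arg[OF b01_slin(2) K] slin_zero_arg[OF b10_slin(1) K] slin_zero_arg[OF b10_slin(2) O0])

lemma b_add:
  "x \<in> carrier O0 \<Longrightarrow> x' \<in> carrier O0 \<Longrightarrow> y \<in> carrier O0 \<Longrightarrow> beta00 L (x \<oplus>\<^bsub>O0\<^esub> x') y = beta00 L x y + beta00 L x' y"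
  "x \<in> carrier O0 \<Longrightarrow> x' \<in> carrier O0 \<Longrightarrow> y \<in> carrier O0 \<Longrightarrow> beta00 L y (x \<oplus>\<^bsub>O0\<^esub> x') = beta00 L y x + beta00 L y x'"
  "x \<in> carrier O0 \<Longrightarrow> x' \<in> carrier O0 \<Longrightarrow> u \<in> carrier K \<Longrightarrow> beta01 L (x \<oplus>\<^bsub>O0\<^esub> x') u = beta01 L x u + beta01 L x' u"
  "u \<in> carrier K \<Longrightarrow> u' \<in> carrier K \<Longrightarrow> y \<in> carrier O0 \<Longrightarrow> beta01 L y (u \<oplus>\<^bsub>K\<^esub> u') = beta01 L y u + beta01 L y u'"
  "u \<in> carrier K \<Longrightarrow> u' \<in> carrier K \<Longrightarrow> y \<in> carrier O0 \<Longrightarrow> beta10 L (u \<oplus>\<^bsub>K\<^esub> u') y = beta10 L u y + beta10 L u' y"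
  "x \<in> carrier O0 \<Longrightarrow> x' \<in> carrier O0 \<Longrightarrow> u \<in> carrier K \<Longrightarrow> beta10 L u (x \<oplus>\<^bsub>O0\<^esub> x') = beta10 L u x + beta10 L u x'"
  using b00 b01 b10 by (simp_all add: polylinear2_iff)

text \<open>\<open>presents\<close> prescribes only the source and the arrow part of
  \<open>br1 G a b\<close>. Both are polylinear in the two arrows, and together they determine the
  value.\<close>

lemma br1_polylinear: "polylinear2 A A A (br1 G)"
  unfolding polylinear2_iff
proof (intro conjI ballI allI)
  have n: "(2::nat) \<ge> 1" by simp
  show "br1 G a b \<in> carrier (tens 2 A)" if "a \<in> carrier A" "b \<in> carrier A" for a b using that by simp
  show "br1 G (a \<oplus>\<^bsub>A\<^esub> a') b = br1 G a b + br1 G a' b" if "a \<in> carrier A" "a' \<in> carrier A" "b \<in> carrier A" for a a' b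
    by (rule tens_A_eqI[OF n])
      (use that in \<open>simp_all add: tens_closed tmaps_add lhomD(2)[OF src] lhomD(2)[OF p] b_add ac_simps\<close>)
  show "br1 G b (a \<oplus>\<^bsub>A\<^esub> a') = br1 G b a + br1 G b a'" if "b \<in> carrier A" "a \<in> carrier A" "a' \<in> carrier A" for a a' b
    by (rule tens_A_eqI[OF n])
      (use that in \<open>simp_all add: tens_closed tmaps_add lhomD(2)[OF src] lhomD(2)[OF tgt] lhomD(2)[OF p] b_add ac_simps\<close>)
  show "br1 G (g \<odot>\<^bsub>A\<^esub> a) (h \<odot>\<^bsub>A\<^esub> b) = lmul A [g, h] (br1 G a b)" if "a \<in> carrier A" "b \<in> carrier A" for a b g h
  proof -
    have l: "length [g, h] = 2" by simp
    show ?thesis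
      by (rule tens_A_eqI[OF n])
        (use that b00 b01 b10 in \<open>simp_all add: A.smult_closed lmul_closed[OF A l n] lmul_tmap[OF A O0 src l n]
          lmul_tmap[OF A K p l n] lhomD(3)[OF src] lhomD(3)[OF tgt] lhomD(3)[OF p] polylinear2_iff lmul_add[OF K l n]\<close>)
  qed
qed

sublocale b1: polylinear_bracket scale comult counit antipode A "br1 G"
  by (rule polylinear_bracket.intro[OF cocommutative_hopf_algebra_axioms polylinear_bracket_axioms.intro[OF A br1_polylinear]])

end

context cocommutative_hopf_algebra
begin

lemma tens_zero_zero [simp]: "tens_rel n M + tens_rel n M = tens_rel n M"
  by (simp add: tens_closed)

lemma cop_inv_ident: "cop_inv [0, 1]" "cop_inv [0, 1, 2]"
  using cop_inv_comp[OF cop_inv_perms(1) cop_inv_perms(1)] cop_inv_comp[OF cop_inv_perms(2) cop_inv_perms(2)]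
  by (simp_all add: perm_def)

lemma slots_swap [simp]:
  assumes M: "left_module M"
  shows "X \<in> carrier (tens 2 M) \<Longrightarrow> slots M [1, 0] (slots M [1, 0] X) = X"
    "X \<in> carrier (tens 3 M) \<Longrightarrow> slots M [1, 0, 2] (slots M [1, 0, 2] X) = X"
proof -
  have u: "[0..<2] = [0, 1]" "[0..<3] = [0, 1, 2]" by (simp_all add: upt_rec)
  show "slots M [1, 0] (slots M [1, 0] X) = X" if X: "X \<in> carrier (tens 2 M)"
    using slots_slots[OF cop_inv_perms(1) cop_inv_perms(1) M _ _ X] slots_id[of 2, unfolded u, OF cop_inv_ident(1) M X] by simp
  show "slots M [1, 0, 2] (slots M [1, 0, 2] X) = X" if X: "X \<in> carrier (tens 3 M)"
    using slots_slots[OF cop_inv_perms(2) cop_inv_perms(2) M _ _ X] slots_id[of 3, unfolded u, OF cop_inv_ident(2) M X] by simp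
qed

lemma lmul_lmul:
  assumes M: "left_module M" and l: "length as = n" "length bs = n" "n \<ge> 1" and X: "X \<in> carrier (tens n M)"
  shows "lmul M as (lmul M bs X) = lmul M (map2 (*) as bs) X"
proof -
  have l': "length (map2 (*) as bs) = n" using l by simp
  show ?thesis using X M
  proof (induction rule: tens_induct)
    case (gen w e)
    then show ?case using l
      by (simp add: lmul_tpure[OF M l(1,3)] lmul_tpure[OF M l(2,3)] lmul_tpure[OF M l' l(3)] map2_mult_assoc)
  next
    case (add X Y)
    then show ?case by (simp add: lmul_add[OF M l(1,3)] lmul_add[OF M l(2,3)] lmul_add[OF M l' l(3)] lmul_closed[OF M l(2,3)])
  qed
qed

text \<open>Scalars are taken out one argument at a time, since \<open>[g, h, k]\<close> is the
  product of \<open>[1, 1, k]\<close>, \<open>[1, h, 1]\<close> and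
  \<open>[g, 1, 1]\<close>.\<close>

lemma polylinear3_of_slin:
  assumes M: "left_module M" and A: "left_module A"
    and s: "\<And>x y. x \<in> carrier A \<Longrightarrow> y \<in> carrier A \<Longrightarrow> slin A M 3 0 (\<lambda>e. f e x y)"
      "\<And>x y. x \<in> carrier A \<Longrightarrow> y \<in> carrier A \<Longrightarrow> slin A M 3 1 (\<lambda>e. f x e y)"
      "\<And>x y. x \<in> carrier A \<Longrightarrow> y \<in> carrier A \<Longrightarrow> slin A M 3 2 (\<lambda>e. f x y e)"
  shows "polylinear3 A M f"
  unfolding polylinear3_iff
proof (intro conjI ballI allI)
  interpret A: left_module A by fact
  show "f x y z \<in> carrier (tens 3 M)" if "x \<in> carrier A" "y \<in> carrier A" "z \<in> carrier A" for x y z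
    by (fact slinD(2)[OF s(1)[OF that(2,3)] that(1)])
  show "f (x \<oplus>\<^bsub>A\<^esub> x') y z = f x y z + f x' y z" "f y (x \<oplus>\<^bsub>A\<^esub> x') z = f y x z + f y x' z"
    "f y z (x \<oplus>\<^bsub>A\<^esub> x') = f y z x + f y z x'"
    if "x \<in> carrier A" "x' \<in> carrier A" "y \<in> carrier A" "z \<in> carrier A" for x x' y z
    by (fact slinD(3)[OF s(1)[OF that(3,4)] that(1,2)] slinD(3)[OF s(2)[OF that(3,4)] that(1,2)]
        slinD(3)[OF s(3)[OF that(3,4)] that(1,2)])+
  show "f (g \<odot>\<^bsub>A\<^esub> x) (h \<odot>\<^bsub>A\<^esub> y) (k \<odot>\<^bsub>A\<^esub> z) = lmul M [g, h, k] (f x y z)"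
    if "x \<in> carrier A" "y \<in> carrier A" "z \<in> carrier A" for x y z g h k
  proof -
    have c: "f x y z \<in> carrier (tens 3 M)" by (fact slinD(2)[OF s(1)[OF that(2,3)] that(1)])
    have "f (g \<odot>\<^bsub>A\<^esub> x) (h \<odot>\<^bsub>A\<^esub> y) (k \<odot>\<^bsub>A\<^esub> z) = lmul M [1, 1, k] (lmul M [1, h, 1] (lmul M [g, 1, 1] (f x y z)))"
      using that slinD(4)[OF s(1)] slinD(4)[OF s(2)] slinD(4)[OF s(3)] by (simp add: A.smult_closed unit_at_3)
    also have "\<dots> = lmul M [g, h, k] (f x y z)"
      using c lmul_closed[OF M _ _ c, of "[g, 1, 1]"] by (simp add: lmul_lmul[OF M, of _ 3] lmul_closed[OF M])
    finally show ?thesis .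
  qed
qed

end

context presentation
begin

lemma cmp_parts:
  assumes "g \<in> carrier A" "f \<in> carrier A" "src C g = tgt C f"
  shows "cmp C (g, f) \<in> carrier A" "src C (cmp C (g, f)) = src C f" "p (cmp C (g, f)) = p f \<oplus>\<^bsub>K\<^esub> p g"
    "tgt C (cmp C (g, f)) = tgt C g"
proof -
  show 1: "cmp C (g, f) \<in> carrier A" "src C (cmp C (g, f)) = src C f" "p (cmp C (g, f)) = p f \<oplus>\<^bsub>K\<^esub> p g"
    using assms by (simp_all add: cmp_eq lhomD(2)[OF src] lhomD(2)[OF p])
  show "tgt C (cmp C (g, f)) = tgt C g"
    using assms left_2_module unfolding left_2_module_def by (force simp: composable_carrier)
qed

text \<open>Skew-symmetry of \<open>\<beta>\<^sub>2\<close>, and (i) and (ii).\<close>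

definition bracket_axioms :: bool where
  "bracket_axioms \<longleftrightarrow> skew2 O0 O0 (beta00 L) \<and>
    (\<forall>x\<in>carrier O0. \<forall>u\<in>carrier K. slots K [1, 0] (beta10 L u x) = \<ominus>\<^bsub>tens 2 K\<^esub> beta01 L x u) \<and>
    (\<forall>x\<in>carrier O0. \<forall>u\<in>carrier K. B 2 (beta01 L x u) = beta00 L x (beta1 L u)) \<and>
    (\<forall>u\<in>carrier K. \<forall>v\<in>carrier K. beta01 L (beta1 L u) v = beta10 L u (beta1 L v))"

end

section \<open>From the bracket axioms to the bracket functor\<close>

locale presentation_bracket = presentation +
  assumes bracket_axioms: bracket_axioms
begin

lemma skew00: "x \<in> carrier O0 \<Longrightarrow> y \<in> carrier O0 \<Longrightarrow> slots O0 [1, 0] (beta00 L y x) = \<ominus>\<^bsub>tens 2 O0\<^esub> beta00 L x y"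
  and skew10: "x \<in> carrier O0 \<Longrightarrow> u \<in> carrier K \<Longrightarrow> slots K [1, 0] (beta10 L u x) = \<ominus>\<^bsub>tens 2 K\<^esub> beta01 L x u"
  and B01: "x \<in> carrier O0 \<Longrightarrow> u \<in> carrier K \<Longrightarrow> B 2 (beta01 L x u) = beta00 L x (beta1 L u)"
  and peiffer: "u \<in> carrier K \<Longrightarrow> v \<in> carrier K \<Longrightarrow> beta01 L (beta1 L u) v = beta10 L u (beta1 L v)"
  using bracket_axioms by (auto simp: bracket_axioms_def skew2_def)

lemma skew01: "x \<in> carrier O0 \<Longrightarrow> u \<in> carrier K \<Longrightarrow> slots K [1, 0] (beta01 L x u) = \<ominus>\<^bsub>tens 2 K\<^esub> beta10 L u x"
proof -
  assume a: "x \<in> carrier O0" "u \<in> carrier K"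
  have "\<ominus>\<^bsub>tens 2 K\<^esub> slots K [1, 0] (beta01 L x u) = slots K [1, 0] (slots K [1, 0] (beta10 L u x))"
    using a by (simp add: skew10 slots_neg[OF cop_inv_perms(1)])
  then have "\<ominus>\<^bsub>tens 2 K\<^esub> slots K [1, 0] (beta01 L x u) = beta10 L u x" using a by simp
  then show ?thesis
    using tens_minus_minus[of "slots K [1, 0] (beta01 L x u)" 2 K] a slots_closed'[OF cop_inv_perms(1), of 2 K] by simp
qed

lemma b10_eq: "x \<in> carrier O0 \<Longrightarrow> u \<in> carrier K \<Longrightarrow> beta10 L u x = \<ominus>\<^bsub>tens 2 K\<^esub> slots K [1, 0] (beta01 L x u)"
  by (simp add: skew01 tens_minus_minus)

lemma B10: "x \<in> carrier O0 \<Longrightarrow> u \<in> carrier K \<Longrightarrow> B 2 (beta10 L u x) = beta00 L (beta1 L u) x"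
  by (simp add: b10_eq tmaps_neg slots_closed'[OF cop_inv_perms(1)] slots_tmap[OF cop_inv_perms(1) K O0 \<beta>1] B01
      skew00 tens_minus_minus)

text \<open>By (i), in the two forms \<open>B01\<close> and \<open>B10\<close>, the map
  \<open>B 2\<close> turns the arrow part into brackets of objects. These are the changes of
  \<open>beta00 L\<close> when first the second and then the first argument passes from source to
  target.\<close>

lemma T_br1 [simp]:
  assumes "a \<in> carrier A" "b \<in> carrier A"
  shows "T 2 (br1 G a b) = beta00 L (tgt C a) (tgt C b)"
proof -
  have "T 2 (br1 G a b) = beta00 L (src C a) (src C b) + (beta00 L (src C a) (beta1 L (p b)) + beta00 L (beta1 L (p a)) (tgt C b))"
    using assms by (simp add: T_eq tmaps_add B01 B10)
  also have "\<dots> = beta00 L (src C a) (tgt C b) + beta00 L (beta1 L (p a)) (tgt C b)"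
    using assms by (simp add: tgt_eq[of b] b_add ac_simps)
  also have "\<dots> = beta00 L (tgt C a) (tgt C b)"
    using assms by (simp add: tgt_eq[of a] b_add)
  finally show ?thesis .
qed

text \<open>By (ii) it does not matter which of the two arrows is taken at its source and which at
  its target. Skew-symmetry needs this, as exchanging the arguments exchanges the two
  formulas.\<close>

lemma P_br1': "a \<in> carrier A \<Longrightarrow> b \<in> carrier A \<Longrightarrow> P 2 (br1 G a b) = beta01 L (tgt C a) (p b) + beta10 L (p a) (src C b)"
  by (simp add: tgt_eq b_add peiffer ac_simps)

lemma bracket_functor: "bracket_functor C (br0 G) (br1 G)"
  unfolding bracket_functor_def
proof (intro conjI ballI)
  have n: "(2::nat) \<ge> 1" by simp
  show "polylinear2 O0 O0 O0 (br0 G)" by simp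
  show "skew2 O0 O0 (br0 G)" by (simp add: skew2_def skew00)
  show "polylinear2 A A A (br1 G)" by (rule br1_polylinear)
  show "skew2 A A (br1 G)"
    unfolding skew2_def
  proof (intro ballI)
    fix a b assume a: "a \<in> carrier A" and b: "b \<in> carrier A"
    note sl = tmaps_slots[OF cop_inv_perms(1), of 2 "br1 G b a"]
    show "slots A [1, 0] (br1 G b a) = \<ominus>\<^bsub>tens 2 A\<^esub> br1 G a b"
    proof (rule tens_A_eqI[OF n])
      show "slots A [1, 0] (br1 G b a) \<in> carrier (tens 2 A)" "\<ominus>\<^bsub>tens 2 A\<^esub> br1 G a b \<in> carrier (tens 2 A)"
        using a b by (simp_all add: tens_closed slots_closed'[OF cop_inv_perms(1)])
      show "S 2 (slots A [1, 0] (br1 G b a)) = S 2 (\<ominus>\<^bsub>tens 2 A\<^esub> br1 G a b)"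
        using a b by (simp add: sl tmaps_neg skew00)
      show "P 2 (slots A [1, 0] (br1 G b a)) = P 2 (\<ominus>\<^bsub>tens 2 A\<^esub> br1 G a b)"
        using a b
        by (simp add: sl tmaps_neg P_br1' [of a b] slots_add'[OF cop_inv_perms(1)] skew01 skew10 neg_add add.commute del: P_br1)
          (simp add: slots_add'[OF cop_inv_perms(1)] skew01 skew10 neg_add add.commute)
    qed
  qed
  show "arrow_in (tens_cat 2 C) (br1 G a b) (br0 G (src C a) (src C b)) (br0 G (tgt C a) (tgt C b))"
    if "a \<in> carrier A" "b \<in> carrier A" for a b
    using that by (simp add: arrow_in_def)
  show "br1 G (idn C x) (idn C y) = internal_cat.idn (tens_cat 2 C) (br0 G x y)"
    if "x \<in> carrier O0" "y \<in> carrier O0" for x y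
    unfolding tens_cat_simps by (rule tens_A_eqI[OF n]) (use that in \<open>simp_all\<close>)
  show "case aa of (a', a) \<Rightarrow> \<forall>(b', b)\<in>carrier (composable C).
      br1 G (internal_cat.cmp C (a', a)) (internal_cat.cmp C (b', b)) = internal_cat.cmp (tens_cat 2 C) (br1 G a' b', br1 G a b)"
    if "aa \<in> carrier (composable C)" for aa
  proof (clarify)
    fix a' a b' b
    assume "aa = (a', a)" and bb: "(b', b) \<in> carrier (composable C)"
    with that have a: "a' \<in> carrier A" "a \<in> carrier A" "src C a' = tgt C a"
      and b: "b' \<in> carrier A" "b \<in> carrier A" "src C b' = tgt C b"
      by (simp_all add: composable_carrier)
    note ca = cmp_parts[OF a] and cb = cmp_parts[OF b]
    have e: "S 2 (br1 G a' b') = T 2 (br1 G a b)" using a b by simp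
    have ac: "br1 G a b \<in> carrier (tens 2 A)" "br1 G a' b' \<in> carrier (tens 2 A)" using a b by simp_all
    note c = tens_cmp_parts[OF n ac e]
    show "br1 G (internal_cat.cmp C (a', a)) (internal_cat.cmp C (b', b)) = internal_cat.cmp (tens_cat 2 C) (br1 G a' b', br1 G a b)"
    proof (rule tens_A_eqI[OF n])
      show "P 2 (br1 G (internal_cat.cmp C (a', a)) (internal_cat.cmp C (b', b))) = P 2 (internal_cat.cmp (tens_cat 2 C) (br1 G a' b', br1 G a b))"
        using a b
        by (simp add: c(3) ca cb b_add tgt_eq[of a] tgt_eq[of b'] peiffer ac_simps)
    qed (use a b in \<open>simp_all add: c ca cb\<close>)
  qed
qed

end

context presentation
begin

lemma bracket_axioms_of_functor:
  assumes bf: "bracket_functor C (br0 G) (br1 G)"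
  shows bracket_axioms
  unfolding bracket_axioms_def
proof (intro conjI ballI)
  have n: "(2::nat) \<ge> 1" by simp
  note bf' = bf[unfolded bracket_functor_def]
  show "skew2 O0 O0 (beta00 L)" using bf' by simp
  have sk: "slots A [1, 0] (br1 G b a) = \<ominus>\<^bsub>tens 2 A\<^esub> br1 G a b" if "a \<in> carrier A" "b \<in> carrier A" for a b
    using bf' that unfolding skew2_def by blast
  have T: "T 2 (br1 G a b) = beta00 L (tgt C a) (tgt C b)" if "a \<in> carrier A" "b \<in> carrier A" for a b
    using bf' that unfolding arrow_in_def by simp
  show "slots K [1, 0] (beta10 L u x) = \<ominus>\<^bsub>tens 2 K\<^esub> beta01 L x u" if "x \<in> carrier O0" "u \<in> carrier K" for x u
    using arg_cong[OF sk[of "idn C x" "\<iota> u"], of "P 2"] that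
    by (simp add: tmaps_slots[OF cop_inv_perms(1)] tmaps_neg)
  show "B 2 (beta01 L x u) = beta00 L x (beta1 L u)" if "x \<in> carrier O0" "u \<in> carrier K" for x u
    using T[of "idn C x" "\<iota> u"] that by (simp add: T_eq)
  show "beta01 L (beta1 L u) v = beta10 L u (beta1 L v)" if u: "u \<in> carrier K" and v: "v \<in> carrier K" for u v
  proof -
    have z: "src C (\<iota> v) = tgt C (idn C \<zero>\<^bsub>O0\<^esub>)" using v by simp
    \<comment> \<open>The interchange law for two trivial composites. On the left the arrow part of
      the bracket of \<open>\<iota> u\<close> and \<open>\<iota> v\<close> is
      \<open>beta10 L u (beta1 L v)\<close>; on the right only the factor with the identity of
      \<open>beta1 L u\<close> contributes, with \<open>beta01 L (beta1 L u) v\<close>.\<close>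
    have "br1 G (cmp C (idn C (beta1 L u), \<iota> u)) (cmp C (\<iota> v, idn C \<zero>\<^bsub>O0\<^esub>)) =
        cmp (tens_cat 2 C) (br1 G (idn C (beta1 L u)) (\<iota> v), br1 G (\<iota> u) (idn C \<zero>\<^bsub>O0\<^esub>))"
    proof -
      have "(idn C (beta1 L u), \<iota> u) \<in> carrier (composable C)" "(\<iota> v, idn C \<zero>\<^bsub>O0\<^esub>) \<in> carrier (composable C)"
        using u v by (simp_all add: composable_carrier)
      with bf' show ?thesis by blast
    qed
    moreover have "cmp C (idn C (beta1 L u), \<iota> u) = \<iota> u" using cmp_idn(2)[of "\<iota> u"] u by simp
    moreover have "cmp C (\<iota> v, idn C \<zero>\<^bsub>O0\<^esub>) = \<iota> v" using cmp_idn(1)[of "\<iota> v"] v by simp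
    ultimately have "P 2 (br1 G (\<iota> u) (\<iota> v)) =
        P 2 (cmp (tens_cat 2 C) (br1 G (idn C (beta1 L u)) (\<iota> v), br1 G (\<iota> u) (idn C \<zero>\<^bsub>O0\<^esub>)))" by (simp del: hom_zero)
    also have "\<dots> = P 2 (br1 G (\<iota> u) (idn C \<zero>\<^bsub>O0\<^esub>)) + P 2 (br1 G (idn C (beta1 L u)) (\<iota> v))"
      using u v by (intro tens_cmp_parts(3)) (simp_all add: T del: hom_zero)
    finally show ?thesis using u v by (simp del: hom_zero add: hom_zero(2)) 
  qed
qed

section \<open>Iterated brackets of arrows and the arrow part of the jacobiator\<close>

lemma plug_ok_any: "left_module M \<Longrightarrow> left_module N \<Longrightarrow> plug_ok M N 3 2 2 0 \<and> plug_ok M N 3 2 2 1 \<and>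
    plug_ok M N 4 2 3 0 \<and> plug_ok M N 4 2 3 1 \<and> plug_ok M N 4 3 2 0 \<and> plug_ok M N 4 3 2 1 \<and> plug_ok M N 4 3 2 2"
  by (simp add: plug_okI)

lemmas ok = plug_ok_any[THEN conjunct1] plug_ok_any[THEN conjunct2, THEN conjunct1]
  plug_ok_any[THEN conjunct2, THEN conjunct2, THEN conjunct1]
  plug_ok_any[THEN conjunct2, THEN conjunct2, THEN conjunct2, THEN conjunct1]
  plug_ok_any[THEN conjunct2, THEN conjunct2, THEN conjunct2, THEN conjunct2, THEN conjunct1]
  plug_ok_any[THEN conjunct2, THEN conjunct2, THEN conjunct2, THEN conjunct2, THEN conjunct2, THEN conjunct1]
  plug_ok_any[THEN conjunct2, THEN conjunct2, THEN conjunct2, THEN conjunct2, THEN conjunct2, THEN conjunct2]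

lemma S_br:
  assumes "a \<in> carrier A" "b \<in> carrier A" "c \<in> carrier A"
  shows "S 3 (br_l A (br1 G) a b c) = br_l O0 (beta00 L) (src C a) (src C b) (src C c)"
    "S 3 (br_r A (br1 G) a b c) = br_r O0 (beta00 L) (src C a) (src C b) (src C c)"
  unfolding br_l_def br_r_def
  using tmap_plug_via[OF ok(1)[OF A A] b1.b_slin0[OF assms(3)] src O0 src O0 b00_slin(1), of "src C c" "br1 G a b"]
    tmap_plug_via[OF ok(2)[OF A A] b1.b_slin1[OF assms(1)] src O0 src O0 b00_slin(2), of "src C a" "br1 G b c"] assms
  by simp_all

lemma P_br_l:
  assumes "a \<in> carrier A" "b \<in> carrier A" "c \<in> carrier A"
  shows "P 3 (br_l A (br1 G) a b c) = plug 3 K 0 (\<lambda>e. beta01 L e (p c)) (beta00 L (src C a) (src C b))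
    + (plug 3 K 0 (\<lambda>e. beta10 L e (tgt C c)) (beta01 L (src C a) (p b))
      + plug 3 K 0 (\<lambda>e. beta10 L e (tgt C c)) (beta10 L (p a) (tgt C b)))"
  unfolding br_l_def
  using tmap_plug_via2[OF ok(1)[OF A A] b1.b_slin0[OF assms(3)] p K src p O0 K b01_slin(1) b10_slin(1),
      of "p c" "tgt C c" "br1 G a b"] assms
  by (simp add: plug_add[OF ok(1)[OF K K] b10_slin(1)])

lemma plug_closed3 [simp]:
  "x \<in> carrier O0 \<Longrightarrow> X \<in> carrier (tens 2 O0) \<Longrightarrow> plug 3 O0 0 (\<lambda>e. beta00 L e x) X \<in> carrier (tens 3 O0)"
  "x \<in> carrier O0 \<Longrightarrow> X \<in> carrier (tens 2 O0) \<Longrightarrow> plug 3 O0 1 (beta00 L x) X \<in> carrier (tens 3 O0)"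
  "u \<in> carrier K \<Longrightarrow> X \<in> carrier (tens 2 O0) \<Longrightarrow> plug 3 K 0 (\<lambda>e. beta01 L e u) X \<in> carrier (tens 3 K)"
  "x \<in> carrier O0 \<Longrightarrow> U \<in> carrier (tens 2 K) \<Longrightarrow> plug 3 K 1 (beta01 L x) U \<in> carrier (tens 3 K)"
  "x \<in> carrier O0 \<Longrightarrow> U \<in> carrier (tens 2 K) \<Longrightarrow> plug 3 K 0 (\<lambda>e. beta10 L e x) U \<in> carrier (tens 3 K)"
  "u \<in> carrier K \<Longrightarrow> X \<in> carrier (tens 2 O0) \<Longrightarrow> plug 3 K 1 (beta10 L u) X \<in> carrier (tens 3 K)"
  using plug_closed[OF ok(1) b00_slin(1)] plug_closed[OF ok(2) b00_slin(2)] plug_closed[OF ok(1) b01_slin(1)]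
    plug_closed[OF ok(2) b01_slin(2)] plug_closed[OF ok(1) b10_slin(1)] plug_closed[OF ok(2) b10_slin(2)] by auto

lemma slots3_closed [simp]:
  assumes "left_module M" "X \<in> carrier (tens 3 M)"
  shows "slots M [1, 0, 2] X \<in> carrier (tens 3 M)" "slots M [0, 2, 1] X \<in> carrier (tens 3 M)"
    "slots M [1, 2, 0] X \<in> carrier (tens 3 M)" "slots M [2, 0, 1] X \<in> carrier (tens 3 M)"
  using assms by (auto intro!: slots_closed' cop_inv_perms)

lemma slots2_closed [simp]:
  assumes "left_module M" "X \<in> carrier (tens 2 M)"
  shows "slots M [1, 0] X \<in> carrier (tens 2 M)"
  using assms by (auto intro!: slots_closed' cop_inv_perms)

lemma jac_polylinear: "polylinear3 O0 A (jac G)"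
proof -
  have n: "(3::nat) \<ge> 1" by simp
  have br: "polylinear3 O0 O0 (br_l O0 (beta00 L))"
    by (rule polylinear3_of_slin[OF O0 O0 b.br_l_slin])
  show ?thesis
    unfolding polylinear3_iff
  proof (intro conjI ballI allI)
    show "jac G x y z \<in> carrier (tens 3 A)" if "x \<in> carrier O0" "y \<in> carrier O0" "z \<in> carrier O0" for x y z
      using that by simp
    fix x x' y z assume h: "x \<in> carrier O0" "x' \<in> carrier O0" "y \<in> carrier O0" "z \<in> carrier O0"
    show "jac G (x \<oplus>\<^bsub>O0\<^esub> x') y z = jac G x y z + jac G x' y z"
      by (rule tens_A_eqI[OF n]) (use h br b3 in \<open>simp_all add: tens_closed tmaps_add polylinear3_iff\<close>)
    show "jac G y (x \<oplus>\<^bsub>O0\<^esub> x') z = jac G y x z + jac G y x' z"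
      by (rule tens_A_eqI[OF n]) (use h br b3 in \<open>simp_all add: tens_closed tmaps_add polylinear3_iff\<close>)
    show "jac G y z (x \<oplus>\<^bsub>O0\<^esub> x') = jac G y z x + jac G y z x'"
      by (rule tens_A_eqI[OF n]) (use h br b3 in \<open>simp_all add: tens_closed tmaps_add polylinear3_iff\<close>)
  next
    fix x y z and g h k :: 'h assume xyz: "x \<in> carrier O0" "y \<in> carrier O0" "z \<in> carrier O0"
    have l: "length [g, h, k] = 3" by simp
    show "jac G (g \<odot>\<^bsub>O0\<^esub> x) (h \<odot>\<^bsub>O0\<^esub> y) (k \<odot>\<^bsub>O0\<^esub> z) = lmul A [g, h, k] (jac G x y z)"
      by (rule tens_A_eqI[OF n])
        (use xyz br b3 in \<open>simp_all add: O0.smult_closed lmul_closed[OF A l n] lmul_tmap[OF A O0 src l n]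
            lmul_tmap[OF A K p l n] polylinear3_iff\<close>)
  qed
qed

text \<open>Skew-symmetry of \<open>\<beta>\<^sub>3\<close>, and (iii) and (iv).\<close>

definition jac_axioms :: bool where
  "jac_axioms \<longleftrightarrow> skew3 O0 K (beta3 L) \<and>
     (\<forall>x\<in>carrier O0. \<forall>y\<in>carrier O0. \<forall>z\<in>carrier O0.
        plug 3 O0 0 (\<lambda>e. beta00 L e z) (beta00 L x y)
        \<ominus>\<^bsub>tens 3 O0\<^esub> plug 3 O0 1 (\<lambda>e. beta00 L x e) (beta00 L y z)
        + slots O0 [1, 0, 2] (plug 3 O0 1 (\<lambda>e. beta00 L y e) (beta00 L x z))
        = \<ominus>\<^bsub>tens 3 O0\<^esub> B 3 (beta3 L x y z)) \<and>
     (\<forall>x\<in>carrier O0. \<forall>y\<in>carrier O0. \<forall>v\<in>carrier K.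
        plug 3 K 0 (\<lambda>e. beta01 L e v) (beta00 L x y)
        \<ominus>\<^bsub>tens 3 K\<^esub> plug 3 K 1 (\<lambda>e. beta01 L x e) (beta01 L y v)
        + slots K [1, 0, 2] (plug 3 K 1 (\<lambda>e. beta01 L y e) (beta01 L x v))
        = \<ominus>\<^bsub>tens 3 K\<^esub> beta3 L x y (beta1 L v))"

text \<open>The target of an arrow is its source plus \<open>B 3\<close> of its arrow part;
  rearranging this for the jacobiator gives (iii).\<close>

lemma jac_target_iff:
  assumes "x \<in> carrier O0" "y \<in> carrier O0" "z \<in> carrier O0"
  shows "T 3 (jac G x y z) = br_j O0 (beta00 L) x y z \<longleftrightarrow>
    plug 3 O0 0 (\<lambda>e. beta00 L e z) (beta00 L x y)
        \<ominus>\<^bsub>tens 3 O0\<^esub> plug 3 O0 1 (\<lambda>e. beta00 L x e) (beta00 L y z)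
        + slots O0 [1, 0, 2] (plug 3 O0 1 (\<lambda>e. beta00 L y e) (beta00 L x z))
        = \<ominus>\<^bsub>tens 3 O0\<^esub> B 3 (beta3 L x y z)"
proof -
  let ?R = "tens_rel 3 O0"
  let ?X = "plug 3 O0 0 (\<lambda>e. beta00 L e z) (beta00 L x y)" and ?Y = "plug 3 O0 1 (\<lambda>e. beta00 L x e) (beta00 L y z)"
    and ?Z = "slots O0 [1, 0, 2] (plug 3 O0 1 (\<lambda>e. beta00 L y e) (beta00 L x z))" and ?D = "B 3 (beta3 L x y z)"
  have c: "?X \<in> carrier (tens 3 O0)" "?Y \<in> carrier (tens 3 O0)" "?Z \<in> carrier (tens 3 O0)" "?D \<in> carrier (tens 3 O0)"
    using assms by simp_all
  obtain a b e d where r: "?X = a +o ?R" "?Y = b +o ?R" "?Z = e +o ?R" "?D = d +o ?R"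
    using c by (meson tens_repE)
  have "T 3 (jac G x y z) = br_j O0 (beta00 L) x y z \<longleftrightarrow> ?X + ?D = ?Y \<ominus>\<^bsub>tens 3 O0\<^esub> ?Z"
    using assms by (simp add: T_eq br_j_def br_l_def br_r_def)
  also have "\<dots> \<longleftrightarrow> ?X \<ominus>\<^bsub>tens 3 O0\<^esub> ?Y + ?Z = \<ominus>\<^bsub>tens 3 O0\<^esub> ?D"
    using c unfolding r by (simp add: tens_calc algebra_simps)
  finally show ?thesis .
qed

text \<open>Subtracting the identity arrow from the jacobiator leaves \<open>J 3\<close> of
  \<open>beta3\<close>. The map \<open>J 3\<close> commutes with \<open>slots\<close> and is
  injective, with \<open>P 3\<close> as a left inverse.\<close>

lemma jac_skew_iff:
  "skew3 O0 A (\<lambda>x y z. jac G x y z \<ominus>\<^bsub>tens 3 A\<^esub> internal_cat.idn (tens_cat 3 C) (br_l O0 (beta00 L) x y z)) \<longleftrightarrow>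
    skew3 O0 K (beta3 L)"
proof -
  have n: "(3::nat) \<ge> 1" by simp
  have D: "jac G x y z \<ominus>\<^bsub>tens 3 A\<^esub> I 3 (br_l O0 (beta00 L) x y z) = J 3 (beta3 L x y z)"
    if "x \<in> carrier O0" "y \<in> carrier O0" "z \<in> carrier O0" for x y z
  proof (rule tens_A_eqI[OF n])
    have zz: "X \<ominus>\<^bsub>tens 3 K\<^esub> tens_rel 3 K = X" if "X \<in> carrier (tens 3 K)" for X
      using that tens_minus_eq_iff[of X 3 K "tens_rel 3 K" X] by (simp add: tens_closed)
    show "P 3 (jac G x y z \<ominus>\<^bsub>tens 3 A\<^esub> I 3 (br_l O0 (beta00 L) x y z)) = P 3 (J 3 (beta3 L x y z))"
      using that by (simp add: tmaps_minus b.br_l_closed zz)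
  qed (use that in \<open>simp_all add: tens_closed b.br_l_closed tmaps_minus tens_minus_self\<close>)
  have J_slots: "slots A \<sigma> (J 3 U) = \<ominus>\<^bsub>tens 3 A\<^esub> J 3 V \<longleftrightarrow> slots K \<sigma> U = \<ominus>\<^bsub>tens 3 K\<^esub> V"
    if "cop_inv \<sigma>" "length \<sigma> = 3" "U \<in> carrier (tens 3 K)" "V \<in> carrier (tens 3 K)" for \<sigma> U V
  proof -
    have "slots A \<sigma> (J 3 U) = \<ominus>\<^bsub>tens 3 A\<^esub> J 3 V \<longleftrightarrow> J 3 (slots K \<sigma> U) = J 3 (\<ominus>\<^bsub>tens 3 K\<^esub> V)"
      using that by (simp add: slots_tmap[OF that(1) K A \<iota>] tmap_neg[OF n K \<iota>])
    also have "\<dots> \<longleftrightarrow> slots K \<sigma> U = \<ominus>\<^bsub>tens 3 K\<^esub> V"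
      using that tmaps_tmaps(6)[OF n] by (metis slots_closed'[OF that(1,2) K] tens_closed(4))
    finally show ?thesis .
  qed
  show ?thesis
    unfolding skew3_def tens_cat_simps
    by (intro ball_cong refl conj_cong) (simp_all add: D J_slots cop_inv_perms)
qed

end

context presentation_bracket
begin

lemma T_br:
  assumes "a \<in> carrier A" "b \<in> carrier A" "c \<in> carrier A"
  shows "T 3 (br_l A (br1 G) a b c) = br_l O0 (beta00 L) (tgt C a) (tgt C b) (tgt C c)"
    "T 3 (br_r A (br1 G) a b c) = br_r O0 (beta00 L) (tgt C a) (tgt C b) (tgt C c)"
  unfolding br_l_def br_r_def
  using tmap_plug_via[OF ok(1)[OF A A] b1.b_slin0[OF assms(3)] tgt O0 tgt O0 b00_slin(1), of "tgt C c" "br1 G a b"]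
    tmap_plug_via[OF ok(2)[OF A A] b1.b_slin1[OF assms(1)] tgt O0 tgt O0 b00_slin(2), of "tgt C a" "br1 G b c"] assms
  by simp_all

lemma P_br_r:
  assumes "a \<in> carrier A" "b \<in> carrier A" "c \<in> carrier A"
  shows "P 3 (br_r A (br1 G) a b c) = plug 3 K 1 (beta01 L (src C a)) (beta01 L (src C b) (p c))
    + plug 3 K 1 (beta01 L (src C a)) (beta10 L (p b) (tgt C c))
    + plug 3 K 1 (beta10 L (p a)) (beta00 L (tgt C b) (tgt C c))"
  unfolding br_r_def
  using tmap_plug_via2[OF ok(2)[OF A A] b1.b_slin1[OF assms(1)] p K p tgt K O0 b01_slin(2) b10_slin(2),
      of "src C a" "p a" "br1 G b c"] assms
  by (simp add: plug_add[OF ok(2)[OF K K] b01_slin(2)])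

lemma S_br_j:
  assumes "a \<in> carrier A" "b \<in> carrier A" "c \<in> carrier A"
  shows "S 3 (br_j A (br1 G) a b c) = br_j O0 (beta00 L) (src C a) (src C b) (src C c)"
  using assms unfolding br_j_def
  by (simp add: tmaps_minus b1.br_r_closed tmaps_slots[OF cop_inv_perms(2)] S_br)

lemma P_br_j:
  assumes "a \<in> carrier A" "b \<in> carrier A" "c \<in> carrier A"
  shows "P 3 (br_j A (br1 G) a b c) = P 3 (br_r A (br1 G) a b c) \<ominus>\<^bsub>tens 3 K\<^esub> slots K [1, 0, 2] (P 3 (br_r A (br1 G) b a c))"
  using assms unfolding br_j_def
  by (simp add: tmaps_minus b1.br_r_closed tmaps_slots[OF cop_inv_perms(2)])

end

section \<open>Signed sums of classes for naturality and coherence\<close>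

context cocommutative_hopf_algebra
begin

lemma tens_neg_flip:
  assumes "a \<in> carrier (tens n M)" "b \<in> carrier (tens n M)" "c \<in> carrier (tens n M)" "d \<in> carrier (tens n M)"
    and "\<ominus>\<^bsub>tens n M\<^esub> a \<ominus>\<^bsub>tens n M\<^esub> (\<ominus>\<^bsub>tens n M\<^esub> b) + \<ominus>\<^bsub>tens n M\<^esub> c = d"
  shows "c \<ominus>\<^bsub>tens n M\<^esub> b + a = \<ominus>\<^bsub>tens n M\<^esub> d"
proof -
  let ?R = "tens_rel n M"
  obtain a' b' c' d' where r: "a = a' +o ?R" "b = b' +o ?R" "c = c' +o ?R" "d = d' +o ?R"
    using assms(1-4) by (meson tens_repE)
  have "- a' + b' - c' - d' \<in> ?R" using assms unfolding r by (simp add: tens_calc)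
  from subgrp_minus[OF subgrp_tens_rel this] show ?thesis
    using assms(1-4) unfolding r by (simp add: tens_calc algebra_simps)
qed

text \<open>The sum of three instances of (iv), one for the arrow part of each of the three arrows.
  Here \<open>s\<close> is \<open>beta3\<close> at the sources, and \<open>d3\<close>,
  \<open>d2\<close>, \<open>d1\<close> are its increments when the third, second and first argument
  pass to their targets.\<close>

lemma naturality_arith:
  fixes n and M :: "('h, 'm) module"
  defines "T \<equiv> tens n M"
  assumes c: "e1 \<in> carrier T" "e2 \<in> carrier T" "e3 \<in> carrier T" "f1 \<in> carrier T" "f2 \<in> carrier T" "f3 \<in> carrier T"
    "g1 \<in> carrier T" "g2 \<in> carrier T" "g3 \<in> carrier T" "g4 \<in> carrier T" "d1 \<in> carrier T" "d2 \<in> carrier T" "d3 \<in> carrier T"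
    "s \<in> carrier T"
    and e: "e1 \<ominus>\<^bsub>T\<^esub> f1 + g1 = \<ominus>\<^bsub>T\<^esub> d3" "e2 \<ominus>\<^bsub>T\<^esub> f2 + g3 = \<ominus>\<^bsub>T\<^esub> d2" "e3 \<ominus>\<^bsub>T\<^esub> f3 + (g2 + g4) = \<ominus>\<^bsub>T\<^esub> d1"
  shows "e1 + (e2 + e3) + (s + d3 + d2 + d1) = s + ((f1 + f2 + f3) \<ominus>\<^bsub>T\<^esub> (g1 + g2 + (g3 + g4)))"
proof -
  let ?R = "tens_rel n M"
  note c' = c[unfolded T_def]
  obtain x1 x2 x3 y1 y2 y3 where x: "e1 = x1 +o ?R" "e2 = x2 +o ?R" "e3 = x3 +o ?R" "f1 = y1 +o ?R" "f2 = y2 +o ?R" "f3 = y3 +o ?R"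
    using c'(1-6) by (meson tens_repE)
  obtain z1 z2 z3 z4 where z: "g1 = z1 +o ?R" "g2 = z2 +o ?R" "g3 = z3 +o ?R" "g4 = z4 +o ?R"
    using c'(7-10) by (meson tens_repE)
  obtain w1 w2 w3 t where w: "d1 = w1 +o ?R" "d2 = w2 +o ?R" "d3 = w3 +o ?R" "s = t +o ?R"
    using c'(11-14) by (meson tens_repE)
  note S = subgrp_tens_rel[of n M]
  have 1: "x1 - y1 + z1 + w3 \<in> ?R" "x2 - y2 + z3 + w2 \<in> ?R" "x3 - y3 + (z2 + z4) + w1 \<in> ?R"
    using e c' unfolding T_def x z w by (simp_all add: tens_calc)
  have "(x1 - y1 + z1 + w3) + (x2 - y2 + z3 + w2) + (x3 - y3 + (z2 + z4) + w1) \<in> ?R"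
    by (rule subgrp_add[OF S subgrp_add[OF S 1(1,2)] 1(3)])
  also have "(x1 - y1 + z1 + w3) + (x2 - y2 + z3 + w2) + (x3 - y3 + (z2 + z4) + w1) =
    (x1 + (x2 + x3) + (t + w3 + w2 + w1)) - (t + ((y1 + y2 + y3) - (z1 + z2 + (z3 + z4))))"
    by (simp add: algebra_simps)
  finally show ?thesis using c' unfolding T_def x z w by (simp add: tens_calc)
qed

text \<open>\<open>t1\<close> to \<open>t10\<close> are the ten terms of (v) in their order in
  \<open>is_linf2\<close>. The two sides of the first equation are the arrow parts of the two
  composites, step by step; each \<open>R\<close> is the zero arrow part of an identity.\<close>

lemma coherence_arith:
  fixes n and M :: "('h, 'm) module"
  defines "T \<equiv> tens n M" and "R \<equiv> tens_rel n M"
  assumes c: "t1 \<in> carrier T" "t2 \<in> carrier T" "t3 \<in> carrier T" "t4 \<in> carrier T" "t5 \<in> carrier T" "t6 \<in> carrier T"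
    "t7 \<in> carrier T" "t8 \<in> carrier T" "t9 \<in> carrier T" "t10 \<in> carrier T"
  shows "\<ominus>\<^bsub>T\<^esub> t4 + (\<ominus>\<^bsub>T\<^esub> t8 \<ominus>\<^bsub>T\<^esub> (\<ominus>\<^bsub>T\<^esub> t6)) + (t1 \<ominus>\<^bsub>T\<^esub> t7 \<ominus>\<^bsub>T\<^esub> t2 + t9) = t5 + (R \<ominus>\<^bsub>T\<^esub> t3) + (t10 \<ominus>\<^bsub>T\<^esub> R + R) \<longleftrightarrow>
    t1 \<ominus>\<^bsub>T\<^esub> t2 + t3 \<ominus>\<^bsub>T\<^esub> t4 \<ominus>\<^bsub>T\<^esub> t5 + t6 \<ominus>\<^bsub>T\<^esub> t7 \<ominus>\<^bsub>T\<^esub> t8 + t9 \<ominus>\<^bsub>T\<^esub> t10 = R"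
proof -
  let ?R = "tens_rel n M"
  note c' = c[unfolded T_def]
  obtain x1 x2 x3 x4 x5 where x: "t1 = x1 +o ?R" "t2 = x2 +o ?R" "t3 = x3 +o ?R" "t4 = x4 +o ?R" "t5 = x5 +o ?R"
    using c'(1-5) by (meson tens_repE)
  obtain x6 x7 x8 x9 x10 where x': "t6 = x6 +o ?R" "t7 = x7 +o ?R" "t8 = x8 +o ?R" "t9 = x9 +o ?R" "t10 = x10 +o ?R"
    using c'(6-10) by (meson tens_repE)
  \<comment> \<open>The zero classes coming from identity arrows also get a named representative, so
    that the rules for cosets apply to them as well.\<close>
  obtain r where r: "?R = r +o ?R" and r0: "r = 0" by auto
  have rc: "r +o ?R \<in> carrier (tens n M)" unfolding r[symmetric] by (rule tens_closed)
  have "\<ominus>\<^bsub>T\<^esub> t4 + (\<ominus>\<^bsub>T\<^esub> t8 \<ominus>\<^bsub>T\<^esub> (\<ominus>\<^bsub>T\<^esub> t6)) + (t1 \<ominus>\<^bsub>T\<^esub> t7 \<ominus>\<^bsub>T\<^esub> t2 + t9) =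
      (- x4 + (- x8 - (- x6)) + (x1 - x7 - x2 + x9)) +o ?R"
    using c' unfolding T_def x x' by (simp add: tens_calc subgrp_0[OF subgrp_tens_rel])
  moreover have "t5 + (R \<ominus>\<^bsub>T\<^esub> t3) + (t10 \<ominus>\<^bsub>T\<^esub> R + R) = (x5 + (r - x3) + (x10 - r + r)) +o ?R"
  proof -
    have "R \<ominus>\<^bsub>T\<^esub> t3 = (r - x3) +o ?R" "t10 \<ominus>\<^bsub>T\<^esub> R = (x10 - r) +o ?R"
      unfolding R_def T_def x x'
      using tens_minus[of x3 n M r] tens_minus[of r n M x10] c'(3) rc unfolding x x' r[symmetric] by simp_all
    then show ?thesis unfolding x x' using coset_add[OF subgrp_tens_rel, of "x10 - r" n M r]
      by (simp add: coset_add[OF subgrp_tens_rel] R_def r[symmetric])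
  qed
  moreover have "t1 \<ominus>\<^bsub>T\<^esub> t2 + t3 \<ominus>\<^bsub>T\<^esub> t4 \<ominus>\<^bsub>T\<^esub> t5 + t6 \<ominus>\<^bsub>T\<^esub> t7 \<ominus>\<^bsub>T\<^esub> t8 + t9 \<ominus>\<^bsub>T\<^esub> t10 =
      (x1 - x2 + x3 - x4 - x5 + x6 - x7 - x8 + x9 - x10) +o ?R"
    using c' unfolding T_def x x' by (simp add: tens_calc subgrp_0[OF subgrp_tens_rel])
  moreover have "(x1 - x2 + x3 - x4 - x5 + x6 - x7 - x8 + x9 - x10) +o ?R = R \<longleftrightarrow>
      (x1 - x2 + x3 - x4 - x5 + x6 - x7 - x8 + x9 - x10) - 0 \<in> ?R"
    using coset_eq_iff[OF subgrp_tens_rel, of _ n M 0] by (simp add: R_def)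
  ultimately show ?thesis
    unfolding r0 by (simp only: coset_eq_iff[OF subgrp_tens_rel]) (simp add: algebra_simps)
qed

end

section \<open>Naturality of the jacobiator\<close>

locale presentation_jac = presentation_bracket +
  assumes jac_axioms: jac_axioms
begin

lemma skew3:
  assumes "x \<in> carrier O0" "y \<in> carrier O0" "z \<in> carrier O0"
  shows "slots K [1, 0, 2] (beta3 L y x z) = \<ominus>\<^bsub>tens 3 K\<^esub> beta3 L x y z"
    "slots K [0, 2, 1] (beta3 L x z y) = \<ominus>\<^bsub>tens 3 K\<^esub> beta3 L x y z"
    "slots K [2, 1, 0] (beta3 L z y x) = \<ominus>\<^bsub>tens 3 K\<^esub> beta3 L x y z"
  using jac_axioms assms by (simp_all add: jac_axioms_def skew3_def)

lemma T_jac [simp]: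
  "x \<in> carrier O0 \<Longrightarrow> y \<in> carrier O0 \<Longrightarrow> z \<in> carrier O0 \<Longrightarrow> T 3 (jac G x y z) = br_j O0 (beta00 L) x y z"
  using jac_axioms by (simp add: jac_axioms_def jac_target_iff)

lemma iv3:
  assumes "x \<in> carrier O0" "y \<in> carrier O0" "v \<in> carrier K"
  shows "plug 3 K 0 (\<lambda>e. beta01 L e v) (beta00 L x y)
        \<ominus>\<^bsub>tens 3 K\<^esub> plug 3 K 1 (beta01 L x) (beta01 L y v)
        + slots K [1, 0, 2] (plug 3 K 1 (beta01 L y) (beta01 L x v))
        = \<ominus>\<^bsub>tens 3 K\<^esub> beta3 L x y (beta1 L v)"
  using jac_axioms assms by (simp add: jac_axioms_def)

text \<open>Skew-symmetry carries (iv) over to a degree 1 element in the second argument: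
  \<open>iv3\<close> is taken at \<open>x\<close>, \<open>z\<close>, \<open>v\<close> and the last
  two slots are exchanged. \<open>E\<close>, \<open>F\<close> and \<open>H\<close> say what becomes
  of its three terms.\<close>

lemma iv2:
  assumes x: "x \<in> carrier O0" and v: "v \<in> carrier K" and z: "z \<in> carrier O0"
  shows "plug 3 K 0 (\<lambda>e. beta10 L e z) (beta01 L x v)
        \<ominus>\<^bsub>tens 3 K\<^esub> plug 3 K 1 (beta01 L x) (beta10 L v z)
        + slots K [1, 0, 2] (plug 3 K 1 (beta10 L v) (beta00 L x z))
        = \<ominus>\<^bsub>tens 3 K\<^esub> beta3 L x (beta1 L v) z"
proof -
  let ?E = "plug 3 K 0 (\<lambda>e. beta01 L e v) (beta00 L x z)" and ?F = "plug 3 K 1 (beta01 L x) (beta01 L z v)"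
    and ?H = "plug 3 K 1 (beta01 L z) (beta01 L x v)"
  have sl1: "slin O0 K 2 1 (\<lambda>e. slots K [1, 0] (beta01 L e v))"
    using slin_slots[OF cop_inv_perms(1) _ K b01_slin(1)[OF v], of 1] by simp
  have sl2: "slin K K 2 0 (\<lambda>e. slots K [1, 0] (beta01 L z e))"
    using slin_slots[OF cop_inv_perms(1) _ K b01_slin(2)[OF z], of 0] by simp
  have E: "slots K [1, 0, 2] (plug 3 K 1 (beta10 L v) (beta00 L x z)) = \<ominus>\<^bsub>tens 3 K\<^esub> slots K [0, 2, 1] ?E"
  proof -
    have "plug 3 K 1 (beta10 L v) (beta00 L x z) = plug 3 K 1 (\<lambda>e. \<ominus>\<^bsub>tens 2 K\<^esub> slots K [1, 0] (beta01 L e v)) (beta00 L x z)"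
      using assms by (intro plug_cong[OF ok(2) b10_slin(2)] b10_eq) auto
    also have "\<dots> = \<ominus>\<^bsub>tens 3 K\<^esub> slots K [2, 0, 1] ?E"
      using assms sl1
      by (simp add: plug_neg_fun[OF ok(2)[OF O0 K] sl1] slots_outer3(2)[OF O0 K b01_slin(1)])
    finally show ?thesis
      using assms slots_slots[OF cop_inv_perms(2) cop_inv_perms(6) K, of 3 ?E]
      by (simp add: slots_neg[OF cop_inv_perms(2)])
  qed
  have F: "slots K [0, 2, 1] ?F = \<ominus>\<^bsub>tens 3 K\<^esub> plug 3 K 1 (beta01 L x) (beta10 L v z)"
    using assms by (simp add: slots_inner3(1)[OF K K b01_slin(2)] skew01 plug_neg[OF ok(2) b01_slin(2)])
  have H: "slots K [0, 2, 1] (slots K [1, 0, 2] ?H) = \<ominus>\<^bsub>tens 3 K\<^esub> plug 3 K 0 (\<lambda>e. beta10 L e z) (beta01 L x v)"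
  proof -
    have "slots K [0, 2, 1] (slots K [1, 0, 2] ?H) = slots K [1, 2, 0] ?H"
      using assms slots_slots[OF cop_inv_perms(3) cop_inv_perms(2) K, of 3 ?H] by simp
    also have "\<dots> = plug 3 K 0 (\<lambda>e. slots K [1, 0] (beta01 L z e)) (beta01 L x v)"
      using assms by (intro slots_outer3(1)[OF K K b01_slin(2)]) auto
    also have "\<dots> = plug 3 K 0 (\<lambda>e. \<ominus>\<^bsub>tens 2 K\<^esub> beta10 L e z) (beta01 L x v)"
      using assms sl2
      by (intro plug_cong[OF ok(1)] skew01) auto
    also have "\<dots> = \<ominus>\<^bsub>tens 3 K\<^esub> plug 3 K 0 (\<lambda>e. beta10 L e z) (beta01 L x v)"
      using assms by (intro plug_neg_fun[OF ok(1) b10_slin(1)]) auto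
    finally show ?thesis .
  qed
  have "slots K [0, 2, 1] (?E \<ominus>\<^bsub>tens 3 K\<^esub> ?F + slots K [1, 0, 2] ?H) = slots K [0, 2, 1] (\<ominus>\<^bsub>tens 3 K\<^esub> beta3 L x z (beta1 L v))"
    using iv3[OF x z v] by simp
  then have "slots K [0, 2, 1] ?E \<ominus>\<^bsub>tens 3 K\<^esub> slots K [0, 2, 1] ?F + slots K [0, 2, 1] (slots K [1, 0, 2] ?H) =
      beta3 L x (beta1 L v) z"
    using assms by (simp add: slots_add'[OF cop_inv_perms(3)] slots_minus[OF cop_inv_perms(3)] slots_neg[OF cop_inv_perms(3)]
        tens_closed skew3 tens_minus_minus)
  then have "\<ominus>\<^bsub>tens 3 K\<^esub> slots K [1, 0, 2] (plug 3 K 1 (beta10 L v) (beta00 L x z))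
      \<ominus>\<^bsub>tens 3 K\<^esub> (\<ominus>\<^bsub>tens 3 K\<^esub> plug 3 K 1 (beta01 L x) (beta10 L v z))
      + \<ominus>\<^bsub>tens 3 K\<^esub> plug 3 K 0 (\<lambda>e. beta10 L e z) (beta01 L x v) = beta3 L x (beta1 L v) z"
    using assms unfolding E F H by (simp add: tens_minus_minus)
  then show ?thesis using assms by (intro tens_neg_flip) simp_all
qed

text \<open>From \<open>iv2\<close> by exchanging the first two slots, again with a sign for each
  exchange of arguments.\<close>

lemma iv1:
  assumes u: "u \<in> carrier K" and y: "y \<in> carrier O0" and z: "z \<in> carrier O0"
  shows "plug 3 K 0 (\<lambda>e. beta10 L e z) (beta10 L u y)
        \<ominus>\<^bsub>tens 3 K\<^esub> plug 3 K 1 (beta10 L u) (beta00 L y z)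
        + slots K [1, 0, 2] (plug 3 K 1 (beta01 L y) (beta10 L u z))
        = \<ominus>\<^bsub>tens 3 K\<^esub> beta3 L (beta1 L u) y z"
proof -
  let ?a1 = "plug 3 K 0 (\<lambda>e. beta10 L e z) (beta10 L u y)" and ?a2 = "plug 3 K 1 (beta10 L u) (beta00 L y z)"
    and ?a3 = "slots K [1, 0, 2] (plug 3 K 1 (beta01 L y) (beta10 L u z))" and ?d = "beta3 L (beta1 L u) y z"
  have "slots K [1, 0, 2] (plug 3 K 0 (\<lambda>e. beta10 L e z) (beta01 L y u)) = \<ominus>\<^bsub>tens 3 K\<^esub> ?a1"
    using assms by (simp add: slots_inner3(2)[OF K K b10_slin(1)] skew01 plug_neg[OF ok(1) b10_slin(1)])
  then have eq: "\<ominus>\<^bsub>tens 3 K\<^esub> ?a1 \<ominus>\<^bsub>tens 3 K\<^esub> ?a3 + ?a2 = ?d"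
    using arg_cong[OF iv2[OF y u z], of "slots K [1, 0, 2]"] assms
    by (simp add: slots_add'[OF cop_inv_perms(2)] slots_minus[OF cop_inv_perms(2)] slots_neg[OF cop_inv_perms(2)]
        tens_closed skew3 tens_minus_minus)
  have c: "?a1 \<in> carrier (tens 3 K)" "?a2 \<in> carrier (tens 3 K)" "?a3 \<in> carrier (tens 3 K)" "?d \<in> carrier (tens 3 K)"
    using assms by simp_all
  obtain a b e d where r: "?a1 = a +o tens_rel 3 K" "?a2 = b +o tens_rel 3 K" "?a3 = e +o tens_rel 3 K" "?d = d +o tens_rel 3 K"
    using c by (meson tens_repE)
  have "- a - e + b - d \<in> tens_rel 3 K" using eq c unfolding r by (simp add: tens_calc)
  from subgrp_minus[OF subgrp_tens_rel this] show ?thesis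
    using c unfolding r by (simp add: tens_calc algebra_simps)
qed

text \<open>The arrow parts are compared by replacing the targets in \<open>beta3\<close> by sources
  one argument at a time (\<open>J1\<close>); each increment is evaluated by the instance of (iv)
  with the degree 1 element in that argument.\<close>

lemma naturality:
  assumes a: "a \<in> carrier A" and b: "b \<in> carrier A" and c: "c \<in> carrier A"
  shows "internal_cat.cmp (tens_cat 3 C) (jac G (tgt C a) (tgt C b) (tgt C c), br_l A (br1 G) a b c) =
    internal_cat.cmp (tens_cat 3 C) (br_j A (br1 G) a b c, jac G (src C a) (src C b) (src C c))"
proof -
  have n: "(3::nat) \<ge> 1" by simp
  have e1: "S 3 (jac G (tgt C a) (tgt C b) (tgt C c)) = T 3 (br_l A (br1 G) a b c)"
    and e2: "S 3 (br_j A (br1 G) a b c) = T 3 (jac G (src C a) (src C b) (src C c))"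
    using assms by (simp_all add: T_br S_br_j)
  have cl: "br_l A (br1 G) a b c \<in> carrier (tens 3 A)" "jac G (tgt C a) (tgt C b) (tgt C c) \<in> carrier (tens 3 A)"
    "jac G (src C a) (src C b) (src C c) \<in> carrier (tens 3 A)" "br_j A (br1 G) a b c \<in> carrier (tens 3 A)"
    using assms by (simp_all add: b1.br_l_closed b1.br_j_closed)
  note c1 = tens_cmp_parts[OF n cl(1,2) e1] and c2 = tens_cmp_parts[OF n cl(3,4) e2]
  let ?sa = "src C a" and ?sb = "src C b" and ?sc = "src C c" and ?ta = "tgt C a" and ?tb = "tgt C b" and ?tc = "tgt C c"
  let ?pa = "p a" and ?pb = "p b" and ?pc = "p c"
  let ?s = "slots K [1, 0, 2]"
  show ?thesis
  proof (rule tens_A_eqI[OF n c1(1) c2(1)])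
    show "S 3 (internal_cat.cmp (tens_cat 3 C) (jac G ?ta ?tb ?tc, br_l A (br1 G) a b c)) =
        S 3 (internal_cat.cmp (tens_cat 3 C) (br_j A (br1 G) a b c, jac G ?sa ?sb ?sc))"
      using assms by (simp add: c1 c2 S_br)
    have J1: "beta3 L ?ta ?tb ?tc = beta3 L ?sa ?sb ?sc + beta3 L ?sa ?sb (beta1 L ?pc)
        + beta3 L ?sa (beta1 L ?pb) ?tc + beta3 L (beta1 L ?pa) ?tb ?tc"
    proof -
      have "beta3 L ?ta ?tb ?tc = beta3 L ?sa ?tb ?tc + beta3 L (beta1 L ?pa) ?tb ?tc"
        using assms b3 unfolding polylinear3_iff by (simp add: tgt_eq[of a])
      also have "beta3 L ?sa ?tb ?tc = beta3 L ?sa ?sb ?tc + beta3 L ?sa (beta1 L ?pb) ?tc"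
        using assms b3 unfolding polylinear3_iff by (simp add: tgt_eq[of b])
      also have "beta3 L ?sa ?sb ?tc = beta3 L ?sa ?sb ?sc + beta3 L ?sa ?sb (beta1 L ?pc)"
        using assms b3 unfolding polylinear3_iff by (simp add: tgt_eq[of c])
      finally show ?thesis .
    qed
    have g: "?s (P 3 (br_r A (br1 G) b a c)) = ?s (plug 3 K 1 (beta01 L ?sb) (beta01 L ?sa ?pc))
        + ?s (plug 3 K 1 (beta01 L ?sb) (beta10 L ?pa ?tc))
        + (?s (plug 3 K 1 (beta10 L ?pb) (beta00 L ?sa ?tc)) + ?s (plug 3 K 1 (beta10 L ?pb) (beta00 L (beta1 L ?pa) ?tc)))"
      using assms
      by (simp add: P_br_r tgt_eq[of a] b_add plug_add[OF ok(2) b10_slin(2)] slots_add'[OF cop_inv_perms(2)] tens_closed)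
    \<comment> \<open>\<open>iv1\<close> produces a bracket with the target of \<open>b\<close>,
      whereas the arrow part of the iterated bracket has the source. For the difference
      \<open>beta1 L ?pb\<close>, (ii) moves \<open>beta1\<close> to the other factor.\<close>
    have g4: "?s (plug 3 K 1 (beta01 L ?tb) (beta10 L ?pa ?tc)) =
        ?s (plug 3 K 1 (beta01 L ?sb) (beta10 L ?pa ?tc)) + ?s (plug 3 K 1 (beta10 L ?pb) (beta00 L (beta1 L ?pa) ?tc))"
    proof -
      have "plug 3 K 1 (beta01 L (beta1 L ?pb)) (beta10 L ?pa ?tc) = plug 3 K 1 (\<lambda>e. beta10 L ?pb (beta1 L e)) (beta10 L ?pa ?tc)"
        using assms by (intro plug_cong[OF ok(2) b01_slin(2)] peiffer) auto
      also have "\<dots> = plug 3 K 1 (beta10 L ?pb) (B 2 (beta10 L ?pa ?tc))"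
        using assms by (intro plug_tmap[OF ok(2) b10_slin(2) K \<beta>1, symmetric]) auto
      finally have 1: "plug 3 K 1 (beta01 L (beta1 L ?pb)) (beta10 L ?pa ?tc) = plug 3 K 1 (beta10 L ?pb) (beta00 L (beta1 L ?pa) ?tc)"
        using assms by (simp add: B10)
      have "plug 3 K 1 (beta01 L ?tb) (beta10 L ?pa ?tc) =
          plug 3 K 1 (\<lambda>e. beta01 L ?sb e + beta01 L (beta1 L ?pb) e) (beta10 L ?pa ?tc)"
        using assms by (intro plug_cong[OF ok(2) b01_slin(2)]) (auto simp: tgt_eq[of b] b_add)
      also have "\<dots> = plug 3 K 1 (beta01 L ?sb) (beta10 L ?pa ?tc) + plug 3 K 1 (beta01 L (beta1 L ?pb)) (beta10 L ?pa ?tc)"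
        using assms by (intro plug_add_fun[OF ok(2) b01_slin(2) b01_slin(2)]) auto
      finally show ?thesis using assms by (simp add: 1 slots_add'[OF cop_inv_perms(2)])
    qed
    have iv: "plug 3 K 0 (\<lambda>e. beta10 L e ?tc) (beta10 L ?pa ?tb)
        \<ominus>\<^bsub>tens 3 K\<^esub> plug 3 K 1 (beta10 L ?pa) (beta00 L ?tb ?tc)
        + (?s (plug 3 K 1 (beta01 L ?sb) (beta10 L ?pa ?tc)) + ?s (plug 3 K 1 (beta10 L ?pb) (beta00 L (beta1 L ?pa) ?tc)))
        = \<ominus>\<^bsub>tens 3 K\<^esub> beta3 L (beta1 L ?pa) ?tb ?tc"
      using iv1[of ?pa ?tb ?tc] assms g4 by simp
    have c': "?sa \<in> carrier O0" "?sb \<in> carrier O0" "?sc \<in> carrier O0" "?ta \<in> carrier O0" "?tb \<in> carrier O0" "?tc \<in> carrier O0"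
      "?pa \<in> carrier K" "?pb \<in> carrier K" "?pc \<in> carrier K" using assms by simp_all
    have "P 3 (br_l A (br1 G) a b c) + beta3 L ?ta ?tb ?tc = beta3 L ?sa ?sb ?sc + P 3 (br_j A (br1 G) a b c)"
      unfolding P_br_l[OF assms] P_br_j[OF assms] g P_br_r[OF assms] J1
      by (rule naturality_arith[OF _ _ _ _ _ _ _ _ _ _ _ _ _ _ iv3[OF c'(1,2,9)] iv2[OF c'(1,8,6)] iv])
        (use c' in simp_all)
    then show "P 3 (internal_cat.cmp (tens_cat 3 C) (jac G ?ta ?tb ?tc, br_l A (br1 G) a b c)) =
        P 3 (internal_cat.cmp (tens_cat 3 C) (br_j A (br1 G) a b c, jac G ?sa ?sb ?sc))"
      using assms by (simp add: c1 c2)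
  qed
qed

lemma jacobiator: "jacobiator C (br0 G) (br1 G) (jac G)"
  unfolding jacobiator_def
proof (intro conjI ballI)
  show "polylinear3 O0 A (jac G)" by (rule jac_polylinear)
  show "skew3 O0 A (\<lambda>x y z. jac G x y z \<ominus>\<^bsub>tens 3 A\<^esub> internal_cat.idn (tens_cat 3 C) (br_l O0 (br0 G) x y z))"
    using jac_axioms jac_skew_iff by (simp add: jac_axioms_def)
  show "iso_arrow_in (tens_cat 3 C) (jac G x y z) (br_l O0 (br0 G) x y z) (br_j O0 (br0 G) x y z)"
    if "x \<in> carrier O0" "y \<in> carrier O0" "z \<in> carrier O0" for x y z
    using that by (simp add: iso_arrow_iff)
qed (rule naturality)

end

context presentation_bracket
begin

text \<open>The target of the jacobiator gives (iii). For (iv), naturality is evaluated at the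
  arrows \<open>idn C x\<close>, \<open>idn C y\<close> and \<open>\<iota> v\<close>: the terms with
  the arrow part of an identity vanish, and so does \<open>beta3\<close> at the source 0 of the
  third arrow.\<close>

lemma jac_axioms_of_jacobiator:
  assumes j: "jacobiator C (br0 G) (br1 G) (jac G)"
  shows jac_axioms
  unfolding jac_axioms_def
proof (intro conjI ballI)
  have n: "(3::nat) \<ge> 1" by simp
  note j' = j[unfolded jacobiator_def]
  show "skew3 O0 K (beta3 L)" using j' jac_skew_iff by simp
  have T: "T 3 (jac G x y z) = br_j O0 (beta00 L) x y z" if "x \<in> carrier O0" "y \<in> carrier O0" "z \<in> carrier O0" for x y z
  proof -
    have "iso_arrow_in (tens_cat 3 C) (jac G x y z) (br_l O0 (br0 G) x y z) (br_j O0 (br0 G) x y z)" using j' that by blast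
    then show ?thesis by (simp add: iso_arrow_iff)
  qed
  show "plug 3 O0 0 (\<lambda>e. beta00 L e z) (beta00 L x y)
        \<ominus>\<^bsub>tens 3 O0\<^esub> plug 3 O0 1 (\<lambda>e. beta00 L x e) (beta00 L y z)
        + slots O0 [1, 0, 2] (plug 3 O0 1 (\<lambda>e. beta00 L y e) (beta00 L x z))
        = \<ominus>\<^bsub>tens 3 O0\<^esub> B 3 (beta3 L x y z)"
    if "x \<in> carrier O0" "y \<in> carrier O0" "z \<in> carrier O0" for x y z
    using T[OF that] jac_target_iff[OF that] by simp
  show "plug 3 K 0 (\<lambda>e. beta01 L e v) (beta00 L x y)
        \<ominus>\<^bsub>tens 3 K\<^esub> plug 3 K 1 (\<lambda>e. beta01 L x e) (beta01 L y v)
        + slots K [1, 0, 2] (plug 3 K 1 (\<lambda>e. beta01 L y e) (beta01 L x v))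
        = \<ominus>\<^bsub>tens 3 K\<^esub> beta3 L x y (beta1 L v)"
    if x: "x \<in> carrier O0" and y: "y \<in> carrier O0" and v: "v \<in> carrier K" for x y v
  proof -
    let ?a = "idn C x" and ?b = "idn C y" and ?c = "\<iota> v"
    have abc: "?a \<in> carrier A" "?b \<in> carrier A" "?c \<in> carrier A" using x y v by simp_all
    have cl: "br_l A (br1 G) ?a ?b ?c \<in> carrier (tens 3 A)" "jac G x y (beta1 L v) \<in> carrier (tens 3 A)"
      "jac G x y \<zero>\<^bsub>O0\<^esub> \<in> carrier (tens 3 A)" "br_j A (br1 G) ?a ?b ?c \<in> carrier (tens 3 A)"
      using abc x y v by (simp_all add: b1.br_l_closed b1.br_j_closed)
    have e1: "S 3 (jac G x y (beta1 L v)) = T 3 (br_l A (br1 G) ?a ?b ?c)"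
      and e2: "S 3 (br_j A (br1 G) ?a ?b ?c) = T 3 (jac G x y \<zero>\<^bsub>O0\<^esub>)"
      using x y v by (simp_all add: T_br[OF abc] S_br_j[OF abc] T)
    have "internal_cat.cmp (tens_cat 3 C) (jac G x y (beta1 L v), br_l A (br1 G) ?a ?b ?c) =
        internal_cat.cmp (tens_cat 3 C) (br_j A (br1 G) ?a ?b ?c, jac G x y \<zero>\<^bsub>O0\<^esub>)"
    proof -
      have "internal_cat.cmp (tens_cat 3 C) (jac G (tgt C ?a) (tgt C ?b) (tgt C ?c), br_l A (br1 G) ?a ?b ?c) =
        internal_cat.cmp (tens_cat 3 C) (br_j A (br1 G) ?a ?b ?c, jac G (src C ?a) (src C ?b) (src C ?c))"
        using j' abc by blast
      then show ?thesis using x y v by simp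
    qed
    from arg_cong[OF this, of "P 3"]
    have eq: "P 3 (br_l A (br1 G) ?a ?b ?c) + beta3 L x y (beta1 L v) = beta3 L x y \<zero>\<^bsub>O0\<^esub> + P 3 (br_j A (br1 G) ?a ?b ?c)"
      using x y v by (simp add: tens_cmp_parts(3)[OF n cl(1,2) e1] tens_cmp_parts(3)[OF n cl(3,4) e2])
    have z0: "plug 3 K 0 (\<lambda>e. beta10 L e c) (tens_rel 2 K) = tens_rel 3 K" if "c \<in> carrier O0" for c
      using that by (intro plug_zero[OF ok(1) b10_slin(1)]) auto
    have z1: "plug 3 K 1 (beta01 L c) (tens_rel 2 K) = tens_rel 3 K" if "c \<in> carrier O0" for c
      using that by (intro plug_zero[OF ok(2) b01_slin(2)]) auto
    have z2: "plug 3 K 1 (beta10 L \<zero>\<^bsub>K\<^esub>) X = tens_rel 3 K" if "X \<in> carrier (tens 2 O0)" for X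
      using plug_cong[OF ok(2)[OF O0 K] b10_slin(2) _ that, of "\<zero>\<^bsub>K\<^esub>" "\<lambda>e. tens_rel 2 K"] plug_zero_fun[OF ok(2)[OF O0 K] that] by simp
    have "P 3 (br_l A (br1 G) ?a ?b ?c) = plug 3 K 0 (\<lambda>e. beta01 L e v) (beta00 L x y)"
      using x y v by (simp add: P_br_l[OF abc] z0)
    moreover have "P 3 (br_j A (br1 G) ?a ?b ?c) = plug 3 K 1 (beta01 L x) (beta01 L y v)
        \<ominus>\<^bsub>tens 3 K\<^esub> slots K [1, 0, 2] (plug 3 K 1 (beta01 L y) (beta01 L x v))"
      using x y v by (simp add: P_br_j[OF abc] P_br_r[OF abc] P_br_r[OF abc(2,1,3)] z1 z2)
    moreover have "beta3 L x y \<zero>\<^bsub>O0\<^esub> = tens_rel 3 K"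
      by (rule slin_zero_arg[OF b3_slin(3)[OF x y] O0])
    ultimately have eq': "plug 3 K 0 (\<lambda>e. beta01 L e v) (beta00 L x y) + beta3 L x y (beta1 L v) =
        plug 3 K 1 (beta01 L x) (beta01 L y v) \<ominus>\<^bsub>tens 3 K\<^esub> slots K [1, 0, 2] (plug 3 K 1 (beta01 L y) (beta01 L x v))"
      using eq x y v by (simp add: tens_closed)
    let ?X = "plug 3 K 0 (\<lambda>e. beta01 L e v) (beta00 L x y)" and ?Y = "plug 3 K 1 (beta01 L x) (beta01 L y v)"
      and ?Z = "slots K [1, 0, 2] (plug 3 K 1 (beta01 L y) (beta01 L x v))" and ?D = "beta3 L x y (beta1 L v)"
    have c: "?X \<in> carrier (tens 3 K)" "?Y \<in> carrier (tens 3 K)" "?Z \<in> carrier (tens 3 K)" "?D \<in> carrier (tens 3 K)"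
      using x y v by simp_all
    obtain a b e d where r: "?X = a +o tens_rel 3 K" "?Y = b +o tens_rel 3 K" "?Z = e +o tens_rel 3 K" "?D = d +o tens_rel 3 K"
      using c by (meson tens_repE)
    have "?X \<ominus>\<^bsub>tens 3 K\<^esub> ?Y + ?Z = \<ominus>\<^bsub>tens 3 K\<^esub> ?D"
      using eq' c unfolding r by (simp add: tens_calc algebra_simps)
    then show ?thesis by simp
  qed
qed

end

section \<open>The coherence law\<close>

context presentation_jac
begin

lemma tmap_plug_cong:
  assumes "plug_ok M A n k l m" "slin M A k m \<phi>" "f \<in> lhom A N" "left_module N"
    and "\<And>e. e \<in> carrier M \<Longrightarrow> tmap k N f (\<phi> e) = \<psi> e" and "X \<in> carrier (tens l M)"
  shows "tmap n N f (plug n A m \<phi> X) = plug n N m \<psi> X"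
proof -
  have "plug_ok M N n k l m" using assms(1,4) by (auto simp: plug_ok_def ins_ok_def)
  then show ?thesis
    using tmap_plug[OF assms(1,2,4,3,6)] plug_cong[OF _ slin_tmap[OF plug_okD(3)[OF assms(1)] assms(4,3,2)] assms(5,6)] by simp
qed

lemmas J_slin = polylinear3_slin[OF jac_polylinear O0]

lemma parts_plug_br1:
  assumes "x \<in> carrier O0" "y \<in> carrier O0" "z \<in> carrier O0" "w \<in> carrier O0"
  defines "X \<equiv> plug 4 A 0 (\<lambda>e. br1 G e (idn C w)) (jac G x y z)" and "Y \<equiv> plug 4 A 1 (br1 G (idn C w)) (jac G x y z)"
  shows "X \<in> carrier (tens 4 A)" "S 4 X = plug 4 O0 0 (\<lambda>e. beta00 L e w) (br_l O0 (beta00 L) x y z)"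
    "T 4 X = plug 4 O0 0 (\<lambda>e. beta00 L e w) (br_j O0 (beta00 L) x y z)"
    "P 4 X = plug 4 K 0 (\<lambda>e. beta10 L e w) (beta3 L x y z)"
    and "Y \<in> carrier (tens 4 A)" "S 4 Y = plug 4 O0 1 (beta00 L w) (br_l O0 (beta00 L) x y z)"
    "T 4 Y = plug 4 O0 1 (beta00 L w) (br_j O0 (beta00 L) x y z)"
    "P 4 Y = plug 4 K 1 (beta01 L w) (beta3 L x y z)"
  unfolding X_def Y_def
  using plug_closed[OF ok(3)[OF A A] b1.b_slin0[of "idn C w"], of "jac G x y z"]
    plug_closed[OF ok(4)[OF A A] b1.b_slin1[of "idn C w"], of "jac G x y z"]
    tmap_plug_via[OF ok(3)[OF A A] b1.b_slin0[of "idn C w"] src O0 src O0 b00_slin(1)[of w], of "jac G x y z"]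
    tmap_plug_via[OF ok(3)[OF A A] b1.b_slin0[of "idn C w"] tgt O0 tgt O0 b00_slin(1)[of w], of "jac G x y z"]
    tmap_plug_via[OF ok(3)[OF A A] b1.b_slin0[of "idn C w"] p K p K b10_slin(1)[of w], of "jac G x y z"]
    tmap_plug_via[OF ok(4)[OF A A] b1.b_slin1[of "idn C w"] src O0 src O0 b00_slin(2)[of w], of "jac G x y z"]
    tmap_plug_via[OF ok(4)[OF A A] b1.b_slin1[of "idn C w"] tgt O0 tgt O0 b00_slin(2)[of w], of "jac G x y z"]
    tmap_plug_via[OF ok(4)[OF A A] b1.b_slin1[of "idn C w"] p K p K b01_slin(2)[of w], of "jac G x y z"]
    assms(1-4)
  by (simp_all add: T_jac tens_closed)

lemma parts_plug_jac:
  assumes "x \<in> carrier O0" "y \<in> carrier O0" "X \<in> carrier (tens 2 O0)"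
  shows "plug 4 A 0 (\<lambda>e. jac G e x y) X \<in> carrier (tens 4 A)"
    "S 4 (plug 4 A 0 (\<lambda>e. jac G e x y) X) = plug 4 O0 0 (\<lambda>e. br_l O0 (beta00 L) e x y) X"
    "T 4 (plug 4 A 0 (\<lambda>e. jac G e x y) X) = plug 4 O0 0 (\<lambda>e. br_j O0 (beta00 L) e x y) X"
    "P 4 (plug 4 A 0 (\<lambda>e. jac G e x y) X) = plug 4 K 0 (\<lambda>e. beta3 L e x y) X"
    "plug 4 A 1 (\<lambda>e. jac G x e y) X \<in> carrier (tens 4 A)"
    "S 4 (plug 4 A 1 (\<lambda>e. jac G x e y) X) = plug 4 O0 1 (\<lambda>e. br_l O0 (beta00 L) x e y) X"
    "T 4 (plug 4 A 1 (\<lambda>e. jac G x e y) X) = plug 4 O0 1 (\<lambda>e. br_j O0 (beta00 L) x e y) X"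
    "P 4 (plug 4 A 1 (\<lambda>e. jac G x e y) X) = plug 4 K 1 (\<lambda>e. beta3 L x e y) X"
    "plug 4 A 2 (jac G x y) X \<in> carrier (tens 4 A)"
    "S 4 (plug 4 A 2 (jac G x y) X) = plug 4 O0 2 (\<lambda>e. br_l O0 (beta00 L) x y e) X"
    "P 4 (plug 4 A 2 (jac G x y) X) = plug 4 K 2 (\<lambda>e. beta3 L x y e) X"
  by (rule plug_closed[OF ok(5)[OF O0 A] J_slin(1)] plug_closed[OF ok(6)[OF O0 A] J_slin(2)] plug_closed[OF ok(7)[OF O0 A] J_slin(3)]
      tmap_plug_cong[OF ok(5)[OF O0 A] J_slin(1)] tmap_plug_cong[OF ok(6)[OF O0 A] J_slin(2)]
      tmap_plug_cong[OF ok(7)[OF O0 A] J_slin(3)]; use assms in \<open>simp add: T_jac\<close>)+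

text \<open>The coherence law contains a bracket with \<open>w\<close> on the right, while (v) has
  \<open>w\<close> on the left; skew-symmetry exchanges the two, moving the slot of \<open>w\<close>
  past the block of three.\<close>

lemma plug_beta10:
  assumes "w \<in> carrier O0" "U \<in> carrier (tens 3 K)"
  shows "plug 4 K 0 (\<lambda>e. beta10 L e w) U = \<ominus>\<^bsub>tens 4 K\<^esub> slots K [1, 2, 3, 0] (plug 4 K 1 (beta01 L w) U)"
proof -
  have s: "slin K K 2 0 (\<lambda>e. slots K [1, 0] (beta01 L w e))"
    using slin_slots[OF cop_inv_perms(1) _ K b01_slin(2)[OF assms(1)], of 0] by simp
  have "plug 4 K 0 (\<lambda>e. beta10 L e w) U = plug 4 K 0 (\<lambda>e. \<ominus>\<^bsub>tens 2 K\<^esub> slots K [1, 0] (beta01 L w e)) U"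
    using assms by (intro plug_cong[OF ok(3) b10_slin(1)] b10_eq) auto
  then show ?thesis
    using assms by (simp add: plug_neg_fun[OF ok(3)[OF K K] s] slots_outer4(1)[OF K K b01_slin(2)])
qed

text \<open>In (v) the inner bracket always fills the first argument of \<open>beta3\<close>, in the
  coherence law any of the three. A transposition of arguments brings it to the front with a sign, a
  cyclic permutation without one.\<close>

lemma plug_beta3:
  assumes "x \<in> carrier O0" "y \<in> carrier O0" "X \<in> carrier (tens 2 O0)"
  shows "plug 4 K 1 (\<lambda>e. beta3 L x e y) X = \<ominus>\<^bsub>tens 4 K\<^esub> slots K [2, 0, 1, 3] (plug 4 K 0 (\<lambda>e. beta3 L e x y) X)"
    "plug 4 K 2 (beta3 L x y) X = slots K [2, 3, 0, 1] (plug 4 K 0 (\<lambda>e. beta3 L e x y) X)"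
proof -
  have s: "slin O0 K 3 1 (\<lambda>e. slots K [1, 0, 2] (beta3 L e x y))"
    using slin_slots[OF cop_inv_perms(2) _ K b3_slin(1)[OF assms(1,2)], of 1] by simp
  have "plug 4 K 1 (\<lambda>e. beta3 L x e y) X = plug 4 K 1 (\<lambda>e. \<ominus>\<^bsub>tens 3 K\<^esub> slots K [1, 0, 2] (beta3 L e x y)) X"
    using assms by (intro plug_cong[OF ok(6) b3_slin(2)]) (auto simp: skew3 tens_minus_minus)
  then show "plug 4 K 1 (\<lambda>e. beta3 L x e y) X = \<ominus>\<^bsub>tens 4 K\<^esub> slots K [2, 0, 1, 3] (plug 4 K 0 (\<lambda>e. beta3 L e x y) X)"
    using assms by (simp add: plug_neg_fun[OF ok(6)[OF O0 K] s] slots_outer4(2)[OF O0 K b3_slin(1)])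
  have "beta3 L x y e = slots K [1, 2, 0] (beta3 L e x y)" if "e \<in> carrier O0" for e
    using assms that slots_slots[OF cop_inv_perms(2,4) K, of 3 "beta3 L e x y"]
    by (simp add: skew3 slots_neg[OF cop_inv_perms(2)] tens_minus_minus)
  then have "plug 4 K 2 (beta3 L x y) X = plug 4 K 2 (\<lambda>e. slots K [1, 2, 0] (beta3 L e x y)) X"
    using assms by (intro plug_cong[OF ok(7) b3_slin(3)]) auto
  then show "plug 4 K 2 (beta3 L x y) X = slots K [2, 3, 0, 1] (plug 4 K 0 (\<lambda>e. beta3 L e x y) X)"
    using assms by (simp add: slots_outer4(4)[OF O0 K b3_slin(1)])
qed

lemma slots4_closed [simp]:
  "cop_inv \<sigma> \<Longrightarrow> length \<sigma> = 4 \<Longrightarrow> left_module M \<Longrightarrow> X \<in> carrier (tens 4 M) \<Longrightarrow> slots M \<sigma> X \<in> carrier (tens 4 M)"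
  by (rule slots_closed')

lemma jac_coherence_iff:
  assumes "x \<in> carrier O0" "y \<in> carrier O0" "z \<in> carrier O0" "w \<in> carrier O0"
  shows "jac_path1 G x y z w = jac_path2 G x y z w \<longleftrightarrow>
    plug 4 K 1 (\<lambda>e. beta01 L x e) (beta3 L y z w)
    \<ominus>\<^bsub>tens 4 K\<^esub> slots K [1, 0, 2, 3] (plug 4 K 1 (\<lambda>e. beta01 L y e) (beta3 L x z w))
    + slots K [1, 2, 0, 3] (plug 4 K 1 (\<lambda>e. beta01 L z e) (beta3 L x y w))
    \<ominus>\<^bsub>tens 4 K\<^esub> slots K [1, 2, 3, 0] (plug 4 K 1 (\<lambda>e. beta01 L w e) (beta3 L x y z))
    \<ominus>\<^bsub>tens 4 K\<^esub> plug 4 K 0 (\<lambda>e. beta3 L e z w) (beta00 L x y)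
    + slots K [0, 2, 1, 3] (plug 4 K 0 (\<lambda>e. beta3 L e y w) (beta00 L x z))
    \<ominus>\<^bsub>tens 4 K\<^esub> slots K [0, 2, 3, 1] (plug 4 K 0 (\<lambda>e. beta3 L e y z) (beta00 L x w))
    \<ominus>\<^bsub>tens 4 K\<^esub> slots K [2, 0, 1, 3] (plug 4 K 0 (\<lambda>e. beta3 L e x w) (beta00 L y z))
    + slots K [2, 0, 3, 1] (plug 4 K 0 (\<lambda>e. beta3 L e x z) (beta00 L y w))
    \<ominus>\<^bsub>tens 4 K\<^esub> slots K [2, 3, 0, 1] (plug 4 K 0 (\<lambda>e. beta3 L e x y) (beta00 L z w))
    = tens_rel 4 K" (is "_ \<longleftrightarrow> ?v")
proof -
  have n: "(4::nat) \<ge> 1" by simp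
  let ?T = "tens 4 A" and ?b = "beta00 L"
  let ?s1 = "slots A [1, 0, 2, 3]" and ?s2 = "slots A [2, 0, 1, 3]" and ?s3 = "slots A [0, 2, 1, 3]" and ?s4 = "slots A [1, 2, 0, 3]"
  define X1 where "X1 = plug 4 A 0 (\<lambda>e. br1 G e (idn C w)) (jac G x y z)"
  define X2 where "X2 = plug 4 A 1 (\<lambda>e. jac G x e w) (?b y z) \<ominus>\<^bsub>?T\<^esub> ?s1 (plug 4 A 1 (\<lambda>e. jac G y e w) (?b x z))"
  define X3 where "X3 = plug 4 A 1 (br1 G (idn C x)) (jac G y z w)
      \<ominus>\<^bsub>?T\<^esub> ?s2 (plug 4 A 2 (jac G y z) (?b x w))
      \<ominus>\<^bsub>?T\<^esub> ?s1 (plug 4 A 1 (br1 G (idn C y)) (jac G x z w))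
      + ?s3 (plug 4 A 2 (jac G x z) (?b y w))"
  define Y1 where "Y1 = plug 4 A 0 (\<lambda>e. jac G e z w) (?b x y)"
  define Y2 where "Y2 = I 4 (plug 4 O0 0 (\<lambda>e. br_r O0 ?b e z w) (?b x y))
      \<ominus>\<^bsub>?T\<^esub> ?s4 (plug 4 A 1 (br1 G (idn C z)) (jac G x y w))"
  define Y3 where "Y3 = plug 4 A 2 (jac G x y) (?b z w)
      \<ominus>\<^bsub>?T\<^esub> I 4 (slots O0 [1, 2, 0, 3] (plug 4 O0 1 (?b z) (br_r O0 ?b x y w)))
      + I 4 (slots O0 [2, 1, 0, 3] (plug 4 O0 1 (?b z) (br_r O0 ?b y x w)))"
  note defs = X1_def X2_def X3_def Y1_def Y2_def Y3_def
  note parts = parts_plug_br1 parts_plug_jac b.plug_br_closed b.slots4_closed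
  have cl: "X1 \<in> carrier ?T" "X2 \<in> carrier ?T" "X3 \<in> carrier ?T" "Y1 \<in> carrier ?T" "Y2 \<in> carrier ?T" "Y3 \<in> carrier ?T"
    unfolding defs using assms by (simp_all add: tens_closed parts cop_inv_perms)
  note simps = tmaps_minus tmaps_add tmaps_slots cop_inv_perms parts tens_closed
  \<comment> \<open>\<open>e1\<close> to \<open>e4\<close> make the two chains composable.
    \<open>e5\<close> says that they start at the same object [[[x*y]*z]*w], read once as a bracket
    with \<open>w\<close> and once with [x*y] inserted.\<close>
  have e1: "S 4 X2 = T 4 X1"
    unfolding defs using assms b.jac_objects1[OF assms] by (simp add: simps)
  have e2: "S 4 X3 = T 4 X2"
    unfolding defs using assms b.jac_objects2[OF assms] by (simp add: simps)
  have e3: "S 4 Y2 = T 4 Y1"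
    unfolding defs using assms b.jac_objects3[OF assms] by (simp add: simps)
  have e4: "S 4 Y3 = T 4 Y2"
    unfolding defs using assms b.jac_objects4[OF assms] by (simp add: simps)
  have e5: "S 4 X1 = S 4 Y1"
    unfolding defs using assms b.br_l_br_l[OF assms] by (simp add: simps)
  note c1 = tens_cmp_parts[OF n cl(1,2) e1] and c2 = tens_cmp_parts[OF n cl(4,5) e3]
  note d1 = tens_cmp_parts[OF n c1(1) cl(3) trans[OF e2 c1(4)[symmetric]]]
    and d2 = tens_cmp_parts[OF n c2(1) cl(6) trans[OF e4 c2(4)[symmetric]]]
  have "jac_path1 G x y z w = jac_path2 G x y z w \<longleftrightarrow>
      internal_cat.cmp (tens_cat 4 C) (X3, internal_cat.cmp (tens_cat 4 C) (X2, X1)) =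
      internal_cat.cmp (tens_cat 4 C) (Y3, internal_cat.cmp (tens_cat 4 C) (Y2, Y1))"
    by (simp add: jac_path1_def jac_path2_def Let_def defs)
  also have "\<dots> \<longleftrightarrow> P 4 X1 + P 4 X2 + P 4 X3 = P 4 Y1 + P 4 Y2 + P 4 Y3"
    unfolding d1(3)[unfolded c1(3), symmetric] d2(3)[unfolded c2(3), symmetric]
    using tens_A_eqI[OF n d1(1) d2(1)] e5 d1(2) d2(2) c1(2) c2(2) by argo
  also have "\<dots> \<longleftrightarrow> ?v"
  proof -
    \<comment> \<open>Products of the slot permutations of the coherence law with those that arose
      from moving the inner bracket to the first argument of \<open>beta3\<close>; the results are
      the permutations that occur in (v).\<close>
    have s: "slots K [1, 0, 2, 3] (slots K [2, 0, 1, 3] U) = slots K [0, 2, 1, 3] U"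
      "slots K [2, 0, 1, 3] (slots K [2, 3, 0, 1] U) = slots K [0, 2, 3, 1] U"
      "slots K [0, 2, 1, 3] (slots K [2, 3, 0, 1] U) = slots K [2, 0, 3, 1] U" if "U \<in> carrier (tens 4 K)" for U
      using that slots_slots[OF cop_inv_perms(7,10) K, of 4 U] slots_slots[OF cop_inv_perms(10,16) K, of 4 U]
        slots_slots[OF cop_inv_perms(8,16) K, of 4 U] by (simp_all add: nth_Cons')
    have c: "plug 4 K 1 (beta01 L x') U \<in> carrier (tens 4 K)" if "x' \<in> carrier O0" "U \<in> carrier (tens 3 K)" for x' U
      by (rule plug_closed[OF ok(4)[OF K K] b01_slin(2)[OF that(1)] that(2)])
    have c': "plug 4 K 0 (\<lambda>e. beta3 L e x' y') U \<in> carrier (tens 4 K)" if "x' \<in> carrier O0" "y' \<in> carrier O0" "U \<in> carrier (tens 2 O0)" for x' y' U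
      by (rule plug_closed[OF ok(5)[OF O0 K] b3_slin(1)[OF that(1,2)] that(3)])
    have neg: "slots K [1, 0, 2, 3] (\<ominus>\<^bsub>tens 4 K\<^esub> U) = \<ominus>\<^bsub>tens 4 K\<^esub> slots K [1, 0, 2, 3] U" if "U \<in> carrier (tens 4 K)" for U
      using that by (simp add: slots_neg[OF cop_inv_perms(7)])
    show ?thesis
      by (subst coherence_arith[symmetric])
        (use assms in \<open>simp_all add: defs simps plug_beta10 plug_beta3 s c c' neg\<close>)
  qed
  finally show ?thesis .
qed

end

context presentation
begin

text \<open>The comparison goes in stages, because each one makes sense of the next: targets of
  brackets are known only under \<open>bracket_axioms\<close>, and the coherence law can be
  evaluated only once the arrows are composable. If a stage fails, both sides of the equivalence are
  false.\<close>

theorem is_lie2_iff_is_linf2: "is_lie2 G \<longleftrightarrow> is_linf2 L"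
proof -
  have lie: "is_lie2 G \<longleftrightarrow> bracket_functor C (br0 G) (br1 G) \<and> jacobiator C (br0 G) (br1 G) (jac G) \<and>
     (\<forall>x\<in>carrier O0. \<forall>y\<in>carrier O0. \<forall>z\<in>carrier O0. \<forall>w\<in>carrier O0. jac_path1 G x y z w = jac_path2 G x y z w)"
    using left_2_module by (simp add: is_lie2_def)
  show ?thesis
  proof (cases "bracket_axioms \<and> jac_axioms")
    case True
    interpret presentation_bracket scale comult counit antipode G L \<iota> p
      by (rule presentation_bracket.intro[OF presentation_axioms presentation_bracket_axioms.intro]) (use True in simp)
    interpret presentation_jac scale comult counit antipode G L \<iota> p
      by (rule presentation_jac.intro[OF presentation_bracket_axioms presentation_jac_axioms.intro]) (use True in simp)
    show ?thesis
      using bracket_functor jacobiator bracket_axioms jac_axioms unfolding lie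
      by (simp add: jac_coherence_iff is_linf2_def Let_def bracket_axioms_def jac_axioms_def)
  next
    case False
    have "\<not> is_lie2 G"
    proof
      assume "is_lie2 G"
      then have b: bracket_axioms unfolding lie by (intro bracket_axioms_of_functor) simp
      interpret presentation_bracket scale comult counit antipode G L \<iota> p
        by (rule presentation_bracket.intro[OF presentation_axioms presentation_bracket_axioms.intro[OF b]])
      from \<open>is_lie2 G\<close> have jac_axioms unfolding lie by (intro jac_axioms_of_jacobiator) simp
      with b False show False by simp
    qed
    moreover have "\<not> is_linf2 L"
      using False by (auto simp: is_linf2_def Let_def bracket_axioms_def jac_axioms_def)
    ultimately show ?thesis by simp
  qed
qed

end

section \<open>Morphisms\<close>

locale linf2_presentation = presentation +
  assumes linf2: "is_linf2 L"

sublocale linf2_presentation \<subseteq> presentation_bracket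
  by (rule presentation_bracket.intro[OF presentation_axioms presentation_bracket_axioms.intro])
    (use linf2 in \<open>simp add: bracket_axioms_def is_linf2_def Let_def\<close>)

sublocale linf2_presentation \<subseteq> presentation_jac
  by (rule presentation_jac.intro[OF presentation_bracket_axioms presentation_jac_axioms.intro])
    (use linf2 in \<open>simp add: jac_axioms_def is_linf2_def Let_def\<close>)

section \<open>Morphisms between two presented objects\<close>

context cocommutative_hopf_algebra
begin

lemma hexagon_iff_arith:
  fixes n and M :: "('h, 'm) module"
  defines "T \<equiv> tens n M"
  assumes c: "a \<in> carrier T" "b \<in> carrier T" "c \<in> carrier T" "d \<in> carrier T" "e \<in> carrier T" "f \<in> carrier T"
    "g \<in> carrier T" "h \<in> carrier T"
  shows "g + (b \<ominus>\<^bsub>T\<^esub> c) + (e \<ominus>\<^bsub>T\<^esub> f) = a + d + h \<longleftrightarrow> a \<ominus>\<^bsub>T\<^esub> b + c + d \<ominus>\<^bsub>T\<^esub> e + f = g \<ominus>\<^bsub>T\<^esub> h"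
proof -
  let ?R = "tens_rel n M"
  note c' = c[unfolded T_def]
  obtain x1 x2 x3 x4 where x: "a = x1 +o ?R" "b = x2 +o ?R" "c = x3 +o ?R" "d = x4 +o ?R"
    using c'(1-4) by (meson tens_repE)
  obtain x5 x6 x7 x8 where x': "e = x5 +o ?R" "f = x6 +o ?R" "g = x7 +o ?R" "h = x8 +o ?R"
    using c'(5-8) by (meson tens_repE)
  have "- v \<in> ?R \<longleftrightarrow> v \<in> ?R" for v
    using subgrp_minus[OF subgrp_tens_rel, of v n M] subgrp_minus[OF subgrp_tens_rel, of "- v" n M] by auto
  from this[of "(x1 - x2 + x3 + x4 - x5 + x6) - (x7 - x8)"]
  have "x7 + (x2 - x3) + (x5 - x6) - (x1 + x4 + x8) \<in> ?R \<longleftrightarrow> (x1 - x2 + x3 + x4 - x5 + x6) - (x7 - x8) \<in> ?R"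
    by (simp add: algebra_simps)
  then show ?thesis using c' unfolding T_def x x' by (simp add: tens_calc)
qed

end

text \<open>The two triples are related by sources and arrow parts only. Neither is assumed to be a
  morphism, so each direction of the correspondence can start from here.\<close>

locale hom_correspondence = cocommutative_hopf_algebra scale comult counit antipode
  + X: linf2_presentation scale comult counit antipode G L \<iota> p
  + Y: linf2_presentation scale comult counit antipode G' L' \<iota>' p'
  for scale :: "'k::field \<Rightarrow> 'h::ring_1 \<Rightarrow> 'h" (infixr \<open>*\<^sub>k\<close> 75)
    and comult :: "'h \<Rightarrow> ('h list \<Rightarrow>\<^sub>0 int) set" and counit :: "'h \<Rightarrow> 'k" and antipode :: "'h \<Rightarrow> 'h"
    and G :: "('h, 'u) lie2" and L :: "('h, 'u) linf2" and \<iota> p :: "'u \<Rightarrow> 'u"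
    and G' :: "('h, 'u) lie2" and L' :: "('h, 'u) linf2" and \<iota>' p' :: "'u \<Rightarrow> 'u" +
  fixes f0 f1 F1 :: "'u \<Rightarrow> 'u" and f2 F2 :: "'u \<Rightarrow> 'u \<Rightarrow> ('h, 'u) tens"
  assumes f0: "f0 \<in> lhom X.O0 Y.O0" and f1: "f1 \<in> lhom X.K Y.K" and f2: "polylinear2 X.O0 X.O0 Y.K f2"
    and F1_eq: "\<And>a. a \<in> carrier X.A \<Longrightarrow> F1 a = idn Y.C (f0 (src X.C a)) \<oplus>\<^bsub>Y.A\<^esub> \<iota>' (f1 (p a))"
    and F2_closed: "\<And>x y. x \<in> carrier X.O0 \<Longrightarrow> y \<in> carrier X.O0 \<Longrightarrow> F2 x y \<in> carrier (tens 2 Y.A)"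
    and S_F2: "\<And>x y. x \<in> carrier X.O0 \<Longrightarrow> y \<in> carrier X.O0 \<Longrightarrow> Y.S 2 (F2 x y) = beta00 L' (f0 x) (f0 y)"
    and P_F2: "\<And>x y. x \<in> carrier X.O0 \<Longrightarrow> y \<in> carrier X.O0 \<Longrightarrow> Y.P 2 (F2 x y) = f2 x y"
begin

declare F2_closed [simp] S_F2 [simp] P_F2 [simp]
lemmas f_closed [simp] = lhomD(1)[OF f0] lhomD(1)[OF f1] polylinear2_closed[OF f2]
lemmas f_zero [simp] = lhom_zero[OF X.O0 Y.O0 f0] lhom_zero[OF X.K Y.K f1]

text \<open>The target is left in the form that holds without the condition that \<open>f0\<close>
  and \<open>f1\<close> commute with \<open>beta1\<close>. Where this condition is available the
  fourth rule is removed, so that targets can be written through \<open>f0\<close>.\<close>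

lemma F1_parts [simp]:
  assumes "a \<in> carrier X.A"
  shows "F1 a \<in> carrier Y.A" "src Y.C (F1 a) = f0 (src X.C a)" "p' (F1 a) = f1 (p a)"
    "tgt Y.C (F1 a) = f0 (src X.C a) \<oplus>\<^bsub>Y.O0\<^esub> beta1 L' (f1 (p a))"
  using assms by (simp_all add: F1_eq lhomD(2)[OF Y.src] lhomD(2)[OF Y.p] lhomD(2)[OF Y.tgt])

lemma F1: "F1 \<in> lhom X.A Y.A"
proof -
  have "(\<lambda>a. idn Y.C (f0 (src X.C a)) \<oplus>\<^bsub>Y.A\<^esub> \<iota>' (f1 (p a))) \<in> lhom X.A Y.A"
    by (intro lhomI)
      (simp_all add: lhomD(2,3)[OF X.src] lhomD(2,3)[OF X.p] lhomD(2,3)[OF f0] lhomD(2,3)[OF f1] lhomD(2,3)[OF Y.idn]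
        lhomD(2,3)[OF Y.\<iota>] Y.A.smult_add Y.A.smult_closed Y.A.a_ac)
  then show ?thesis by (rule lhom_cong[OF X.A _ F1_eq])
qed

lemma F1_idn [simp]: "x \<in> carrier X.O0 \<Longrightarrow> F1 (idn X.C x) = idn Y.C (f0 x)"
  by (simp add: F1_eq)

lemma tmap_F1 [simp]:
  assumes "n \<ge> 1" and X: "X \<in> carrier (tens n X.A)"
  shows "tmap n Y.A F1 X \<in> carrier (tens n Y.A)" "Y.S n (tmap n Y.A F1 X) = tmap n Y.O0 f0 (X.S n X)"
    "Y.P n (tmap n Y.A F1 X) = tmap n Y.K f1 (X.P n X)"
proof -
  show "tmap n Y.A F1 X \<in> carrier (tens n Y.A)" by (rule tmap_closed[OF assms(1) X.A F1 X])
  show "Y.S n (tmap n Y.A F1 X) = tmap n Y.O0 f0 (X.S n X)"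
    using tmap_tmap[OF assms(1) X.A Y.A F1 Y.src X] tmap_tmap[OF assms(1) X.A X.O0 X.src f0 X]
      tmap_cong[OF assms(1) X.A lhom_comp[OF F1 Y.src] X, of "\<lambda>a. f0 (src X.C a)"] by simp
  show "Y.P n (tmap n Y.A F1 X) = tmap n Y.K f1 (X.P n X)"
    using tmap_tmap[OF assms(1) X.A Y.A F1 Y.p X] tmap_tmap[OF assms(1) X.A X.K X.p f1 X]
      tmap_cong[OF assms(1) X.A lhom_comp[OF F1 Y.p] X, of "\<lambda>a. f1 (p a)"] by simp
qed

lemma tmap_f_closed [simp]:
  "n \<ge> 1 \<Longrightarrow> X \<in> carrier (tens n X.O0) \<Longrightarrow> tmap n Y.O0 f0 X \<in> carrier (tens n Y.O0)"
  "n \<ge> 1 \<Longrightarrow> U \<in> carrier (tens n X.K) \<Longrightarrow> tmap n Y.K f1 U \<in> carrier (tens n Y.K)"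
  by (rule tmap_closed[OF _ X.O0 f0] tmap_closed[OF _ X.K f1]; assumption)+

lemma F2: "polylinear2 X.O0 X.O0 Y.A F2"
  unfolding polylinear2_iff
proof (intro conjI ballI allI)
  have n: "(2::nat) \<ge> 1" by simp
  note f = f2[unfolded polylinear2_iff] and b = Y.b00[unfolded polylinear2_iff]
  show "F2 x y \<in> carrier (tens 2 Y.A)" if "x \<in> carrier X.O0" "y \<in> carrier X.O0" for x y using that by simp
  show "F2 (x \<oplus>\<^bsub>X.O0\<^esub> x') y = F2 x y + F2 x' y" if "x \<in> carrier X.O0" "x' \<in> carrier X.O0" "y \<in> carrier X.O0" for x x' y
    by (rule Y.tens_A_eqI[OF n])
      (use that f b in \<open>simp_all add: tens_closed Y.tmaps_add lhomD(2)[OF f0]\<close>)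
  show "F2 y (x \<oplus>\<^bsub>X.O0\<^esub> x') = F2 y x + F2 y x'" if "y \<in> carrier X.O0" "x \<in> carrier X.O0" "x' \<in> carrier X.O0" for x x' y
    by (rule Y.tens_A_eqI[OF n])
      (use that f b in \<open>simp_all add: tens_closed Y.tmaps_add lhomD(2)[OF f0]\<close>)
  show "F2 (g \<odot>\<^bsub>X.O0\<^esub> x) (h \<odot>\<^bsub>X.O0\<^esub> y) = lmul Y.A [g, h] (F2 x y)" if "x \<in> carrier X.O0" "y \<in> carrier X.O0" for x y g h
  proof -
    have l: "length [g, h] = 2" by simp
    show ?thesis
      by (rule Y.tens_A_eqI[OF n])
        (use that f b in \<open>simp_all add: X.O0.smult_closed lmul_closed[OF Y.A l n] lmul_tmap[OF Y.A Y.O0 Y.src l n]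
            lmul_tmap[OF Y.A Y.K Y.p l n] lhomD(3)[OF f0]\<close>)
  qed
qed

lemma left_2_module_hom_iff:
  "left_2_module_hom X.C Y.C f0 F1 \<longleftrightarrow> (\<forall>u\<in>carrier X.K. beta1 L' (f1 u) = f0 (beta1 L u))"
proof
  assume h: "left_2_module_hom X.C Y.C f0 F1"
  show "\<forall>u\<in>carrier X.K. beta1 L' (f1 u) = f0 (beta1 L u)"
  proof
    fix u assume u: "u \<in> carrier X.K"
    then have "\<iota> u \<in> carrier X.A" by simp
    with h have "tgt Y.C (F1 (\<iota> u)) = f0 (tgt X.C (\<iota> u))" unfolding left_2_module_hom_def by blast
    with u show "beta1 L' (f1 u) = f0 (beta1 L u)" by simp
  qed
next
  assume h: "\<forall>u\<in>carrier X.K. beta1 L' (f1 u) = f0 (beta1 L u)"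
  have t: "tgt Y.C (F1 a) = f0 (tgt X.C a)" if "a \<in> carrier X.A" for a
    using that h by (simp add: X.tgt_eq lhomD(2)[OF f0])
  have "F1 (cmp X.C (g, f)) = cmp Y.C (F1 g, F1 f)" if "(g, f) \<in> carrier (composable X.C)" for g f
  proof -
    from that have gf: "g \<in> carrier X.A" "f \<in> carrier X.A" "src X.C g = tgt X.C f" by (simp_all add: X.composable_carrier)
    have s: "src Y.C (F1 g) = tgt Y.C (F1 f)" using gf t by simp
    show ?thesis
      using gf Y.cmp_eq[OF F1_parts(1)[OF gf(1)] F1_parts(1)[OF gf(2)] s]
      by (simp del: F1_parts(4)) (simp add: F1_eq[of f] F1_eq[of "cmp X.C (g, f)"] X.cmp_parts[OF gf] lhomD(2)[OF f1]
          lhomD(2)[OF Y.\<iota>] Y.A.a_assoc)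
  qed
  then show "left_2_module_hom X.C Y.C f0 F1"
    unfolding left_2_module_hom_def using f0 F1 t by (auto simp del: F1_parts(4))
qed

lemma T_F2_iff:
  assumes "x \<in> carrier X.O0" "y \<in> carrier X.O0"
  shows "Y.T 2 (F2 x y) = tmap 2 Y.O0 f0 (beta00 L x y) \<longleftrightarrow>
    tmap 2 Y.O0 f0 (beta00 L x y) = tmap 2 Y.O0 (beta1 L') (f2 x y) + beta00 L' (f0 x) (f0 y)"
  using assms by (auto simp: Y.T_eq add.commute)

context
  assumes chain: "\<And>u. u \<in> carrier X.K \<Longrightarrow> beta1 L' (f1 u) = f0 (beta1 L u)"
    and T_F2: "\<And>x y. x \<in> carrier X.O0 \<Longrightarrow> y \<in> carrier X.O0 \<Longrightarrow> Y.T 2 (F2 x y) = tmap 2 Y.O0 f0 (beta00 L x y)"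
begin

lemma tgt_F1: "a \<in> carrier X.A \<Longrightarrow> tgt Y.C (F1 a) = f0 (tgt X.C a)"
  using chain by (simp add: X.tgt_eq lhomD(2)[OF f0])

text \<open>\<open>chain\<close> and \<open>T_F2\<close> make the arrows composable. The two
  composites then have the same source, and only their arrow parts have to be compared.\<close>

lemma naturality_F2_iff:
  assumes a: "a \<in> carrier X.A" and b: "b \<in> carrier X.A"
  shows "internal_cat.cmp (tens_cat 2 Y.C) (F2 (tgt X.C a) (tgt X.C b), br1 G' (F1 a) (F1 b)) =
      internal_cat.cmp (tens_cat 2 Y.C) (tmap 2 Y.A F1 (br1 G a b), F2 (src X.C a) (src X.C b)) \<longleftrightarrow>
    beta01 L' (f0 (src X.C a)) (f1 (p b)) + beta10 L' (f1 (p a)) (f0 (tgt X.C b)) + f2 (tgt X.C a) (tgt X.C b) =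
    f2 (src X.C a) (src X.C b) + (tmap 2 Y.K f1 (beta01 L (src X.C a) (p b)) + tmap 2 Y.K f1 (beta10 L (p a) (tgt X.C b)))"
    (is "?l = ?r \<longleftrightarrow> ?v")
proof -
  have n: "(2::nat) \<ge> 1" by simp
  have cl: "br1 G' (F1 a) (F1 b) \<in> carrier (tens 2 Y.A)" "F2 (tgt X.C a) (tgt X.C b) \<in> carrier (tens 2 Y.A)"
    "F2 (src X.C a) (src X.C b) \<in> carrier (tens 2 Y.A)" "tmap 2 Y.A F1 (br1 G a b) \<in> carrier (tens 2 Y.A)"
    using assms by simp_all
  have e1: "Y.S 2 (F2 (tgt X.C a) (tgt X.C b)) = Y.T 2 (br1 G' (F1 a) (F1 b))"
    using assms by (simp add: tgt_F1 del: F1_parts(4))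
  have e2: "Y.S 2 (tmap 2 Y.A F1 (br1 G a b)) = Y.T 2 (F2 (src X.C a) (src X.C b))"
    using assms by (simp add: T_F2)
  note c1 = Y.tens_cmp_parts[OF n cl(1,2) e1] and c2 = Y.tens_cmp_parts[OF n cl(3,4) e2]
  have "?l = ?r \<longleftrightarrow> Y.P 2 ?l = Y.P 2 ?r"
    using Y.tens_A_eqI[OF n c1(1) c2(1)] assms by (auto simp: c1(2) c2(2))
  also have "\<dots> \<longleftrightarrow> ?v"
    using assms by (simp add: c1(3) c2(3) tgt_F1 tmap_add[OF n X.K f1] del: F1_parts(4))
  finally show ?thesis .
qed

text \<open>The pairs \<open>(idn x, \<iota> u)\<close> and \<open>(\<iota> u, idn x)\<close> give
  the two halves of the homotopy identity. Conversely, the change of \<open>f2\<close> from the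
  sources to the targets of a pair of arrows is a sum of two terms, one for each half.\<close>

lemma naturality_iff:
  "(\<forall>a\<in>carrier X.A. \<forall>b\<in>carrier X.A. internal_cat.cmp (tens_cat 2 Y.C) (F2 (tgt X.C a) (tgt X.C b), br1 G' (F1 a) (F1 b)) =
      internal_cat.cmp (tens_cat 2 Y.C) (tmap 2 Y.A F1 (br1 G a b), F2 (src X.C a) (src X.C b))) \<longleftrightarrow>
    (\<forall>x\<in>carrier X.O0. \<forall>u\<in>carrier X.K.
      tmap 2 Y.K f1 (beta01 L x u) = f2 x (beta1 L u) + beta01 L' (f0 x) (f1 u) \<and>
      tmap 2 Y.K f1 (beta10 L u x) = f2 (beta1 L u) x + beta10 L' (f1 u) (f0 x))" (is "?nat \<longleftrightarrow> ?h")
proof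
  note fz = X.slin_zero_arg[OF polylinear2_slin0[OF f2 X.O0] X.O0] X.slin_zero_arg[OF polylinear2_slin1[OF f2 X.O0] X.O0]
  have z: "tmap 2 Y.K f1 (tens_rel 2 X.K) = tens_rel 2 Y.K"
    by (rule tmap_zero[OF _ X.K f1]) simp
  assume nat: ?nat
  note n = naturality_F2_iff[THEN iffD1, OF _ _ nat[THEN bspec, THEN bspec]]
  show ?h
  proof (intro ballI conjI)
    fix x u assume xu: "x \<in> carrier X.O0" "u \<in> carrier X.K"
    show "tmap 2 Y.K f1 (beta01 L x u) = f2 x (beta1 L u) + beta01 L' (f0 x) (f1 u)"
      using n[of "idn X.C x" "\<iota> u"] xu chain by (simp add: fz z tens_closed add.commute)
    show "tmap 2 Y.K f1 (beta10 L u x) = f2 (beta1 L u) x + beta10 L' (f1 u) (f0 x)"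
      using n[of "\<iota> u" "idn X.C x"] xu chain by (simp add: fz z tens_closed add.commute)
  qed
next
  assume h: ?h
  show ?nat
  proof (intro ballI)
    fix a b assume ab: "a \<in> carrier X.A" "b \<in> carrier X.A"
    have "f2 (tgt X.C a) (tgt X.C b) = f2 (src X.C a) (src X.C b) + f2 (src X.C a) (beta1 L (p b)) + f2 (beta1 L (p a)) (tgt X.C b)"
      using ab f2 unfolding polylinear2_iff by (simp add: X.tgt_eq[of a]) (simp add: X.tgt_eq[of b])
    then show "internal_cat.cmp (tens_cat 2 Y.C) (F2 (tgt X.C a) (tgt X.C b), br1 G' (F1 a) (F1 b)) =
      internal_cat.cmp (tens_cat 2 Y.C) (tmap 2 Y.A F1 (br1 G a b), F2 (src X.C a) (src X.C b))"
      unfolding naturality_F2_iff[OF ab] using h ab by (simp add: ac_simps)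
  qed
qed

lemma f2_slin: "y \<in> carrier X.O0 \<Longrightarrow> slin X.O0 Y.K 2 0 (\<lambda>x. f2 x y)" "y \<in> carrier X.O0 \<Longrightarrow> slin X.O0 Y.K 2 1 (f2 y)"
  by (rule polylinear2_slin0[OF f2 X.O0] polylinear2_slin1[OF f2 X.O0]; assumption)+

lemma F2_slin: "y \<in> carrier X.O0 \<Longrightarrow> slin X.O0 Y.A 2 0 (\<lambda>x. F2 x y)" "y \<in> carrier X.O0 \<Longrightarrow> slin X.O0 Y.A 2 1 (F2 y)"
  by (rule polylinear2_slin0[OF F2 X.O0] polylinear2_slin1[OF F2 X.O0]; assumption)+

lemma parts_plug_br1_F2:
  assumes "x \<in> carrier X.O0" "y \<in> carrier X.O0" "z \<in> carrier X.O0"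
  defines "U \<equiv> plug 3 Y.A 0 (\<lambda>e. br1 G' e (idn Y.C (f0 z))) (F2 x y)" and "V \<equiv> plug 3 Y.A 1 (br1 G' (idn Y.C (f0 z))) (F2 x y)"
  shows "U \<in> carrier (tens 3 Y.A)" "Y.S 3 U = br_l Y.O0 (beta00 L') (f0 x) (f0 y) (f0 z)"
    "Y.T 3 U = plug 3 Y.O0 0 (\<lambda>e. beta00 L' e (f0 z)) (tmap 2 Y.O0 f0 (beta00 L x y))"
    "Y.P 3 U = plug 3 Y.K 0 (\<lambda>e. beta10 L' e (f0 z)) (f2 x y)"
    and "V \<in> carrier (tens 3 Y.A)" "Y.S 3 V = br_r Y.O0 (beta00 L') (f0 z) (f0 x) (f0 y)"
    "Y.T 3 V = plug 3 Y.O0 1 (beta00 L' (f0 z)) (tmap 2 Y.O0 f0 (beta00 L x y))"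
    "Y.P 3 V = plug 3 Y.K 1 (beta01 L' (f0 z)) (f2 x y)"
  unfolding U_def V_def br_l_def br_r_def
  using plug_closed[OF Y.ok(1)[OF Y.A Y.A] Y.b1.b_slin0[of "idn Y.C (f0 z)"], of "F2 x y"]
    plug_closed[OF Y.ok(2)[OF Y.A Y.A] Y.b1.b_slin1[of "idn Y.C (f0 z)"], of "F2 x y"]
    tmap_plug_via[OF Y.ok(1)[OF Y.A Y.A] Y.b1.b_slin0[of "idn Y.C (f0 z)"] Y.src Y.O0 Y.src Y.O0 Y.b00_slin(1)[of "f0 z"], of "F2 x y"]
    tmap_plug_via[OF Y.ok(1)[OF Y.A Y.A] Y.b1.b_slin0[of "idn Y.C (f0 z)"] Y.tgt Y.O0 Y.tgt Y.O0 Y.b00_slin(1)[of "f0 z"], of "F2 x y"]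
    tmap_plug_via[OF Y.ok(1)[OF Y.A Y.A] Y.b1.b_slin0[of "idn Y.C (f0 z)"] Y.p Y.K Y.p Y.K Y.b10_slin(1)[of "f0 z"], of "F2 x y"]
    tmap_plug_via[OF Y.ok(2)[OF Y.A Y.A] Y.b1.b_slin1[of "idn Y.C (f0 z)"] Y.src Y.O0 Y.src Y.O0 Y.b00_slin(2)[of "f0 z"], of "F2 x y"]
    tmap_plug_via[OF Y.ok(2)[OF Y.A Y.A] Y.b1.b_slin1[of "idn Y.C (f0 z)"] Y.tgt Y.O0 Y.tgt Y.O0 Y.b00_slin(2)[of "f0 z"], of "F2 x y"]
    tmap_plug_via[OF Y.ok(2)[OF Y.A Y.A] Y.b1.b_slin1[of "idn Y.C (f0 z)"] Y.p Y.K Y.p Y.K Y.b01_slin(2)[of "f0 z"], of "F2 x y"]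
    assms(1-3)
  by (simp_all add: tens_closed T_F2)

lemma parts_plug_F2:
  assumes "x \<in> carrier X.O0" "X \<in> carrier (tens 2 X.O0)"
  shows "plug 3 Y.A 0 (\<lambda>e. F2 e x) X \<in> carrier (tens 3 Y.A)"
    "Y.S 3 (plug 3 Y.A 0 (\<lambda>e. F2 e x) X) = plug 3 Y.O0 0 (\<lambda>e. beta00 L' e (f0 x)) (tmap 2 Y.O0 f0 X)"
    "Y.T 3 (plug 3 Y.A 0 (\<lambda>e. F2 e x) X) = tmap 3 Y.O0 f0 (plug 3 X.O0 0 (\<lambda>e. beta00 L e x) X)"
    "Y.P 3 (plug 3 Y.A 0 (\<lambda>e. F2 e x) X) = plug 3 Y.K 0 (\<lambda>e. f2 e x) X"
    "plug 3 Y.A 1 (F2 x) X \<in> carrier (tens 3 Y.A)"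
    "Y.S 3 (plug 3 Y.A 1 (F2 x) X) = plug 3 Y.O0 1 (beta00 L' (f0 x)) (tmap 2 Y.O0 f0 X)"
    "Y.T 3 (plug 3 Y.A 1 (F2 x) X) = tmap 3 Y.O0 f0 (plug 3 X.O0 1 (beta00 L x) X)"
    "Y.P 3 (plug 3 Y.A 1 (F2 x) X) = plug 3 Y.K 1 (f2 x) X"
proof -
  note ok = Y.ok(1)[OF X.O0 Y.A] Y.ok(2)[OF X.O0 Y.A]
  note F = F2_slin[OF assms(1)]
  have fx: "f0 x \<in> carrier Y.O0" using assms by simp
  show "plug 3 Y.A 0 (\<lambda>e. F2 e x) X \<in> carrier (tens 3 Y.A)" "plug 3 Y.A 1 (F2 x) X \<in> carrier (tens 3 Y.A)"
    by (rule plug_closed[OF ok(1) F(1) assms(2)] plug_closed[OF ok(2) F(2) assms(2)])+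
  show "Y.S 3 (plug 3 Y.A 0 (\<lambda>e. F2 e x) X) = plug 3 Y.O0 0 (\<lambda>e. beta00 L' e (f0 x)) (tmap 2 Y.O0 f0 X)"
    by (rule tmap_plug_via[OF ok(1) F(1) Y.src Y.O0 f0 Y.O0 Y.b00_slin(1)[OF fx]]) (use assms in simp_all)
  show "Y.S 3 (plug 3 Y.A 1 (F2 x) X) = plug 3 Y.O0 1 (beta00 L' (f0 x)) (tmap 2 Y.O0 f0 X)"
    by (rule tmap_plug_via[OF ok(2) F(2) Y.src Y.O0 f0 Y.O0 Y.b00_slin(2)[OF fx]]) (use assms in simp_all)
  show "Y.P 3 (plug 3 Y.A 0 (\<lambda>e. F2 e x) X) = plug 3 Y.K 0 (\<lambda>e. f2 e x) X"
    by (rule Y.tmap_plug_cong[OF ok(1) F(1) Y.p Y.K]) (use assms in simp_all)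
  show "Y.P 3 (plug 3 Y.A 1 (F2 x) X) = plug 3 Y.K 1 (f2 x) X"
    by (rule Y.tmap_plug_cong[OF ok(2) F(2) Y.p Y.K]) (use assms in simp_all)
  have "Y.T 3 (plug 3 Y.A 0 (\<lambda>e. F2 e x) X) = plug 3 Y.O0 0 (\<lambda>e. tmap 2 Y.O0 f0 (beta00 L e x)) X"
    by (rule Y.tmap_plug_cong[OF ok(1) F(1) Y.tgt Y.O0]) (use assms T_F2 in simp_all)
  then show "Y.T 3 (plug 3 Y.A 0 (\<lambda>e. F2 e x) X) = tmap 3 Y.O0 f0 (plug 3 X.O0 0 (\<lambda>e. beta00 L e x) X)"
    using tmap_plug[OF Y.ok(1)[OF X.O0 X.O0] X.b00_slin(1)[OF assms(1)] Y.O0 f0 assms(2)] by simp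
  have "Y.T 3 (plug 3 Y.A 1 (F2 x) X) = plug 3 Y.O0 1 (\<lambda>e. tmap 2 Y.O0 f0 (beta00 L x e)) X"
    by (rule Y.tmap_plug_cong[OF ok(2) F(2) Y.tgt Y.O0]) (use assms T_F2 in simp_all)
  then show "Y.T 3 (plug 3 Y.A 1 (F2 x) X) = tmap 3 Y.O0 f0 (plug 3 X.O0 1 (beta00 L x) X)"
    using tmap_plug[OF Y.ok(2)[OF X.O0 X.O0] X.b00_slin(2)[OF assms(1)] Y.O0 f0 assms(2)] by simp
qed

text \<open>Both composites start at the bracket of \<open>f0 x\<close>, \<open>f0 y\<close>,
  \<open>f0 z\<close> nested to the left. In order, the three arrows of the first have as arrow
  parts \<open>beta3 L'\<close>, brackets with \<open>f2\<close>, and \<open>f2\<close> of brackets;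
  those of the second are a bracket with \<open>f2\<close>, \<open>f2\<close> of a bracket, and the
  image of \<open>beta3 L\<close> under \<open>f1\<close>.\<close>

lemma hexagon_iff:
  assumes xyz: "x \<in> carrier X.O0" "y \<in> carrier X.O0" "z \<in> carrier X.O0"
  shows "internal_cat.cmp (tens_cat 3 Y.C)
          (plug 3 Y.A 1 (F2 x) (beta00 L y z) \<ominus>\<^bsub>tens 3 Y.A\<^esub> slots Y.A [1, 0, 2] (plug 3 Y.A 1 (F2 y) (beta00 L x z)),
           internal_cat.cmp (tens_cat 3 Y.C)
            (plug 3 Y.A 1 (br1 G' (idn Y.C (f0 x))) (F2 y z)
               \<ominus>\<^bsub>tens 3 Y.A\<^esub> slots Y.A [1, 0, 2] (plug 3 Y.A 1 (br1 G' (idn Y.C (f0 y))) (F2 x z)),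
             jac G' (f0 x) (f0 y) (f0 z))) =
        internal_cat.cmp (tens_cat 3 Y.C)
          (tmap 3 Y.A F1 (jac G x y z),
           internal_cat.cmp (tens_cat 3 Y.C)
            (plug 3 Y.A 0 (\<lambda>e. F2 e z) (beta00 L x y),
             plug 3 Y.A 0 (\<lambda>e. br1 G' e (idn Y.C (f0 z))) (F2 x y))) \<longleftrightarrow>
    hexagon_defect L L' f0 f2 x y z = beta3 L' (f0 x) (f0 y) (f0 z) \<ominus>\<^bsub>tens 3 Y.K\<^esub> tmap 3 Y.K f1 (beta3 L x y z)"
    (is "internal_cat.cmp ?D (?Z3, internal_cat.cmp ?D (?Z2, ?Z1)) = internal_cat.cmp ?D (?W3, internal_cat.cmp ?D (?W2, ?W1)) \<longleftrightarrow> ?v")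
proof -
  have n: "(3::nat) \<ge> 1" by simp
  note simps = Y.tmaps_minus Y.tmaps_slots[OF cop_inv_perms(2)] parts_plug_br1_F2 parts_plug_F2 tens_closed
  have cl: "?Z1 \<in> carrier (tens 3 Y.A)" "?Z2 \<in> carrier (tens 3 Y.A)" "?Z3 \<in> carrier (tens 3 Y.A)"
    "?W1 \<in> carrier (tens 3 Y.A)" "?W2 \<in> carrier (tens 3 Y.A)" "?W3 \<in> carrier (tens 3 Y.A)"
    using xyz by (simp_all add: simps)
  have e1: "Y.S 3 ?Z2 = Y.T 3 ?Z1" using xyz by (simp add: simps br_j_def)
  have e2: "Y.S 3 ?Z3 = Y.T 3 ?Z2" using xyz by (simp add: simps)
  have e3: "Y.S 3 ?W2 = Y.T 3 ?W1" using xyz by (simp add: simps)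
  have e4: "Y.S 3 ?W3 = Y.T 3 ?W2" using xyz by (simp add: simps br_l_def)
  have e5: "Y.S 3 ?Z1 = Y.S 3 ?W1" using xyz by (simp add: simps)
  note c1 = Y.tens_cmp_parts[OF n cl(1,2) e1] and c2 = Y.tens_cmp_parts[OF n cl(4,5) e3]
  note d1 = Y.tens_cmp_parts[OF n c1(1) cl(3) trans[OF e2 c1(4)[symmetric]]]
    and d2 = Y.tens_cmp_parts[OF n c2(1) cl(6) trans[OF e4 c2(4)[symmetric]]]
  have "internal_cat.cmp ?D (?Z3, internal_cat.cmp ?D (?Z2, ?Z1)) = internal_cat.cmp ?D (?W3, internal_cat.cmp ?D (?W2, ?W1)) \<longleftrightarrow>
      Y.P 3 ?Z1 + Y.P 3 ?Z2 + Y.P 3 ?Z3 = Y.P 3 ?W1 + Y.P 3 ?W2 + Y.P 3 ?W3"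
    unfolding d1(3)[unfolded c1(3), symmetric] d2(3)[unfolded c2(3), symmetric]
    using Y.tens_A_eqI[OF n d1(1) d2(1)] e5 d1(2) d2(2) c1(2) c2(2) by argo
  also have "\<dots> \<longleftrightarrow> ?v"
  proof -
    have c: "plug 3 Y.K 0 (\<lambda>e. f2 e x) X \<in> carrier (tens 3 Y.K)" "plug 3 Y.K 1 (f2 x) X \<in> carrier (tens 3 Y.K)"
      if "x \<in> carrier X.O0" "X \<in> carrier (tens 2 X.O0)" for x X
      by (rule plug_closed[OF Y.ok(1)[OF X.O0 Y.K] f2_slin(1)[OF that(1)] that(2)]
          plug_closed[OF Y.ok(2)[OF X.O0 Y.K] f2_slin(2)[OF that(1)] that(2)])+
    show ?thesis
      unfolding hexagon_defect_def Let_def tens_add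
      by (subst hexagon_iff_arith[symmetric]) (use xyz in \<open>simp_all add: simps c\<close>)
  qed
  finally show ?thesis .
qed

end

text \<open>Naturality and the hexagon can be compared only once the arrows are composable. The two
  conditions of the case distinction ensure this; each belongs to both notions of morphism, so if
  one fails neither triple is a morphism.\<close>

theorem hom_iff:
  assumes "f0 \<in> extensional (carrier X.O0)" "f1 \<in> extensional (carrier X.K)" "f2 \<in> extensional2 (carrier X.O0)"
    "F1 \<in> extensional (carrier X.A)" "F2 \<in> extensional2 (carrier X.O0)"
  shows "(f0, F1, F2) \<in> lie2_hom G G' \<longleftrightarrow> (f0, f1, f2) \<in> linf2_hom L L'"
proof (cases "(\<forall>u\<in>carrier X.K. beta1 L' (f1 u) = f0 (beta1 L u)) \<and>
    (\<forall>x\<in>carrier X.O0. \<forall>y\<in>carrier X.O0. Y.T 2 (F2 x y) = tmap 2 Y.O0 f0 (beta00 L x y))")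
  case True
  then have chain: "\<And>u. u \<in> carrier X.K \<Longrightarrow> beta1 L' (f1 u) = f0 (beta1 L u)"
    and T: "\<And>x y. x \<in> carrier X.O0 \<Longrightarrow> y \<in> carrier X.O0 \<Longrightarrow> Y.T 2 (F2 x y) = tmap 2 Y.O0 f0 (beta00 L x y)" by auto
  show ?thesis
    unfolding lie2_hom_def Let_def linf2_hom_iff[OF X.linf2 Y.linf2] mem_Collect_eq prod.case left_2_module_hom_iff
      X.br0 Y.br0 X.deg0 Y.deg0
    using assms f0 f1 f2 F2 chain T T_F2_iff hexagon_iff[OF chain T] naturality_iff[OF chain T] by (simp add: Y.iso_arrow_iff)
next
  case False
  then show ?thesis
    unfolding lie2_hom_def Let_def linf2_hom_iff[OF X.linf2 Y.linf2] mem_Collect_eq prod.case left_2_module_hom_iff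
      X.br0 Y.br0 X.deg0 Y.deg0
    using T_F2_iff by (auto simp: Y.iso_arrow_iff)
qed

end

section \<open>The bijection between the sets of morphisms\<close>

type_synonym ('h, 'u) splitting = "('h, 'u) lie2 \<times> ('h, 'u) linf2 \<times> ('u \<Rightarrow> 'u) \<times> ('u \<Rightarrow> 'u)"

context cocommutative_hopf_algebra
begin

text \<open>Only \<open>is_linf2 L\<close> is demanded; under \<open>presents\<close> it is
  equivalent to \<open>is_lie2 G\<close> by \<open>is_lie2_iff_is_linf2\<close>.\<close>

definition splitting :: "('h, 'u) splitting \<Rightarrow> bool" where
  "splitting = (\<lambda>(G, L, \<iota>, p). presents G L \<iota> p \<and> is_linf2 L)"

definition lie2_of :: "('h, 'u) splitting \<Rightarrow> ('h, 'u) splitting \<Rightarrow> ('h, 'u) mor \<Rightarrow> ('h, 'u) mor" where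
  "lie2_of = (\<lambda>(G, L, \<iota>, p) (G', L', \<iota>', p') (f0, f1, f2).
     (f0, \<lambda>a\<in>carrier (Ar (lcat G)). idn (lcat G') (f0 (src (lcat G) a)) \<oplus>\<^bsub>Ar (lcat G')\<^esub> \<iota>' (f1 (p a)),
      \<lambda>x\<in>carrier (Ob (lcat G)). \<lambda>y\<in>carrier (Ob (lcat G)).
        tmap 2 (Ar (lcat G')) (idn (lcat G')) (beta00 L' (f0 x) (f0 y)) + tmap 2 (Ar (lcat G')) \<iota>' (f2 x y)))"

definition linf2_of :: "('h, 'u) splitting \<Rightarrow> ('h, 'u) splitting \<Rightarrow> ('h, 'u) mor \<Rightarrow> ('h, 'u) mor" where
  "linf2_of = (\<lambda>(G, L, \<iota>, p) (G', L', \<iota>', p') (F0, F1, F2).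
     (F0, \<lambda>u\<in>carrier (deg1 L). p' (F1 (\<iota> u)),
      \<lambda>x\<in>carrier (Ob (lcat G)). \<lambda>y\<in>carrier (Ob (lcat G)). tmap 2 (deg1 L') p' (F2 x y)))"

lemma presentationI: "presents G L \<iota> p \<Longrightarrow> presentation scale comult counit antipode G L \<iota> p"
  by (intro presentation.intro split_category.intro split_category_axioms.intro presentation_axioms.intro
      cocommutative_hopf_algebra_axioms) (simp_all add: presents_def Let_def)

lemma linf2_presentationI: "splitting (G, L, \<iota>, p) \<Longrightarrow> linf2_presentation scale comult counit antipode G L \<iota> p"
  by (intro linf2_presentation.intro presentationI linf2_presentation_axioms.intro) (simp_all add: splitting_def)

lemma hom_correspondence_lie2_of:
  assumes e: "splitting (G, L, \<iota>, p)" "splitting (G', L', \<iota>', p')"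
    and f: "f0 \<in> lhom (deg0 L) (deg0 L')" "f1 \<in> lhom (deg1 L) (deg1 L')" "polylinear2 (deg0 L) (deg0 L) (deg1 L') f2"
    and F: "lie2_of (G, L, \<iota>, p) (G', L', \<iota>', p') (f0, f1, f2) = (f0, F1, F2)"
  shows "hom_correspondence scale comult counit antipode G L \<iota> p G' L' \<iota>' p' f0 f1 F1 f2 F2"
proof -
  interpret X: linf2_presentation scale comult counit antipode G L \<iota> p by (rule linf2_presentationI[OF e(1)])
  interpret Y: linf2_presentation scale comult counit antipode G' L' \<iota>' p' by (rule linf2_presentationI[OF e(2)])
  have n: "(2::nat) \<ge> 1" by simp
  note f' = f[unfolded X.deg0 Y.deg0]
  have F1: "F1 = (\<lambda>a\<in>carrier X.A. idn Y.C (f0 (src X.C a)) \<oplus>\<^bsub>Y.A\<^esub> \<iota>' (f1 (p a)))"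
    and F2: "F2 = (\<lambda>x\<in>carrier X.O0. \<lambda>y\<in>carrier X.O0. Y.I 2 (beta00 L' (f0 x) (f0 y)) + Y.J 2 (f2 x y))"
    using F by (simp_all add: lie2_of_def)
  show ?thesis
    by (intro hom_correspondence.intro hom_correspondence_axioms.intro cocommutative_hopf_algebra_axioms
        X.linf2_presentation_axioms Y.linf2_presentation_axioms f')
      (simp_all add: F1 F2 tens_closed Y.tmaps_add lhomD(1)[OF f'(1)] polylinear2_closed[OF f'(3)])
qed

lemma hom_correspondence_linf2_of:
  assumes e: "splitting (G, L, \<iota>, p)" "splitting (G', L', \<iota>', p')" and F: "(F0, F1, F2) \<in> lie2_hom G G'"
    and f: "linf2_of (G, L, \<iota>, p) (G', L', \<iota>', p') (F0, F1, F2) = (F0, f1, f2)"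
  shows "hom_correspondence scale comult counit antipode G L \<iota> p G' L' \<iota>' p' F0 f1 F1 f2 F2"
proof -
  interpret X: linf2_presentation scale comult counit antipode G L \<iota> p by (rule linf2_presentationI[OF e(1)])
  interpret Y: linf2_presentation scale comult counit antipode G' L' \<iota>' p' by (rule linf2_presentationI[OF e(2)])
  have f1: "f1 = (\<lambda>u\<in>carrier X.K. p' (F1 (\<iota> u)))"
    and f2: "f2 = (\<lambda>x\<in>carrier X.O0. \<lambda>y\<in>carrier X.O0. Y.P 2 (F2 x y))"
    using f by (simp_all add: linf2_of_def)
  note F' = F[unfolded lie2_hom_def Let_def mem_Collect_eq prod.case]
  have h: "F0 \<in> lhom X.O0 Y.O0" "F1 \<in> lhom X.A Y.A" "polylinear2 X.O0 X.O0 Y.A F2"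
    using F' unfolding left_2_module_hom_def by blast+
  have s: "src Y.C (F1 a) = F0 (src X.C a)" if "a \<in> carrier X.A" for a
    using F' that unfolding left_2_module_hom_def by blast
  have i: "F1 (idn X.C x) = idn Y.C (F0 x)" if "x \<in> carrier X.O0" for x
    using F' that unfolding left_2_module_hom_def by blast
  have S: "F2 x y \<in> carrier (tens 2 Y.A)" "Y.S 2 (F2 x y) = beta00 L' (F0 x) (F0 y)"
    if "x \<in> carrier X.O0" "y \<in> carrier X.O0" for x y
  proof -
    have "iso_arrow_in (tens_cat 2 Y.C) (F2 x y) (br0 G' (F0 x) (F0 y)) (tmap 2 Y.O0 F0 (br0 G x y))" using F' that by blast
    then show "F2 x y \<in> carrier (tens 2 Y.A)" "Y.S 2 (F2 x y) = beta00 L' (F0 x) (F0 y)" by (simp_all add: Y.iso_arrow_iff)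
  qed
  have f1': "f1 \<in> lhom X.K Y.K"
    by (rule lhom_cong[OF X.K lhom_comp[OF lhom_comp[OF X.\<iota> h(2)] Y.p]]) (simp add: f1)
  have f2': "polylinear2 X.O0 X.O0 Y.K f2"
    by (rule polylinear2_cong[OF X.O0 X.O0 polylinear2_tmap[OF h(3) Y.A Y.K Y.p lhom_ident lhom_ident]]) (simp add: f2)
  have F1: "F1 a = idn Y.C (F0 (src X.C a)) \<oplus>\<^bsub>Y.A\<^esub> \<iota>' (f1 (p a))" if a: "a \<in> carrier X.A" for a
  proof -
    have "F1 a = F1 (idn X.C (src X.C a)) \<oplus>\<^bsub>Y.A\<^esub> F1 (\<iota> (p a))"
      using X.split[OF a] lhomD(2)[OF h(2), of "idn X.C (src X.C a)" "\<iota> (p a)"] a by simp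
    \<comment> \<open>\<open>F1\<close> preserves sources, so it maps the kernel of the source map
      into the kernel, and the decomposition of the image has no identity part.\<close>
    moreover have "F1 (\<iota> (p a)) = \<iota>' (f1 (p a))"
      using Y.split[of "F1 (\<iota> (p a))"] a lhomD(1)[OF h(2), of "\<iota> (p a)"] by (simp add: s f1 lhom_zero[OF X.O0 Y.O0 h(1)])
    ultimately show ?thesis using a by (simp add: i)
  qed
  show ?thesis
    by (intro hom_correspondence.intro hom_correspondence_axioms.intro cocommutative_hopf_algebra_axioms
        X.linf2_presentation_axioms Y.linf2_presentation_axioms h(1) f1' f2' F1 S) (simp_all add: f2)
qed

text \<open>Starting from either side one lands in a \<open>hom_correspondence\<close>, where
  \<open>hom_iff\<close> transfers the axioms of a morphism. The round trips are the decomposition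
  of an arrow into its identity and its arrow part.\<close>

theorem lie2_of_bij:
  assumes e: "splitting e" "splitting e'"
  shows "bij_betw (lie2_of e e') (linf2_hom (fst (snd e)) (fst (snd e'))) (lie2_hom (fst e) (fst e'))"
proof (rule bij_betw_byWitness[where f' = "linf2_of e e'"])
  obtain G L \<iota> p where e1: "e = (G, L, \<iota>, p)" by (cases e)
  obtain G' L' \<iota>' p' where e2: "e' = (G', L', \<iota>', p')" by (cases e')
  note s = e[unfolded e1 e2]
  interpret X: linf2_presentation scale comult counit antipode G L \<iota> p by (rule linf2_presentationI[OF s(1)])
  interpret Y: linf2_presentation scale comult counit antipode G' L' \<iota>' p' by (rule linf2_presentationI[OF s(2)])
  have 1: "linf2_of e e' (lie2_of e e' f) = f \<and> lie2_of e e' f \<in> lie2_hom G G'" if f: "f \<in> linf2_hom L L'" for f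
  proof -
    obtain f0 f1 f2 where ff: "f = (f0, f1, f2)" by (cases f)
    obtain F1 F2 where F: "lie2_of e e' f = (f0, F1, F2)" by (simp add: lie2_of_def e1 e2 ff)
    note h = linf2_homD[OF X.linf2 Y.linf2 f[unfolded ff]]
    interpret hom_correspondence scale comult counit antipode G L \<iota> p G' L' \<iota>' p' f0 f1 F1 f2 F2
      by (rule hom_correspondence_lie2_of[OF s h(1,3,5) F[unfolded e1 e2 ff]])
    have "F1 \<in> extensional (carrier X.A)" "F2 \<in> extensional2 (carrier X.O0)"
      using F by (auto simp: lie2_of_def e1 e2 ff extensional2_restrict)
    then have "lie2_of e e' f \<in> lie2_hom G G'"
      using hom_iff f[unfolded ff] h unfolding F by simp
    moreover have "linf2_of e e' (f0, F1, F2) = (f0, f1, f2)"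
      using h(4,6)
      by (auto simp: linf2_of_def e1 e2 extensional_restrict intro!: extensionalityI[of _ "carrier X.K"] extensional2_eqI[of _ "carrier X.O0"]
          extensional2_restrict)
    ultimately show ?thesis using F ff by simp
  qed
  have 2: "lie2_of e e' (linf2_of e e' F) = F \<and> linf2_of e e' F \<in> linf2_hom L L'" if F: "F \<in> lie2_hom G G'" for F
  proof -
    obtain F0 F1 F2 where FF: "F = (F0, F1, F2)" by (cases F)
    obtain f1 f2 where f: "linf2_of e e' F = (F0, f1, f2)" by (simp add: linf2_of_def e1 e2 FF)
    interpret hom_correspondence scale comult counit antipode G L \<iota> p G' L' \<iota>' p' F0 f1 F1 f2 F2
      by (rule hom_correspondence_linf2_of[OF s F[unfolded FF] f[unfolded e1 e2 FF]])
    have x: "F0 \<in> extensional (carrier X.O0)" "F1 \<in> extensional (carrier X.A)" "F2 \<in> extensional2 (carrier X.O0)"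
      using F unfolding FF lie2_hom_def Let_def by blast+
    have "f1 \<in> extensional (carrier X.K)" "f2 \<in> extensional2 (carrier X.O0)"
      using f by (auto simp: linf2_of_def e1 e2 FF extensional2_restrict)
    then have "linf2_of e e' F \<in> linf2_hom L L'"
      using hom_iff x F[unfolded FF] unfolding f by simp
    moreover have "Y.I 2 (beta00 L' (F0 x) (F0 y)) + Y.J 2 (f2 x y) = F2 x y"
      if "x \<in> carrier X.O0" "y \<in> carrier X.O0" for x y
      using that Y.tens_split[of 2 "F2 x y"] by simp
    then have "lie2_of e e' (F0, f1, f2) = (F0, F1, F2)"
      using x by (auto simp: lie2_of_def e1 e2 F1_eq intro!: extensionalityI[of _ "carrier X.A"] extensional2_eqI[of _ "carrier X.O0"]
          extensional2_restrict)
    ultimately show ?thesis using f FF by simp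
  qed
  show "\<forall>f\<in>linf2_hom (fst (snd e)) (fst (snd e')). linf2_of e e' (lie2_of e e' f) = f"
    "lie2_of e e' ` linf2_hom (fst (snd e)) (fst (snd e')) \<subseteq> lie2_hom (fst e) (fst e')"
    using 1 by (auto simp: e1 e2)
  show "\<forall>F\<in>lie2_hom (fst e) (fst e'). lie2_of e e' (linf2_of e e' F) = F"
    "linf2_of e e' ` lie2_hom (fst e) (fst e') \<subseteq> linf2_hom (fst (snd e)) (fst (snd e'))"
    using 2 by (auto simp: e1 e2)
qed

lemma lie2_of_id:
  assumes e: "splitting e"
  shows "lie2_of e e (linf2_id (fst (snd e))) = lie2_id (fst e)"
proof -
  obtain G L \<iota> p where e1: "e = (G, L, \<iota>, p)" by (cases e)
  interpret X: linf2_presentation scale comult counit antipode G L \<iota> p by (rule linf2_presentationI[OF e[unfolded e1]])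
  have z: "X.J 2 (tens_rel 2 X.K) = tens_rel 2 X.A" by (rule tmap_zero[OF _ X.K X.\<iota>]) simp
  show ?thesis
    by (auto simp: e1 lie2_of_def linf2_id_def lie2_id_def z tens_closed X.split[symmetric] intro!: restrict_ext)
qed

text \<open>Arrow parts add under composition in \<open>tens_cat\<close>, and \<open>G1\<close> acts
  on the arrow part of \<open>F2\<close> through \<open>g1\<close>. This is the formula for the
  third component in \<open>linf2_comp\<close>.\<close>

lemma lie2_of_comp:
  assumes e: "splitting e" "splitting e'" "splitting e''"
    and f: "f \<in> linf2_hom (fst (snd e)) (fst (snd e'))" and g: "g \<in> linf2_hom (fst (snd e')) (fst (snd e''))"
  shows "lie2_of e e'' (linf2_comp (fst (snd e)) (fst (snd e')) (fst (snd e'')) g f) =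
    lie2_comp (fst e) (fst e') (fst e'') (lie2_of e' e'' g) (lie2_of e e' f)"
proof -
  obtain G L \<iota> p where e1: "e = (G, L, \<iota>, p)" by (cases e)
  obtain G' L' \<iota>' p' where e2: "e' = (G', L', \<iota>', p')" by (cases e')
  obtain G'' L'' \<iota>'' p'' where e3: "e'' = (G'', L'', \<iota>'', p'')" by (cases e'')
  note s = e[unfolded e1 e2 e3]
  obtain f0 f1 f2 where ff: "f = (f0, f1, f2)" by (cases f)
  obtain g0 g1 g2 where gg: "g = (g0, g1, g2)" by (cases g)
  obtain F1 F2 where F: "lie2_of e e' f = (f0, F1, F2)" by (simp add: lie2_of_def e1 e2 ff)
  obtain G1 G2 where GG: "lie2_of e' e'' g = (g0, G1, G2)" by (simp add: lie2_of_def e2 e3 gg)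
  interpret X: linf2_presentation scale comult counit antipode G L \<iota> p by (rule linf2_presentationI[OF s(1)])
  interpret Y: linf2_presentation scale comult counit antipode G' L' \<iota>' p' by (rule linf2_presentationI[OF s(2)])
  interpret Z: linf2_presentation scale comult counit antipode G'' L'' \<iota>'' p'' by (rule linf2_presentationI[OF s(3)])
  have n: "(2::nat) \<ge> 1" by simp
  have f': "(f0, f1, f2) \<in> linf2_hom L L'" and g': "(g0, g1, g2) \<in> linf2_hom L' L''"
    using f g by (simp_all add: e1 e2 e3 ff gg)
  note hf = linf2_homD[OF X.linf2 Y.linf2 f'] and hg = linf2_homD[OF Y.linf2 Z.linf2 g']
  interpret F: hom_correspondence scale comult counit antipode G L \<iota> p G' L' \<iota>' p' f0 f1 F1 f2 F2
    by (rule hom_correspondence_lie2_of[OF s(1,2) hf(1,3,5) F[unfolded e1 e2 ff]])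
  interpret G: hom_correspondence scale comult counit antipode G' L' \<iota>' p' G'' L'' \<iota>'' p'' g0 g1 G1 g2 G2
    by (rule hom_correspondence_lie2_of[OF s(2,3) hg(1,3,5) GG[unfolded e2 e3 gg]])
  have A: "idn Z.C (g0 (f0 (src X.C a))) \<oplus>\<^bsub>Z.A\<^esub> \<iota>'' (g1 (f1 (p a))) = G1 (F1 a)" if "a \<in> carrier X.A" for a
    using that G.F1_eq[of "F1 a"] by simp
  have B: "Z.I 2 (beta00 L'' (g0 (f0 x)) (g0 (f0 y))) + Z.J 2 (g2 (f0 x) (f0 y) + tmap 2 Z.K g1 (f2 x y)) =
      internal_cat.cmp (tens_cat 2 Z.C) (tmap 2 Z.A G1 (F2 x y), G2 (f0 x) (f0 y))"
    if xy: "x \<in> carrier X.O0" "y \<in> carrier X.O0" for x y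
  proof -
    have cl: "G2 (f0 x) (f0 y) \<in> carrier (tens 2 Z.A)" "tmap 2 Z.A G1 (F2 x y) \<in> carrier (tens 2 Z.A)"
      using xy by simp_all
    have "Z.S 2 (tmap 2 Z.A G1 (F2 x y)) = Z.T 2 (G2 (f0 x) (f0 y))"
      using xy G.T_F2_iff[of "f0 x" "f0 y"] hg(8)[of "f0 x" "f0 y"] by simp
    note c = Z.tens_cmp_parts[OF n cl this]
    show ?thesis
      using Z.tens_split[OF n c(1)] xy by (simp add: c)
  qed
  show ?thesis
    unfolding F GG
    by (auto simp: e1 e2 e3 ff gg lie2_of_def linf2_comp_def lie2_comp_def A B intro!: restrict_ext)
qed

section \<open>Every object has a splitting\<close>

lemma ex_splits:
  fixes M0 M1 :: "('h, 'u) module"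
  assumes inf: "infinite (UNIV :: 'u set)" and M0: "left_module M0" and M1: "left_module M1" and \<beta>: "\<beta> \<in> lhom M1 M0"
  obtains C \<iota> p where "splits C M1 \<iota> p \<beta>" "Ob C = M0"
proof -
  interpret M0: left_module M0 by fact
  interpret M1: left_module M1 by fact
  \<comment> \<open>The arrows are to be pairs of a source and an arrow part, but must live in
    \<open>'u\<close>; an infinite type contains a copy of its own square.\<close>
  obtain enc :: "'u \<times> 'u \<Rightarrow> 'u" where enc: "inj enc"
    using card_of_Times_same_infinite[OF inf] unfolding UNIV_Times_UNIV card_of_ordIso[symmetric] bij_betw_def by blast
  define dec where "dec = inv_into UNIV enc"
  have dec [simp]: "dec (enc q) = q" for q by (simp add: dec_def enc)
  define A :: "('h, 'u) module" where "A = \<lparr>carrier = enc ` (carrier M0 \<times> carrier M1), mult = undefined, one = undefined, zero = enc (\<zero>\<^bsub>M0\<^esub>, \<zero>\<^bsub>M1\<^esub>),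
    add = (\<lambda>a b. enc (fst (dec a) \<oplus>\<^bsub>M0\<^esub> fst (dec b), snd (dec a) \<oplus>\<^bsub>M1\<^esub> snd (dec b))),
    smult = (\<lambda>r a. enc (r \<odot>\<^bsub>M0\<^esub> fst (dec a), r \<odot>\<^bsub>M1\<^esub> snd (dec a)))\<rparr>"
  \<comment> \<open>The second component of an encoded pair is the arrow part:
    \<open>\<beta>\<close> of it leads from source to target, and composition adds arrow parts and
    keeps the source of \<open>f\<close>.\<close>
  define C where "C = \<lparr>Ob = M0, Ar = A, src = (\<lambda>a. fst (dec a)), tgt = (\<lambda>a. fst (dec a) \<oplus>\<^bsub>M0\<^esub> \<beta> (snd (dec a))),
    idn = (\<lambda>x. enc (x, \<zero>\<^bsub>M1\<^esub>)), cmp = (\<lambda>(g, f). enc (fst (dec f), snd (dec f) \<oplus>\<^bsub>M1\<^esub> snd (dec g)))\<rparr>"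
  note \<beta>' [simp] = lhomD[OF \<beta>] lhom_zero[OF M1 M0 \<beta>]
  note ac = M0.a_ac M1.a_ac M0.smult_closed M1.smult_closed M0.smult_add M1.smult_add M0.smult_mult M1.smult_mult M0.smult_1 M1.smult_1
    M0.smult_add_scalar M1.smult_add_scalar
  have carA: "a \<in> carrier A \<longleftrightarrow> (\<exists>x\<in>carrier M0. \<exists>u\<in>carrier M1. a = enc (x, u))" for a
    by (auto simp: A_def)
  have zr: "r \<odot>\<^bsub>M1\<^esub> \<zero>\<^bsub>M1\<^esub> = \<zero>\<^bsub>M1\<^esub>" "r \<odot>\<^bsub>M0\<^esub> \<zero>\<^bsub>M0\<^esub> = \<zero>\<^bsub>M0\<^esub>" for r
    using lhomD(3)[OF lhom_zero_map[OF M1], of "\<zero>\<^bsub>M1\<^esub>" M1 r] lhomD(3)[OF lhom_zero_map[OF M0], of "\<zero>\<^bsub>M0\<^esub>" M0 r] by simp_all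
  have A: "left_module A"
  proof (rule left_module.intro)
    show "abelian_group A"
    proof (rule abelian_groupI)
      fix a assume "a \<in> carrier A"
      then obtain x u where a: "a = enc (x, u)" "x \<in> carrier M0" "u \<in> carrier M1" by (auto simp: carA)
      show "\<exists>y\<in>carrier A. y \<oplus>\<^bsub>A\<^esub> a = \<zero>\<^bsub>A\<^esub>"
        using a by (intro bexI[of _ "enc (\<ominus>\<^bsub>M0\<^esub> x, \<ominus>\<^bsub>M1\<^esub> u)"]) (auto simp: A_def M0.l_neg M1.l_neg)
    qed (auto simp: A_def ac)
    show "left_module_axioms A"
      by unfold_locales (auto simp: A_def ac)
  qed
  have l2: "left_2_module C"
    unfolding left_2_module_def
    by (auto simp: C_def M0 A composable_def carA intro!: lhomI) (auto simp: A_def ac zr)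
  have "splits C M1 (\<lambda>u. enc (\<zero>\<^bsub>M0\<^esub>, u)) (\<lambda>a. snd (dec a)) \<beta>"
    unfolding splits_def
    by (intro conjI l2 M1) (auto simp: C_def carA intro!: lhomI, auto simp: A_def zr)
  moreover have "Ob C = M0" by (simp add: C_def)
  ultimately show ?thesis by (rule that)
qed

lemma ex_lie2:
  fixes L :: "('h, 'u) linf2"
  assumes inf: "infinite (UNIV :: 'u set)" and L: "is_linf2 L"
  shows "\<exists>G \<iota> p. splitting (G, L, \<iota>, p)"
proof -
  note l = linf2D[OF L]
  obtain C \<iota> p where C: "splits C (deg1 L) \<iota> p (beta1 L)" "Ob C = deg0 L"
    by (rule ex_splits[OF inf l(1,2,3)])
  interpret split_category scale comult counit antipode C "deg1 L" \<iota> p "beta1 L"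
    by (intro split_category.intro split_category_axioms.intro cocommutative_hopf_algebra_axioms C(1))
  \<comment> \<open>Every structure arrow is the identity of its prescribed source plus its
    prescribed arrow part. That the targets come out right is left to the comparison of the two sets
    of axioms.\<close>
  define G where "G = \<lparr>lcat = C, br0 = beta00 L,
    br1 = (\<lambda>a b. I 2 (beta00 L (src C a) (src C b)) + J 2 (beta01 L (src C a) (p b) + beta10 L (p a) (tgt C b))),
    jac = (\<lambda>x y z. I 3 (br_l O0 (beta00 L) x y z) + J 3 (beta3 L x y z))\<rparr>"
  note l' = l[folded C(2)]
  interpret b: polylinear_bracket scale comult counit antipode O0 "beta00 L"
    by (rule polylinear_bracket.intro[OF cocommutative_hopf_algebra_axioms polylinear_bracket_axioms.intro[OF O0 l'(4)]])
  have "presents G L \<iota> p"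
    unfolding presents_def Let_def G_def
    using splits l' by (simp add: C(2)[symmetric] tmaps_add tens_closed b.br_l_closed polylinear2_closed[OF l'(4)] polylinear2_closed[OF l'(5)]
        polylinear2_closed[OF l'(6)] polylinear3_closed[OF l'(7)])
  with L show ?thesis by (auto simp: splitting_def)
qed

lemma polylinear3_tmap:
  assumes "polylinear3 A M f" "left_module M" "left_module N" "g \<in> lhom M N"
  shows "polylinear3 A N (\<lambda>x y z. tmap 3 N g (f x y z))"
proof -
  have l: "length [x, y, z :: 'h] = 3" "(3::nat) \<ge> 1" for x y z by auto
  show ?thesis
    using assms(1) unfolding polylinear3_iff
    by (simp add: tmap_closed[OF l(2) assms(2,4)] tmap_add[OF l(2) assms(2,4)] lmul_tmap[OF assms(2,3,4) l])
qed

lemma ex_linf2: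
  fixes G :: "('h, 'u) lie2"
  assumes G: "is_lie2 G"
  shows "\<exists>L \<iota> p. splitting (G, L, \<iota>, p)"
proof -
  define C where "C = lcat G"
  note G' = G[unfolded is_lie2_def bracket_functor_def jacobiator_def, folded C_def]
  have l2: "left_2_module C" using G' by blast
  note h = l2[unfolded left_2_module_def]
  have O0: "left_module (Ob C)" and A: "left_module (Ar C)" and s: "src C \<in> lhom (Ar C) (Ob C)"
    and t: "tgt C \<in> lhom (Ar C) (Ob C)" and i: "idn C \<in> lhom (Ob C) (Ar C)"
    and si: "\<And>x. x \<in> carrier (Ob C) \<Longrightarrow> src C (idn C x) = x"
    using h by blast+
  interpret O0: left_module "Ob C" by fact
  interpret A: left_module "Ar C" by fact
  note hD [simp] = lhomD(1)[OF s] lhomD(1)[OF t] lhomD(1)[OF i] lhom_zero[OF A O0 s] lhom_zero[OF O0 A i]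
  note neg = lhom_neg[OF A O0 s] lhom_neg[OF O0 A i]
  define K where "K = Ar C\<lparr>carrier := {a \<in> carrier (Ar C). src C a = \<zero>\<^bsub>Ob C\<^esub>}\<rparr>"
  define p where "p = (\<lambda>a. a \<ominus>\<^bsub>Ar C\<^esub> idn C (src C a))"
  have zr: "r \<odot>\<^bsub>Ob C\<^esub> \<zero>\<^bsub>Ob C\<^esub> = \<zero>\<^bsub>Ob C\<^esub>" for r
    using lhomD(3)[OF lhom_zero_map[OF O0], of "\<zero>\<^bsub>Ob C\<^esub>" "Ob C" r] by simp
  have sneg: "r \<odot>\<^bsub>Ar C\<^esub> (\<ominus>\<^bsub>Ar C\<^esub> a) = \<ominus>\<^bsub>Ar C\<^esub> (r \<odot>\<^bsub>Ar C\<^esub> a)" if "a \<in> carrier (Ar C)" for r a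
  proof -
    have "r \<odot>\<^bsub>Ar C\<^esub> (\<ominus>\<^bsub>Ar C\<^esub> a) \<oplus>\<^bsub>Ar C\<^esub> r \<odot>\<^bsub>Ar C\<^esub> a = r \<odot>\<^bsub>Ar C\<^esub> \<zero>\<^bsub>Ar C\<^esub>"
      using A.smult_add[of "\<ominus>\<^bsub>Ar C\<^esub> a" a r] that by (simp add: A.l_neg)
    also have "\<dots> = \<zero>\<^bsub>Ar C\<^esub>" using lhomD(3)[OF lhom_zero_map[OF A], of "\<zero>\<^bsub>Ar C\<^esub>" "Ar C" r] by simp
    finally show ?thesis using that by (intro A.minus_equality[symmetric]) (auto simp: A.smult_closed)
  qed
  have K: "left_module K"
  proof (rule left_module.intro)
    show "abelian_group K"
    proof (rule abelian_groupI)
      fix a assume "a \<in> carrier K"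
      then show "\<exists>y\<in>carrier K. y \<oplus>\<^bsub>K\<^esub> a = \<zero>\<^bsub>K\<^esub>"
        by (intro bexI[of _ "\<ominus>\<^bsub>Ar C\<^esub> a"]) (auto simp: K_def neg A.l_neg)
    qed (auto simp: K_def lhomD(2)[OF s] A.a_ac)
    show "left_module_axioms K"
      by unfold_locales (auto simp: K_def lhomD(3)[OF s] zr A.smult_closed A.smult_add A.smult_add_scalar A.smult_mult A.smult_1)
  qed
  have p: "p \<in> lhom (Ar C) K"
    by (rule lhomI)
      (auto simp: p_def K_def a_minus_def lhomD(2,3)[OF s] lhomD(2,3)[OF i] neg si O0.r_neg A.minus_add A.a_ac
        A.smult_closed A.smult_add sneg)
  have \<iota>: "(\<lambda>u. u) \<in> lhom K (Ar C)" by (rule lhomI) (auto simp: K_def)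
  have t': "tgt C \<in> lhom K (Ob C)" by (rule lhomI) (auto simp: K_def lhomD[OF t])
  have "splits C K (\<lambda>u. u) p (tgt C)"
    unfolding splits_def
    by (auto simp: l2 K p \<iota> t') (auto simp: K_def p_def a_minus_def A.a_ac A.r_neg)
  moreover have KD: "u \<in> carrier (Ar C)" "src C u = \<zero>\<^bsub>Ob C\<^esub>" if "u \<in> carrier K" for u using that by (auto simp: K_def)
  ultimately interpret split_category scale comult counit antipode C K "\<lambda>u. u" p "tgt C"
    by (intro split_category.intro split_category_axioms.intro cocommutative_hopf_algebra_axioms)
  \<comment> \<open>Here \<open>\<iota>\<close> is the identity and \<open>\<beta>\<close> is
    \<open>tgt C\<close>, so this rule would rewrite \<open>tgt C u\<close> to itself.\<close>
  note tgt_\<iota> [simp del]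
  \<comment> \<open>An object enters a bracket with an element of the kernel through its identity
    arrow. The values have to be projected by \<open>P n\<close>, because classes over
    \<open>K\<close> and over \<open>Ar C\<close> are cosets of different subgroups.\<close>
  define L where "L = \<lparr>deg0 = Ob C, deg1 = K, beta1 = tgt C, beta00 = br0 G,
    beta01 = (\<lambda>x u. P 2 (br1 G (idn C x) u)), beta10 = (\<lambda>u x. P 2 (br1 G u (idn C x))), beta3 = (\<lambda>x y z. P 3 (jac G x y z))\<rparr>"
  have b1: "polylinear2 A A A (br1 G)" and j: "polylinear3 O0 A (jac G)" and b0: "polylinear2 O0 O0 O0 (br0 G)" using G' by blast+
  note cl [simp] = polylinear2_closed[OF b1] polylinear3_closed[OF j]
  have ST: "S 2 (br1 G a b) = br0 G (src C a) (src C b)" "T 2 (br1 G a b) = br0 G (tgt C a) (tgt C b)"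
    if "a \<in> carrier A" "b \<in> carrier A" for a b
  proof -
    have "arrow_in (tens_cat 2 C) (br1 G a b) (br0 G (src C a) (src C b)) (br0 G (tgt C a) (tgt C b))" using G' that by blast
    then show "S 2 (br1 G a b) = br0 G (src C a) (src C b)" "T 2 (br1 G a b) = br0 G (tgt C a) (tgt C b)"
      by (simp_all add: arrow_in_def)
  qed
  have id: "br1 G (idn C x) (idn C y) = I 2 (br0 G x y)" if "x \<in> carrier O0" "y \<in> carrier O0" for x y
    using G' that unfolding tens_cat_simps by blast
  have Sj: "S 3 (jac G x y z) = br_l O0 (br0 G) x y z" if "x \<in> carrier O0" "y \<in> carrier O0" "z \<in> carrier O0" for x y z
  proof -
    have "iso_arrow_in (tens_cat 3 C) (jac G x y z) (br_l O0 (br0 G) x y z) (br_j O0 (br0 G) x y z)" using G' that by blast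
    then show ?thesis by (simp add: iso_arrow_iff)
  qed
  note b1' = b1[unfolded polylinear2_iff]
  have F: "\<forall>(a', a)\<in>carrier (composable C). \<forall>(b', b)\<in>carrier (composable C).
      br1 G (internal_cat.cmp C (a', a)) (internal_cat.cmp C (b', b)) = internal_cat.cmp (tens_cat 2 C) (br1 G a' b', br1 G a b)"
    using G' by (elim conjE)
  \<comment> \<open>The interchange law factors the bracket of \<open>u\<close> and \<open>b\<close>
    as the bracket of 0 and \<open>b\<close>, which vanishes, followed by the bracket of
    \<open>u\<close> and the identity of the target of \<open>b\<close>.\<close>
  have P1: "P 2 (br1 G u b) = P 2 (br1 G u (idn C (tgt C b)))" if u: "u \<in> carrier K" and b: "b \<in> carrier A" for u b
  proof -
    have uA: "u \<in> carrier A" "src C u = \<zero>\<^bsub>O0\<^esub>" using KD[OF u] by blast+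
    have z: "br1 G \<zero>\<^bsub>A\<^esub> b = tens_rel 2 A"
      by (rule slin_zero_arg[OF polylinear2_slin0[OF b1 A b] A])
    have "(u, \<zero>\<^bsub>A\<^esub>) \<in> carrier (composable C)" "(idn C (tgt C b), b) \<in> carrier (composable C)"
      using uA b by (simp_all add: composable_carrier)
    then have "br1 G (internal_cat.cmp C (u, \<zero>\<^bsub>A\<^esub>)) (internal_cat.cmp C (idn C (tgt C b), b)) =
        internal_cat.cmp (tens_cat 2 C) (br1 G u (idn C (tgt C b)), br1 G \<zero>\<^bsub>A\<^esub> b)" using F by blast
    then have "br1 G u b = internal_cat.cmp (tens_cat 2 C) (br1 G u (idn C (tgt C b)), br1 G \<zero>\<^bsub>A\<^esub> b)"
      using cmp_idn(1)[OF uA(1)] cmp_idn(2)[OF b] uA(2) by simp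
    also have "P 2 \<dots> = P 2 (br1 G \<zero>\<^bsub>A\<^esub> b) + P 2 (br1 G u (idn C (tgt C b)))"
      using uA b by (intro tens_cmp_parts(3)) (simp_all add: ST)
    finally show ?thesis using uA b by (simp add: z tens_closed tmap_zero[OF _ A p])
  qed
  \<comment> \<open>Additivity splits \<open>a\<close>, and then the second argument in the term
    with the identity of the source of \<open>a\<close>. In the term with \<open>p a\<close>,
    \<open>P1\<close> replaces \<open>b\<close> by the identity of its target, which is the
    asymmetry between source and target in \<open>presents\<close>.\<close>
  have P2: "P 2 (br1 G a b) = P 2 (br1 G (idn C (src C a)) (p b)) + P 2 (br1 G (p a) (idn C (tgt C b)))"
    if a: "a \<in> carrier A" and b: "b \<in> carrier A" for a b
  proof -
    have pA: "p a \<in> carrier A" "p b \<in> carrier A" using a b lhomD(1)[OF \<iota>] by auto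
    have "br1 G a b = br1 G (idn C (src C a)) b + br1 G (p a) b"
      using b1' a b pA split[OF a] by (metis hom_closed(1,3))
    also have "br1 G (idn C (src C a)) b = br1 G (idn C (src C a)) (idn C (src C b)) + br1 G (idn C (src C a)) (p b)"
      using b1' a b pA split[OF b] by (metis hom_closed(1,3))
    finally have "P 2 (br1 G a b) = P 2 (br1 G (idn C (src C a)) (p b)) + P 2 (br1 G (p a) b)"
      using a b pA by (simp add: tmaps_add tens_closed id polylinear2_closed[OF b0])
    then show ?thesis using P1[OF _ b, of "p a"] a by simp
  qed
  have "presents G L (\<lambda>u. u) p"
    unfolding presents_def Let_def L_def linf2.select_convs C_def[symmetric]
    by (intro conjI ballI splits refl b0 polylinear2_tmap[OF b1 A K p idn \<iota>] polylinear2_tmap[OF b1 A K p \<iota> idn]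
        polylinear3_tmap[OF j A K p] P2 ST(1) Sj cl)
  moreover from this have "is_linf2 L" using G presentation.is_lie2_iff_is_linf2[OF presentationI] by blast
  ultimately show ?thesis by (auto simp: splitting_def)
qed

end

section \<open>The equivalence\<close>

text \<open>An element of \<open>T\<close> relates the object \<open>d e\<close> of \<open>D\<close> to the object \<open>c e\<close> of \<open>C\<close>; an object may
  belong to several of them. \<open>C\<close> is not assumed to be a category.\<close>

locale tagged_functor =
  fixes D :: "('p, 'b) category" and C :: "('o, 'a) category" and T :: "'e set" and d :: "'e \<Rightarrow> 'p" and c :: "'e \<Rightarrow> 'o"
    and \<Psi> :: "'e \<Rightarrow> 'e \<Rightarrow> 'b \<Rightarrow> 'a"
  assumes D: "is_category D"
    and d: "e \<in> T \<Longrightarrow> d e \<in> Obj D"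
    and maps: "e \<in> T \<Longrightarrow> e' \<in> T \<Longrightarrow> f \<in> Hom D (d e) (d e') \<Longrightarrow> \<Psi> e e' f \<in> Hom C (c e) (c e')"
    and ident: "e \<in> T \<Longrightarrow> \<Psi> e e (Idt D (d e)) = Idt C (c e)"
    and comp: "e \<in> T \<Longrightarrow> e' \<in> T \<Longrightarrow> e'' \<in> T \<Longrightarrow> f \<in> Hom D (d e) (d e') \<Longrightarrow> g \<in> Hom D (d e') (d e'') \<Longrightarrow>
      \<Psi> e e'' (Cmp D (d e) (d e') (d e'') g f) = Cmp C (c e) (c e') (c e'') (\<Psi> e' e'' g) (\<Psi> e e' f)"
begin

lemma id_closed: "X \<in> Obj D \<Longrightarrow> Idt D X \<in> Hom D X X"
  and id_right: "X \<in> Obj D \<Longrightarrow> Y \<in> Obj D \<Longrightarrow> f \<in> Hom D X Y \<Longrightarrow> Cmp D X X Y f (Idt D X) = f"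
  and id_left: "X \<in> Obj D \<Longrightarrow> Y \<in> Obj D \<Longrightarrow> f \<in> Hom D X Y \<Longrightarrow> Cmp D X Y Y (Idt D Y) f = f"
  using D by (simp_all add: is_category_def)

text \<open>For two tags over the same object of \<open>D\<close>, the image of its identity
  compares the two objects of \<open>C\<close>. Precomposition with this comparison only changes the
  first tag; this is also its naturality.\<close>

lemma retag_right:
  assumes "e \<in> T" "e' \<in> T" "e'' \<in> T" "d e' = d e" "f \<in> Hom D (d e) (d e'')"
  shows "Cmp C (c e) (c e') (c e'') (\<Psi> e' e'' f) (\<Psi> e e' (Idt D (d e))) = \<Psi> e e'' f"
  using comp[OF assms(1-3), of "Idt D (d e)" f] assms d id_closed[of "d e"] id_right by simp

lemma retag_left:
  assumes "e \<in> T" "e' \<in> T" "e'' \<in> T" "d e' = d e''" "f \<in> Hom D (d e) (d e'')"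
  shows "Cmp C (c e) (c e') (c e'') (\<Psi> e' e'' (Idt D (d e''))) (\<Psi> e e' f) = \<Psi> e e'' f"
  using comp[OF assms(1-3), of f "Idt D (d e'')"] assms d id_closed[of "d e''"] id_left by simp

lemma retag_iso:
  assumes "e \<in> T" "e' \<in> T" "d e' = d e"
  shows "is_isomorphism C (c e) (c e') (\<Psi> e e' (Idt D (d e)))"
  unfolding is_isomorphism_def
proof (intro conjI bexI)
  have i: "Idt D (d e) \<in> Hom D (d e) (d e)" using d id_closed assms by blast
  show "\<Psi> e e' (Idt D (d e)) \<in> Hom C (c e) (c e')" "\<Psi> e' e (Idt D (d e)) \<in> Hom C (c e') (c e)"
    using assms i by (auto intro!: maps)
  show "Cmp C (c e) (c e') (c e) (\<Psi> e' e (Idt D (d e))) (\<Psi> e e' (Idt D (d e))) = Idt C (c e)"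
    using retag_right[of e e' e] assms i ident by simp
  show "Cmp C (c e') (c e) (c e') (\<Psi> e e' (Idt D (d e))) (\<Psi> e' e (Idt D (d e))) = Idt C (c e')"
    using retag_right[of e' e e'] assms i ident[of e'] by simp
qed

end

text \<open>A tag is chosen for every object of \<open>C\<close> and for every object of
  \<open>D\<close>, and the functors follow these choices. An object and its image under the round
  trip have tags over a common object of the other category, and \<open>retag_iso\<close> compares
  them. The category axioms of \<open>C\<close> are read off from those of \<open>D\<close>, since
  every arrow of \<open>C\<close> is the image of one in \<open>D\<close>.\<close>

theorem equivalent_categories_tagged:
  assumes "tagged_functor D C T d c \<Psi>"
    and c: "c ` T = Obj C" and d: "d ` T = Obj D"
    and bij: "\<And>e e'. e \<in> T \<Longrightarrow> e' \<in> T \<Longrightarrow> bij_betw (\<Psi> e e') (Hom D (d e) (d e')) (Hom C (c e) (c e'))"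
  shows "equivalent_categories C D"
proof -
  interpret \<Psi>: tagged_functor D C T d c \<Psi> by fact
  define \<Phi> where "\<Phi> e e' = inv_into (Hom D (d e) (d e')) (\<Psi> e e')" for e e'
  have \<Psi>\<Phi>: "\<Psi> e e' (\<Phi> e e' f) = f" "\<Phi> e e' f \<in> Hom D (d e) (d e')" if "e \<in> T" "e' \<in> T" "f \<in> Hom C (c e) (c e')" for e e' f
    using bij[OF that(1,2)] that(3) unfolding \<Phi>_def bij_betw_def by (metis f_inv_into_f, metis inv_into_into)
  have \<Phi>\<Psi>: "\<Phi> e e' (\<Psi> e e' f) = f" if "e \<in> T" "e' \<in> T" "f \<in> Hom D (d e) (d e')" for e e' f
    using bij[OF that(1,2)] that(3) unfolding \<Phi>_def bij_betw_def by simp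
  have "\<exists>e. e \<in> T \<and> c e = X" if "X \<in> Obj C" for X using that unfolding c[symmetric] by auto
  then obtain a where a: "\<And>X. X \<in> Obj C \<Longrightarrow> a X \<in> T \<and> c (a X) = X" by metis
  have "\<exists>e. e \<in> T \<and> d e = Y" if "Y \<in> Obj D" for Y using that unfolding d[symmetric] by auto
  then obtain b where b: "\<And>Y. Y \<in> Obj D \<Longrightarrow> b Y \<in> T \<and> d (b Y) = Y" by metis
  have cO: "c e \<in> Obj C" and dO: "d e \<in> Obj D" if "e \<in> T" for e using c d that by auto
  note D = \<Psi>.D[unfolded is_category_def]
  have lift: "\<exists>f'\<in>Hom D (d e) (d e'). f = \<Psi> e e' f'" if "e \<in> T" "e' \<in> T" "f \<in> Hom C (c e) (c e')" for e e' f
    using \<Psi>\<Phi>[OF that] by metis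
  have Dc: "Cmp D (d e) (d e') (d e'') g f \<in> Hom D (d e) (d e'')"
    if "e \<in> T" "e' \<in> T" "e'' \<in> T" "f \<in> Hom D (d e) (d e')" "g \<in> Hom D (d e') (d e'')" for e e' e'' f g
    using D dO that by blast
  have C: "is_category C"
    unfolding is_category_def
  proof (intro conjI ballI)
    show "Idt C X \<in> Hom C X X" if "X \<in> Obj C" for X
      using a[OF that] \<Psi>.maps[of "a X" "a X"] \<Psi>.ident[of "a X"] \<Psi>.id_closed dO by metis
    show "Cmp C X Y Z g f \<in> Hom C X Z"
      if h: "X \<in> Obj C" "Y \<in> Obj C" "Z \<in> Obj C" "f \<in> Hom C X Y" "g \<in> Hom C Y Z" for X Y Z f g
    proof -
      note a' = a[OF h(1)] a[OF h(2)] a[OF h(3)]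
      obtain f' where f: "f' \<in> Hom D (d (a X)) (d (a Y))" "f = \<Psi> (a X) (a Y) f'" using lift[of "a X" "a Y" f] a' h by auto
      obtain g' where g: "g' \<in> Hom D (d (a Y)) (d (a Z))" "g = \<Psi> (a Y) (a Z) g'" using lift[of "a Y" "a Z" g] a' h by auto
      show ?thesis
        using \<Psi>.comp[of "a X" "a Y" "a Z" f' g'] \<Psi>.maps[of "a X" "a Z", OF _ _ Dc[of "a X" "a Y" "a Z" f' g']] a' f g by simp
    qed
    fix X Y f assume XY: "X \<in> Obj C" "Y \<in> Obj C" "f \<in> Hom C X Y"
    note a' = a[OF XY(1)] a[OF XY(2)]
    obtain f' where f: "f' \<in> Hom D (d (a X)) (d (a Y))" "f = \<Psi> (a X) (a Y) f'" using lift[of "a X" "a Y" f] a' XY by auto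
    show "Cmp C X X Y f (Idt C X) = f" "Cmp C X Y Y (Idt C Y) f = f"
      using \<Psi>.retag_right[of "a X" "a X" "a Y" f'] \<Psi>.retag_left[of "a X" "a Y" "a Y" f'] a' f
        \<Psi>.ident[of "a X"] \<Psi>.ident[of "a Y"] by simp_all
  next
    fix W X Y Z f g h
    assume o: "W \<in> Obj C" "X \<in> Obj C" "Y \<in> Obj C" "Z \<in> Obj C" and m: "f \<in> Hom C W X" "g \<in> Hom C X Y" "h \<in> Hom C Y Z"
    note a' = a[OF o(1)] a[OF o(2)] a[OF o(3)] a[OF o(4)]
    obtain f' where f: "f' \<in> Hom D (d (a W)) (d (a X))" "f = \<Psi> (a W) (a X) f'" using lift[of "a W" "a X" f] a' m by auto
    obtain g' where g: "g' \<in> Hom D (d (a X)) (d (a Y))" "g = \<Psi> (a X) (a Y) g'" using lift[of "a X" "a Y" g] a' m by auto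
    obtain h' where h: "h' \<in> Hom D (d (a Y)) (d (a Z))" "h = \<Psi> (a Y) (a Z) h'" using lift[of "a Y" "a Z" h] a' m by auto
    have T: "a W \<in> T" "a X \<in> T" "a Y \<in> T" "a Z \<in> T" and e: "c (a W) = W" "c (a X) = X" "c (a Y) = Y" "c (a Z) = Z"
      using a' by auto
    have "Cmp D (d (a W)) (d (a Y)) (d (a Z)) h' (Cmp D (d (a W)) (d (a X)) (d (a Y)) g' f') =
        Cmp D (d (a W)) (d (a X)) (d (a Z)) (Cmp D (d (a X)) (d (a Y)) (d (a Z)) h' g') f'"
      using D dO[OF T(1)] dO[OF T(2)] dO[OF T(3)] dO[OF T(4)] f(1) g(1) h(1) by blast
    from arg_cong[OF this, of "\<Psi> (a W) (a Z)"]
    show "Cmp C W Y Z h (Cmp C W X Y g f) = Cmp C W X Z (Cmp C X Y Z h g) f"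
      using T f g h by (simp add: \<Psi>.comp Dc e)
  qed
  \<comment> \<open>With \<open>C\<close> known to be a category, the inverse bijections make the
    situation symmetric, so that the comparison of tags is available in \<open>D\<close> as
    well.\<close>
  interpret \<Phi>: tagged_functor C D T c d \<Phi>
  proof
    show "is_category C" by fact
    show "c e \<in> Obj C" if "e \<in> T" for e by (rule cO[OF that])
    show "\<Phi> e e' f \<in> Hom D (d e) (d e')" if "e \<in> T" "e' \<in> T" "f \<in> Hom C (c e) (c e')" for e e' f
      by (rule \<Psi>\<Phi>(2)[OF that])
    show "\<Phi> e e (Idt C (c e)) = Idt D (d e)" if "e \<in> T" for e
      using \<Phi>\<Psi>[of e e "Idt D (d e)"] \<Psi>.id_closed[OF dO[OF that]] that by (simp add: \<Psi>.ident)
    show "\<Phi> e e'' (Cmp C (c e) (c e') (c e'') g f) = Cmp D (d e) (d e') (d e'') (\<Phi> e' e'' g) (\<Phi> e e' f)"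
      if "e \<in> T" "e' \<in> T" "e'' \<in> T" "f \<in> Hom C (c e) (c e')" "g \<in> Hom C (c e') (c e'')" for e e' e'' f g
      using \<Phi>\<Psi>[OF that(1,3) Dc[OF that(1-3) \<Psi>\<Phi>(2)[OF that(1,2,4)] \<Psi>\<Phi>(2)[OF that(2,3,5)]]] that
        \<Psi>.comp[OF that(1-3) \<Psi>\<Phi>(2)[OF that(1,2,4)] \<Psi>\<Phi>(2)[OF that(2,3,5)]] by (simp add: \<Psi>\<Phi>)
  qed
  let ?F = "\<lambda>X. d (a X)" and ?FA = "\<lambda>X Y. \<Phi> (a X) (a Y)" and ?G = "\<lambda>Y. c (b Y)" and ?GA = "\<lambda>X Y. \<Psi> (b X) (b Y)"
  have aT: "X \<in> Obj C \<Longrightarrow> a X \<in> T" and ca: "X \<in> Obj C \<Longrightarrow> c (a X) = X"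
    and bT: "Y \<in> Obj D \<Longrightarrow> b Y \<in> T" and db: "Y \<in> Obj D \<Longrightarrow> d (b Y) = Y" for X Y using a b by auto
  have F: "is_functor C D ?F ?FA"
    unfolding is_functor_def
  proof (intro conjI ballI)
    show "?F X \<in> Obj D" "?FA X X (Idt C X) = Idt D (?F X)" if "X \<in> Obj C" for X
      using \<Phi>.ident[of "a X"] that aT ca dO by simp_all
    show "?FA X Y f \<in> Hom D (?F X) (?F Y)" if "X \<in> Obj C" "Y \<in> Obj C" "f \<in> Hom C X Y" for X Y f
      using \<Phi>.maps[of "a X" "a Y" f] that aT ca by simp
    show "?FA X Z (Cmp C X Y Z g f) = Cmp D (?F X) (?F Y) (?F Z) (?FA Y Z g) (?FA X Y f)"
      if "X \<in> Obj C" "Y \<in> Obj C" "Z \<in> Obj C" "f \<in> Hom C X Y" "g \<in> Hom C Y Z" for X Y Z f g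
      using \<Phi>.comp[of "a X" "a Y" "a Z" f g] that aT ca by simp
  qed
  have G: "is_functor D C ?G ?GA"
    unfolding is_functor_def
  proof (intro conjI ballI)
    show "?G X \<in> Obj C" "?GA X X (Idt D X) = Idt C (?G X)" if "X \<in> Obj D" for X
      using \<Psi>.ident[of "b X"] that bT db cO by simp_all
    show "?GA X Y f \<in> Hom C (?G X) (?G Y)" if "X \<in> Obj D" "Y \<in> Obj D" "f \<in> Hom D X Y" for X Y f
      using \<Psi>.maps[of "b X" "b Y" f] that bT db by simp
    show "?GA X Z (Cmp D X Y Z g f) = Cmp C (?G X) (?G Y) (?G Z) (?GA Y Z g) (?GA X Y f)"
      if "X \<in> Obj D" "Y \<in> Obj D" "Z \<in> Obj D" "f \<in> Hom D X Y" "g \<in> Hom D Y Z" for X Y Z f g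
      using \<Psi>.comp[of "b X" "b Y" "b Z" f g] that bT db by simp
  qed
  \<comment> \<open>The tags \<open>a X\<close> and \<open>b (?F X)\<close> both lie over
    \<open>?F X\<close>; the component at \<open>X\<close> is the change from the first to the
    second.\<close>
  have "is_natural_iso C C (\<lambda>X. X) (\<lambda>X Y f. f) (\<lambda>X. ?G (?F X)) (\<lambda>X Y f. ?GA (?F X) (?F Y) (?FA X Y f))
      (\<lambda>X. \<Psi> (a X) (b (?F X)) (Idt D (?F X)))"
    unfolding is_natural_iso_def
  proof (intro conjI ballI)
    show "is_isomorphism C X (?G (?F X)) (\<Psi> (a X) (b (?F X)) (Idt D (?F X)))" if "X \<in> Obj C" for X
      using \<Psi>.retag_iso[of "a X" "b (?F X)"] that aT bT ca db dO by simp
    fix X Y f assume h: "X \<in> Obj C" "Y \<in> Obj C" "f \<in> Hom C X Y"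
    have T: "a X \<in> T" "a Y \<in> T" "b (?F X) \<in> T" "b (?F Y) \<in> T" using h aT bT dO by simp_all
    have e: "d (b (?F X)) = ?F X" "d (b (?F Y)) = ?F Y" using T db dO by simp_all
    have p: "\<Phi> (a X) (a Y) f \<in> Hom D (?F X) (?F Y)" "\<Psi> (a X) (a Y) (\<Phi> (a X) (a Y) f) = f"
      using \<Psi>\<Phi>[of "a X" "a Y" f] T h ca by simp_all
    show "Cmp C X Y (?G (?F Y)) (\<Psi> (a Y) (b (?F Y)) (Idt D (?F Y))) f =
        Cmp C X (?G (?F X)) (?G (?F Y)) (?GA (?F X) (?F Y) (?FA X Y f)) (\<Psi> (a X) (b (?F X)) (Idt D (?F X)))"
      using \<Psi>.retag_left[of "a X" "a Y" "b (?F Y)" "?FA X Y f"] \<Psi>.retag_right[of "a X" "b (?F X)" "b (?F Y)" "?FA X Y f"]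
        T e p h ca by simp
  qed
  moreover have "is_natural_iso D D (\<lambda>Y. ?F (?G Y)) (\<lambda>X Y g. ?FA (?G X) (?G Y) (?GA X Y g)) (\<lambda>Y. Y) (\<lambda>X Y g. g)
      (\<lambda>Y. \<Phi> (a (?G Y)) (b Y) (Idt C (?G Y)))"
    unfolding is_natural_iso_def
  proof (intro conjI ballI)
    show "is_isomorphism D (?F (?G Y)) Y (\<Phi> (a (?G Y)) (b Y) (Idt C (?G Y)))" if "Y \<in> Obj D" for Y
      using \<Phi>.retag_iso[of "a (?G Y)" "b Y"] that aT bT ca db cO by simp
    fix X Y g assume h: "X \<in> Obj D" "Y \<in> Obj D" "g \<in> Hom D X Y"
    have T: "b X \<in> T" "b Y \<in> T" "a (?G X) \<in> T" "a (?G Y) \<in> T" using h aT bT cO by simp_all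
    have e: "c (a (?G X)) = ?G X" "c (a (?G Y)) = ?G Y" using T ca cO by simp_all
    have p: "\<Psi> (b X) (b Y) g \<in> Hom C (?G X) (?G Y)" "\<Phi> (b X) (b Y) (\<Psi> (b X) (b Y) g) = g"
      using \<Phi>\<Psi>[of "b X" "b Y" g] \<Psi>.maps[of "b X" "b Y" g] T h db by simp_all
    show "Cmp D (?F (?G X)) (?F (?G Y)) Y (\<Phi> (a (?G Y)) (b Y) (Idt C (?G Y))) (?FA (?G X) (?G Y) (?GA X Y g)) =
        Cmp D (?F (?G X)) X Y g (\<Phi> (a (?G X)) (b X) (Idt C (?G X)))"
      using \<Phi>.retag_left[of "a (?G X)" "a (?G Y)" "b Y" "?GA X Y g"] \<Phi>.retag_right[of "a (?G X)" "b X" "b Y" "?GA X Y g"]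
        T e p h db by simp
  qed
  ultimately show ?thesis
    unfolding equivalent_categories_def using C \<Psi>.D F G by blast
qed

theorem theorem6p4:
  fixes scale :: "'k::field \<Rightarrow> 'h::ring_1 \<Rightarrow> 'h"
    and comult :: "'h \<Rightarrow> ('h list \<Rightarrow>\<^sub>0 int) set"
    and counit :: "'h \<Rightarrow> 'k"
    and antipode :: "'h \<Rightarrow> 'h"
  assumes "cocommutative_hopf_algebra scale comult counit antipode"
    and "infinite (UNIV :: 'u set)"
  shows "equivalent_categories
           (comult_data.Lie2 scale comult :: (('h, 'u) lie2, ('h, 'u) mor) category)
           (comult_data.two_shLie scale comult :: (('h, 'u) linf2, ('h, 'u) mor) category)"
proof -
  interpret cocommutative_hopf_algebra scale comult counit antipode by fact
  let ?T = "Collect splitting :: ('h, 'u) splitting set"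
  have lie: "is_lie2 (fst e)" and linf: "is_linf2 (fst (snd e))" if "splitting e" for e :: "('h, 'u) splitting"
    using that presentation.is_lie2_iff_is_linf2[OF presentationI] by (cases e; fastforce simp: splitting_def)+
  have bij: "bij_betw (lie2_of e e') (linf2_hom (fst (snd e)) (fst (snd e'))) (lie2_hom (fst e) (fst e'))"
    if "e \<in> ?T" "e' \<in> ?T" for e e' using lie2_of_bij that by simp
  show ?thesis
  proof (rule equivalent_categories_tagged)
    show "tagged_functor two_shLie Lie2 ?T (\<lambda>e. fst (snd e)) fst lie2_of"
    proof
      show "is_category (two_shLie :: (('h, 'u) linf2, ('h, 'u) mor) category)" by (rule two_shLie_category)
    qed (use linf bij[THEN bij_betw_apply] lie2_of_id lie2_of_comp in \<open>simp_all add: two_shLie_def Lie2_def\<close>)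
    show "fst ` ?T = Obj Lie2"
      using lie ex_linf2 by (force simp: Lie2_def)
    \<comment> \<open>Essential surjectivity on this side is where \<open>'u\<close> has to be
      infinite: a module of arrows must be constructed inside it.\<close>
    show "(\<lambda>e. fst (snd e)) ` ?T = Obj two_shLie"
      using linf ex_lie2[OF assms(2)] by (force simp: two_shLie_def)
  qed (use bij in \<open>simp add: two_shLie_def Lie2_def\<close>)
qed

end
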